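(* Let $\{f_1,\dots,f_g\}$ be an orthonormal basis of $S_2(\Gamma)$ with respect to the Petersson inner product. Then the set $$\{Z_{f_i,f_j}\}_{i\ne j}\cup\{Z_{f_i,f_i}-Z_{f_1,f_1}\}_{i=2}^g\cup\{f_i\textstyle\int f_j\}_{i,j}\cup\{f_i\}_i$$ is a basis of $S_2^2(\Gamma)$, where $f_i\int f_j$ denotes the function $z\mapsto f_i(z)\int_{z_0}^z f_j(w)\,dw$ for a fixed $z_0\in\mathfrak H$.
   Context: Let $\Gamma\subset PSL_2(\mathbb{R})$ be a Fuchsian group of the first kind acting on $\mathfrak{H}=\{z=x+iy:y>0\}$ with $\Gamma\backslash\mathfrak{H}$ non-compact of genus $g$. Fix a fundamental domain $\mathfrak F$ and representatives $\mathfrak a$ of the inequivalent cusps in $\overline{\mathfrak F}$ with scaling matrices $\sigma_{\mathfrak a}$ ($\sigma_{\mathfrak a}\infty=\mathfrak a$, $\sigma_{\mathfrak a}^{-1}\Gamma_{\mathfrak a}\sigma_{\mathfrak a}=\{\pm\begin{pmatrix}1&n\\0&1\end{pmatrix}\}$). For $z\in\mathfrak F$ let $y_{\mathfrak F}(z)=\max_{\mathfrak a}\mathrm{Im}(\sigma_{\mathfrak a}^{-1}z)$. For $\gamma=\pm\begin{pmatrix}a&b\\c&d\end{pmatrix}$: $j(\gamma,z)=cz+d$, $(f|_k\gamma)(z)=f(\gamma z)j(\gamma,z)^{-k}$ (extended linearly), $\varepsilon(\gamma,z)=j(\gamma,z)/|j(\gamma,z)|$, $e(z)=e^{2\pi i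 z}$. $S_2(\Gamma)$: holomorphic weight-2 cusp forms (invariant under $|_2\Gamma$, exponentially decaying at every cusp); Petersson product $\langle f_1,f_2\rangle=\int_{\Gamma\backslash\mathfrak H}f_1\overline{f_2}\,y^2\frac{dx\,dy}{y^2}$. $S_2^2(\Gamma)$: holomorphic $f$ with $f|_2(\gamma-1)\in S_2(\Gamma)$ for all $\gamma\in\Gamma$, $f|_2(\pi-1)=0$ for all parabolic $\pi\in\Gamma$, and $(f|_2\sigma_{\mathfrak a})(z)\ll e^{-cy}$ ($c>0$) as $y\to\infty$ uniformly in $x$ at every cusp. Modular symbol: $\langle\gamma,\lambda\rangle=\int_z^{\gamma z}\lambda(w)\,dw$ for $\gamma\in\Gamma$, $\lambda\in S_2(\Gamma)$. For $\lambda\in S_2(\Gamma)$ put $F_{\mathfrak a}(z)=\int_{\mathfrak a}^z\lambda(w)dw$ and, for integers $m\ge0$ (where convergent), $U_{\mathfrak a m}(z,s,k)=\sum_{\gamma\in\Gamma_{\mathfrak a}\backslash\Gamma}\mathrm{Im}(\sigma_{\mathfrak a}^{-1}\gamma z)^se(m\sigma_{\mathfrak a}^{-1}\gamma z)\varepsilon(\sigma_{\mathfrak a}^{-1}\gamma,z)^{-k}$, $G_{\mathfrak a m}(z,s)=\sum_{\gamma\in\Gamma_{\mathfrak a}\backslash\Gamma}\overline{F_{\mathfrak a}(\gamma z)}j(\sigma_{\mathfrak a}^{-1}\gamma,z)^{-2}\mathrm{Im}(\sigma_{\mathfrak a}^{-1}\gamma z)^se(m\sigma_{\mathfrak a}^{-1}\gamma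 z)$, and $Z_{\mathfrak a m}(z,s;\lambda)=G_{\mathfrak a m}(z,s)-\overline{F_{\mathfrak a}(z)}y^{-1}U_{\mathfrak a m}(z,s+1,2)$; this has an analytic continuation to a neighbourhood of $s=0$ and $Z_{\mathfrak a m}(z,0;\lambda)$ is its value there. For $\lambda,\mu\in S_2(\Gamma)$, $Z_{\lambda,\mu}$ denotes a function which is a finite linear combination of the functions $Z_{\mathfrak a m}(\cdot,0;\lambda)$ with $m>0$ and which satisfies: $Z_{\lambda,\mu}|_2(\gamma-1)=\overline{\langle\gamma,\lambda\rangle}\mu$ for all $\gamma\in\Gamma$; $y^2\frac{d}{d\bar z}Z_{\lambda,\mu}=\overline{\langle\lambda,\mu\rangle}$; and $yZ_{\lambda,\mu}(z)\ll y_{\mathfrak F}(z)^{1/2}$ for $z\in\mathfrak F$ (such a function exists).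
   Formalization: The equation y² dZ/dz̄ = conj⟨λ,μ⟩, unsolvable for ⟨λ,μ⟩ ≠ 0 by Stokes (the area of 𝔉 is a rational multiple of π), is taken up to a common arbitrary constant κ (correct: 1/area); 𝔉 is open, connected, with null boundary and compact closure in ℍ with cusps. *)

theory Defs
  imports
    "HOL-Complex_Analysis.Complex_Analysis"
    "HOL-Homology.Homology"
    "HOL-Library.Function_Algebras"
begin

section \<open>Moebius action and automorphy factors\<close>

definition uhp :: "complex set" where
  "uhp = {z. Im z > 0}"

definition jfac :: "real^2^2 \<Rightarrow> complex \<Rightarrow> complex" where
  "jfac A z = of_real (A $ 2 $ 1) * z + of_real (A $ 2 $ 2)"

definition moeb :: "real^2^2 \<Rightarrow> complex \<Rightarrow> complex" where
  "moeb A z = (of_real (A $ 1 $ 1) * z + of_real (A $ 1 $ 2)) / jfac A z"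

definition epsfac :: "real^2^2 \<Rightarrow> complex \<Rightarrow> complex" where
  "epsfac A z = jfac A z / of_real (norm (jfac A z))"

definition slash :: "int \<Rightarrow> (complex \<Rightarrow> complex) \<Rightarrow> real^2^2 \<Rightarrow> complex \<Rightarrow> complex" where
  "slash k f A = (\<lambda>z. f (moeb A z) * jfac A z powi (- k))"

definition efun :: "complex \<Rightarrow> complex" where
  "efun z = exp (2 * of_real pi * \<i> * z)"

text \<open>The action on the Riemann sphere, whose points are \<open>Some z\<close> and \<open>None\<close>
  (the point at infinity).\<close>

definition act :: "real^2^2 \<Rightarrow> complex option \<Rightarrow> complex option" where
  "act A p = (case p of
      None \<Rightarrow> if A $ 2 $ 1 = 0 then None else Some (of_real (A $ 1 $ 1 / A $ 2 $ 1))
    | Some z \<Rightarrow> if jfac A z = 0 then None else Some (moeb A z))"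

section \<open>Fuchsian groups of the first kind\<close>

text \<open>A subgroup of \<open>PSL\<^sub>2(\<real>)\<close> is represented by its preimage in \<open>SL\<^sub>2(\<real>)\<close>,
  that is, by a subgroup of \<open>SL\<^sub>2(\<real>)\<close> closed under negation.\<close>

definition fuchsian :: "(real^2^2) set \<Rightarrow> bool" where
  "fuchsian \<Gamma> \<longleftrightarrow>
     (\<forall>A\<in>\<Gamma>. det A = 1) \<and> mat 1 \<in> \<Gamma> \<and>
     (\<forall>A\<in>\<Gamma>. \<forall>B\<in>\<Gamma>. A ** B \<in> \<Gamma>) \<and>
     (\<forall>A\<in>\<Gamma>. matrix_inv A \<in> \<Gamma>) \<and>
     (\<forall>A\<in>\<Gamma>. - A \<in> \<Gamma>) \<and>
     discrete \<Gamma>"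

definition parabolic :: "real^2^2 \<Rightarrow> bool" where
  "parabolic A \<longleftrightarrow> det A = 1 \<and> \<bar>trace A\<bar> = 2 \<and> A \<noteq> mat 1 \<and> A \<noteq> - mat 1"

definition boundary_points :: "complex option set" where
  "boundary_points = insert None (Some ` \<real>)"

definition cusp :: "(real^2^2) set \<Rightarrow> complex option \<Rightarrow> bool" where
  "cusp \<Gamma> \<aa> \<longleftrightarrow> \<aa> \<in> boundary_points \<and> (\<exists>A\<in>\<Gamma>. parabolic A \<and> act A \<aa> = \<aa>)"

definition stab :: "(real^2^2) set \<Rightarrow> complex option \<Rightarrow> (real^2^2) set" where
  "stab \<Gamma> \<aa> = {A \<in> \<Gamma>. act A \<aa> = \<aa>}"

definition transl :: "real \<Rightarrow> real^2^2" where
  "transl x = vector [vector [1, x], vector [0, 1]]"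

definition scaling_matrix :: "(real^2^2) set \<Rightarrow> complex option \<Rightarrow> real^2^2 \<Rightarrow> bool" where
  "scaling_matrix \<Gamma> \<aa> S \<longleftrightarrow>
     det S = 1 \<and> act S None = \<aa> \<and>
     (\<lambda>A. matrix_inv S ** A ** S) ` stab \<Gamma> \<aa> =
       (\<Union>n::int. {transl (of_int n), - transl (of_int n)})"

text \<open>The extended half-plane \<open>\<H>\<^sup>*\<close>, the union of \<open>\<H>\<close> and the set of cusps. A set is open
  if its intersection with \<open>\<H>\<close> is open and it contains a horoball at each of its cusps; the horoballs
  at \<open>\<aa> = A \<infinity>\<close> are the sets \<open>A {z. Im z > Y}\<close>, and it does not matter which \<open>A\<close> is used.\<close>

definition ext_open :: "(real^2^2) set \<Rightarrow> complex option set \<Rightarrow> bool" where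
  "ext_open \<Gamma> U \<longleftrightarrow>
     U \<subseteq> Some ` uhp \<union> {\<aa>. cusp \<Gamma> \<aa>} \<and>
     open {z \<in> uhp. Some z \<in> U} \<and>
     (\<forall>\<aa>\<in>U. cusp \<Gamma> \<aa> \<longrightarrow>
       (\<forall>A. det A = 1 \<and> act A None = \<aa> \<longrightarrow>
         (\<exists>Y>0. \<forall>z. Im z > Y \<longrightarrow> Some (moeb A z) \<in> U)))"

definition ext_uhp :: "(real^2^2) set \<Rightarrow> complex option topology" where
  "ext_uhp \<Gamma> = topology (ext_open \<Gamma>)"

lemma istopology_ext_open: "istopology (ext_open \<Gamma>)"
  unfolding istopology_def
proof (intro conjI allI impI)
  fix S T assume S: "ext_open \<Gamma> S" and T: "ext_open \<Gamma> T"
  have "{z \<in> uhp. Some z \<in> S \<inter> T} = {z \<in> uhp. Some z \<in> S} \<inter> {z \<in> uhp. Some z \<in> T}"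
    by auto
  then have op: "open {z \<in> uhp. Some z \<in> S \<inter> T}"
    using S T by (auto simp: ext_open_def)
  have "\<exists>Y>0. \<forall>z. Im z > Y \<longrightarrow> Some (moeb A z) \<in> S \<inter> T"
    if a: "\<aa> \<in> S \<inter> T" "cusp \<Gamma> \<aa>" "det A = 1 \<and> act A None = \<aa>" for \<aa> A
  proof -
    obtain Y1 where Y1: "Y1 > 0" "\<And>z. Im z > Y1 \<Longrightarrow> Some (moeb A z) \<in> S"
      using S a unfolding ext_open_def by blast
    obtain Y2 where Y2: "Y2 > 0" "\<And>z. Im z > Y2 \<Longrightarrow> Some (moeb A z) \<in> T"
      using T a unfolding ext_open_def by blast
    show ?thesis using Y1 Y2 by (intro exI[of _ "max Y1 Y2"]) auto
  qed
  then show "ext_open \<Gamma> (S \<inter> T)"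
    using op S unfolding ext_open_def by blast
next
  fix K assume K: "\<forall>S\<in>K. ext_open \<Gamma> S"
  have "{z \<in> uhp. Some z \<in> \<Union>K} = (\<Union>S\<in>K. {z \<in> uhp. Some z \<in> S})"
    by auto
  then have op: "open {z \<in> uhp. Some z \<in> \<Union>K}"
    using K by (auto simp: ext_open_def)
  have sub: "\<Union>K \<subseteq> Some ` uhp \<union> {\<aa>. cusp \<Gamma> \<aa>}"
    using K unfolding ext_open_def by blast
  have "\<exists>Y>0. \<forall>z. Im z > Y \<longrightarrow> Some (moeb A z) \<in> \<Union>K"
    if a: "\<aa> \<in> \<Union>K" "cusp \<Gamma> \<aa>" "det A = 1 \<and> act A None = \<aa>" for \<aa> A
  proof -
    obtain S where S: "S \<in> K" "\<aa> \<in> S" using a by blast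
    then obtain Y where "Y > 0" "\<And>z. Im z > Y \<Longrightarrow> Some (moeb A z) \<in> S"
      using K a unfolding ext_open_def by blast
    then show ?thesis using S by blast
  qed
  then show "ext_open \<Gamma> (\<Union>K)"
    using op sub unfolding ext_open_def by blast
qed

lemma openin_ext_uhp: "openin (ext_uhp \<Gamma>) = ext_open \<Gamma>"
  unfolding ext_uhp_def using istopology_ext_open by (rule topology_inverse')

definition orbit :: "(real^2^2) set \<Rightarrow> complex option \<Rightarrow> complex option set" where
  "orbit \<Gamma> p = (\<lambda>A. act A p) ` \<Gamma>"

definition orbit_open :: "(real^2^2) set \<Rightarrow> complex option topology \<Rightarrow> complex option set set \<Rightarrow> bool" where
  "orbit_open \<Gamma> X V \<longleftrightarrow>
     V \<subseteq> orbit \<Gamma> ` topspace X \<and> openin X {p \<in> topspace X. orbit \<Gamma> p \<in> V}"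

text \<open>The set of orbits with the quotient topology.\<close>

definition orbit_space :: "(real^2^2) set \<Rightarrow> complex option topology \<Rightarrow> complex option set topology" where
  "orbit_space \<Gamma> X = topology (orbit_open \<Gamma> X)"

lemma istopology_orbit_open: "istopology (orbit_open \<Gamma> X)"
  unfolding istopology_def
proof (intro conjI allI impI)
  fix S T assume S: "orbit_open \<Gamma> X S" and T: "orbit_open \<Gamma> X T"
  have "{p \<in> topspace X. orbit \<Gamma> p \<in> S \<inter> T} =
      {p \<in> topspace X. orbit \<Gamma> p \<in> S} \<inter> {p \<in> topspace X. orbit \<Gamma> p \<in> T}"
    by auto
  then show "orbit_open \<Gamma> X (S \<inter> T)"
    using S T by (auto simp: orbit_open_def)
next
  fix K assume K: "\<forall>S\<in>K. orbit_open \<Gamma> X S"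
  have "{p \<in> topspace X. orbit \<Gamma> p \<in> \<Union>K} = (\<Union>S\<in>K. {p \<in> topspace X. orbit \<Gamma> p \<in> S})"
    by auto
  moreover have "\<Union>K \<subseteq> orbit \<Gamma> ` topspace X"
    using K unfolding orbit_open_def by blast
  ultimately show "orbit_open \<Gamma> X (\<Union>K)"
    using K by (auto simp: orbit_open_def)
qed

lemma openin_orbit_space: "openin (orbit_space \<Gamma> X) = orbit_open \<Gamma> X"
  unfolding orbit_space_def using istopology_orbit_open by (rule topology_inverse')

text \<open>Shimura's definition: \<open>\<Gamma>\<close> is of the first kind if the quotient of \<open>\<H>\<^sup>*\<close> by \<open>\<Gamma>\<close> is
  compact.\<close>

definition fuchsian_first_kind :: "(real^2^2) set \<Rightarrow> bool" where
  "fuchsian_first_kind \<Gamma> \<longleftrightarrow> fuchsian \<Gamma> \<and> compact_space (orbit_space \<Gamma> (ext_uhp \<Gamma>))"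

definition noncompact_quotient :: "(real^2^2) set \<Rightarrow> bool" where
  "noncompact_quotient \<Gamma> \<longleftrightarrow>
     \<not> compact_space (orbit_space \<Gamma> (subtopology (ext_uhp \<Gamma>) (Some ` uhp)))"

text \<open>The genus of the compact surface obtained from the quotient of \<open>\<H>\<close> by adding the cusps: half the rank of its first
  singular homology group.\<close>

definition has_genus :: "(real^2^2) set \<Rightarrow> nat \<Rightarrow> bool" where
  "has_genus \<Gamma> g \<longleftrightarrow>
     homology_group 1 (orbit_space \<Gamma> (ext_uhp \<Gamma>)) \<cong> free_Abelian_group {..<2 * g}"

text \<open>The last condition makes the closure of \<open>F\<close> consist of points of \<open>\<H>\<close> and finitely many
  cusps, as it is for a fundamental polygon with finitely many sides.\<close>

definition fundamental_domain :: "(real^2^2) set \<Rightarrow> complex set \<Rightarrow> bool" where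
  "fundamental_domain \<Gamma> F \<longleftrightarrow>
     F \<subseteq> uhp \<and> open F \<and> connected F \<and>
     (\<forall>z\<in>F. \<forall>A\<in>\<Gamma>. moeb A z \<in> F \<longrightarrow> moeb A z = z) \<and>
     (\<forall>z\<in>uhp. \<exists>A\<in>\<Gamma>. moeb A z \<in> closure F) \<and>
     negligible (frontier F \<inter> uhp) \<and>
     compactin (ext_uhp \<Gamma>) (ext_uhp \<Gamma> closure_of (Some ` F))"

definition cusp_representatives ::
    "(real^2^2) set \<Rightarrow> complex set \<Rightarrow> complex option set \<Rightarrow> bool" where
  "cusp_representatives \<Gamma> F C \<longleftrightarrow>
     finite C \<and> C \<subseteq> {\<aa>. cusp \<Gamma> \<aa>} \<inter> (ext_uhp \<Gamma> closure_of (Some ` F)) \<and>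
     (\<forall>\<bb>. cusp \<Gamma> \<bb> \<longrightarrow> (\<exists>!\<aa>. \<aa> \<in> C \<and> \<aa> \<in> orbit \<Gamma> \<bb>))"

definition yF :: "complex option set \<Rightarrow> (complex option \<Rightarrow> real^2^2) \<Rightarrow> complex \<Rightarrow> real" where
  "yF C \<sigma> z = Max ((\<lambda>\<aa>. Im (moeb (matrix_inv (\<sigma> \<aa>)) z)) ` C)"

section \<open>Spaces of functions\<close>

text \<open>Functions on \<open>\<H>\<close> are represented by functions on \<open>\<complex>\<close> that vanish outside \<open>\<H>\<close>.\<close>

definition cscale :: "complex \<Rightarrow> (complex \<Rightarrow> complex) \<Rightarrow> (complex \<Rightarrow> complex)" where
  "cscale c f = (\<lambda>z. c * f z)"

interpretation funspace: vector_space cscale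
  by unfold_locales (auto simp: cscale_def fun_eq_iff algebra_simps)

definition basis_family ::
    "'i set \<Rightarrow> ('i \<Rightarrow> complex \<Rightarrow> complex) \<Rightarrow> (complex \<Rightarrow> complex) set \<Rightarrow> bool" where
  "basis_family I b V \<longleftrightarrow>
     inj_on b I \<and> funspace.independent (b ` I) \<and> funspace.span (b ` I) = V"

definition decays_at_cusps :: "(real^2^2) set \<Rightarrow> (complex \<Rightarrow> complex) \<Rightarrow> bool" where
  "decays_at_cusps \<Gamma> f \<longleftrightarrow>
     (\<forall>\<aa> S. cusp \<Gamma> \<aa> \<and> scaling_matrix \<Gamma> \<aa> S \<longrightarrow>
       (\<exists>c>0. \<exists>K Y. \<forall>z. Im z > Y \<and> Im z > 0 \<longrightarrow>
         norm (slash 2 f S z) \<le> K * exp (- c * Im z)))"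

definition S2 :: "(real^2^2) set \<Rightarrow> (complex \<Rightarrow> complex) set" where
  "S2 \<Gamma> = {f. f holomorphic_on uhp \<and> (\<forall>z. z \<notin> uhp \<longrightarrow> f z = 0) \<and>
     (\<forall>A\<in>\<Gamma>. slash 2 f A = f) \<and> decays_at_cusps \<Gamma> f}"

definition S22 :: "(real^2^2) set \<Rightarrow> (complex \<Rightarrow> complex) set" where
  "S22 \<Gamma> = {f. f holomorphic_on uhp \<and> (\<forall>z. z \<notin> uhp \<longrightarrow> f z = 0) \<and>
     (\<forall>A\<in>\<Gamma>. slash 2 f A - f \<in> S2 \<Gamma>) \<and>
     (\<forall>A\<in>\<Gamma>. parabolic A \<longrightarrow> slash 2 f A - f = 0) \<and>
     decays_at_cusps \<Gamma> f}"

text \<open>The integral over the quotient of \<open>\<H>\<close> by \<open>\<Gamma>\<close> is taken over the fundamental domain \<open>F\<close>.\<close>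

definition petersson ::
    "complex set \<Rightarrow> (complex \<Rightarrow> complex) \<Rightarrow> (complex \<Rightarrow> complex) \<Rightarrow> complex" where
  "petersson F f1 f2 =
     (LINT z:F|lborel. f1 z * cnj (f2 z) * of_real ((Im z)\<^sup>2) / of_real ((Im z)\<^sup>2))"

definition orthonormal_basis ::
    "(real^2^2) set \<Rightarrow> complex set \<Rightarrow> nat \<Rightarrow> (nat \<Rightarrow> complex \<Rightarrow> complex) \<Rightarrow> bool" where
  "orthonormal_basis \<Gamma> F g f \<longleftrightarrow>
     basis_family {1..g} f (S2 \<Gamma>) \<and>
     (\<forall>i\<in>{1..g}. \<forall>j\<in>{1..g}. petersson F (f i) (f j) = (if i = j then 1 else 0))"

text \<open>The integral of \<open>\<lambda> \<in> S\<^sub>2(\<Gamma>)\<close> from \<open>z\<close> to \<open>A z\<close> does not depend on \<open>z \<in> \<H>\<close>;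
  the base point \<open>\<i>\<close> is used.\<close>

definition modsym :: "real^2^2 \<Rightarrow> (complex \<Rightarrow> complex) \<Rightarrow> complex" where
  "modsym A lam = contour_integral (linepath \<i> (moeb A \<i>)) lam"

section \<open>The series\<close>

text \<open>The integral of \<open>\<lambda>\<close> from the cusp \<open>\<aa>\<close> to \<open>z\<close>, where \<open>S\<close> is a scaling matrix of \<open>\<aa>\<close>:
  \<open>S (i t)\<close> tends to \<open>\<aa>\<close> as \<open>t\<close> tends to infinity.\<close>

definition cusp_integral :: "real^2^2 \<Rightarrow> (complex \<Rightarrow> complex) \<Rightarrow> complex \<Rightarrow> complex" where
  "cusp_integral S lam z =
     Lim at_top (\<lambda>t::real. contour_integral (linepath (moeb S (\<i> * of_real t)) z) lam)"

text \<open>Sum over the cosets \<open>H A\<close> (\<open>A \<in> \<Gamma>\<close>) of a function \<open>t\<close> on \<open>\<Gamma>\<close> that is left invariant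
  under \<open>H\<close>.\<close>

definition coset_sum :: "(real^2^2) set \<Rightarrow> (real^2^2) set \<Rightarrow> (real^2^2 \<Rightarrow> complex) \<Rightarrow> complex" where
  "coset_sum H \<Gamma> t =
     (\<Sum>\<^sub>\<infinity>D\<in>(\<lambda>A. (\<lambda>P. P ** A) ` H) ` \<Gamma>. t (SOME A. A \<in> D))"

definition Useries ::
    "(real^2^2) set \<Rightarrow> complex option \<Rightarrow> real^2^2 \<Rightarrow> nat \<Rightarrow> complex \<Rightarrow> complex \<Rightarrow> int \<Rightarrow> complex" where
  "Useries \<Gamma> \<aa> S m z s k = coset_sum (stab \<Gamma> \<aa>) \<Gamma> (\<lambda>A.
     let B = matrix_inv S ** A in
       of_real (Im (moeb B z)) powr s * efun (of_nat m * moeb B z) * epsfac B z powi (- k))"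

definition Gseries ::
    "(real^2^2) set \<Rightarrow> complex option \<Rightarrow> real^2^2 \<Rightarrow> (complex \<Rightarrow> complex) \<Rightarrow> nat \<Rightarrow>
     complex \<Rightarrow> complex \<Rightarrow> complex" where
  "Gseries \<Gamma> \<aa> S lam m z s = coset_sum (stab \<Gamma> \<aa>) \<Gamma> (\<lambda>A.
     let B = matrix_inv S ** A in
       cnj (cusp_integral S lam (moeb A z)) * jfac B z powi (- 2) *
       of_real (Im (moeb B z)) powr s * efun (of_nat m * moeb B z))"

definition Zseries ::
    "(real^2^2) set \<Rightarrow> complex option \<Rightarrow> real^2^2 \<Rightarrow> (complex \<Rightarrow> complex) \<Rightarrow> nat \<Rightarrow>
     complex \<Rightarrow> complex \<Rightarrow> complex" where
  "Zseries \<Gamma> \<aa> S lam m z s =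
     Gseries \<Gamma> \<aa> S lam m z s -
     cnj (cusp_integral S lam z) * of_real (inverse (Im z)) * Useries \<Gamma> \<aa> S m z (s + 1) 2"

text \<open>The value at \<open>s = 0\<close> of the continuation of \<open>Zseries\<close>, whose terms are summable for
  \<open>Re s > 0\<close>. Any two continuations agree at \<open>0\<close>, because the domains considered have
  connected intersections.\<close>

definition Zzero ::
    "(real^2^2) set \<Rightarrow> complex option \<Rightarrow> real^2^2 \<Rightarrow> (complex \<Rightarrow> complex) \<Rightarrow> nat \<Rightarrow>
     complex \<Rightarrow> complex" where
  "Zzero \<Gamma> \<aa> S lam m z =
     (if z \<in> uhp then
        (THE v. \<exists>e>0. \<exists>h. h holomorphic_on ({s. Re s > 0} \<union> ball 0 e) \<and>
           (\<forall>s. Re s > 0 \<longrightarrow> h s = Zseries \<Gamma> \<aa> S lam m z s) \<and> h 0 = v)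
      else 0)"

text \<open>The Wirtinger derivative \<open>\<partial>f/\<partial>(cnj z)\<close> of a real differentiable function.\<close>

definition has_dbar :: "(complex \<Rightarrow> complex) \<Rightarrow> complex \<Rightarrow> complex \<Rightarrow> bool" where
  "has_dbar f d z \<longleftrightarrow> (\<exists>D. (f has_derivative D) (at z) \<and> d = (D 1 + \<i> * D \<i>) / 2)"

text \<open>The defining properties of \<open>Z\<^bsub>\<lambda>,\<mu>\<^esub>\<close>. The Wirtinger derivative is prescribed up to a
  constant \<open>\<kappa>\<close>, the same for all \<open>\<lambda>\<close> and \<open>\<mu>\<close>, which accounts for the normalization of the
  Petersson product: \<open>\<kappa> = 1\<close> is the equation \<open>y\<^sup>2 \<partial>Z/\<partial>(cnj z) = cnj \<langle>\<lambda>,\<mu>\<rangle>\<close>, while for the product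
  without a volume factor, as in \<open>petersson\<close>, Stokes' theorem gives the reciprocal of the
  area of \<open>F\<close> if \<open>\<langle>\<lambda>,\<mu>\<rangle> \<noteq> 0\<close>.\<close>

definition is_Zfun ::
    "(real^2^2) set \<Rightarrow> complex set \<Rightarrow> complex option set \<Rightarrow> (complex option \<Rightarrow> real^2^2) \<Rightarrow>
     complex \<Rightarrow> (complex \<Rightarrow> complex) \<Rightarrow> (complex \<Rightarrow> complex) \<Rightarrow> (complex \<Rightarrow> complex) \<Rightarrow> bool" where
  "is_Zfun \<Gamma> F C \<sigma> \<kappa> lam mu W \<longleftrightarrow>
     W \<in> funspace.span {Zzero \<Gamma> \<aa> (\<sigma> \<aa>) lam m |\<aa> m. \<aa> \<in> C \<and> m > 0} \<and>
     (\<forall>A\<in>\<Gamma>. slash 2 W A - W = cscale (cnj (modsym A lam)) mu) \<and>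
     (\<forall>z\<in>uhp. \<exists>d. has_dbar W d z \<and> of_real ((Im z)\<^sup>2) * d = \<kappa> * cnj (petersson F lam mu)) \<and>
     (\<exists>K. \<forall>z\<in>F. Im z * norm (W z) \<le> K * yF C \<sigma> z powr (1 / 2))"

definition times_int ::
    "complex \<Rightarrow> (complex \<Rightarrow> complex) \<Rightarrow> (complex \<Rightarrow> complex) \<Rightarrow> complex \<Rightarrow> complex" where
  "times_int z0 f h = (\<lambda>z. f z * contour_integral (linepath z0 z) h)"

end

theory Submission
  imports Defs
begin

text \<open>For \<open>h \<in> S\<^sub>2\<^sup>2(\<Gamma>)\<close> write \<open>h|(\<gamma> - 1) = \<Sum>\<^sub>j \<chi>\<^sub>j(\<gamma>) f\<^sub>j\<close>. The \<open>\<chi>\<^sub>j\<close> are homomorphisms from \<open>\<Gamma>\<close> to the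
  complex numbers that vanish on parabolic elements, so they factor through the first homology of the compactified quotient and
  lie in a space of dimension at most \<open>2g\<close>. The \<open>2g\<close> period homomorphisms
  \<open>\<gamma> \<mapsto> \<langle>\<gamma>,f\<^sub>i\<rangle>\<close> and their conjugates are linearly independent, by Stokes' theorem and the positivity of the
  Petersson product; hence they span this space, and
  \<open>\<chi>\<^sub>j = \<Sum>\<^sub>i b\<^sub>i\<^sub>j \<langle>\<cdot>,f\<^sub>i\<rangle> + \<Sum>\<^sub>i a\<^sub>i\<^sub>j cnj \<langle>\<cdot>,f\<^sub>i\<rangle>\<close>. Stokes' theorem, applied to the invariant function
  \<open>h - \<Sum> b\<^sub>i\<^sub>j f\<^sub>j \<integral>f\<^sub>i - \<Sum> a\<^sub>i\<^sub>j f\<^sub>j cnj \<integral>f\<^sub>i\<close>, shows that the matrix \<open>a\<close> has trace zero. The combinations of the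
  \<open>Z\<close>-functions with such coefficients are holomorphic, and they realize
  the conjugate periods, as the functions \<open>f\<^sub>j \<integral>f\<^sub>i\<close> realize the periods. What remains of
  \<open>h\<close> is a cusp form.\<close>

text \<open>The domain \<open>F\<close> is merely an open set with negligible frontier, without
  sides, and it may reach the cusps, so boundary integrals are avoided. An invariant function is
  written as the sum of the translates of a compactly supported function on the half-plane, the
  integral over \<open>F\<close> unfolds to an integral over the plane, and there the integral of a
  derivative vanishes. Cusps are treated by cutoffs in the height, whose contribution disappears
  because \<open>F\<close> has finite hyperbolic area. The quotient map may be branched at elliptic
  points and at cusps, so loops are not lifted through it. A homomorphism is instead turned into
  local potentials on the orbit space, whose increments along paths pair with singular chains.
  Homology only bounds the dimension by \<open>2 * g\<close> from above; the bound is attained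
  because the orthonormal basis has as many members as the genus. A combination of
  \<open>Z\<close>-functions has derivative \<open>\<kappa> / y^2\<close> times the trace of its
  coefficients by \<open>cnj z\<close>, which vanishes for trace zero whatever
  \<open>\<kappa>\<close> is; the growth bound for the \<open>Z\<close>-functions then forces decay
  at the cusps.\<close>

unbundle no Formal_Power_Series.fps_syntax

section \<open>Moebius transformations\<close>

lemma sl2_det: "det A = 1 \<longleftrightarrow> A$1$1 * A$2$2 - A$1$2 * A$2$1 = (1::real)" for A :: "real^2^2"
  by (simp add: det_2)

lemma mult_entry: "(A ** B) $ i $ j = A$i$1 * B$1$j + A$i$2 * B$2$j" for A B :: "real^2^2"
  by (simp add: matrix_matrix_mult_def sum_2)

lemma mat2_eqI:
  fixes A B :: "real^2^2"
  assumes "A$1$1 = B$1$1" "A$1$2 = B$1$2" "A$2$1 = B$2$1" "A$2$2 = B$2$2"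
  shows "A = B"
  using assms by (simp add: vec_eq_iff forall_2)

lemma mat1_entry [simp]:
  "(mat 1 :: real^2^2) $ 1 $ 1 = 1" "(mat 1 :: real^2^2) $ 1 $ 2 = 0"
  "(mat 1 :: real^2^2) $ 2 $ 1 = 0" "(mat 1 :: real^2^2) $ 2 $ 2 = 1"
  by (simp_all add: mat_def)

lemma transl_entry [simp]:
  "transl x $ 1 $ 1 = 1" "transl x $ 1 $ 2 = x" "transl x $ 2 $ 1 = 0" "transl x $ 2 $ 2 = 1"
  by (simp_all add: transl_def)

lemma det_transl [simp]: "det (transl x) = 1"
  by (simp add: sl2_det)

lemma det_uminus_sl2: "det (- A) = det A" for A :: "real^2^2"
  by (simp add: det_2)

lemma
  fixes A :: "real^2^2"
  assumes "det A = 1"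
  shows matrix_inv_right_sl2: "A ** matrix_inv A = mat 1"
    and matrix_inv_left_sl2: "matrix_inv A ** A = mat 1"
proof -
  have "invertible A"
    using assms by (simp add: invertible_det_nz)
  then have "A ** matrix_inv A = mat 1 \<and> matrix_inv A ** A = mat 1"
    unfolding invertible_def matrix_inv_def by (rule someI_ex)
  then show "A ** matrix_inv A = mat 1" "matrix_inv A ** A = mat 1" by simp_all
qed

lemma matrix_inv_entry:
  fixes A :: "real^2^2"
  assumes "det A = 1"
  shows "matrix_inv A $ 1 $ 1 = A$2$2" "matrix_inv A $ 1 $ 2 = - A$1$2"
    "matrix_inv A $ 2 $ 1 = - A$2$1" "matrix_inv A $ 2 $ 2 = A$1$1"
proof -
  define B :: "real^2^2" where "B = vector [vector [A$2$2, - A$1$2], vector [- A$2$1, A$1$1]]"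
  have B: "B$1$1 = A$2$2" "B$1$2 = - A$1$2" "B$2$1 = - A$2$1" "B$2$2 = A$1$1"
    by (simp_all add: B_def)
  have "A ** B = mat 1"
    using assms by (intro mat2_eqI) (auto simp: mult_entry B sl2_det algebra_simps)
  then have "matrix_inv A ** (A ** B) = matrix_inv A" by simp
  then have "B = matrix_inv A"
    using matrix_inv_left_sl2[OF assms] by (simp add: matrix_mul_assoc)
  then show "matrix_inv A $ 1 $ 1 = A$2$2" "matrix_inv A $ 1 $ 2 = - A$1$2"
    "matrix_inv A $ 2 $ 1 = - A$2$1" "matrix_inv A $ 2 $ 2 = A$1$1"
    using B by simp_all
qed

lemma det_matrix_inv_sl2: "det A = 1 \<Longrightarrow> det (matrix_inv A) = 1" for A :: "real^2^2"
  by (simp add: sl2_det matrix_inv_entry) (simp add: sl2_det matrix_inv_entry algebra_simps)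

lemma matrix_inv_inv_sl2: "det A = 1 \<Longrightarrow> matrix_inv (matrix_inv A) = A" for A :: "real^2^2"
  by (intro mat2_eqI) (simp_all add: matrix_inv_entry det_matrix_inv_sl2)

lemma det_mult_sl2: "det A = 1 \<Longrightarrow> det B = 1 \<Longrightarrow> det (A ** B) = 1" for A B :: "real^2^2"
  by (simp add: det_mul)

lemma matrix_inv_mult_sl2:
  fixes A B :: "real^2^2"
  assumes "det A = 1" "det B = 1"
  shows "matrix_inv (A ** B) = matrix_inv B ** matrix_inv A"
  using assms by (intro mat2_eqI)
    (simp_all add: matrix_inv_entry det_mult_sl2 mult_entry algebra_simps)

lemma minus_matrix_mult: "(- A) ** B = - (A ** B)" "A ** (- B) = - (A ** B)"
  for A B :: "real^2^2"
  by (auto intro!: mat2_eqI simp: mult_entry)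

lemma matrix_inv_cancel:
  fixes A B :: "real^2^2"
  assumes "det A = 1"
  shows "matrix_inv A ** (A ** B) = B" "A ** (matrix_inv A ** B) = B"
    "(B ** A) ** matrix_inv A = B" "(B ** matrix_inv A) ** A = B"
  using matrix_inv_right_sl2[OF assms] matrix_inv_left_sl2[OF assms]
  by (simp_all add: matrix_mul_assoc) (simp_all flip: matrix_mul_assoc)

section \<open>The action on the upper half-plane and its automorphy factors\<close>

lemma open_uhp: "open uhp"
  unfolding uhp_def by (rule open_halfspace_Im_gt)

lemma convex_uhp: "convex uhp"
  unfolding uhp_def by (rule convex_halfspace_Im_gt)

lemma jfac_0_Im:
  assumes "det A = 1" "jfac A z = 0" shows "Im z = 0"
proof -
  have "A$2$1 * Im z = 0" "A$2$1 * Re z + A$2$2 = 0"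
    using assms(2) by (simp_all add: jfac_def complex_eq_iff)
  then show ?thesis using assms(1) by (auto simp: sl2_det)
qed

lemma jfac_nonzero: "det A = 1 \<Longrightarrow> z \<in> uhp \<Longrightarrow> jfac A z \<noteq> 0"
  using jfac_0_Im by (fastforce simp: uhp_def)

lemma Im_moeb: 
  assumes "det A = 1" shows "Im (moeb A z) = Im z / (norm (jfac A z))\<^sup>2"
proof -
  have *: "A$1$1 * A$2$2 = 1 + A$1$2 * A$2$1"
    using assms by (simp add: sl2_det)
  have "A$1$1 * A$2$2 * Im z - A$1$2 * A$2$1 * Im z = Im z"
    unfolding * by (simp add: algebra_simps)
  then show ?thesis
    by (simp add: moeb_def Im_divide jfac_def cmod_power2 algebra_simps)
qed

lemma moeb_uhp_iff: "det A = 1 \<Longrightarrow> moeb A z \<in> uhp \<longleftrightarrow> z \<in> uhp"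
  using jfac_0_Im[of A z] by (auto simp: uhp_def Im_moeb zero_less_divide_iff)

lemma moeb_uhp: "det A = 1 \<Longrightarrow> z \<in> uhp \<Longrightarrow> moeb A z \<in> uhp"
  by (simp add: moeb_uhp_iff)

lemma jfac_mult:
  assumes "jfac B z \<noteq> 0"
  shows "jfac (A ** B) z = jfac A (moeb B z) * jfac B z"
  using assms by (simp add: jfac_def[of A] jfac_def[of "A ** B"] moeb_def mult_entry field_simps)
    (simp add: jfac_def algebra_simps)

lemma moeb_mult_gen:
  assumes "jfac B z \<noteq> 0"
  shows "moeb (A ** B) z = moeb A (moeb B z)"
proof -
  have "of_real ((A ** B)$1$1) * z + of_real ((A ** B)$1$2) =
      (of_real (A$1$1) * moeb B z + of_real (A$1$2)) * jfac B z"
    using assms by (simp add: moeb_def mult_entry field_simps) (simp add: jfac_def algebra_simps)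
  then show ?thesis
    using assms jfac_mult[OF assms, of A] by (simp add: moeb_def[of "A ** B"] moeb_def[of A])
qed

lemma moeb_mult: "det B = 1 \<Longrightarrow> z \<in> uhp \<Longrightarrow> moeb (A ** B) z = moeb A (moeb B z)"
  by (simp add: moeb_mult_gen jfac_nonzero)

lemma jfac_mult_uhp:
  "det B = 1 \<Longrightarrow> z \<in> uhp \<Longrightarrow> jfac (A ** B) z = jfac A (moeb B z) * jfac B z"
  by (simp add: jfac_mult jfac_nonzero)

lemma jfac_minus [simp]: "jfac (- A) z = - jfac A z"
  by (simp add: jfac_def)

lemma moeb_minus [simp]: "moeb (- A) z = moeb A z"
proof -
  have "moeb (- A) z = (- (of_real (A$1$1) * z + of_real (A$1$2))) / (- jfac A z)"
    by (simp add: moeb_def)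
  then show ?thesis by (simp only: minus_divide_divide moeb_def)
qed

lemma moeb_1 [simp]: "moeb (mat 1) z = z" and jfac_1 [simp]: "jfac (mat 1) z = 1"
  by (simp_all add: moeb_def jfac_def)

lemma moeb_transl [simp]: "moeb (transl x) z = z + of_real x" and
  jfac_transl [simp]: "jfac (transl x) z = 1"
  by (simp_all add: moeb_def jfac_def)

lemma moeb_inv_cancel:
  assumes "det A = 1" "z \<in> uhp"
  shows "moeb (matrix_inv A) (moeb A z) = z" "moeb A (moeb (matrix_inv A) z) = z"
  using assms by (simp_all flip: moeb_mult add: matrix_inv_left_sl2 matrix_inv_right_sl2 det_matrix_inv_sl2)

lemma jfac_has_derivative: "(jfac A has_field_derivative of_real (A$2$1)) (at z)"
  unfolding jfac_def by (auto intro!: derivative_eq_intros)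

lemma moeb_has_derivative:
  assumes "det A = 1" "jfac A z \<noteq> 0"
  shows "(moeb A has_field_derivative 1 / (jfac A z)\<^sup>2) (at z)"
proof -
  have 1: "(of_real (A$1$1) * jfac A z - (of_real (A$1$1) * z + of_real (A$1$2)) * of_real (A$2$1)) =
     of_real (det A)"
    by (simp add: jfac_def det_2 algebra_simps)
  have "((\<lambda>z. (of_real (A$1$1) * z + of_real (A$1$2)) / jfac A z) has_field_derivative
      (of_real (A$1$1) * jfac A z - (of_real (A$1$1) * z + of_real (A$1$2)) * of_real (A$2$1)) /
        (jfac A z * jfac A z)) (at z)"
    by (auto intro!: derivative_eq_intros jfac_has_derivative assms)
  then show ?thesis
    unfolding 1 using assms(1) by (simp add: moeb_def[abs_def] power2_eq_square)
qed

lemma holomorphic_jfac: "jfac A holomorphic_on S"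
  unfolding jfac_def by (intro holomorphic_intros)

lemma holomorphic_moeb: "det A = 1 \<Longrightarrow> moeb A holomorphic_on uhp"
  using moeb_has_derivative[of A] jfac_nonzero[of A]
  by (fastforce simp: holomorphic_on_open[OF open_uhp])

lemma slash2: "slash 2 f A z = f (moeb A z) / (jfac A z)\<^sup>2"
  by (simp add: slash_def power_int_def divide_inverse power_inverse)

lemma slash2_mult:
  assumes "det B = 1" "z \<in> uhp"
  shows "slash 2 f (A ** B) z = slash 2 (slash 2 f A) B z"
  using assms by (simp add: slash2 moeb_mult jfac_mult_uhp power_mult_distrib)

lemma Im_slash2:
  assumes "det A = 1" "z \<in> uhp"
  shows "Im z * norm (slash 2 f A z) = Im (moeb A z) * norm (f (moeb A z))"
  using assms by (simp add: slash2 Im_moeb norm_divide norm_power)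

lemma holomorphic_slash2:
  assumes "det A = 1" "f holomorphic_on uhp"
  shows "slash 2 f A holomorphic_on uhp"
proof -
  have "(f \<circ> moeb A) holomorphic_on uhp"
    using assms by (intro holomorphic_on_compose_gen[OF holomorphic_moeb]) (auto simp: moeb_uhp)
  then show ?thesis
    unfolding slash2[abs_def] using assms
    by (auto intro!: holomorphic_intros holomorphic_jfac simp: o_def jfac_nonzero)
qed

section \<open>The action on the Riemann sphere\<close>

lemma num_nonzero_if_jfac_0:
  assumes "det A = 1" "jfac A z = 0"
  shows "of_real (A$1$1) * z + of_real (A$1$2) \<noteq> 0"
proof
  assume n: "of_real (A$1$1) * z + of_real (A$1$2) = 0"
  have "of_real (det A) = of_real (A$1$1) * jfac A z - of_real (A$2$1) * (of_real (A$1$1) * z + of_real (A$1$2))"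
    by (simp add: jfac_def det_2 algebra_simps)
  then show False using n assms by simp
qed

lemma act_mult:
  assumes "det A = 1" "det B = 1"
  shows "act (A ** B) p = act A (act B p)"
proof (cases p)
  case None
  have nz: "B$1$1 \<noteq> 0 \<or> B$2$1 \<noteq> 0" using assms by (auto simp: sl2_det)
  show ?thesis
  proof (cases "B$2$1 = 0")
    case True
    then have "B$1$1 \<noteq> 0" using nz by simp
    then show ?thesis using True None by (simp add: act_def mult_entry)
  next
    case False
    have "jfac A (of_real (B$1$1 / B$2$1)) = of_real ((A ** B)$2$1 / B$2$1)"
      using False by (simp add: jfac_def mult_entry field_simps)
    moreover have "moeb A (of_real (B$1$1 / B$2$1)) = of_real ((A ** B)$1$1 / (A ** B)$2$1)"
      if "(A ** B)$2$1 \<noteq> 0"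
    proof -
      have "of_real (A$1$1) * of_real (B$1$1 / B$2$1) + of_real (A$1$2) =
          (of_real ((A ** B)$1$1 / B$2$1) :: complex)"
        using False by (simp add: mult_entry field_simps)
      then show ?thesis unfolding moeb_def calculation using False that by simp
    qed
    ultimately show ?thesis using False None
      by (simp add: act_def)
  qed
next
  case (Some z)
  show ?thesis
  proof (cases "jfac B z = 0")
    case True
    \<comment> \<open>\<open>B\<close> sends \<open>z\<close> to infinity; its numerator
      \<open>n\<close> is nonzero, and cancelling it shows that \<open>A ** B\<close> sends
      \<open>z\<close> where \<open>A\<close> sends infinity.\<close>
    define n where "n = of_real (B$1$1) * z + of_real (B$1$2)"
    have n: "n \<noteq> 0" using num_nonzero_if_jfac_0[OF assms(2) True] by (simp add: n_def)
    have 1: "jfac (A ** B) z = of_real (A$2$1) * n + of_real (A$2$2) * jfac B z"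
      by (simp add: n_def jfac_def mult_entry algebra_simps)
    have 2: "of_real ((A ** B)$1$1) * z + of_real ((A ** B)$1$2) =
        of_real (A$1$1) * n + of_real (A$1$2) * jfac B z"
      by (simp add: n_def jfac_def mult_entry algebra_simps)
    show ?thesis using True n Some 1 2 by (simp add: act_def moeb_def[of "A ** B"])
  next
    case False
    then show ?thesis using Some jfac_mult[OF False, of A] moeb_mult_gen[OF False, of A]
      by (simp add: act_def)
  qed
qed

lemma act_1 [simp]: "act (mat 1) p = p"
  by (cases p) (simp_all add: act_def)

lemma act_inv_cancel:
  assumes "det A = 1"
  shows "act (matrix_inv A) (act A p) = p" "act A (act (matrix_inv A) p) = p"
  using assms by (simp_all flip: act_mult add: matrix_inv_left_sl2 matrix_inv_right_sl2 det_matrix_inv_sl2)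

lemma act_Some_uhp: "det A = 1 \<Longrightarrow> z \<in> uhp \<Longrightarrow> act A (Some z) = Some (moeb A z)"
  by (simp add: act_def jfac_nonzero)

lemma act_None_iff: "act A None = None \<longleftrightarrow> A$2$1 = 0"
  by (simp add: act_def)

lemma act_boundary:
  assumes "p \<in> boundary_points" shows "act A p \<in> boundary_points"
proof (cases p)
  case None then show ?thesis by (auto simp: act_def boundary_points_def)
next
  case (Some z)
  then obtain x where x: "z = of_real x" using assms by (auto simp: boundary_points_def Reals_def)
  have "moeb A z = of_real ((A$1$1 * x + A$1$2) / (A$2$1 * x + A$2$2))"
    by (simp add: moeb_def jfac_def x)
  then show ?thesis using Some by (auto simp: act_def boundary_points_def)
qed

lemma Some_uhp_not_boundary: "z \<in> uhp \<Longrightarrow> Some z \<notin> boundary_points"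
  by (auto simp: boundary_points_def uhp_def complex_is_Real_iff)

lemma norm_mat2_le: "norm A \<le> \<bar>A$1$1\<bar> + \<bar>A$1$2\<bar> + \<bar>A$2$1\<bar> + \<bar>A$2$2\<bar>" for A :: "real^2^2"
proof -
  have "norm A \<le> norm (A$1) + norm (A$2)"
    using norm_le_l1_cart[of "\<chi> i. norm (A$i)"]
    by (simp add: norm_vec_def L2_set_def sum_2)
  moreover have "norm (A$i) \<le> \<bar>A$i$1\<bar> + \<bar>A$i$2\<bar>" for i
    using norm_le_l1_cart[of "A$i"] by (simp add: sum_2)
  ultimately show ?thesis
    by (smt (verit))
qed

lemma entry_le_norm: "\<bar>A$i$j\<bar> \<le> norm A" for A :: "real^2^2"
  by (rule order_trans[OF component_le_norm_cart]) (rule Finite_Cartesian_Product.norm_nth_le)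

lemma norm_mult_mat2: "norm (A ** B) \<le> 8 * norm A * norm B" for A B :: "real^2^2"
proof -
  \<comment> \<open>Each of the four entries is a sum of two products, which gives the constant
    8.\<close>
  have "\<bar>(A ** B)$i$j\<bar> \<le> 2 * (norm A * norm B)" for i j
  proof -
    have "\<bar>A$i$k * B$k$j\<bar> \<le> norm A * norm B" for k
      unfolding abs_mult by (intro mult_mono entry_le_norm) auto
    from this[of 1] this[of 2] show ?thesis unfolding mult_entry by (smt (verit))
  qed
  from this[of 1 1] this[of 1 2] this[of 2 1] this[of 2 2] norm_mat2_le[of "A ** B"]
  have "norm (A ** B) \<le> 8 * (norm A * norm B)" by linarith
  then show ?thesis by simp
qed

lemma norm_matrix_inv_sl2: "det A = 1 \<Longrightarrow> norm (matrix_inv A) \<le> 4 * norm A" for A :: "real^2^2"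
  using norm_mat2_le[of "matrix_inv A"] entry_le_norm[of A 1 1] entry_le_norm[of A 1 2]
    entry_le_norm[of A 2 1] entry_le_norm[of A 2 2]
  by (simp add: matrix_inv_entry)

section \<open>Fuchsian groups and their cusps\<close>

locale fuchsian_group =
  fixes \<Gamma> :: "(real^2^2) set"
  assumes fuchsian: "fuchsian \<Gamma>"
begin

lemma det_Gamma: "A \<in> \<Gamma> \<Longrightarrow> det A = 1"
  and one_Gamma: "mat 1 \<in> \<Gamma>"
  and mult_Gamma: "A \<in> \<Gamma> \<Longrightarrow> B \<in> \<Gamma> \<Longrightarrow> A ** B \<in> \<Gamma>"
  and inv_Gamma: "A \<in> \<Gamma> \<Longrightarrow> matrix_inv A \<in> \<Gamma>"
  and minus_Gamma: "A \<in> \<Gamma> \<Longrightarrow> - A \<in> \<Gamma>"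
  using fuchsian by (auto simp: fuchsian_def)

text \<open>Discreteness only isolates each point separately. Left translation to the identity makes
  the isolation radius uniform on bounded sets, and a bounded uniformly discrete set is
  finite.\<close>

lemma finite_bounded_Gamma: "finite {A \<in> \<Gamma>. norm A \<le> R}"
proof -
  let ?T = "{A \<in> \<Gamma>. norm A \<le> R}"
  have "mat 1 isolated_in \<Gamma>"
    using fuchsian one_Gamma by (auto simp: fuchsian_def discrete_def)
  then obtain e where e: "e > 0" "\<And>A. A \<in> \<Gamma> \<Longrightarrow> dist (mat 1) A < e \<Longrightarrow> A = mat 1"
    unfolding isolated_in_dist_Ex_iff by blast
  \<comment> \<open>The factor 32 is \<open>8 * 4\<close>, from \<open>norm_mult_mat2\<close> and
    \<open>norm_matrix_inv_sl2\<close>; the added 1 keeps the denominator positive.\<close>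
  define d where "d = e / (32 * \<bar>R\<bar> + 1)"
  have d: "d > 0" using e by (simp add: d_def add_nonneg_pos)
  have "A = B" if A: "A \<in> ?T" and B: "B \<in> ?T" and AB: "dist A B < d" for A B
  proof -
    have dA: "det A = 1" using A det_Gamma by auto
    have "matrix_inv A ** (B - A) = matrix_inv A ** B - matrix_inv A ** A"
      by (intro mat2_eqI) (simp_all add: mult_entry algebra_simps)
    then have eq: "matrix_inv A ** (B - A) = matrix_inv A ** B - mat 1"
      by (simp add: matrix_inv_left_sl2[OF dA])
    have "norm (matrix_inv A ** (B - A)) \<le> 8 * norm (matrix_inv A) * norm (B - A)"
      by (rule norm_mult_mat2)
    also have "\<dots> \<le> 8 * (4 * \<bar>R\<bar>) * norm (B - A)"
      using norm_matrix_inv_sl2[OF dA] A by (intro mult_right_mono) auto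
    also have "\<dots> \<le> (32 * \<bar>R\<bar> + 1) * norm (B - A)"
      by (simp add: algebra_simps)
    also have "\<dots> < (32 * \<bar>R\<bar> + 1) * d"
      using AB by (intro mult_strict_left_mono) (auto simp: dist_norm norm_minus_commute)
    also have "\<dots> = e" by (simp add: d_def add_nonneg_eq_0_iff)
    finally have "dist (mat 1) (matrix_inv A ** B) < e"
      by (simp add: eq dist_norm norm_minus_commute)
    then have "matrix_inv A ** B = mat 1"
      using e A B by (simp add: mult_Gamma inv_Gamma)
    then have "A ** (matrix_inv A ** B) = A" by simp
    then show ?thesis using matrix_inv_cancel[OF dA] by simp
  qed
  then have "uniform_discrete ?T"
    using d unfolding uniform_discrete_def by blast
  moreover have "bounded ?T" by (auto simp: bounded_iff)
  ultimately show ?thesis using uniform_discrete_finite_iff by blast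
qed

lemma countable_Gamma: "countable \<Gamma>"
proof -
  have "\<Gamma> = (\<Union>n::nat. {A \<in> \<Gamma>. norm A \<le> real n})"
    using real_arch_simple by auto
  moreover have "countable (\<Union>n::nat. {A \<in> \<Gamma>. norm A \<le> real n})"
    by (intro countable_UN) (auto simp: finite_bounded_Gamma countable_finite)
  ultimately show ?thesis by simp
qed

text \<open>The automorphy factor is bounded because the image stays above height \<open>e2\<close>;
  the numerator is the image times this factor. Numerator and denominator are affine functions of
  \<open>z\<close>, and an affine function bounded at a point away from the real axis has bounded
  coefficients. So the matrices in question have bounded norm.\<close>

lemma proper_discontinuity:
  assumes "compact Q1" "Q1 \<subseteq> uhp" "compact Q2" "Q2 \<subseteq> uhp"
  shows "finite {A \<in> \<Gamma>. \<exists>z\<in>Q1. moeb A z \<in> Q2}"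
proof -
  have bd: "\<exists>e>0. \<exists>R>0. \<forall>z\<in>Q. Im z \<ge> e \<and> norm z \<le> R" if Q: "compact Q" "Q \<subseteq> uhp" for Q
  proof (cases "Q = {}")
    case False
    have "continuous_on Q Im" by (intro continuous_intros)
    then obtain z where z: "z \<in> Q" "\<And>w. w \<in> Q \<Longrightarrow> Im z \<le> Im w"
      using continuous_attains_inf[OF Q(1) False] by blast
    obtain R where "R > 0" "\<forall>z\<in>Q. norm z \<le> R"
      using compact_imp_bounded[OF Q(1)] unfolding bounded_pos by blast
    then show ?thesis using z Q by (intro exI[of _ "Im z"]) (auto simp: uhp_def)
  qed (auto intro: exI[of _ 1])
  obtain e1 R1 where 1: "e1 > 0" "R1 > 0" "\<And>z. z \<in> Q1 \<Longrightarrow> Im z \<ge> e1 \<and> norm z \<le> R1"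
    using bd assms by metis
  obtain e2 R2 where 2: "e2 > 0" "R2 > 0" "\<And>z. z \<in> Q2 \<Longrightarrow> Im z \<ge> e2 \<and> norm z \<le> R2"
    using bd assms by metis
  define J where "J = sqrt (R1 / e2)"
  \<comment> \<open>The imaginary part isolates \<open>p\<close>, since \<open>Im z\<close> is at
    least \<open>e1\<close>.\<close>
  have lin: "\<bar>p\<bar> \<le> K / e1 \<and> \<bar>q\<bar> \<le> K + K / e1 * R1"
    if z: "z \<in> Q1" and K: "norm (of_real p * z + of_real q) \<le> K" for p q K z
  proof -
    have "\<bar>p\<bar> * e1 \<le> \<bar>p\<bar> * Im z" using 1(3)[OF z] by (simp add: mult_left_mono)
    also have "\<dots> = \<bar>Im (of_real p * z + of_real q)\<bar>"
      using 1(1) 1(3)[OF z] by (simp add: abs_mult)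
    also have "\<dots> \<le> K" using K abs_Im_le_cmod order_trans by blast
    finally have p: "\<bar>p\<bar> \<le> K / e1" using 1 by (simp add: field_simps)
    have "\<bar>q\<bar> = norm ((of_real p * z + of_real q) - of_real p * z)" by simp
    also have "\<dots> \<le> norm (of_real p * z + of_real q) + norm (of_real p * z)"
      by (rule norm_triangle_ineq4)
    also have "norm (of_real p * z) \<le> K / e1 * R1"
      unfolding norm_mult using 1(3)[OF z] p by (intro mult_mono) auto
    finally show ?thesis using p K by linarith
  qed
  define RR where "RR = R2 * J / e1 + (R2 * J + R2 * J / e1 * R1) + J / e1 + (J + J / e1 * R1)"
  have "norm A \<le> RR" if A: "A \<in> \<Gamma>" and z: "z \<in> Q1" and w: "moeb A z \<in> Q2" for A z
  proof -
    have dA: "det A = 1" using A by (rule det_Gamma)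
    have zu: "z \<in> uhp" using z assms by auto
    have jz: "jfac A z \<noteq> 0" using jfac_nonzero dA zu by blast
    have "e2 * (norm (jfac A z))\<^sup>2 \<le> Im (moeb A z) * (norm (jfac A z))\<^sup>2"
      using 2(3)[OF w] by (intro mult_right_mono) auto
    also have "\<dots> = Im z" using jz by (simp add: Im_moeb[OF dA])
    also have "\<dots> \<le> R1" using 1(3)[OF z] abs_Im_le_cmod[of z] by linarith
    finally have "(norm (jfac A z))\<^sup>2 \<le> R1 / e2" using 2 by (simp add: field_simps)
    then have J: "norm (jfac A z) \<le> J" unfolding J_def by (rule real_le_rsqrt)
    have "norm (of_real (A$1$1) * z + of_real (A$1$2)) = norm (moeb A z) * norm (jfac A z)"
      using jz by (simp add: moeb_def norm_divide)
    also have "\<dots> \<le> R2 * J" using 2(3)[OF w] J 2(2) by (intro mult_mono) auto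
    finally have N: "norm (of_real (A$1$1) * z + of_real (A$1$2)) \<le> R2 * J" .
    show ?thesis
      using lin[OF z N] lin[OF z J[unfolded jfac_def]] norm_mat2_le[of A] unfolding RR_def
      by linarith
  qed
  then have "{A \<in> \<Gamma>. \<exists>z\<in>Q1. moeb A z \<in> Q2} \<subseteq> {A \<in> \<Gamma>. norm A \<le> RR}" by blast
  then show ?thesis using finite_bounded_Gamma finite_subset by blast
qed

text \<open>Only the finitely many elements of \<open>N\<close> can return a point of a small ball
  to that ball. For each of them that moves \<open>z\<close>, continuity separates a sufficiently
  small ball from its image.\<close>

lemma point_neighbourhood:
  assumes z: "z \<in> uhp"
  obtains e where "e > 0" "ball z e \<subseteq> uhp"
    "\<And>A w. A \<in> \<Gamma> \<Longrightarrow> w \<in> ball z e \<Longrightarrow> moeb A w \<in> ball z e \<Longrightarrow> moeb A z = z"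
proof -
  obtain r where r: "r > 0" "cball z r \<subseteq> uhp"
    using open_uhp z open_contains_cball by blast
  define N where "N = {A \<in> \<Gamma>. \<exists>w\<in>cball z r. moeb A w \<in> cball z r}"
  have fN: "finite N" unfolding N_def using r by (intro proper_discontinuity) auto
  have "\<exists>e>0. \<forall>w\<in>ball z e. moeb A w \<in> ball z e \<longrightarrow> moeb A z = z" if A: "A \<in> N" for A
  proof (cases "moeb A z = z")
    case False
    define d where "d = dist (moeb A z) z / 2"
    have d: "d > 0" using False by (simp add: d_def)
    have "isCont (moeb A) z"
      using moeb_has_derivative A z det_Gamma jfac_nonzero DERIV_isCont unfolding N_def by blast
    then obtain e where e: "e > 0" "\<And>w. dist w z < e \<Longrightarrow> dist (moeb A w) (moeb A z) < d"
      using d unfolding continuous_at_eps_delta by metis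
    have "moeb A w \<notin> ball z (min e d)" if "w \<in> ball z (min e d)" for w
    proof
      assume "moeb A w \<in> ball z (min e d)"
      then have "dist (moeb A w) z < d" by (simp add: dist_commute)
      moreover have "dist (moeb A w) (moeb A z) < d" using e that by (simp add: dist_commute)
      ultimately show False using dist_triangle2[of "moeb A z" z "moeb A w"]
        by (simp add: d_def dist_commute)
    qed
    then show ?thesis using e d by (intro exI[of _ "min e d"]) auto
  qed (auto intro: exI[of _ 1])
  then obtain e where e: "\<And>A. A \<in> N \<Longrightarrow> e A > 0"
    "\<And>A w. A \<in> N \<Longrightarrow> w \<in> ball z (e A) \<Longrightarrow> moeb A w \<in> ball z (e A) \<Longrightarrow> moeb A z = z"
    by metis
  define m where "m = Min (insert r (e ` N))"
  have m: "m > 0" "m \<le> r" "\<And>A. A \<in> N \<Longrightarrow> m \<le> e A"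
    unfolding m_def using fN e r by auto
  show ?thesis
  proof
    show "m > 0" by fact
    show "ball z m \<subseteq> uhp" using m r by (meson ball_subset_cball cball_subset_cball_iff order_trans subset_ball)
    fix A w assume A: "A \<in> \<Gamma>" and w: "w \<in> ball z m" "moeb A w \<in> ball z m"
    then have "w \<in> cball z r" "moeb A w \<in> cball z r" using m(2) by auto
    then have "A \<in> N" unfolding N_def using A by blast
    then show "moeb A z = z" using e(2)[of A w] w m(3)[of A] by auto
  qed
qed

lemma stab_point_finite:
  assumes "z \<in> uhp" shows "finite {A \<in> \<Gamma>. moeb A z = z}"
  using proper_discontinuity[of "{z}" "{z}"] assms by simp

section \<open>Homomorphisms from the group to the complex numbers\<close>

lemma hom_one:
  fixes \<phi> :: "real^2^2 \<Rightarrow> complex"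
  assumes "\<And>A B. A \<in> \<Gamma> \<Longrightarrow> B \<in> \<Gamma> \<Longrightarrow> \<phi> (A ** B) = \<phi> A + \<phi> B"
  shows "\<phi> (mat 1) = 0"
  using assms[OF one_Gamma one_Gamma] by simp

lemma hom_inv:
  fixes \<phi> :: "real^2^2 \<Rightarrow> complex"
  assumes "\<And>A B. A \<in> \<Gamma> \<Longrightarrow> B \<in> \<Gamma> \<Longrightarrow> \<phi> (A ** B) = \<phi> A + \<phi> B" "A \<in> \<Gamma>"
  shows "\<phi> (matrix_inv A) = - \<phi> A"
  using assms(1)[OF assms(2) inv_Gamma[OF assms(2)]] hom_one[of \<phi>] assms
  by (simp add: matrix_inv_right_sl2 det_Gamma eq_neg_iff_add_eq_0 add.commute)

text \<open>The square of \<open>- mat 1\<close> is the identity, and the additive group of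
  \<complex> has no torsion.\<close>

lemma hom_minus:
  fixes \<phi> :: "real^2^2 \<Rightarrow> complex"
  assumes hom: "\<And>A B. A \<in> \<Gamma> \<Longrightarrow> B \<in> \<Gamma> \<Longrightarrow> \<phi> (A ** B) = \<phi> A + \<phi> B" and "A \<in> \<Gamma>"
  shows "\<phi> (- A) = \<phi> A"
proof -
  have "\<phi> (- mat 1) + \<phi> (- mat 1) = \<phi> (- mat 1 ** - mat 1)"
    using hom[of "- mat 1" "- mat 1"] one_Gamma minus_Gamma by simp
  also have "\<dots> = 0" using hom_one[OF hom] by (simp add: minus_matrix_mult)
  finally have "\<phi> (- mat 1) = 0" by (simp flip: mult_2)
  then show ?thesis
    using hom[of "- mat 1" A] one_Gamma minus_Gamma assms by (simp add: minus_matrix_mult)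
qed

text \<open>Point stabilizers are finite and \<open>\<complex>\<close> is torsion free.\<close>

lemma hom_stab_point:
  fixes \<phi> :: "real^2^2 \<Rightarrow> complex"
  assumes hom: "\<And>A B. A \<in> \<Gamma> \<Longrightarrow> B \<in> \<Gamma> \<Longrightarrow> \<phi> (A ** B) = \<phi> A + \<phi> B"
    and A: "A \<in> \<Gamma>" "moeb A z = z" and z: "z \<in> uhp"
  shows "\<phi> A = 0"
proof -
  define P where "P n = ((\<lambda>B. A ** B) ^^ n) (mat 1)" for n
  have P: "P n \<in> \<Gamma> \<and> moeb (P n) z = z \<and> \<phi> (P n) = of_nat n * \<phi> A" for n
  proof (induction n)
    case 0 show ?case using one_Gamma hom_one[OF hom] by (simp add: P_def)
  next
    case (Suc n)
    have "P (Suc n) = A ** P n" by (simp add: P_def)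
    moreover have "moeb (A ** P n) z = z" using Suc A z by (subst moeb_mult) (auto simp: det_Gamma)
    ultimately show ?case using Suc A hom[of A "P n"] by (simp add: mult_Gamma algebra_simps)
  qed
  have "\<not> inj P"
  proof
    assume "inj P"
    then have "infinite (range P)" by (simp add: range_inj_infinite)
    moreover have "range P \<subseteq> {A \<in> \<Gamma>. moeb A z = z}" using P by auto
    ultimately show False using stab_point_finite[OF z] finite_subset by blast
  qed
  then obtain m n where "m \<noteq> n" "P m = P n" unfolding inj_def by blast
  then have "of_nat m * \<phi> A = of_nat n * \<phi> A" using P by metis
  then show ?thesis using \<open>m \<noteq> n\<close> by simp
qed

section \<open>Scaling matrices and heights above the cusps\<close>

lemma scaling_transl_stab:
  assumes "scaling_matrix \<Gamma> \<aa> S"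
  shows "S ** transl (of_int n) ** matrix_inv S \<in> stab \<Gamma> \<aa>"
proof -
  have S: "det S = 1" using assms by (simp add: scaling_matrix_def)
  have "transl (of_int n) \<in> (\<lambda>A. matrix_inv S ** A ** S) ` stab \<Gamma> \<aa>"
    using assms unfolding scaling_matrix_def by blast
  then obtain A where A: "A \<in> stab \<Gamma> \<aa>" "transl (of_int n) = matrix_inv S ** A ** S" by blast
  have "S ** transl (of_int n) ** matrix_inv S = A"
    unfolding A(2) by (simp add: matrix_inv_cancel[OF S] matrix_inv_right_sl2[OF S] matrix_mul_assoc)
  then show ?thesis using A by simp
qed

lemma stab_scaling_cases:
  assumes "scaling_matrix \<Gamma> \<aa> S" "A \<in> stab \<Gamma> \<aa>"
  obtains n :: int where "matrix_inv S ** A ** S = transl (of_int n) \<or>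
    matrix_inv S ** A ** S = - transl (of_int n)"
  using assms unfolding scaling_matrix_def by blast

lemma stab_scaling_conj:
  assumes "scaling_matrix \<Gamma> \<aa> S" "A \<in> stab \<Gamma> \<aa>"
  obtains n :: int where "A = S ** transl (of_int n) ** matrix_inv S \<or>
    A = - (S ** transl (of_int n) ** matrix_inv S)"
proof -
  have S: "det S = 1" using assms by (simp add: scaling_matrix_def)
  have A: "A = S ** (matrix_inv S ** A ** S) ** matrix_inv S"
    by (simp add: matrix_inv_cancel[OF S] matrix_inv_right_sl2[OF S] matrix_mul_assoc)
  obtain n :: int where "matrix_inv S ** A ** S = transl (of_int n) \<or>
    matrix_inv S ** A ** S = - transl (of_int n)"
    using stab_scaling_cases[OF assms] .
  then show ?thesis using that[of n] A by (metis minus_matrix_mult)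
qed

text \<open>An upper triangular \<open>D\<close> conjugates the translation by 1 into the
  translation by the square of \<open>D$1$1\<close>. The conjugate comes from the stabilizer of
  \<open>\<bb>\<close>, which consists of integral translations up to sign in the coordinate of
  \<open>S'\<close>, so this square is a positive integer.\<close>

lemma scaling_pair_upper:
  assumes S: "scaling_matrix \<Gamma> \<aa> S" and S': "scaling_matrix \<Gamma> \<bb> S'" and A: "A \<in> \<Gamma>"
    and 0: "(matrix_inv S' ** A ** S) $ 2 $ 1 = 0"
  shows "act A \<aa> = \<bb>" "((matrix_inv S' ** A ** S) $ 1 $ 1)\<^sup>2 \<ge> 1"
proof -
  define D where "D = matrix_inv S' ** A ** S"
  have d: "det S = 1" "det S' = 1" "det A = 1" and n: "act S None = \<aa>" "act S' None = \<bb>"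
    using assms by (auto simp: scaling_matrix_def det_Gamma)
  have dD: "det D = 1" using d by (simp add: D_def det_mult_sl2 det_matrix_inv_sl2)
  have "act D None = None" using 0 by (simp add: act_None_iff D_def)
  then have "act S' (act D None) = \<bb>" using n by simp
  moreover have "act S' (act D None) = act A \<aa>"
    using d n by (simp add: D_def act_mult det_mult_sl2 det_matrix_inv_sl2 act_inv_cancel)
  ultimately show ab: "act A \<aa> = \<bb>" by simp
  define T where "T = S ** transl (of_int 1) ** matrix_inv S"
  have T: "T \<in> \<Gamma>" "act T \<aa> = \<aa>" using scaling_transl_stab[OF S, of 1] by (auto simp: T_def stab_def)
  define P where "P = A ** T ** matrix_inv A"
  have P: "P \<in> \<Gamma>" using T A by (simp add: P_def mult_Gamma inv_Gamma)
  have "act (matrix_inv A) \<bb> = \<aa>" using ab d act_inv_cancel(1)[of A \<aa>] by simp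
  then have "act P \<bb> = \<bb>"
    using T d ab by (simp add: P_def act_mult det_mult_sl2 det_matrix_inv_sl2 det_Gamma)
  then have "P \<in> stab \<Gamma> \<bb>" using P by (simp add: stab_def)
  then obtain m :: int where m: "matrix_inv S' ** P ** S' = transl (of_int m) \<or>
    matrix_inv S' ** P ** S' = - transl (of_int m)"
    using stab_scaling_cases[OF S'] by blast
  have "matrix_inv S' ** P ** S' = D ** transl 1 ** matrix_inv D"
    using d by (simp add: P_def T_def D_def matrix_inv_mult_sl2 det_mult_sl2 det_matrix_inv_sl2
        matrix_inv_inv_sl2 matrix_mul_assoc)
  moreover have "(D ** transl 1 ** matrix_inv D) $ 1 $ 2 = (D$1$1)\<^sup>2"
    "(D ** transl 1 ** matrix_inv D) $ 1 $ 1 = 1"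
    using 0 dD by (simp_all add: mult_entry matrix_inv_entry D_def sl2_det power2_eq_square algebra_simps)
  ultimately have "(D$1$1)\<^sup>2 = of_int m"
    using m by (auto)
  moreover have "D$1$1 \<noteq> 0" using dD 0 by (auto simp: D_def sl2_det)
  then have "(D$1$1)\<^sup>2 > 0" by simp
  ultimately have "of_int m > (0::real)" by simp
  then have "m \<ge> 1" by simp
  then show "((matrix_inv S' ** A ** S) $ 1 $ 1)\<^sup>2 \<ge> 1"
    using \<open>(D$1$1)\<^sup>2 = of_int m\<close> by (simp add: D_def)
qed

text \<open>The lower bound of \<open>scaling_pair_upper\<close> holds for \<open>D\<close> and for
  its inverse. The diagonal entries have product 1, so both have square 1, and \<open>D\<close> is a
  translation up to sign.\<close>

lemma scaling_pair_Im:
  assumes S: "scaling_matrix \<Gamma> \<aa> S" and S': "scaling_matrix \<Gamma> \<bb> S'" and A: "A \<in> \<Gamma>"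
    and 0: "(matrix_inv S' ** A ** S) $ 2 $ 1 = 0"
  shows "Im (moeb (matrix_inv S' ** A ** S) w) = Im w"
proof -
  define D where "D = matrix_inv S' ** A ** S"
  have d: "det S = 1" "det S' = 1" "det A = 1"
    using assms by (auto simp: scaling_matrix_def det_Gamma)
  have dD: "det D = 1" using d by (simp add: D_def det_mult_sl2 det_matrix_inv_sl2)
  have "matrix_inv D = matrix_inv S ** matrix_inv A ** S'"
    using d by (simp add: D_def matrix_inv_mult_sl2 det_mult_sl2 det_matrix_inv_sl2
        matrix_inv_inv_sl2 matrix_mul_assoc)
  then have "(matrix_inv S ** matrix_inv A ** S') $ 2 $ 1 = 0"
    "(matrix_inv S ** matrix_inv A ** S') $ 1 $ 1 = D$2$2"
    using matrix_inv_entry[OF dD] 0 by (simp_all add: D_def)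
  then have "(D$2$2)\<^sup>2 \<ge> 1"
    using scaling_pair_upper(2)[OF S' S inv_Gamma[OF A]] by simp
  moreover have "(D$1$1)\<^sup>2 \<ge> 1" using scaling_pair_upper(2)[OF assms] by (simp add: D_def)
  moreover have "(D$1$1)\<^sup>2 * (D$2$2)\<^sup>2 = 1"
    using dD 0 by (simp add: sl2_det D_def flip: power_mult_distrib)
  ultimately have "(D$2$2)\<^sup>2 = 1"
    by (smt (verit) mult_le_cancel_right1)
  then show ?thesis using dD 0 
    by (simp add: Im_moeb jfac_def D_def flip: of_real_add)
qed

text \<open>Multiplying \<open>D\<close> on both sides by integral translations keeps its lower left
  entry \<open>c\<close> and replaces \<open>A\<close> by another element of the group. If
  \<open>|c| < 1\<close>, the diagonal entries can be moved to within \<open>|c|\<close> of 1; the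
  determinant then bounds the remaining entry, and only finitely many matrices are left.\<close>

lemma scaling_pair_lower:
  assumes S: "scaling_matrix \<Gamma> \<aa> S" and S': "scaling_matrix \<Gamma> \<bb> S'"
  obtains c0 where "c0 > 0"
    "\<And>A. A \<in> \<Gamma> \<Longrightarrow> (matrix_inv S' ** A ** S) $ 2 $ 1 \<noteq> 0 \<Longrightarrow> \<bar>(matrix_inv S' ** A ** S) $ 2 $ 1\<bar> \<ge> c0"
proof -
  let ?D = "\<lambda>A. matrix_inv S' ** A ** S"
  have d: "det S = 1" "det S' = 1"
    using assms by (auto simp: scaling_matrix_def)
  \<comment> \<open>The bound 8 is \<open>2 + 3 + 1 + 2\<close>, the bounds of the four entries
    after the normalization below.\<close>
  define X where "X = {A \<in> \<Gamma>. norm (?D A) \<le> 8}"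
  have "norm A \<le> 8 * (8 * norm S' * 8) * norm (matrix_inv S)" if "norm (?D A) \<le> 8" for A
  proof -
    have "A = S' ** ?D A ** matrix_inv S"
      by (simp add: matrix_inv_cancel d matrix_inv_right_sl2 matrix_mul_assoc)
    then have "norm A \<le> 8 * norm (S' ** ?D A) * norm (matrix_inv S)"
      using norm_mult_mat2[of "S' ** ?D A" "matrix_inv S"] by simp
    also have "norm (S' ** ?D A) \<le> 8 * norm S' * norm (?D A)"
      by (rule norm_mult_mat2)
    also have "\<dots> \<le> 8 * norm S' * 8" using that by (intro mult_left_mono) auto
    finally show ?thesis by (simp add: mult_left_mono mult_right_mono)
  qed
  then have fX: "finite X"
    unfolding X_def by (intro finite_subset[OF _ finite_bounded_Gamma]) auto
  define c0 where "c0 = Min (insert 1 ((\<lambda>A. \<bar>?D A $ 2 $ 1\<bar>) ` {A \<in> X. ?D A $ 2 $ 1 \<noteq> 0}))"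
  have c0: "c0 > 0" "c0 \<le> 1" "\<And>A. A \<in> X \<Longrightarrow> ?D A $ 2 $ 1 \<noteq> 0 \<Longrightarrow> c0 \<le> \<bar>?D A $ 2 $ 1\<bar>"
    unfolding c0_def using fX by (auto intro: Min_le)
  show ?thesis
  proof (rule that[OF c0(1)])
    fix A assume A: "A \<in> \<Gamma>" and nz: "?D A $ 2 $ 1 \<noteq> 0"
    define a b c e where "a = ?D A $ 1 $ 1" and "b = ?D A $ 1 $ 2" and "c = ?D A $ 2 $ 1" and "e = ?D A $ 2 $ 2"
    show "c0 \<le> \<bar>?D A $ 2 $ 1\<bar>"
    proof (cases "\<bar>c\<bar> \<ge> 1")
      case True then show ?thesis using c0 by (simp add: c_def)
    next
      case False
      have shift: "\<exists>m::int. \<bar>x + of_int m * c - 1\<bar> \<le> \<bar>c\<bar>" for x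
      proof (intro exI)
        have "x + of_int (- \<lfloor>(x - 1) / c\<rfloor>) * c - 1 = c * frac ((x - 1) / c)"
          using nz by (simp add: frac_def c_def field_simps)
        moreover have "\<bar>frac ((x - 1) / c)\<bar> \<le> 1"
          using frac_lt_1[of "(x-1)/c"] frac_ge_0[of "(x-1)/c"] by linarith
        ultimately show "\<bar>x + of_int (- \<lfloor>(x - 1) / c\<rfloor>) * c - 1\<bar> \<le> \<bar>c\<bar>"
          by (simp add: abs_mult mult_left_le)
      qed
      obtain m n :: int where m: "\<bar>a + of_int m * c - 1\<bar> \<le> \<bar>c\<bar>" and n: "\<bar>e + of_int n * c - 1\<bar> \<le> \<bar>c\<bar>"
        using shift by blast
      define B where "B = (S' ** transl (of_int m) ** matrix_inv S') ** A ** (S ** transl (of_int n) ** matrix_inv S)"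
      have B: "B \<in> \<Gamma>"
        using scaling_transl_stab[OF S', of m] scaling_transl_stab[OF S, of n] A
        by (simp add: B_def stab_def mult_Gamma)
      have DB: "?D B = transl (of_int m) ** ?D A ** transl (of_int n)"
        unfolding B_def by (simp add: matrix_inv_cancel d matrix_inv_left_sl2 matrix_mul_assoc)
      define a' e' where "a' = a + of_int m * c" and "e' = e + of_int n * c"
      have E: "?D B $ 1 $ 1 = a'" "?D B $ 2 $ 1 = c" "?D B $ 2 $ 2 = e'"
        unfolding DB a_def c_def e_def a'_def e'_def by (simp_all add: mult_entry algebra_simps)
      have dB: "det (?D B) = 1" using d B by (simp add: det_mult_sl2 det_matrix_inv_sl2 det_Gamma)
      define b' where "b' = ?D B $ 1 $ 2"
      \<comment> \<open>The determinant equation in terms of the deviations of \<open>a'\<close> and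
        \<open>e'\<close> from 1; each of the three terms on the right is at most
        \<open>|c|\<close>.\<close>
      have bc: "b' * c = (a' - 1) + (e' - 1) + (a' - 1) * (e' - 1)"
        using dB E by (simp add: sl2_det b'_def algebra_simps)
      have "\<bar>(a' - 1) * (e' - 1)\<bar> \<le> \<bar>c\<bar> * 1"
        unfolding abs_mult using m n False by (intro mult_mono) (auto simp: a'_def e'_def)
      then have "\<bar>b'\<bar> * \<bar>c\<bar> \<le> 3 * \<bar>c\<bar>"
        using bc m n by (simp add: a'_def e'_def flip: abs_mult)
      then have "\<bar>b'\<bar> \<le> 3" using nz by (simp add: c_def)
      moreover have "\<bar>a'\<bar> \<le> 2" "\<bar>e'\<bar> \<le> 2" using m n False by (auto simp: a'_def e'_def)
      ultimately have "norm (?D B) \<le> 8"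
        using norm_mat2_le[of "?D B"] E False b'_def by linarith
      then have "B \<in> X" using B by (simp add: X_def)
      then show ?thesis using c0(3)[of B] E nz by (simp add: c_def)
    qed
  qed
qed

text \<open>From \<open>|c w + d| >= |c| * Im w\<close> the height of the image is at most
  \<open>1 / (c0^2 * Im w)\<close>. Thus a point high above one cusp is low above every cusp, except
  through matrices that identify the two cusps, and those preserve the height.\<close>

lemma scaling_pair_height:
  assumes S: "scaling_matrix \<Gamma> \<aa> S" and S': "scaling_matrix \<Gamma> \<bb> S'"
  obtains R where "R > 0"
    "\<And>A w. A \<in> \<Gamma> \<Longrightarrow> w \<in> uhp \<Longrightarrow> (matrix_inv S' ** A ** S) $ 2 $ 1 \<noteq> 0 \<Longrightarrow>
      Im (moeb (matrix_inv S' ** A ** S) w) \<le> R / Im w"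
proof -
  obtain c0 where c0: "c0 > 0" "\<And>A. A \<in> \<Gamma> \<Longrightarrow> (matrix_inv S' ** A ** S) $ 2 $ 1 \<noteq> 0 \<Longrightarrow>
      \<bar>(matrix_inv S' ** A ** S) $ 2 $ 1\<bar> \<ge> c0"
    using scaling_pair_lower[OF assms] by blast
  show ?thesis
  proof
    show "1 / c0\<^sup>2 > 0" using c0 by simp
    fix A w assume A: "A \<in> \<Gamma>" and w: "w \<in> uhp" and nz: "(matrix_inv S' ** A ** S) $ 2 $ 1 \<noteq> 0"
    define D where "D = matrix_inv S' ** A ** S"
    have dD: "det D = 1"
      using assms A by (simp add: D_def det_mult_sl2 det_matrix_inv_sl2 scaling_matrix_def det_Gamma)
    have y: "Im w > 0" using w by (simp add: uhp_def)
    have "c0 * Im w \<le> \<bar>D$2$1\<bar> * Im w" using c0(2)[OF A nz] y by (simp add: D_def)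
    also have "\<dots> = \<bar>Im (jfac D w)\<bar>" using y by (simp add: jfac_def abs_mult)
    also have "\<dots> \<le> norm (jfac D w)" by (rule abs_Im_le_cmod)
    finally have "(c0 * Im w)\<^sup>2 \<le> (norm (jfac D w))\<^sup>2" using c0 y by (intro power_mono) auto
    then have "Im w / (norm (jfac D w))\<^sup>2 \<le> Im w / (c0 * Im w)\<^sup>2"
      using c0 y by (intro divide_left_mono mult_pos_pos) (auto simp: jfac_nonzero[OF dD w])
    then show "Im (moeb (matrix_inv S' ** A ** S) w) \<le> 1 / c0\<^sup>2 / Im w"
      using y Im_moeb[OF dD] by (simp add: D_def power2_eq_square field_simps)
  qed
qed

end

lemma trace_conj_sl2: "det A = 1 \<Longrightarrow> trace (A ** B ** matrix_inv A) = trace B" for A B :: "real^2^2"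
  using trace_mul_sym[of "A ** B" "matrix_inv A"] by (simp add: matrix_inv_cancel)

lemma parabolic_conj:
  assumes "det A = 1" "parabolic B" shows "parabolic (A ** B ** matrix_inv A)"
proof -
  have B: "B = matrix_inv A ** (A ** B ** matrix_inv A) ** A"
    using assms by (simp add: matrix_inv_cancel matrix_inv_left_sl2 matrix_mul_assoc)
  have "A ** B ** matrix_inv A \<noteq> mat 1" "A ** B ** matrix_inv A \<noteq> - mat 1"
    using assms B by (auto simp: parabolic_def minus_matrix_mult matrix_inv_left_sl2)
  then show ?thesis
    using assms by (simp add: parabolic_def trace_conj_sl2 det_mult_sl2 det_matrix_inv_sl2)
qed

lemma cusp_not_uhp: "cusp \<Gamma> \<aa> \<Longrightarrow> \<aa> \<notin> Some ` uhp"
  using Some_uhp_not_boundary by (auto simp: cusp_def)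

lemma orbit_self: "fuchsian \<Gamma> \<Longrightarrow> p \<in> orbit \<Gamma> p"
  unfolding orbit_def fuchsian_def by (metis act_1 image_eqI)

section \<open>The topology of the extended half-plane and of its quotient\<close>

definition horoball :: "real^2^2 \<Rightarrow> real \<Rightarrow> complex option set" where
  "horoball S Y = insert (act S None) (Some ` {z \<in> uhp. Im (moeb (matrix_inv S) z) > Y})"

lemma continuous_on_moeb: "det A = 1 \<Longrightarrow> continuous_on uhp (moeb A)"
  by (simp add: holomorphic_moeb holomorphic_on_imp_continuous_on)

context fuchsian_group
begin

lemma cusp_act: assumes "cusp \<Gamma> \<aa>" "A \<in> \<Gamma>" shows "cusp \<Gamma> (act A \<aa>)"
proof -
  obtain B where B: "B \<in> \<Gamma>" "parabolic B" "act B \<aa> = \<aa>" using assms by (auto simp: cusp_def)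
  have "act (A ** B ** matrix_inv A) (act A \<aa>) = act A \<aa>"
    using B assms by (simp add: act_mult det_Gamma det_mult_sl2 det_matrix_inv_sl2 act_inv_cancel)
  moreover have "A ** B ** matrix_inv A \<in> \<Gamma>" using assms B by (simp add: mult_Gamma inv_Gamma)
  ultimately show ?thesis
    using assms B parabolic_conj[of A B] by (auto simp: cusp_def act_boundary det_Gamma)
qed

lemma scaling_act:
  assumes S: "scaling_matrix \<Gamma> \<aa> S" and A: "A \<in> \<Gamma>"
  shows "scaling_matrix \<Gamma> (act A \<aa>) (A ** S)"
proof -
  have d: "det S = 1" "det A = 1" "act S None = \<aa>" using assms by (auto simp: scaling_matrix_def det_Gamma)
  have st: "stab \<Gamma> (act A \<aa>) = (\<lambda>B. A ** B ** matrix_inv A) ` stab \<Gamma> \<aa>"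
  proof (intro equalityI subsetI)
    fix B assume B: "B \<in> stab \<Gamma> (act A \<aa>)"
    then have "matrix_inv A ** B ** A \<in> stab \<Gamma> \<aa>"
      using A d by (auto simp: stab_def mult_Gamma inv_Gamma act_mult det_Gamma det_mult_sl2 det_matrix_inv_sl2 act_inv_cancel)
    moreover have "B = A ** (matrix_inv A ** B ** A) ** matrix_inv A"
      using d by (simp add: matrix_inv_cancel matrix_inv_right_sl2 matrix_mul_assoc)
    ultimately show "B \<in> (\<lambda>B. A ** B ** matrix_inv A) ` stab \<Gamma> \<aa>" by blast
  next
    fix B assume "B \<in> (\<lambda>B. A ** B ** matrix_inv A) ` stab \<Gamma> \<aa>"
    then show "B \<in> stab \<Gamma> (act A \<aa>)"
      using A d by (auto simp: stab_def mult_Gamma inv_Gamma act_mult det_Gamma det_mult_sl2 det_matrix_inv_sl2 act_inv_cancel)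
  qed
  have "matrix_inv (A ** S) ** (A ** B ** matrix_inv A) ** (A ** S) = matrix_inv S ** B ** S" for B
    using d by (simp add: matrix_inv_mult_sl2 matrix_inv_cancel matrix_inv_left_sl2 matrix_mul_assoc)
  then have "(\<lambda>B. matrix_inv (A ** S) ** B ** (A ** S)) ` stab \<Gamma> (act A \<aa>) =
      (\<lambda>A. matrix_inv S ** A ** S) ` stab \<Gamma> \<aa>"
    unfolding st image_image by simp
  then show ?thesis
    using S d by (simp add: scaling_matrix_def det_mult_sl2 act_mult)
qed

lemma ext_open_Some:
  assumes "open V" "V \<subseteq> uhp" shows "ext_open \<Gamma> (Some ` V)"
proof -
  have "{z \<in> uhp. Some z \<in> Some ` V} = V" using assms by auto
  moreover have "\<not> cusp \<Gamma> \<aa>" if "\<aa> \<in> Some ` V" for \<aa>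
    using that assms cusp_not_uhp by blast
  ultimately show ?thesis unfolding ext_open_def using assms by auto
qed

lemma ext_open_horoball:
  assumes S: "det S = 1" and c: "cusp \<Gamma> (act S None)" and Y: "Y > 0"
  shows "ext_open \<Gamma> (horoball S Y)"
  unfolding ext_open_def
proof (intro conjI ballI impI allI)
  show "horoball S Y \<subseteq> Some ` uhp \<union> {\<aa>. cusp \<Gamma> \<aa>}"
    using c by (auto simp: horoball_def)
  have "{z \<in> uhp. Some z \<in> horoball S Y} = {z \<in> uhp. Im (moeb (matrix_inv S) z) > Y}"
    using cusp_not_uhp[OF c] by (auto simp: horoball_def) (metis imageI)
  also have "open \<dots>"
  proof -
    have "continuous_on uhp (\<lambda>z. Im (moeb (matrix_inv S) z))"
      using S by (intro continuous_intros continuous_on_moeb det_matrix_inv_sl2)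
    then have "open ((\<lambda>z. Im (moeb (matrix_inv S) z)) -` {Y<..} \<inter> uhp)"
      using continuous_on_open_vimage[OF open_uhp] open_greaterThan by blast
    moreover have "{z \<in> uhp. Im (moeb (matrix_inv S) z) > Y} = (\<lambda>z. Im (moeb (matrix_inv S) z)) -` {Y<..} \<inter> uhp"
      by auto
    ultimately show ?thesis by simp
  qed
  finally show "open {z \<in> uhp. Some z \<in> horoball S Y}" .
  fix \<aa> A assume a: "\<aa> \<in> horoball S Y" "cusp \<Gamma> \<aa>" and A: "det A = 1 \<and> act A None = \<aa>"
  have aS: "\<aa> = act S None" using a cusp_not_uhp by (auto simp: horoball_def)
  \<comment> \<open>\<open>A\<close> and \<open>S\<close> send infinity to the same cusp, so
    \<open>D\<close> is upper triangular and multiplies all heights by one factor.\<close>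
  define D where "D = matrix_inv S ** A"
  have dD: "det D = 1" using A S by (simp add: D_def det_mult_sl2 det_matrix_inv_sl2)
  have "act D None = None" using A S aS by (simp add: D_def act_mult det_matrix_inv_sl2 act_inv_cancel)
  then have D0: "D$2$1 = 0" by (simp add: act_None_iff)
  then have d: "D$2$2 \<noteq> 0" using dD by (auto simp: sl2_det)
  show "\<exists>Y'>0. \<forall>z. Im z > Y' \<longrightarrow> Some (moeb A z) \<in> horoball S Y"
  proof (intro exI conjI allI impI)
    show pos: "Y * (D$2$2)\<^sup>2 > 0" using Y d by simp
    fix z assume z: "Im z > Y * (D$2$2)\<^sup>2"
    then have zu: "z \<in> uhp" using pos by (simp add: uhp_def)
    have "Im (moeb D z) = Im z / (D$2$2)\<^sup>2" using dD D0 by (simp add: Im_moeb jfac_def)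
    then have "Im (moeb D z) > Y" using z d by (simp add: pos_less_divide_eq)
    moreover have "moeb D z = moeb (matrix_inv S) (moeb A z)"
      using A zu by (simp add: D_def moeb_mult)
    ultimately show "Some (moeb A z) \<in> horoball S Y"
      using A zu by (auto simp: horoball_def moeb_uhp)
  qed
qed

lemma topspace_ext: "topspace (ext_uhp \<Gamma>) = Some ` uhp \<union> {\<aa>. cusp \<Gamma> \<aa>}" (is "_ = ?E")
proof -
  have 1: "{z \<in> uhp. Some z \<in> ?E} = uhp" by auto
  have 2: "Some (moeb A z) \<in> Some ` uhp" if "det A = 1" "Im z > 1" for A z
    using that moeb_uhp[of A z] by (auto simp: uhp_def)
  have "ext_open \<Gamma> ?E"
    unfolding ext_open_def 1 using open_uhp 2 zero_less_one by (intro conjI ballI impI allI) blast+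
  moreover have "U \<subseteq> ?E" if "ext_open \<Gamma> U" for U using that unfolding ext_open_def by blast
  ultimately show ?thesis
    unfolding topspace_def openin_ext_uhp by blast
qed

lemma ext_open_act:
  assumes U: "ext_open \<Gamma> U" and A: "A \<in> \<Gamma>"
  shows "ext_open \<Gamma> (act A ` U)"
  unfolding ext_open_def
proof (intro conjI ballI impI allI)
  have dA: "det A = 1" and dA': "det (matrix_inv A) = 1"
    using A by (auto simp: det_Gamma det_matrix_inv_sl2)
  have U': "U \<subseteq> Some ` uhp \<union> {\<aa>. cusp \<Gamma> \<aa>}" using U by (simp add: ext_open_def)
  have "act A p \<in> Some ` uhp \<union> {\<aa>. cusp \<Gamma> \<aa>}" if "p \<in> Some ` uhp \<union> {\<aa>. cusp \<Gamma> \<aa>}" for p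
    using that dA A by (auto simp: act_Some_uhp moeb_uhp cusp_act)
  then show "act A ` U \<subseteq> Some ` uhp \<union> {\<aa>. cusp \<Gamma> \<aa>}" using U' by blast
  have mem: "p \<in> act A ` U \<longleftrightarrow> act (matrix_inv A) p \<in> U" for p
    using act_inv_cancel[OF dA] by (metis image_iff)
  have "{z \<in> uhp. Some z \<in> act A ` U} = moeb (matrix_inv A) -` {z \<in> uhp. Some z \<in> U} \<inter> uhp"
    using dA' by (auto simp: mem act_Some_uhp moeb_uhp)
  also have "open \<dots>"
    using continuous_on_open_vimage[OF open_uhp] continuous_on_moeb[OF dA'] U
    unfolding ext_open_def by blast
  finally show "open {z \<in> uhp. Some z \<in> act A ` U}" .
  fix \<aa> B assume a: "\<aa> \<in> act A ` U" "cusp \<Gamma> \<aa>" and B: "det B = 1 \<and> act B None = \<aa>"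
  have "act (matrix_inv A) \<aa> \<in> U" "cusp \<Gamma> (act (matrix_inv A) \<aa>)"
    using a mem A by (auto simp: cusp_act inv_Gamma)
  moreover have "det (matrix_inv A ** B) = 1" "act (matrix_inv A ** B) None = act (matrix_inv A) \<aa>"
    using B dA' by (auto simp: det_mult_sl2 act_mult)
  ultimately obtain Y where Y: "Y > 0" "\<And>z. Im z > Y \<Longrightarrow> Some (moeb (matrix_inv A ** B) z) \<in> U"
    using U unfolding ext_open_def by blast
  show "\<exists>Y>0. \<forall>z. Im z > Y \<longrightarrow> Some (moeb B z) \<in> act A ` U"
  proof (intro exI conjI allI impI)
    show "Y > 0" by fact
    fix z assume z: "Im z > Y"
    then have "z \<in> uhp" using Y by (simp add: uhp_def)
    then show "Some (moeb B z) \<in> act A ` U"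
      using Y(2)[OF z] B dA' by (simp add: mem act_Some_uhp moeb_uhp moeb_mult)
  qed
qed

lemma orbit_act: "A \<in> \<Gamma> \<Longrightarrow> orbit \<Gamma> (act A p) = orbit \<Gamma> p"
proof -
  assume A: "A \<in> \<Gamma>"
  have *: "orbit \<Gamma> (act B q) \<subseteq> orbit \<Gamma> q" if "B \<in> \<Gamma>" for B q
    using that unfolding orbit_def by (auto simp: det_Gamma mult_Gamma simp flip: act_mult)
  show ?thesis
    using *[OF A, of p] *[OF inv_Gamma[OF A], of "act A p"] A
    by (simp add: act_inv_cancel det_Gamma)
qed

lemma orbit_eqD: "orbit \<Gamma> p = orbit \<Gamma> q \<Longrightarrow> \<exists>A\<in>\<Gamma>. q = act A p"
  using orbit_self[OF fuchsian, of q] by (auto simp: orbit_def)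

text \<open>The preimage of the image of \<open>U\<close> is the union of the translates of
  \<open>U\<close>, each of them open.\<close>

lemma openin_orbit_image:
  assumes U: "ext_open \<Gamma> U"
  shows "openin (orbit_space \<Gamma> (ext_uhp \<Gamma>)) (orbit \<Gamma> ` U)"
  unfolding openin_orbit_space orbit_open_def openin_ext_uhp
proof
  have U': "U \<subseteq> topspace (ext_uhp \<Gamma>)" using U by (simp add: ext_open_def topspace_ext)
  then show "orbit \<Gamma> ` U \<subseteq> orbit \<Gamma> ` topspace (ext_uhp \<Gamma>)" by blast
  have sub: "act A ` U \<subseteq> topspace (ext_uhp \<Gamma>)" if "A \<in> \<Gamma>" for A
    using ext_open_act[OF U that] by (simp add: ext_open_def topspace_ext)
  have "{p \<in> topspace (ext_uhp \<Gamma>). orbit \<Gamma> p \<in> orbit \<Gamma> ` U} = (\<Union>A\<in>\<Gamma>. act A ` U)"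
  proof (intro equalityI subsetI)
    fix p assume "p \<in> {p \<in> topspace (ext_uhp \<Gamma>). orbit \<Gamma> p \<in> orbit \<Gamma> ` U}"
    then obtain q where "q \<in> U" "orbit \<Gamma> q = orbit \<Gamma> p" by auto
    then show "p \<in> (\<Union>A\<in>\<Gamma>. act A ` U)" using orbit_eqD[of q p] by blast
  next
    fix p assume "p \<in> (\<Union>A\<in>\<Gamma>. act A ` U)"
    then obtain A q where A: "A \<in> \<Gamma>" "q \<in> U" "p = act A q" by blast
    then have "orbit \<Gamma> p = orbit \<Gamma> q" by (simp add: orbit_act)
    then show "p \<in> {p \<in> topspace (ext_uhp \<Gamma>). orbit \<Gamma> p \<in> orbit \<Gamma> ` U}"
      using sub A by blast
  qed
  moreover have "openin (ext_uhp \<Gamma>) (\<Union>A\<in>\<Gamma>. act A ` U)"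
    by (intro openin_Union) (auto simp: openin_ext_uhp intro: ext_open_act[OF U])
  ultimately show "ext_open \<Gamma> {p \<in> topspace (ext_uhp \<Gamma>). orbit \<Gamma> p \<in> orbit \<Gamma> ` U}"
    by (simp add: openin_ext_uhp)
qed

lemma topspace_orbit_space: "topspace (orbit_space \<Gamma> (ext_uhp \<Gamma>)) = orbit \<Gamma> ` topspace (ext_uhp \<Gamma>)"
proof
  show "topspace (orbit_space \<Gamma> (ext_uhp \<Gamma>)) \<subseteq> orbit \<Gamma> ` topspace (ext_uhp \<Gamma>)"
    unfolding topspace_def[of "orbit_space \<Gamma> (ext_uhp \<Gamma>)"] openin_orbit_space orbit_open_def by blast
  show "orbit \<Gamma> ` topspace (ext_uhp \<Gamma>) \<subseteq> topspace (orbit_space \<Gamma> (ext_uhp \<Gamma>))"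
    using openin_orbit_image[of "topspace (ext_uhp \<Gamma>)"] openin_subset
    by (metis openin_ext_uhp openin_topspace)
qed

lemma continuous_map_orbit: "continuous_map (ext_uhp \<Gamma>) (orbit_space \<Gamma> (ext_uhp \<Gamma>)) (orbit \<Gamma>)"
  unfolding continuous_map_def topspace_orbit_space openin_orbit_space
  by (auto simp: orbit_open_def)

lemma continuous_map_Some: "continuous_map (top_of_set uhp) (ext_uhp \<Gamma>) Some"
  unfolding continuous_map_def topspace_ext openin_ext_uhp
  by (auto simp: ext_open_def openin_open_eq[OF open_uhp])

text \<open>At a cusp a horoball is taken so high that two of its points can only be related by
  elements fixing the cusp; inside the half-plane a ball from \<open>point_neighbourhood\<close>
  serves. Because of this, a translate of \<open>U\<close> determines the translating element up to
  elements fixing \<open>p\<close>.\<close>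

lemma ext_neighbourhood:
  assumes sc: "\<And>\<aa>. cusp \<Gamma> \<aa> \<Longrightarrow> \<exists>S. scaling_matrix \<Gamma> \<aa> S"
    and p: "p \<in> topspace (ext_uhp \<Gamma>)"
  shows "\<exists>U. ext_open \<Gamma> U \<and> p \<in> U \<and> (\<forall>A\<in>\<Gamma>. \<forall>q\<in>U. act A q \<in> U \<longrightarrow> act A p = p)"
proof (cases "p \<in> Some ` uhp")
  case True
  then obtain z where z: "z \<in> uhp" "p = Some z" by blast
  obtain e where e: "e > 0" "ball z e \<subseteq> uhp"
    "\<And>A w. A \<in> \<Gamma> \<Longrightarrow> w \<in> ball z e \<Longrightarrow> moeb A w \<in> ball z e \<Longrightarrow> moeb A z = z"
    using point_neighbourhood[OF z(1)] by blast
  show ?thesis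
  proof (intro exI conjI ballI impI)
    show "ext_open \<Gamma> (Some ` ball z e)" using e by (intro ext_open_Some) auto
    show "p \<in> Some ` ball z e" using e z by auto
    fix A q assume A: "A \<in> \<Gamma>" and q: "q \<in> Some ` ball z e" "act A q \<in> Some ` ball z e"
    then obtain w where w: "w \<in> ball z e" "q = Some w" by blast
    then have "moeb A w \<in> ball z e" using q A e by (auto simp: act_Some_uhp det_Gamma subset_eq)
    then show "act A p = p" using e(3)[OF A w(1)] z A by (simp add: act_Some_uhp det_Gamma)
  qed
next
  case False
  then have c: "cusp \<Gamma> p" using p by (auto simp: topspace_ext)
  obtain S where S: "scaling_matrix \<Gamma> p S" using sc[OF c] by blast
  then have dS: "det S = 1" "act S None = p" by (auto simp: scaling_matrix_def)
  obtain R where R: "R > 0" "\<And>A w. A \<in> \<Gamma> \<Longrightarrow> w \<in> uhp \<Longrightarrow> (matrix_inv S ** A ** S) $ 2 $ 1 \<noteq> 0 \<Longrightarrow>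
      Im (moeb (matrix_inv S ** A ** S) w) \<le> R / Im w"
    using scaling_pair_height[OF S S] by blast
  show ?thesis
  proof (intro exI conjI ballI impI)
    \<comment> \<open>Height \<open>R + 1\<close> excludes a nonzero lower left entry: a point of
      height at least 1 would be sent to height at most \<open>R\<close>.\<close>
    show "ext_open \<Gamma> (horoball S (R + 1))" using dS c R by (intro ext_open_horoball) auto
    show "p \<in> horoball S (R + 1)" using dS by (simp add: horoball_def)
    fix A q assume A: "A \<in> \<Gamma>" and q: "q \<in> horoball S (R + 1)" "act A q \<in> horoball S (R + 1)"
    show "act A p = p"
    proof (cases "q = p")
      case True
      then show ?thesis using q cusp_act[OF c A] cusp_not_uhp dS by (auto simp: horoball_def)
    next
      case False
      then obtain z where z: "z \<in> uhp" "q = Some z" "Im (moeb (matrix_inv S) z) > R + 1"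
        using q dS by (auto simp: horoball_def)
      have Az: "moeb A z \<in> uhp" "act A q = Some (moeb A z)" using z A by (auto simp: act_Some_uhp moeb_uhp det_Gamma)
      then have "Im (moeb (matrix_inv S) (moeb A z)) > R + 1"
        using q cusp_not_uhp[OF c] dS unfolding horoball_def by fastforce
      moreover define w where "w = moeb (matrix_inv S) z"
      have w: "w \<in> uhp" "z = moeb S w"
        using z dS by (simp_all add: w_def moeb_uhp det_matrix_inv_sl2 moeb_inv_cancel)
      have "moeb (matrix_inv S) (moeb A z) = moeb (matrix_inv S ** A ** S) w"
        using w dS A by (simp add: moeb_mult moeb_uhp det_mult_sl2 det_matrix_inv_sl2 det_Gamma)
      ultimately have *: "Im (moeb (matrix_inv S ** A ** S) w) > R + 1" by simp
      have "R / Im w \<le> R" using z R by (simp add: w_def[symmetric] field_simps)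
      then have "(matrix_inv S ** A ** S) $ 2 $ 1 = 0"
        using R(2)[OF A w(1)] * by force
      then show ?thesis using scaling_pair_upper(1)[OF S S A] by simp
    qed
  qed
qed

lemma stab_cusp_cases:
  assumes S: "scaling_matrix \<Gamma> \<aa> S" and A: "A \<in> stab \<Gamma> \<aa>"
  shows "A = mat 1 \<or> A = - mat 1 \<or> parabolic A"
proof -
  have dS: "det S = 1" using S by (auto simp: scaling_matrix_def)
  obtain n :: int where n: "A = S ** transl (of_int n) ** matrix_inv S \<or>
    A = - (S ** transl (of_int n) ** matrix_inv S)"
    by (rule stab_scaling_conj[OF S A])
  show ?thesis
  proof (cases "n = 0")
    case True
    have "transl 0 = mat 1" by (intro mat2_eqI) simp_all
    then show ?thesis using n True dS by (auto simp: matrix_inv_right_sl2)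
  next
    case False
    have "parabolic (transl (of_int n))"
      using False by (auto simp: parabolic_def trace_def sum_2 vec_eq_iff forall_2)
    then have "parabolic (S ** transl (of_int n) ** matrix_inv S)"
      using dS by (intro parabolic_conj)
    moreover have "parabolic (- B)" if "parabolic B" for B
    proof -
      have "B \<noteq> mat 1" "B \<noteq> - mat 1" "det B = 1" "\<bar>trace B\<bar> = 2"
        using that by (auto simp: parabolic_def)
      moreover have "trace (- B) = - trace B" by (simp add: trace_def sum_2)
      moreover have "- B = mat 1 \<Longrightarrow> B = - mat 1" by (drule arg_cong[of _ _ uminus]) simp
      ultimately show ?thesis unfolding parabolic_def det_uminus_sl2 by auto
    qed
    ultimately show ?thesis using n by blast
  qed
qed

text \<open>An element fixing a cusp is plus or minus 1 or parabolic, and stabilizers of points of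
  the half-plane are finite. With this, the homomorphism can be read on the orbit space, where
  points have no distinguished lifts.\<close>

lemma hom_stab:
  fixes \<phi> :: "real^2^2 \<Rightarrow> complex"
  assumes hom: "\<And>A B. A \<in> \<Gamma> \<Longrightarrow> B \<in> \<Gamma> \<Longrightarrow> \<phi> (A ** B) = \<phi> A + \<phi> B"
    and par: "\<And>A. A \<in> \<Gamma> \<Longrightarrow> parabolic A \<Longrightarrow> \<phi> A = 0"
    and sc: "\<And>\<aa>. cusp \<Gamma> \<aa> \<Longrightarrow> \<exists>S. scaling_matrix \<Gamma> \<aa> S"
    and p: "p \<in> topspace (ext_uhp \<Gamma>)" and A: "A \<in> \<Gamma>" "act A p = p"
  shows "\<phi> A = 0"
proof (cases "p \<in> Some ` uhp")
  case True
  then obtain z where z: "z \<in> uhp" "p = Some z" by blast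
  then have "moeb A z = z" using A by (simp add: act_Some_uhp det_Gamma)
  then show ?thesis using hom_stab_point[OF hom A(1) _ z(1)] by simp
next
  case False
  then have c: "cusp \<Gamma> p" using p by (auto simp: topspace_ext)
  obtain S where S: "scaling_matrix \<Gamma> p S" using sc[OF c] by blast
  have "A \<in> stab \<Gamma> p" using A by (simp add: stab_def)
  then have "A = mat 1 \<or> A = - mat 1 \<or> parabolic A" by (rule stab_cusp_cases[OF S])
  then show ?thesis using hom_one[OF hom] hom_minus[OF hom one_Gamma] par A by auto
qed

end

section \<open>Homology of the quotient and parabolic homomorphisms\<close>

text \<open>The pairing of an integral chain with the complex cochain \<open>v\<close>.\<close>

definition frag_eval :: "('a \<Rightarrow> complex) \<Rightarrow> ('a \<Rightarrow>\<^sub>0 int) \<Rightarrow> complex" where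
  "frag_eval v c = (\<Sum>f\<in>Poly_Mapping.keys c. of_int (Poly_Mapping.lookup c f) * v f)"

lemma frag_eval_superset:
  assumes "finite K" "Poly_Mapping.keys c \<subseteq> K"
  shows "frag_eval v c = (\<Sum>f\<in>K. of_int (Poly_Mapping.lookup c f) * v f)"
  unfolding frag_eval_def using assms by (intro sum.mono_neutral_left) (auto simp: in_keys_iff)

lemma frag_eval_0 [simp]: "frag_eval v 0 = 0"
  by (simp add: frag_eval_def)

lemma frag_eval_of [simp]: "frag_eval v (frag_of f) = v f"
  by (simp add: frag_eval_def)

lemma frag_eval_diff: "frag_eval v (a - b) = frag_eval v a - frag_eval v b"
proof -
  define K where "K = Poly_Mapping.keys a \<union> Poly_Mapping.keys b"
  have "Poly_Mapping.keys (a - b) \<subseteq> K" unfolding K_def by (rule keys_diff)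
  then show ?thesis
    by (simp add: frag_eval_superset[of K] K_def lookup_minus left_diff_distrib sum_subtractf)
qed

lemma frag_eval_minus: "frag_eval v (- a) = - frag_eval v a"
  using frag_eval_diff[of v 0 a] by simp

lemma frag_eval_add: "frag_eval v (a + b) = frag_eval v a + frag_eval v b"
  using frag_eval_diff[of v a "- b"] by (simp add: frag_eval_minus)

lemma frag_eval_sum: "frag_eval v (sum a I) = (\<Sum>i\<in>I. frag_eval v (a i))"
  by (induction I rule: infinite_finite_induct) (auto simp: frag_eval_add)

lemma frag_eval_cmul: "frag_eval v (frag_cmul n a) = of_int n * frag_eval v a"
proof -
  have "Poly_Mapping.keys (frag_cmul n a) \<subseteq> Poly_Mapping.keys a" by (rule keys_cmul)
  then show ?thesis
    by (simp add: frag_eval_superset[of "Poly_Mapping.keys a"] sum_distrib_left mult.assoc)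
qed

lemma frag_eval_extend_eq_0:
  assumes "\<And>f. f \<in> Poly_Mapping.keys c \<Longrightarrow> frag_eval v (b f) = 0"
  shows "frag_eval v (frag_extend b c) = 0"
  using assms by (simp add: frag_extend_def frag_eval_sum frag_eval_cmul)

text \<open>The genus is given by an isomorphism between groups of homology classes; this turns it
  into a statement about chains. The cycles \<open>b k\<close> represent the preimages of the free
  generators, and the coefficients of \<open>c\<close> are the coordinates of its class.\<close>

lemma homology_generators:
  fixes X :: "'x topology"
  assumes "homology_group 1 X \<cong> free_Abelian_group {..<n::nat}"
  obtains b where "\<And>k. k < n \<Longrightarrow> singular_relcycle 1 X {} (b k)"
    "\<And>c. singular_relcycle 1 X {} c \<Longrightarrow>
       \<exists>m::nat \<Rightarrow> int. singular_relboundary 1 X {} (c - (\<Sum>k<n. frag_cmul (m k) (b k)))"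
proof -
  note One_nat_def [simp del]
  let ?H = "relative_homology_group (int 1) X {}"
  obtain h where h: "h \<in> iso ?H (free_Abelian_group {..<n})"
    using assms unfolding is_iso_def by auto
  then have hom: "h \<in> hom ?H (free_Abelian_group {..<n})"
    and bij: "bij_betw h (carrier ?H) (carrier (free_Abelian_group {..<n}))"
    by (auto simp: iso_def)
  \<comment> \<open>\<open>g\<close> reads the class of a cycle in coordinates. It is additive
    because homology is a quotient group, whose product is the sum of cosets.\<close>
  define g where "g c = h (homologous_rel_set 1 X {} c)" for c
  have car: "homologous_rel_set 1 X {} c \<in> carrier ?H" if "singular_relcycle 1 X {} c" for c
    using that unfolding carrier_relative_homology_group by blast
  have g_add: "g (a + b) = g a + g b" if a: "singular_relcycle 1 X {} a" and b: "singular_relcycle 1 X {} b" for a b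
  proof -
    let ?R = "relcycle_group 1 X {}" and ?N = "singular_relboundary_set 1 X {}"
    interpret N: normal ?N ?R by (rule normal_subgroup_singular_relboundary_relcycle)
    have "(?N #>\<^bsub>?R\<^esub> a) <#>\<^bsub>?R\<^esub> (?N #>\<^bsub>?R\<^esub> b) = ?N #>\<^bsub>?R\<^esub> (a \<otimes>\<^bsub>?R\<^esub> b)"
      using a b by (intro N.rcos_sum) (auto simp: carrier_relcycle_group)
    moreover have "x \<otimes>\<^bsub>?H\<^esub> y = x <#>\<^bsub>?R\<^esub> y" for x y
      unfolding nontrivial_relative_homology_group FactGroup_def by simp
    ultimately have "homologous_rel_set 1 X {} a \<otimes>\<^bsub>?H\<^esub> homologous_rel_set 1 X {} b =
      homologous_rel_set 1 X {} (a + b)"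
      unfolding right_coset_singular_relboundary by simp
    then show ?thesis
      using hom_mult[OF hom car[OF a] car[OF b]] by (simp add: g_def)
  qed
  have cyc_sum: "singular_relcycle 1 X {} (sum a I)" if "\<And>i. i \<in> I \<Longrightarrow> singular_relcycle 1 X {} (a i)" for a and I :: "nat set"
    using that by (induction I rule: infinite_finite_induct) (auto simp: singular_relcycle_add)
  have g_0: "g 0 = 0"
    using g_add[of 0 0] by simp
  have g_sum: "g (sum a I) = (\<Sum>i\<in>I. g (a i))" if "\<And>i. i \<in> I \<Longrightarrow> singular_relcycle 1 X {} (a i)" for a and I :: "nat set"
    using that by (induction I rule: infinite_finite_induct) (auto simp: g_0 g_add cyc_sum)
  have g_minus: "g (- a) = - g a" if "singular_relcycle 1 X {} a" for a
    using g_add[OF that singular_relcycle_minus[THEN iffD2, OF that]] g_0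
    by (simp add: minus_unique)
  have cyc_cmul_nat: "singular_relcycle 1 X {} (frag_cmul (int m) a)" if "singular_relcycle 1 X {} a" for m a
    using that by (induction m) (auto simp: frag_cmul_distrib singular_relcycle_add)
  have cyc_cmul: "singular_relcycle 1 X {} (frag_cmul m a)" if a: "singular_relcycle 1 X {} a" for m a
  proof (cases m rule: int_cases2)
    case (nonneg k) then show ?thesis using cyc_cmul_nat[OF a] by simp
  next
    case (nonpos k)
    then have "frag_cmul m a = - frag_cmul (int k) a" by simp
    then show ?thesis using cyc_cmul_nat[OF a] singular_relcycle_minus by metis
  qed
  have g_cmul_nat: "g (frag_cmul (int m) a) = frag_cmul (int m) (g a)" if "singular_relcycle 1 X {} a" for m a
    using that by (induction m) (auto simp: g_0 frag_cmul_distrib g_add cyc_cmul)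
  have g_cmul: "g (frag_cmul m a) = frag_cmul m (g a)" if a: "singular_relcycle 1 X {} a" for m a
  proof (cases m rule: int_cases2)
    case (nonneg k) then show ?thesis using g_cmul_nat[OF a] by simp
  next
    case (nonpos k)
    have "frag_cmul m a = - frag_cmul (int k) a" using nonpos by simp
    then show ?thesis using g_minus[OF cyc_cmul[OF a]] g_cmul_nat[OF a] nonpos by simp
  qed
  have "\<exists>c. singular_relcycle 1 X {} c \<and> g c = frag_of k" if "k < n" for k
  proof -
    have "frag_of k \<in> h ` carrier ?H" using bij that by (simp add: bij_betw_def)
    then show ?thesis unfolding carrier_relative_homology_group g_def by auto
  qed
  then obtain b where b: "\<And>k. k < n \<Longrightarrow> singular_relcycle 1 X {} (b k)" "\<And>k. k < n \<Longrightarrow> g (b k) = frag_of k"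
    by metis
  show ?thesis
  proof (rule that[OF b(1)])
    fix c assume c: "singular_relcycle 1 X {} c"
    define m where "m k = Poly_Mapping.lookup (g c) k" for k
    define s where "s = (\<Sum>k<n. frag_cmul (m k) (b k))"
    have s: "singular_relcycle 1 X {} s" unfolding s_def by (intro cyc_sum cyc_cmul b) auto
    have "g c \<in> carrier (free_Abelian_group {..<n})"
      unfolding g_def by (rule hom_in_carrier[OF hom car[OF c]])
    then have "Poly_Mapping.keys (g c) \<subseteq> {..<n}" by simp
    then have "g c = (\<Sum>k<n. frag_cmul (m k) (frag_of k))"
      by (intro poly_mapping_eqI) (auto simp: lookup_sum m_def when_def in_keys_iff subset_eq if_distrib cong: if_cong)
    moreover have "g s = (\<Sum>k<n. frag_cmul (m k) (frag_of k))"
      unfolding s_def by (subst g_sum) (auto simp: b g_cmul cyc_cmul)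
    ultimately have "g (c - s) = 0"
      using g_add[OF c singular_relcycle_minus[THEN iffD2, OF s]] g_minus[OF s] by simp
    then have "h (homologous_rel_set 1 X {} (c - s)) = h (homologous_rel_set 1 X {} 0)"
      using g_0 by (simp add: g_def)
    then have "homologous_rel_set 1 X {} (c - s) = homologous_rel_set 1 X {} 0"
      using bij car[OF singular_relcycle_diff[OF c s]] car[of 0] by (auto simp: bij_betw_def dest: inj_onD)
    then have "singular_relboundary 1 X {} (c - s)"
      by (metis diff_zero homologous_rel_def homologous_rel_set_eq)
    then show "\<exists>m. singular_relboundary 1 X {} (c - (\<Sum>k<n. frag_cmul (m k) (b k)))"
      unfolding s_def by blast
  qed
qed

text \<open>The differences \<open>d i - d j\<close> form a Cech cocycle of locally constant
  functions on the cover. The functions \<open>d i\<close> themselves need not be continuous, which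
  allows them to be defined from an arbitrary choice of orbit representatives.\<close>

locale local_system =
  fixes X :: "'x topology" and I :: "'i set" and V :: "'i \<Rightarrow> 'x set" and d :: "'i \<Rightarrow> 'x \<Rightarrow> complex"
  assumes openV: "i \<in> I \<Longrightarrow> openin X (V i)"
    and coverV: "x \<in> topspace X \<Longrightarrow> \<exists>i\<in>I. x \<in> V i"
    and trans: "i \<in> I \<Longrightarrow> j \<in> I \<Longrightarrow> x \<in> V i \<Longrightarrow> x \<in> V j \<Longrightarrow>
       \<exists>N. openin X N \<and> x \<in> N \<and> N \<subseteq> V i \<inter> V j \<and> (\<forall>y\<in>N. d i y - d j y = d i x - d j x)"
begin

text \<open>The functions \<open>d i\<close> are local potentials whose differences are locally constant; \<open>adapted\<close> functions
  are their continuations along a map. Their increments along paths depend only on the homology class.\<close>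

definition adapted :: "('t::topological_space \<Rightarrow> 'x) \<Rightarrow> 't set \<Rightarrow> ('t \<Rightarrow> complex) \<Rightarrow> bool" where
  "adapted \<sigma> S D \<longleftrightarrow> (\<forall>t\<in>S. \<forall>i\<in>I. \<sigma> t \<in> V i \<longrightarrow>
     (\<exists>T. open T \<and> t \<in> T \<and> (\<forall>u\<in>T \<inter> S. \<sigma> u \<in> V i \<and> D u - d i (\<sigma> u) = D t - d i (\<sigma> t))))"

lemma adaptedE:
  assumes "adapted \<sigma> S D" "t \<in> S" "i \<in> I" "\<sigma> t \<in> V i"
  obtains T where "open T" "t \<in> T" "\<And>u. u \<in> T \<inter> S \<Longrightarrow> \<sigma> u \<in> V i \<and> D u - d i (\<sigma> u) = D t - d i (\<sigma> t)"
proof -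
  have "\<exists>T. open T \<and> t \<in> T \<and> (\<forall>u\<in>T \<inter> S. \<sigma> u \<in> V i \<and> D u - d i (\<sigma> u) = D t - d i (\<sigma> t))"
    using assms unfolding adapted_def by simp
  then show ?thesis using that by (elim exE conjE) auto
qed

lemma continuous_nbhd:
  assumes "continuous_map (top_of_set S) X \<sigma>" "openin X N" "t \<in> S" "\<sigma> t \<in> N"
  obtains T where "open T" "t \<in> T" "\<And>u. u \<in> T \<Longrightarrow> u \<in> S \<Longrightarrow> \<sigma> u \<in> N"
proof -
  have "openin (top_of_set S) {u \<in> S. \<sigma> u \<in> N}"
    using openin_continuous_map_preimage[OF assms(1,2)] by simp
  then obtain T where "open T" "{u \<in> S. \<sigma> u \<in> N} = S \<inter> T" unfolding openin_open by auto
  then show ?thesis using that[of T] assms by blast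
qed

text \<open>One index at each point suffices: near the point every other potential differs from it
  by a constant.\<close>

lemma adaptedI:
  assumes c: "continuous_map (top_of_set S) X \<sigma>"
    and D: "\<And>t. t \<in> S \<Longrightarrow> \<exists>i\<in>I. \<sigma> t \<in> V i \<and>
       (\<exists>T. open T \<and> t \<in> T \<and> (\<forall>u\<in>T \<inter> S. D u - d i (\<sigma> u) = D t - d i (\<sigma> t)))"
  shows "adapted \<sigma> S D"
  unfolding adapted_def
proof (intro ballI impI)
  fix t j assume t: "t \<in> S" and j: "j \<in> I" "\<sigma> t \<in> V j"
  obtain i T where i: "i \<in> I" "\<sigma> t \<in> V i" and T: "open T" "t \<in> T"
    "\<And>u. u \<in> T \<Longrightarrow> u \<in> S \<Longrightarrow> D u - d i (\<sigma> u) = D t - d i (\<sigma> t)"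
    using D[OF t] by blast
  obtain N where N: "openin X N" "\<sigma> t \<in> N" "N \<subseteq> V i \<inter> V j"
    "\<And>y. y \<in> N \<Longrightarrow> d i y - d j y = d i (\<sigma> t) - d j (\<sigma> t)"
    using trans[OF i(1) j(1) i(2) j(2)] by blast
  obtain T' where T': "open T'" "t \<in> T'" "\<And>u. u \<in> T' \<Longrightarrow> u \<in> S \<Longrightarrow> \<sigma> u \<in> N"
    using continuous_nbhd[OF c N(1) t N(2)] by blast
  have "\<sigma> u \<in> V j \<and> D u - d j (\<sigma> u) = D t - d j (\<sigma> t)" if "u \<in> (T \<inter> T') \<inter> S" for u
  proof -
    have "\<sigma> u \<in> N" using T' that by blast
    moreover have "D u - d i (\<sigma> u) = D t - d i (\<sigma> t)" using T that by blast
    moreover have "D u - d j (\<sigma> u) = (D u - d i (\<sigma> u)) + (d i (\<sigma> u) - d j (\<sigma> u))" by simp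
    ultimately show ?thesis using N(3) N(4)[of "\<sigma> u"] by auto
  qed
  then show "\<exists>T. open T \<and> t \<in> T \<and> (\<forall>u\<in>T \<inter> S. \<sigma> u \<in> V j \<and> D u - d j (\<sigma> u) = D t - d j (\<sigma> t))"
    using T T' by (intro exI[of _ "T \<inter> T'"]) auto
qed

lemma adapted_subset:
  assumes D: "adapted \<sigma> S D" and S': "S' \<subseteq> S" shows "adapted \<sigma> S' D"
  unfolding adapted_def
proof (intro ballI impI)
  fix t i assume "t \<in> S'" "i \<in> I" "\<sigma> t \<in> V i"
  then obtain T where "open T" "t \<in> T" "\<forall>u\<in>T \<inter> S. \<sigma> u \<in> V i \<and> D u - d i (\<sigma> u) = D t - d i (\<sigma> t)"
    using D S' unfolding adapted_def by blast
  then show "\<exists>T. open T \<and> t \<in> T \<and> (\<forall>u\<in>T \<inter> S'. \<sigma> u \<in> V i \<and> D u - d i (\<sigma> u) = D t - d i (\<sigma> t))"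
    using S' by (intro exI[of _ T]) auto
qed

lemma adapted_comp:
  assumes D: "adapted \<sigma> S D" and g: "continuous_on S' g" "g ` S' \<subseteq> S"
    and eq: "\<And>t. t \<in> S' \<Longrightarrow> \<tau> t = \<sigma> (g t)"
  shows "adapted \<tau> S' (D \<circ> g)"
  unfolding adapted_def
proof (intro ballI impI)
  fix t i assume t: "t \<in> S'" and i: "i \<in> I" "\<tau> t \<in> V i"
  have "g t \<in> S" "\<sigma> (g t) \<in> V i" using t i g eq by auto
  then have "\<exists>T. open T \<and> g t \<in> T \<and>
      (\<forall>u\<in>T \<inter> S. \<sigma> u \<in> V i \<and> D u - d i (\<sigma> u) = D (g t) - d i (\<sigma> (g t)))"
    using D i(1) unfolding adapted_def by simp
  then obtain T where T: "open T" "g t \<in> T" "\<And>u. u \<in> T \<Longrightarrow> u \<in> S \<Longrightarrow>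
      \<sigma> u \<in> V i \<and> D u - d i (\<sigma> u) = D (g t) - d i (\<sigma> (g t))"
    by auto
  obtain T' where T': "open T'" "T' \<inter> S' = g -` T \<inter> S'"
    using g(1) T(1) unfolding continuous_on_open_invariant by metis
  show "\<exists>T. open T \<and> t \<in> T \<and> (\<forall>u\<in>T \<inter> S'. \<tau> u \<in> V i \<and> (D \<circ> g) u - d i (\<tau> u) = (D \<circ> g) t - d i (\<tau> t))"
  proof (intro exI[of _ T'] conjI ballI)
    show "t \<in> T'" using T' T t by blast
    fix u assume "u \<in> T' \<inter> S'"
    then have "u \<in> S'" "g u \<in> T" "g u \<in> S" using T' g by auto
    then show "\<tau> u \<in> V i" "(D \<circ> g) u - d i (\<tau> u) = (D \<circ> g) t - d i (\<tau> t)"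
      using T(3)[of "g u"] eq t by auto
  qed (fact T')
qed

text \<open>Near each point both continuations follow the same potential, so their difference is
  locally constant.\<close>

lemma adapted_unique:
  assumes c: "continuous_map (top_of_set S) X \<sigma>"
    and D: "adapted \<sigma> S D" and D': "adapted \<sigma> S D'" and S: "connected S" "a \<in> S" "b \<in> S"
  shows "D a - D' a = D b - D' b"
proof (rule connected_local_const[OF S])
  show "\<forall>a\<in>S. \<forall>\<^sub>F b in at a within S. D a - D' a = D b - D' b"
  proof
    fix t assume t: "t \<in> S"
    have "\<sigma> t \<in> topspace X" using c t by (auto simp: continuous_map_def)
    then obtain i where i: "i \<in> I" "\<sigma> t \<in> V i" using coverV by blast
    obtain T where T: "open T" "t \<in> T" "\<And>u. u \<in> T \<inter> S \<Longrightarrow> D u - d i (\<sigma> u) = D t - d i (\<sigma> t)"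
      by (rule adaptedE[OF D t i]) auto
    obtain T' where T': "open T'" "t \<in> T'" "\<And>u. u \<in> T' \<inter> S \<Longrightarrow> D' u - d i (\<sigma> u) = D' t - d i (\<sigma> t)"
      by (rule adaptedE[OF D' t i]) auto
    have "D t - D' t = D u - D' u" if "u \<in> (T \<inter> T') \<inter> S" for u
    proof -
      have "D u - D' u = (D u - d i (\<sigma> u)) - (D' u - d i (\<sigma> u))" by simp
      also have "\<dots> = (D t - d i (\<sigma> t)) - (D' t - d i (\<sigma> t))"
        using T(3)[of u] T'(3)[of u] that by simp
      finally show ?thesis by simp
    qed
    then show "\<forall>\<^sub>F b in at t within S. D t - D' t = D b - D' b"
      unfolding eventually_at_topological using T T' by (intro exI[of _ "T \<inter> T'"]) auto
  qed
qed

text \<open>On the connected intersection the two continuations differ by a constant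
  \<open>k\<close>, which is absorbed into the second one. Since the sets are closed, a point
  outside one of them has a neighbourhood in which that set imposes no condition.\<close>

lemma adapted_glue:
  assumes c: "continuous_map (top_of_set (A \<union> B)) X \<sigma>"
    and D1: "adapted \<sigma> A D1" and D2: "adapted \<sigma> B D2"
    and cl: "closed A" "closed B" and con: "connected (A \<inter> B)"
  shows "\<exists>D. adapted \<sigma> (A \<union> B) D"
proof -
  have cAB: "continuous_map (top_of_set (A \<inter> B)) X \<sigma>"
    using continuous_map_from_subtopology_mono[OF c] by blast
  obtain k where k: "\<And>t. t \<in> A \<inter> B \<Longrightarrow> D1 t = D2 t + k"
  proof (cases "A \<inter> B = {}")
    case False
    then obtain a where a: "a \<in> A \<inter> B" by blast
    have "D1 t = D2 t + (D1 a - D2 a)" if "t \<in> A \<inter> B" for t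
      using adapted_unique[OF cAB _ _ con a that] adapted_subset[OF D1] adapted_subset[OF D2]
      by (simp add: algebra_simps)
    then show ?thesis using that by blast
  qed (use that in auto)
  define D where "D t = (if t \<in> A then D1 t else D2 t + k)" for t
  have DB: "D t = D2 t + k" if "t \<in> B" for t using that k by (simp add: D_def)
  have DA: "D t = D1 t" if "t \<in> A" for t using that by (simp add: D_def)
  have "adapted \<sigma> (A \<union> B) D"
    unfolding adapted_def
  proof (intro ballI impI)
    fix t i assume t: "t \<in> A \<union> B" and i: "i \<in> I" "\<sigma> t \<in> V i"
    have 1: "\<exists>T. open T \<and> t \<in> T \<and> (\<forall>u\<in>T \<inter> A. \<sigma> u \<in> V i \<and> D u - d i (\<sigma> u) = D t - d i (\<sigma> t))"
    proof (cases "t \<in> A")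
      case True
      obtain T where "open T" "t \<in> T" "\<And>u. u \<in> T \<inter> A \<Longrightarrow> \<sigma> u \<in> V i \<and> D1 u - d i (\<sigma> u) = D1 t - d i (\<sigma> t)"
        by (rule adaptedE[OF D1 True i]) auto
      then show ?thesis using True DA by (intro exI[of _ T]) (metis IntD2)
    next
      case False
      then show ?thesis using cl by (intro exI[of _ "- A"]) auto
    qed
    have 2: "\<exists>T. open T \<and> t \<in> T \<and> (\<forall>u\<in>T \<inter> B. \<sigma> u \<in> V i \<and> D u - d i (\<sigma> u) = D t - d i (\<sigma> t))"
    proof (cases "t \<in> B")
      case True
      obtain T where T: "open T" "t \<in> T" "\<And>u. u \<in> T \<inter> B \<Longrightarrow> \<sigma> u \<in> V i \<and> D2 u - d i (\<sigma> u) = D2 t - d i (\<sigma> t)"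
        by (rule adaptedE[OF D2 True i]) auto
      have "\<sigma> u \<in> V i \<and> D u - d i (\<sigma> u) = D t - d i (\<sigma> t)" if u: "u \<in> T \<inter> B" for u
      proof
        show "\<sigma> u \<in> V i" using T(3)[OF u] by simp
        have "D u - d i (\<sigma> u) = (D2 u - d i (\<sigma> u)) + k" using DB[of u] u by simp
        also have "\<dots> = (D2 t - d i (\<sigma> t)) + k" using T(3)[OF u] by simp
        finally show "D u - d i (\<sigma> u) = D t - d i (\<sigma> t)" using DB[OF True] by simp
      qed
      then show ?thesis using T(1,2) by (intro exI[of _ T] conjI ballI) blast+
    next
      case False
      then show ?thesis using cl by (intro exI[of _ "- B"]) auto
    qed
    obtain T where "open T" "t \<in> T" "\<forall>u\<in>T \<inter> A. \<sigma> u \<in> V i \<and> D u - d i (\<sigma> u) = D t - d i (\<sigma> t)"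
      using 1 by (elim exE conjE)
    moreover obtain T' where "open T'" "t \<in> T'" "\<forall>u\<in>T' \<inter> B. \<sigma> u \<in> V i \<and> D u - d i (\<sigma> u) = D t - d i (\<sigma> t)"
      using 2 by (elim exE conjE)
    ultimately show "\<exists>T. open T \<and> t \<in> T \<and> (\<forall>u\<in>T \<inter> (A \<union> B). \<sigma> u \<in> V i \<and> D u - d i (\<sigma> u) = D t - d i (\<sigma> t))"
      by (intro exI[of _ "T \<inter> T'"] conjI ballI) blast+
  qed
  then show ?thesis by blast
qed

text \<open>A small rectangle is mapped into a single \<open>V i\<close>, where the potential itself
  is a continuation. Bisection, applied to the second coordinate over a fixed \<open>s\<close> and
  afterwards to the first coordinate, pastes the rectangles together.\<close>

lemma adapted_exists_square:
  fixes \<sigma> :: "real \<times> real \<Rightarrow> 'x"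
  assumes c: "continuous_map (top_of_set ({0..1} \<times> {0..1})) X \<sigma>"
  shows "\<exists>D. adapted \<sigma> ({0..1} \<times> {0..1}) D"
proof -
  let ?Q = "{0..1} \<times> {0..1} :: (real \<times> real) set"
  \<comment> \<open>Intersecting with \<open>?Q\<close> admits intervals that stick out of the unit
    interval, as the bisection principle \<open>Bolzano\<close> produces them.\<close>
  define good where "good a b p q \<longleftrightarrow> (\<exists>D. adapted \<sigma> (({a..b} \<times> {p..q}) \<inter> ?Q) D)" for a b p q
  have cR: "continuous_map (top_of_set (R \<inter> ?Q)) X \<sigma>" for R
    using continuous_map_from_subtopology_mono[OF c] by blast
  have conn: "connected (({a..b} \<times> {p..q}) \<inter> ?Q)" for a b p q :: real
    by (intro convex_connected convex_Int convex_Times) auto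
  have glue: "\<exists>D. adapted \<sigma> (({a..b} \<times> {p..q}) \<inter> ?Q) D"
    if "{a..b} \<times> {p..q} = {a1..b1} \<times> {p1..q1} \<union> {a2..b2} \<times> {p2..q2}" "good a1 b1 p1 q1" "good a2 b2 p2 q2"
    for a b p q a1 b1 p1 q1 a2 b2 p2 q2 :: real
  proof -
    let ?A = "({a1..b1} \<times> {p1..q1}) \<inter> ?Q" and ?B = "({a2..b2} \<times> {p2..q2}) \<inter> ?Q"
    have AB: "({a..b} \<times> {p..q}) \<inter> ?Q = ?A \<union> ?B" using that(1) by blast
    have "?A \<inter> ?B = ({max a1 a2..min b1 b2} \<times> {max p1 p2..min q1 q2}) \<inter> ?Q" by auto
    then have con: "connected (?A \<inter> ?B)" by (simp only: conn)
    have "continuous_map (top_of_set (?A \<union> ?B)) X \<sigma>" unfolding AB[symmetric] by (rule cR)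
    moreover have "closed ?A" "closed ?B" by (intro closed_Int closed_Times; simp)+
    ultimately show ?thesis
      unfolding AB using that(2,3) adapted_glue[OF _ _ _ _ _ con] unfolding good_def by blast
  qed
  have local: "\<exists>e>0. \<forall>a b p q. a \<le> s \<and> s \<le> b \<and> b - a < e \<and> p \<le> t \<and> t \<le> q \<and> q - p < e \<longrightarrow> good a b p q"
    if st: "s \<in> {0..1}" "t \<in> {0..1}" for s t
  proof -
    have "\<sigma> (s, t) \<in> topspace X" using c st by (auto simp: continuous_map_def)
    then obtain i where i: "i \<in> I" "\<sigma> (s, t) \<in> V i" using coverV by blast
    obtain T where T: "open T" "(s, t) \<in> T" "\<And>u. u \<in> T \<Longrightarrow> u \<in> ?Q \<Longrightarrow> \<sigma> u \<in> V i"
      using continuous_nbhd[OF c openV[OF i(1)] _ i(2)] st by (metis SigmaI)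
    obtain e where e: "e > 0" "ball (s, t) e \<subseteq> T" using T open_contains_ball by blast
    have "good a b p q" if "a \<le> s" "s \<le> b" "b - a < e / 2" "p \<le> t" "t \<le> q" "q - p < e / 2" for a b p q
    proof -
      have "{a..b} \<times> {p..q} \<subseteq> ball (s, t) e"
      proof
        fix u assume "u \<in> {a..b} \<times> {p..q}"
        then have "a \<le> fst u" "fst u \<le> b" "p \<le> snd u" "snd u \<le> q" by auto
        then have "\<bar>s - fst u\<bar> < e / 2" "\<bar>t - snd u\<bar> < e / 2"
          using that unfolding abs_less_iff by linarith+
        then have "norm ((s, t) - u) < e"
          using sqrt_sum_squares_le_sum_abs[of "s - fst u" "t - snd u"]
          by (simp add: norm_prod_def)
        then show "u \<in> ball (s, t) e" by (simp add: dist_norm)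
      qed
      then have "adapted \<sigma> (({a..b} \<times> {p..q}) \<inter> ?Q) (\<lambda>u. d i (\<sigma> u))"
        using i T e by (intro adaptedI[OF cR] bexI[OF _ i(1)] conjI exI[of _ UNIV]) auto
      then show ?thesis unfolding good_def by blast
    qed
    then show ?thesis using e by (intro exI[of _ "e / 2"]) auto
  qed
  have strip: "\<exists>e>0. \<forall>a b. a \<le> s \<and> s \<le> b \<and> b - a < e \<longrightarrow> good a b 0 1" if s: "s \<in> {0..1}" for s
  proof (rule Bolzano[where P = "\<lambda>p q. \<exists>e>0. \<forall>a b. a \<le> s \<and> s \<le> b \<and> b - a < e \<longrightarrow> good a b p q"])
    fix p q r :: real
    assume "\<exists>e>0. \<forall>a b. a \<le> s \<and> s \<le> b \<and> b - a < e \<longrightarrow> good a b p q"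
      "\<exists>e>0. \<forall>a b. a \<le> s \<and> s \<le> b \<and> b - a < e \<longrightarrow> good a b q r" and pq: "p \<le> q" "q \<le> r"
    then obtain e1 e2 where e: "e1 > 0" "e2 > 0"
      "\<And>a b. a \<le> s \<Longrightarrow> s \<le> b \<Longrightarrow> b - a < e1 \<Longrightarrow> good a b p q"
      "\<And>a b. a \<le> s \<Longrightarrow> s \<le> b \<Longrightarrow> b - a < e2 \<Longrightarrow> good a b q r" by metis
    have "good a b p r" if "a \<le> s" "s \<le> b" "b - a < min e1 e2" for a b
    proof -
      have "{a..b} \<times> {p..r} = {a..b} \<times> {p..q} \<union> {a..b} \<times> {q..r}" using pq by auto
      then show ?thesis using glue[OF _ e(3) e(4)] that unfolding good_def by auto
    qed
    then show "\<exists>e>0. \<forall>a b. a \<le> s \<and> s \<le> b \<and> b - a < e \<longrightarrow> good a b p r"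
      using e by (intro exI[of _ "min e1 e2"]) auto
  next
    fix t :: real assume t: "0 \<le> t" "t \<le> 1"
    obtain e where "e > 0" "\<And>a b p q. a \<le> s \<and> s \<le> b \<and> b - a < e \<and> p \<le> t \<and> t \<le> q \<and> q - p < e \<Longrightarrow> good a b p q"
      using local[of s t] s t by auto
    then show "\<exists>e>0. \<forall>p q. p \<le> t \<and> t \<le> q \<and> q - p < e \<longrightarrow>
        (\<exists>e>0. \<forall>a b. a \<le> s \<and> s \<le> b \<and> b - a < e \<longrightarrow> good a b p q)" by blast
  qed simp
  have "good 0 1 0 1"
  proof (rule Bolzano[where P = "\<lambda>a b. good a b 0 1"])
    fix a b e assume "good a b 0 1" "good b e 0 1" "a \<le> b" "b \<le> (e::real)"
    moreover have "{a..e} \<times> {0..1::real} = {a..b} \<times> {0..1} \<union> {b..e} \<times> {0..1}"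
      using \<open>a \<le> b\<close> \<open>b \<le> e\<close> by auto
    ultimately show "good a e 0 1" using glue unfolding good_def by metis
  qed (use strip in auto)
  then show ?thesis by (simp add: good_def)
qed

section \<open>Integration of a local system over singular simplices\<close>

definition edge_path :: "real \<Rightarrow> nat \<Rightarrow> real" where
  "edge_path t = (\<lambda>i. if i = 0 then 1 - t else if i = 1 then t else 0)"

text \<open>The square is folded onto the 2-simplex: its side with first coordinate 0 collapses to a
  vertex, and the other three sides become the three faces.\<close>

definition square_path :: "real \<times> real \<Rightarrow> nat \<Rightarrow> real" where
  "square_path u = (\<lambda>i. if i = 0 then 1 - fst u else if i = 1 then fst u * (1 - snd u)
     else if i = 2 then fst u * snd u else 0)"

lemma edge_path_continuous:
  "continuous_map (top_of_set {0..1}) (subtopology (powertop_real UNIV) (standard_simplex 1)) edge_path"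
proof -
  have "continuous_map (top_of_set {0..1}) euclideanreal (\<lambda>t. edge_path t i)" for i
    unfolding edge_path_def
    by (cases "i = 0"; cases "i = 1") (auto intro!: continuous_intros)
  then show ?thesis
    unfolding continuous_map_in_subtopology continuous_map_componentwise_UNIV
    by (auto simp: standard_simplex_def edge_path_def)
qed

lemma square_path_continuous:
  "continuous_map (top_of_set ({0..1} \<times> {0..1})) (subtopology (powertop_real UNIV) (standard_simplex 2)) square_path"
proof -
  have "continuous_map (top_of_set ({0..1} \<times> {0..1})) euclideanreal (\<lambda>t. square_path t i)" for i
    unfolding square_path_def
    by (cases "i = 0"; cases "i = 1"; cases "i = 2") (auto intro!: continuous_intros)
  moreover have "square_path u \<in> standard_simplex 2" if uQ: "u \<in> {0..1} \<times> {0..1}" for u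
  proof -
    obtain s t where u: "u = (s, t)" "0 \<le> s" "s \<le> 1" "0 \<le> t" "t \<le> 1" using uQ by (cases u) auto
    have "s * (1 - t) \<le> 1" "s * t \<le> 1" using u by (auto intro: mult_le_one)
    moreover have "(\<Sum>i\<le>2. square_path u i) = 1"
      by (simp add: u(1) square_path_def numeral_2_eq_2 right_diff_distrib)
    ultimately show ?thesis
      unfolding standard_simplex_def using u by (auto simp: square_path_def)
  qed
  ultimately show ?thesis
    unfolding continuous_map_in_subtopology continuous_map_componentwise_UNIV by auto
qed

text \<open>The choice is harmless, since any two continuations along a path differ by a
  constant.\<close>

definition path_val :: "((nat \<Rightarrow> real) \<Rightarrow> 'x) \<Rightarrow> complex" where
  "path_val f = (SOME v. \<exists>D. adapted (f \<circ> edge_path) {0..1} D \<and> v = D 1 - D 0)"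

lemma path_val_eq:
  assumes f: "singular_simplex 1 X f" and D: "adapted (f \<circ> edge_path) {0..1} D"
  shows "path_val f = D 1 - D 0"
proof -
  have c: "continuous_map (top_of_set {0..1}) X (f \<circ> edge_path)"
    using f edge_path_continuous continuous_map_compose unfolding singular_simplex_def by blast
  have "\<exists>D. adapted (f \<circ> edge_path) {0..1} D \<and> path_val f = D 1 - D 0"
    unfolding path_val_def by (rule someI_ex) (use D in blast)
  then obtain D' where "adapted (f \<circ> edge_path) {0..1} D'" "path_val f = D' 1 - D' 0" by blast
  moreover from this have "D 1 = D' 1 + (D 0 - D' 0)" using adapted_unique[OF c D, of D' 0 1] by simp
  ultimately show ?thesis by simp
qed

lemma simplical_face_edge_path:
  "simplical_face 0 (edge_path t) = square_path (1, t)"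
  "simplical_face 1 (edge_path t) = square_path (t, 1)"
  "simplical_face 2 (edge_path t) = square_path (t, 0)"
  by (auto simp: fun_eq_iff simplical_face_def edge_path_def square_path_def)

lemma path_val_face:
  assumes f: "singular_simplex 2 X f" and k: "k \<le> 2"
    and D: "adapted (f \<circ> square_path) ({0..1} \<times> {0..1}) D"
    and g: "continuous_on {0..1} g" "g ` {0..1} \<subseteq> {0..1} \<times> {0..1}"
    and eq: "\<And>t. t \<in> {0..1} \<Longrightarrow> simplical_face k (edge_path t) = square_path (g t)"
  shows "path_val (singular_face 2 k f) = D (g 1) - D (g 0)"
proof -
  have "singular_simplex 1 X (singular_face 2 k f)"
    using singular_simplex_singular_face[OF f _ k] by simp
  moreover have "adapted (singular_face 2 k f \<circ> edge_path) {0..1} (D \<circ> g)"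
  proof (rule adapted_comp[OF D g])
    fix t :: real assume t: "t \<in> {0..1}"
    then have "edge_path t \<in> standard_simplex 1"
      using edge_path_continuous by (auto simp: continuous_map_in_subtopology)
    then show "(singular_face 2 k f \<circ> edge_path) t = (f \<circ> square_path) (g t)"
      using eq[OF t] by (simp add: singular_face_def)
  qed
  ultimately show ?thesis using path_val_eq by fastforce
qed

text \<open>A continuation exists over the whole 2-simplex, parametrized by the square. The
  increments along its three faces, taken with alternating signs, cancel at the vertices up to the
  increment along the collapsed side, which is zero.\<close>

lemma frag_eval_boundary:
  assumes "singular_relboundary 1 X {} c"
  shows "frag_eval path_val c = 0"
proof -
  obtain e where e: "singular_chain 2 X e" "chain_boundary 2 e = c"
    using assms unfolding singular_relboundary_def mod_subset_empty by (auto simp: numeral_2_eq_2)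
  have "frag_eval path_val (\<Sum>k\<le>2. frag_cmul ((-1) ^ k) (frag_of (singular_face 2 k f))) = 0"
    if f: "singular_simplex 2 X f" for f
  proof -
    have "continuous_map (top_of_set ({0..1} \<times> {0..1})) X (f \<circ> square_path)"
      using f square_path_continuous continuous_map_compose unfolding singular_simplex_def by blast
    then obtain D where D: "adapted (f \<circ> square_path) ({0..1} \<times> {0..1}) D"
      using adapted_exists_square by blast
    have 0: "path_val (singular_face 2 0 f) = D (1, 1) - D (1, 0)"
      by (rule path_val_face[OF f _ D, where g = "\<lambda>t. (1, t)"])
        (auto simp: simplical_face_edge_path simp del: One_nat_def intro!: continuous_intros)
    have 1: "path_val (singular_face 2 1 f) = D (1, 1) - D (0, 1)"
      by (rule path_val_face[OF f _ D, where g = "\<lambda>t. (t, 1)"])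
        (auto simp: simplical_face_edge_path simp del: One_nat_def intro!: continuous_intros)
    have 2: "path_val (singular_face 2 2 f) = D (1, 0) - D (0, 0)"
      by (rule path_val_face[OF f _ D, where g = "\<lambda>t. (t, 0)"])
        (auto simp: simplical_face_edge_path simp del: One_nat_def intro!: continuous_intros)
    \<comment> \<open>The map is constant on the collapsed side, so a constant function is a
      continuation there.\<close>
    have 3: "D (0, 1) = D (0, 0)"
    proof -
      define h where "h t = (f \<circ> square_path) (0, t)" for t
      have sq: "square_path (0, t) = square_path (0, 0)" for t by (auto simp: square_path_def)
      have "adapted h {0..1} (D \<circ> Pair 0)"
        by (rule adapted_comp[OF D]) (auto simp: h_def intro!: continuous_intros)
      moreover have x: "h t = h 0" for t unfolding h_def o_def sq[of t] ..
      have "h 0 \<in> topspace X"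
        using f square_path_continuous unfolding h_def singular_simplex_def continuous_map_def by fastforce
      then have c: "continuous_map (top_of_set {0..1}) X h"
        using x continuous_map_eq[OF continuous_map_const[THEN iffD2]] by metis
      moreover have "adapted h {0..1} (\<lambda>_. 0)"
        using x coverV[OF \<open>h 0 \<in> topspace X\<close>] by (intro adaptedI[OF c]) (metis open_UNIV UNIV_I)
      ultimately show ?thesis using adapted_unique[OF c, of "D \<circ> Pair 0" "\<lambda>_. 0" 0 1] by simp
    qed
    have "{..2::nat} = {0,1,2}" by auto
    then show ?thesis using 0 1 2 3 by (simp add: frag_eval_add frag_eval_minus frag_eval_diff)
  qed
  then show ?thesis
    using e(1) unfolding e(2)[symmetric] chain_boundary_def singular_chain_def
    by (auto intro!: frag_eval_extend_eq_0)
qed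

end

section \<open>Group elements as loops in the quotient\<close>

definition loop_simplex :: "(real^2^2) set \<Rightarrow> real^2^2 \<Rightarrow> (nat \<Rightarrow> real) \<Rightarrow> complex option set" where
  "loop_simplex \<Gamma> A = restrict (\<lambda>x. orbit \<Gamma> (Some (linepath \<i> (moeb A \<i>) (x 1)))) (standard_simplex 1)"

lemma i_in_uhp: "\<i> \<in> uhp" by (simp add: uhp_def)

lemma linepath_uhp: "a \<in> uhp \<Longrightarrow> b \<in> uhp \<Longrightarrow> t \<in> {0..1} \<Longrightarrow> linepath a b t \<in> uhp"
  using convex_uhp by (auto simp: linepath_def convex_alt)

context fuchsian_group
begin

lemma singular_simplex_loop:
  assumes A: "A \<in> \<Gamma>"
  shows "singular_simplex 1 (orbit_space \<Gamma> (ext_uhp \<Gamma>)) (loop_simplex \<Gamma> A)"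
proof -
  let ?c = "linepath \<i> (moeb A \<i>)" and ?T = "subtopology (powertop_real UNIV) (standard_simplex 1)"
  have "continuous_map ?T euclideanreal (\<lambda>x. x 1)"
    by (intro continuous_map_from_subtopology continuous_map_product_projection) simp
  then have 1: "continuous_map ?T (top_of_set {0..1}) (\<lambda>x. x 1)"
    by (auto simp: continuous_map_in_subtopology standard_simplex_def)
  have "continuous_on {0..1} ?c" by (rule continuous_on_linepath)
  moreover have "?c ` {0..1} \<subseteq> uhp" using A by (auto intro!: linepath_uhp simp: i_in_uhp moeb_uhp det_Gamma)
  ultimately have 2: "continuous_map (top_of_set {0..1}) (top_of_set uhp) ?c"
    by (auto simp: continuous_map_in_subtopology)
  have "continuous_map ?T (orbit_space \<Gamma> (ext_uhp \<Gamma>)) (orbit \<Gamma> \<circ> (Some \<circ> (?c \<circ> (\<lambda>x. x 1))))"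
    by (intro continuous_map_compose[OF _ continuous_map_orbit] continuous_map_compose[OF _ continuous_map_Some]
        continuous_map_compose[OF 1 2])
  then have "continuous_map ?T (orbit_space \<Gamma> (ext_uhp \<Gamma>)) (loop_simplex \<Gamma> A)"
    by (rule continuous_map_eq) (auto simp: loop_simplex_def)
  then show ?thesis by (simp add: singular_simplex_def loop_simplex_def)
qed

text \<open>Both faces of the simplex are the orbit of \<open>\<i>\<close>, and they enter the
  boundary with opposite signs.\<close>

lemma relcycle_loop:
  assumes A: "A \<in> \<Gamma>"
  shows "singular_relcycle 1 (orbit_space \<Gamma> (ext_uhp \<Gamma>)) {} (frag_of (loop_simplex \<Gamma> A))"
proof -
  have "orbit \<Gamma> (Some (moeb A \<i>)) = orbit \<Gamma> (Some \<i>)"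
    using orbit_act[OF A, of "Some \<i>"] A by (simp add: act_Some_uhp i_in_uhp det_Gamma)
  then have eq: "singular_face 1 0 (loop_simplex \<Gamma> A) = singular_face 1 1 (loop_simplex \<Gamma> A)"
    unfolding singular_face_def
    by (intro restrict_ext) (auto simp: loop_simplex_def simplical_face_def standard_simplex_def linepath_def)
  have "{..1::nat} = {0, 1}" by auto
  then have "chain_boundary 1 (frag_of (loop_simplex \<Gamma> A)) = 0"
    using eq by (simp add: chain_boundary_def)
  then show ?thesis
    using singular_simplex_loop[OF A] by (simp add: singular_relcycle_def singular_chain_of)
qed

text \<open>A discontinuous choice \<open>r\<close> of orbit representatives serves as a section.
  The potential at \<open>p\<close> gives an orbit the value \<open>\<phi> A\<close> when its
  representative lies in the translate of \<open>U p\<close> by \<open>A\<close>. Another choice of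
  the representative changes all potentials at that orbit by the same amount, so their differences
  have a meaning.\<close>

lemma parabolic_hom_local_system:
  fixes \<phi> :: "real^2^2 \<Rightarrow> complex"
  assumes hom: "\<And>A B. A \<in> \<Gamma> \<Longrightarrow> B \<in> \<Gamma> \<Longrightarrow> \<phi> (A ** B) = \<phi> A + \<phi> B"
    and par: "\<And>A. A \<in> \<Gamma> \<Longrightarrow> parabolic A \<Longrightarrow> \<phi> A = 0"
    and sc: "\<And>\<aa>. cusp \<Gamma> \<aa> \<Longrightarrow> \<exists>S. scaling_matrix \<Gamma> \<aa> S"
  obtains v where
    "\<And>c. singular_relboundary 1 (orbit_space \<Gamma> (ext_uhp \<Gamma>)) {} c \<Longrightarrow> frag_eval v c = 0"
    "\<And>A. A \<in> \<Gamma> \<Longrightarrow> v (loop_simplex \<Gamma> A) = - \<phi> A"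
proof -
  let ?X = "orbit_space \<Gamma> (ext_uhp \<Gamma>)" and ?E = "topspace (ext_uhp \<Gamma>)"
  obtain U where U: "\<And>p. p \<in> ?E \<Longrightarrow> ext_open \<Gamma> (U p)" "\<And>p. p \<in> ?E \<Longrightarrow> p \<in> U p"
    "\<And>p A q. p \<in> ?E \<Longrightarrow> A \<in> \<Gamma> \<Longrightarrow> q \<in> U p \<Longrightarrow> act A q \<in> U p \<Longrightarrow> act A p = p"
    using ext_neighbourhood[OF sc] by metis
  have UE: "U p \<subseteq> ?E" if "p \<in> ?E" for p using U(1)[OF that] by (simp add: ext_open_def topspace_ext)
  have fix0: "\<phi> A = \<phi> B" if A: "A \<in> \<Gamma>" and B: "B \<in> \<Gamma>" and p: "p \<in> ?E" and eq: "act (matrix_inv B ** A) p = p" for A B p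
  proof -
    have "\<phi> (matrix_inv B ** A) = 0"
      using hom_stab[OF hom par sc p] A B eq by (simp add: mult_Gamma inv_Gamma)
    then show ?thesis using hom[OF inv_Gamma[OF B] A] hom_inv[OF hom B] by simp
  qed
  \<comment> \<open>The chosen element is determined up to elements fixing \<open>p\<close>, on
    which \<open>\<phi>\<close> vanishes.\<close>
  define u where "u p w = \<phi> (SOME A. A \<in> \<Gamma> \<and> w \<in> act A ` U p)" for p w
  have u: "u p (act A q) = \<phi> A" if p: "p \<in> ?E" and A: "A \<in> \<Gamma>" and q: "q \<in> U p" for p A q
  proof -
    define B where "B = (SOME B. B \<in> \<Gamma> \<and> act A q \<in> act B ` U p)"
    have B: "B \<in> \<Gamma>" "act A q \<in> act B ` U p"
      using someI[of "\<lambda>B. B \<in> \<Gamma> \<and> act A q \<in> act B ` U p" A] A q unfolding B_def by blast+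
    then obtain q' where q': "q' \<in> U p" "act A q = act B q'" by blast
    have "act (matrix_inv B ** A) q = q'"
      using A B q' by (simp add: act_mult det_Gamma det_matrix_inv_sl2 act_inv_cancel)
    then have "act (matrix_inv B ** A) p = p"
      using U(3)[OF p _ q, of "matrix_inv B ** A"] q' A B by (simp add: mult_Gamma inv_Gamma)
    then have "\<phi> A = \<phi> B" using fix0[OF A B(1) p] by simp
    then show ?thesis by (simp add: u_def B_def)
  qed
  define r where "r x = (SOME p. p \<in> ?E \<and> orbit \<Gamma> p = x)" for x
  have r: "\<exists>A\<in>\<Gamma>. r (orbit \<Gamma> p) = act A p" if "p \<in> ?E" for p
  proof -
    have "orbit \<Gamma> (r (orbit \<Gamma> p)) = orbit \<Gamma> p"
      unfolding r_def by (rule someI2[of _ p]) (use that in auto)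
    then show ?thesis using orbit_eqD[of p "r (orbit \<Gamma> p)"] by auto
  qed
  define V where "V p = orbit \<Gamma> ` U p" for p
  define d where "d p x = u p (r x)" for p x
  have d: "d p (orbit \<Gamma> q) = \<phi> A" if "p \<in> ?E" "A \<in> \<Gamma>" "q \<in> U p" "r (orbit \<Gamma> q) = act A q" for p q A
    using u that by (simp add: d_def)
  interpret local_system ?X ?E V d
  proof
    fix p assume "p \<in> ?E" then show "openin ?X (V p)" unfolding V_def by (intro openin_orbit_image U)
  next
    fix x assume "x \<in> topspace ?X"
    then show "\<exists>p\<in>?E. x \<in> V p" using U(2) by (auto simp: topspace_orbit_space V_def)
  next
    fix p q x assume p: "p \<in> ?E" and q: "q \<in> ?E" and x: "x \<in> V p" "x \<in> V q"
    obtain w0 w1 where w: "w0 \<in> U p" "x = orbit \<Gamma> w0" "w1 \<in> U q" "x = orbit \<Gamma> w1"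
      using x by (auto simp: V_def)
    obtain C where C: "C \<in> \<Gamma>" "w0 = act C w1" using orbit_eqD[of w1 w0] w by auto
    \<comment> \<open>On \<open>N\<close> one and the same element \<open>C\<close> links the lifts
      in \<open>U q\<close> to those in \<open>U p\<close>, so the difference of the two potentials
      is constant there.\<close>
    define N where "N = orbit \<Gamma> ` (U p \<inter> act C ` U q)"
    have xN: "x \<in> N" using w C by (auto simp: N_def)
    have "openin (ext_uhp \<Gamma>) (U p \<inter> act C ` U q)"
      by (intro openin_Int) (auto simp: openin_ext_uhp intro: U p ext_open_act[OF U(1)[OF q] C(1)])
    then have oN: "openin ?X N" unfolding N_def by (intro openin_orbit_image) (simp add: openin_ext_uhp)
    have sub: "N \<subseteq> V p \<inter> V q"
      using orbit_act[OF C(1)] by (auto simp: N_def V_def)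
    have diff: "d p y - d q y = - \<phi> C" if y: "y \<in> N" for y
    proof -
      obtain w w' where ww: "w \<in> U p" "w' \<in> U q" "w = act C w'" "y = orbit \<Gamma> w"
        using y by (auto simp: N_def)
      have wE: "w \<in> ?E" "w' \<in> ?E" using ww UE p q by auto
      obtain \<delta> where \<delta>: "\<delta> \<in> \<Gamma>" "r (orbit \<Gamma> w) = act \<delta> w" using r[OF wE(1)] by blast
      have yw': "y = orbit \<Gamma> w'" using ww orbit_act[OF C(1)] by simp
      have "r (orbit \<Gamma> w') = act (\<delta> ** C) w'"
        using \<delta> ww C yw' by (simp add: act_mult det_Gamma)
      then have "d q y = \<phi> (\<delta> ** C)" using d[OF q _ ww(2)] \<delta> C yw' by (simp add: mult_Gamma)
      moreover have "d p y = \<phi> \<delta>" using d[OF p \<delta>(1) ww(1) \<delta>(2)] ww by simp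
      ultimately show ?thesis using hom \<delta> C by simp
    qed
    show "\<exists>N. openin ?X N \<and> x \<in> N \<and> N \<subseteq> V p \<inter> V q \<and> (\<forall>y\<in>N. d p y - d q y = d p x - d q x)"
      using oN xN sub diff by (intro exI[of _ N]) auto
  qed
  have "path_val (loop_simplex \<Gamma> A) = - \<phi> A" if A: "A \<in> \<Gamma>" for A
  proof -
    define c where "c t = Some (linepath \<i> (moeb A \<i>) t)" for t
    have Ai: "moeb A \<i> \<in> uhp" using A by (simp add: i_in_uhp moeb_uhp det_Gamma)
    have cE: "c t \<in> ?E" if "t \<in> {0..1}" for t
      using that linepath_uhp[OF i_in_uhp Ai] by (auto simp: c_def topspace_ext)
    have cc: "continuous_map (top_of_set {0..1}) (ext_uhp \<Gamma>) c"
    proof -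
      have "continuous_map (top_of_set {0..1}) (top_of_set uhp) (linepath \<i> (moeb A \<i>))"
        using linepath_uhp[OF i_in_uhp Ai] by (auto simp: continuous_map_in_subtopology)
      from continuous_map_compose[OF this continuous_map_Some] show ?thesis by (simp add: c_def[abs_def] o_def)
    qed
    define \<sigma> where "\<sigma> = loop_simplex \<Gamma> A \<circ> edge_path"
    have \<sigma>: "\<sigma> t = orbit \<Gamma> (c t)" if "t \<in> {0..1}" for t
    proof -
      have "edge_path t \<in> standard_simplex 1"
        using edge_path_continuous that by (auto simp: continuous_map_in_subtopology)
      then show ?thesis by (simp add: \<sigma>_def loop_simplex_def c_def edge_path_def)
    qed
    have c\<sigma>: "continuous_map (top_of_set {0..1}) ?X \<sigma>"
      unfolding \<sigma>_def using singular_simplex_loop[OF A] edge_path_continuous continuous_map_compose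
      unfolding singular_simplex_def by blast
    \<comment> \<open>\<open>\<delta> t\<close> takes the point of the lifted path to the
      representative of its orbit. It jumps where \<open>r\<close> does, but
      \<open>\<phi> (\<delta> t)\<close> follows the potentials.\<close>
    define \<delta> where "\<delta> t = (SOME B. B \<in> \<Gamma> \<and> r (orbit \<Gamma> (c t)) = act B (c t))" for t
    have \<delta>: "\<delta> t \<in> \<Gamma>" "r (orbit \<Gamma> (c t)) = act (\<delta> t) (c t)" if "t \<in> {0..1}" for t
      using someI_ex[of "\<lambda>B. B \<in> \<Gamma> \<and> r (orbit \<Gamma> (c t)) = act B (c t)"] r[OF cE[OF that]]
      unfolding \<delta>_def by auto
    have "adapted \<sigma> {0..1} (\<lambda>t. \<phi> (\<delta> t))"
    proof (rule adaptedI[OF c\<sigma>])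
      fix t :: real assume t: "t \<in> {0..1}"
      have op: "openin (ext_uhp \<Gamma>) (U (c t))" using U(1)[OF cE[OF t]] by (simp add: openin_ext_uhp)
      have "openin (top_of_set {0..1}) {s \<in> {0..1}. c s \<in> U (c t)}"
        using openin_continuous_map_preimage[OF cc op] by simp
      then obtain T where T: "open T" "{s \<in> {0..1}. c s \<in> U (c t)} = {0..1} \<inter> T"
        unfolding openin_open by auto
      have ct: "c t \<in> U (c t)" using U(2) cE t by blast
      have z: "\<phi> (\<delta> s) - d (c t) (\<sigma> s) = 0" if s: "s \<in> T \<inter> {0..1}" for s
      proof -
        have "c s \<in> U (c t)" using T(2) s by blast
        then show ?thesis using d[OF cE[OF t] _ _ \<delta>(2)] \<delta>(1) \<sigma> s by simp
      qed
      have tT: "t \<in> T" using T(2) t ct by blast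
      show "\<exists>p\<in>?E. \<sigma> t \<in> V p \<and> (\<exists>T. open T \<and> t \<in> T \<and>
          (\<forall>s\<in>T \<inter> {0..1}. \<phi> (\<delta> s) - d p (\<sigma> s) = \<phi> (\<delta> t) - d p (\<sigma> t)))"
        using z tT T(1) t ct cE[OF t] \<sigma>[OF t] unfolding V_def
        by (intro bexI[of _ "c t"] conjI exI[of _ T]) auto
    qed
    then have "path_val (loop_simplex \<Gamma> A) = \<phi> (\<delta> 1) - \<phi> (\<delta> 0)"
      using path_val_eq[OF singular_simplex_loop[OF A]] unfolding \<sigma>_def by blast
    \<comment> \<open>The path ends at \<open>act A (c 0)\<close>, whose orbit has the same
      representative as that of \<open>c 0\<close>; this is the origin of the sign in
      \<open>- \<phi> A\<close>.\<close>
    moreover have "\<phi> (\<delta> 0) = \<phi> (\<delta> 1 ** A)"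
    proof (rule fix0[where p = "c 0"])
      have c1: "c 1 = act A (c 0)" using A by (simp add: c_def linepath_def act_Some_uhp i_in_uhp det_Gamma)
      have o: "orbit \<Gamma> (c 1) = orbit \<Gamma> (c 0)" unfolding c1 by (rule orbit_act[OF A])
      have "act (\<delta> 0) (c 0) = act (\<delta> 1 ** A) (c 0)"
        using \<delta>(2)[of 0] \<delta>(2)[of 1] \<delta>(1)[of 1] A o c1 by (simp add: act_mult det_Gamma)
      moreover have "det (\<delta> 1 ** A) = 1" "det (\<delta> 0) = 1"
        using det_Gamma[OF mult_Gamma[OF \<delta>(1)[of 1] A]] det_Gamma[OF \<delta>(1)[of 0]] by simp_all
      ultimately show "act (matrix_inv (\<delta> 1 ** A) ** \<delta> 0) (c 0) = c 0"
        by (simp add: act_mult[of "matrix_inv (\<delta> 1 ** A)"] det_matrix_inv_sl2 act_inv_cancel)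
    qed (use \<delta>(1)[of 0] \<delta>(1)[of 1] A cE[of 0] in \<open>auto simp: mult_Gamma\<close>)
    ultimately show ?thesis using hom[OF \<delta>(1)[of 1] A] by simp
  qed
  then show ?thesis using that[of path_val] frag_eval_boundary by blast
qed

text \<open>The value \<open>m k A\<close> is the \<open>k\<close>-th coordinate of the class of the loop of \<open>A\<close> in the
  first homology group.\<close>

lemma parabolic_hom_finite_dim:
  assumes sc: "\<And>\<aa>. cusp \<Gamma> \<aa> \<Longrightarrow> \<exists>S. scaling_matrix \<Gamma> \<aa> S" and g: "has_genus \<Gamma> g"
  obtains m :: "nat \<Rightarrow> real^2^2 \<Rightarrow> int" where
    "\<And>\<phi> :: real^2^2 \<Rightarrow> complex. (\<And>A B. A \<in> \<Gamma> \<Longrightarrow> B \<in> \<Gamma> \<Longrightarrow> \<phi> (A ** B) = \<phi> A + \<phi> B) \<Longrightarrow>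
       (\<And>A. A \<in> \<Gamma> \<Longrightarrow> parabolic A \<Longrightarrow> \<phi> A = 0) \<Longrightarrow>
       \<exists>v. \<forall>A\<in>\<Gamma>. \<phi> A = (\<Sum>k<2 * g. v k * of_int (m k A))"
proof -
  let ?X = "orbit_space \<Gamma> (ext_uhp \<Gamma>)"
  obtain b where b: "\<And>c. singular_relcycle 1 ?X {} c \<Longrightarrow>
      \<exists>m::nat \<Rightarrow> int. singular_relboundary 1 ?X {} (c - (\<Sum>k<2 * g. frag_cmul (m k) (b k)))"
    by (rule homology_generators[OF g[unfolded has_genus_def]]) blast
  have "\<forall>A\<in>\<Gamma>. \<exists>m. singular_relboundary 1 ?X {}
      (frag_of (loop_simplex \<Gamma> A) - (\<Sum>k<2 * g. frag_cmul (m k) (b k)))"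
    using b[OF relcycle_loop] by (intro ballI)
  then obtain m where m: "\<And>A. A \<in> \<Gamma> \<Longrightarrow> singular_relboundary 1 ?X {}
      (frag_of (loop_simplex \<Gamma> A) - (\<Sum>k<2 * g. frag_cmul (m A k) (b k)))"
    by (drule_tac bchoice) blast
  show ?thesis
  proof (rule that[of "\<lambda>k A. m A k"])
    fix \<phi> :: "real^2^2 \<Rightarrow> complex"
    assume hom: "\<And>A B. A \<in> \<Gamma> \<Longrightarrow> B \<in> \<Gamma> \<Longrightarrow> \<phi> (A ** B) = \<phi> A + \<phi> B"
      and par: "\<And>A. A \<in> \<Gamma> \<Longrightarrow> parabolic A \<Longrightarrow> \<phi> A = 0"
    obtain v where v: "\<And>c. singular_relboundary 1 ?X {} c \<Longrightarrow> frag_eval v c = 0"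
      "\<And>A. A \<in> \<Gamma> \<Longrightarrow> v (loop_simplex \<Gamma> A) = - \<phi> A"
      by (rule parabolic_hom_local_system[OF hom par sc]) blast+
    have "\<phi> A = (\<Sum>k<2 * g. - frag_eval v (b k) * of_int (m A k))" if A: "A \<in> \<Gamma>" for A
    proof -
      define t where "t = (\<Sum>k<2 * g. of_int (m A k) * frag_eval v (b k))"
      have t: "- \<phi> A = t"
        using v(1)[OF m[OF A]] v(2)[OF A] by (simp add: t_def frag_eval_diff frag_eval_sum frag_eval_cmul)
      moreover have "(\<Sum>k<2 * g. - frag_eval v (b k) * of_int (m A k)) = - t"
        by (simp add: t_def sum_negf mult.commute)
      moreover have "\<phi> A = - t" unfolding t[symmetric] by simp
      ultimately show ?thesis by metis
    qed
    then show "\<exists>v. \<forall>A\<in>\<Gamma>. \<phi> A = (\<Sum>k<2 * g. v k * of_int (m A k))"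
      by (intro exI[of _ "\<lambda>k. - frag_eval v (b k)"] ballI)
  qed
qed

end

section \<open>Cusp forms and modular symbols\<close>

abbreviation prim :: "complex \<Rightarrow> (complex \<Rightarrow> complex) \<Rightarrow> complex \<Rightarrow> complex" where
  "prim z0 f z \<equiv> contour_integral (linepath z0 z) f"

lemma uhp_primitive:
  assumes "f holomorphic_on uhp"
  obtains g where "\<And>z. z \<in> uhp \<Longrightarrow> (g has_field_derivative f z) (at z)"
    "\<And>a b. a \<in> uhp \<Longrightarrow> b \<in> uhp \<Longrightarrow> prim a f b = g b - g a"
proof -
  have c: "continuous_on uhp f" using assms by (rule holomorphic_on_imp_continuous_on)
  have fd: "f field_differentiable at x" if "x \<in> interior uhp - {}" for x
    using assms that unfolding interior_open[OF open_uhp] holomorphic_on_open[OF open_uhp] field_differentiable_def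
    by blast
  obtain g where g: "\<And>z. z \<in> uhp \<Longrightarrow> (g has_field_derivative f z) (at z within uhp)"
    by (rule holomorphic_convex_primitive[OF convex_uhp finite.emptyI c fd]) blast+
  show ?thesis
  proof
    show "(g has_field_derivative f z) (at z)" if "z \<in> uhp" for z
      using g[OF that] at_within_open[OF that open_uhp] by simp
    show "prim a f b = g b - g a" if "a \<in> uhp" "b \<in> uhp" for a b
    proof -
      have "path_image (linepath a b) \<subseteq> uhp"
        using that convex_uhp by (simp add: closed_segment_subset)
      from contour_integral_primitive[OF g valid_path_linepath this]
      show ?thesis by (intro contour_integral_unique) simp
    qed
  qed
qed

lemma prim_has_derivative:
  assumes "f holomorphic_on uhp" "a \<in> uhp" "z \<in> uhp"
  shows "(prim a f has_field_derivative f z) (at z)"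
proof -
  obtain g where g: "\<And>z. z \<in> uhp \<Longrightarrow> (g has_field_derivative f z) (at z)"
    "\<And>a b. a \<in> uhp \<Longrightarrow> b \<in> uhp \<Longrightarrow> prim a f b = g b - g a"
    by (rule uhp_primitive[OF assms(1)]) blast+
  have "((\<lambda>z. g z - g a) has_field_derivative f z) (at z)"
    using DERIV_diff[OF g(1)[OF assms(3)] DERIV_const] by simp
  then show ?thesis
    by (rule has_field_derivative_transform_within_open[OF _ open_uhp assms(3)]) (simp add: g assms)
qed

lemma prim_holomorphic:
  assumes "f holomorphic_on uhp" "a \<in> uhp" shows "prim a f holomorphic_on uhp"
  unfolding holomorphic_on_open[OF open_uhp] using prim_has_derivative[OF assms] by blast

section \<open>The two spaces of cusp forms\<close>

lemma S2_D:
  assumes "f \<in> S2 \<Gamma>"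
  shows "f holomorphic_on uhp" "z \<notin> uhp \<Longrightarrow> f z = 0" "A \<in> \<Gamma> \<Longrightarrow> slash 2 f A = f" "decays_at_cusps \<Gamma> f"
  using assms by (auto simp: S2_def)

lemma slash2_add: "slash 2 (f + g) A = slash 2 f A + slash 2 g A"
  by (auto simp: fun_eq_iff slash2 add_divide_distrib)

lemma slash2_diff: "slash 2 (f - g) A = slash 2 f A - slash 2 g A"
  by (auto simp: fun_eq_iff slash2 diff_divide_distrib)

lemma slash2_cscale: "slash 2 (cscale c f) A = cscale c (slash 2 f A)"
  by (auto simp: fun_eq_iff slash2 cscale_def)

lemma decays_0: "decays_at_cusps \<Gamma> 0"
  by (auto simp: decays_at_cusps_def slash2 intro!: exI[of _ "1::real"])

text \<open>Applied to constants and to integrals of cusp forms, which stay bounded near the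
  cusps.\<close>

lemma decays_mult_bounded:
  assumes f: "decays_at_cusps \<Gamma> f"
    and g: "\<And>\<aa> S. cusp \<Gamma> \<aa> \<Longrightarrow> scaling_matrix \<Gamma> \<aa> S \<Longrightarrow> \<exists>B Y. \<forall>w. Im w > Y \<longrightarrow> norm (g (moeb S w)) \<le> B"
  shows "decays_at_cusps \<Gamma> (\<lambda>z. f z * g z)"
  unfolding decays_at_cusps_def
proof (intro allI impI)
  fix \<aa> S assume S: "cusp \<Gamma> \<aa> \<and> scaling_matrix \<Gamma> \<aa> S"
  obtain c K Y where K: "c > 0" "\<And>z. Im z > Y \<and> Im z > 0 \<Longrightarrow> norm (slash 2 f S z) \<le> K * exp (- c * Im z)"
    using f S unfolding decays_at_cusps_def by blast
  obtain B Y' where B: "\<And>w. Im w > Y' \<Longrightarrow> norm (g (moeb S w)) \<le> B" using g S by blast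
  have "norm (slash 2 (\<lambda>z. f z * g z) S z) \<le> (K * \<bar>B\<bar>) * exp (- c * Im z)"
    if "Im z > max Y Y' \<and> Im z > 0" for z
  proof -
    have "norm (slash 2 (\<lambda>z. f z * g z) S z) = norm (slash 2 f S z) * norm (g (moeb S z))"
      by (simp add: slash2 norm_mult norm_divide)
    also have "\<dots> \<le> (K * exp (- c * Im z)) * \<bar>B\<bar>"
      using K(2)[of z] B[of z] that order_trans[OF norm_ge_zero K(2)[of z]] by (intro mult_mono) auto
    finally show ?thesis by (simp add: mult_ac)
  qed
  then show "\<exists>c>0. \<exists>K Y. \<forall>z. Im z > Y \<and> Im z > 0 \<longrightarrow> norm (slash 2 (\<lambda>z. f z * g z) S z) \<le> K * exp (- c * Im z)"
    using K(1) by blast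
qed

lemma decays_cscale: "decays_at_cusps \<Gamma> f \<Longrightarrow> decays_at_cusps \<Gamma> (cscale c f)"
  using decays_mult_bounded[of \<Gamma> f "\<lambda>_. c"] by (auto simp: cscale_def mult.commute)

lemma decays_add:
  assumes f: "decays_at_cusps \<Gamma> f" and g: "decays_at_cusps \<Gamma> g"
  shows "decays_at_cusps \<Gamma> (f + g)"
  unfolding decays_at_cusps_def
proof (intro allI impI)
  fix \<aa> S assume S: "cusp \<Gamma> \<aa> \<and> scaling_matrix \<Gamma> \<aa> S"
  obtain c K Y where K: "c > 0" "\<And>z. Im z > Y \<and> Im z > 0 \<Longrightarrow> norm (slash 2 f S z) \<le> K * exp (- c * Im z)"
    using f S unfolding decays_at_cusps_def by blast
  obtain c' K' Y' where K': "c' > 0" "\<And>z. Im z > Y' \<and> Im z > 0 \<Longrightarrow> norm (slash 2 g S z) \<le> K' * exp (- c' * Im z)"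
    using g S unfolding decays_at_cusps_def by blast
  define m where "m = min c c'"
  have le: "L * exp (- b * y) \<le> \<bar>L\<bar> * exp (- m * y)" if "m \<le> b" "y > 0" for L b y :: real
    using that by (intro mult_mono) (auto simp: mult_right_mono)
  have "norm (slash 2 (f + g) S z) \<le> (\<bar>K\<bar> + \<bar>K'\<bar>) * exp (- m * Im z)"
    if z: "Im z > max Y Y' \<and> Im z > 0" for z
  proof -
    have "norm (slash 2 (f + g) S z) \<le> norm (slash 2 f S z) + norm (slash 2 g S z)"
      by (simp add: slash2_add norm_triangle_ineq)
    also have "\<dots> \<le> \<bar>K\<bar> * exp (- m * Im z) + \<bar>K'\<bar> * exp (- m * Im z)"
      using K(2)[of z] K'(2)[of z] le[of c "Im z" K] le[of c' "Im z" K'] z by (auto simp: m_def)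
    finally show ?thesis by (simp add: distrib_right)
  qed
  moreover have "m > 0" using K K' by (simp add: m_def)
  ultimately show "\<exists>c>0. \<exists>K Y. \<forall>z. Im z > Y \<and> Im z > 0 \<longrightarrow> norm (slash 2 (f + g) S z) \<le> K * exp (- c * Im z)"
    by blast
qed

lemma decays_diff:
  assumes "decays_at_cusps \<Gamma> f" "decays_at_cusps \<Gamma> g" shows "decays_at_cusps \<Gamma> (f - g)"
proof -
  have "f - g = f + cscale (-1) g" by (auto simp: cscale_def)
  then show ?thesis using assms decays_add decays_cscale by metis
qed

lemma holomorphic_on_cscale: "f holomorphic_on U \<Longrightarrow> cscale c f holomorphic_on U"
  unfolding cscale_def by (intro holomorphic_intros)

lemma holomorphic_on_plus_fun: "f holomorphic_on U \<Longrightarrow> g holomorphic_on U \<Longrightarrow> (f + g) holomorphic_on U"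
  unfolding plus_fun_def by (intro holomorphic_intros)

lemma S2_subspace: "funspace.subspace (S2 \<Gamma>)"
  unfolding funspace.subspace_def S2_def
  by (auto simp: slash2_add slash2_cscale holomorphic_on_plus_fun holomorphic_on_cscale decays_add
      decays_cscale decays_0) (auto simp: zero_fun_def cscale_def fun_eq_iff slash2)

lemma S22_subspace: "funspace.subspace (S22 \<Gamma>)"
proof -
  have 1: "slash 2 (f + g) A - (f + g) = (slash 2 f A - f) + (slash 2 g A - g)" for f g A
    by (simp add: slash2_add)
  have 2: "slash 2 (cscale c f) A - cscale c f = cscale c (slash 2 f A - f)" for c f A
    by (simp add: slash2_cscale) (auto simp: cscale_def fun_eq_iff algebra_simps)
  have 3: "slash 2 0 A - 0 = 0" for A by (auto simp: fun_eq_iff slash2)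
  have 4: "cscale c 0 = 0" for c by (auto simp: cscale_def)
  show ?thesis
    unfolding funspace.subspace_def S22_def mem_Collect_eq 1 2 3
    using funspace.subspace_add[OF S2_subspace] funspace.subspace_scale[OF S2_subspace]
      funspace.subspace_0[OF S2_subspace]
    by (auto simp: holomorphic_on_plus_fun holomorphic_on_cscale decays_add decays_cscale decays_0 4)
      (auto simp: cscale_def zero_fun_def)
qed

lemma cusp_local_decay:
  assumes "decays_at_cusps \<Gamma> f" "cusp \<Gamma> \<aa>" "scaling_matrix \<Gamma> \<aa> S"
  obtains c K Y where "c > 0" "K > 0" "Y > 0" "\<And>w. Im w > Y \<Longrightarrow> norm (slash 2 f S w) \<le> K * exp (- c * Im w)"
proof -
  obtain c K Y where K: "c > 0" "\<And>z. Im z > Y \<and> Im z > 0 \<Longrightarrow> norm (slash 2 f S z) \<le> K * exp (- c * Im z)"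
    using assms unfolding decays_at_cusps_def by blast
  have "norm (slash 2 f S w) \<le> (\<bar>K\<bar> + 1) * exp (- c * Im w)" if "Im w > \<bar>Y\<bar> + 1" for w
  proof -
    have "Im w > Y \<and> Im w > 0" using that by linarith
    then have "norm (slash 2 f S w) \<le> K * exp (- c * Im w)" by (rule K(2))
    also have "\<dots> \<le> (\<bar>K\<bar> + 1) * exp (- c * Im w)" by (intro mult_right_mono) auto
    finally show ?thesis .
  qed
  then show ?thesis using that[of c "\<bar>K\<bar> + 1" "\<bar>Y\<bar> + 1"] K(1) by auto
qed

lemma prim_moeb_derivative:
  assumes "f holomorphic_on uhp" "a \<in> uhp" "det S = 1" "w \<in> uhp"
  shows "((\<lambda>w. prim a f (moeb S w)) has_field_derivative slash 2 f S w) (at w)"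
  using DERIV_chain2[OF prim_has_derivative[OF assms(1,2) moeb_uhp[OF assms(3,4)]]
      moeb_has_derivative[OF assms(3) jfac_nonzero[OF assms(3,4)]]]
  by (simp add: slash2)

context fuchsian_group
begin

section \<open>Periods of cusp forms\<close>

lemma S2_transform: "f \<in> S2 \<Gamma> \<Longrightarrow> A \<in> \<Gamma> \<Longrightarrow> z \<in> uhp \<Longrightarrow> f (moeb A z) = f z * (jfac A z)\<^sup>2"
  using fun_cong[OF S2_D(3), of f \<Gamma> A z] jfac_nonzero[OF det_Gamma, of A z] by (simp add: slash2 field_simps)

text \<open>The difference of the two primitives has derivative \<open>slash 2 f A - f\<close>,
  which is zero; evaluating it at \<open>\<i>\<close>, the base point of \<open>modsym\<close>,
  identifies the constant.\<close>

lemma prim_moeb: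
  assumes f: "f \<in> S2 \<Gamma>" and A: "A \<in> \<Gamma>" and a: "a \<in> uhp" and z: "z \<in> uhp"
  shows "prim a f (moeb A z) = prim a f z + modsym A f"
proof -
  have hol: "f holomorphic_on uhp" and dA: "det A = 1" using f A by (auto simp: S2_D det_Gamma)
  define h where "h z = prim a f (moeb A z) - prim a f z" for z
  have "(h has_field_derivative 0) (at z within uhp)" if "z \<in> uhp" for z
  proof -
    have "(h has_field_derivative slash 2 f A z - f z) (at z)"
      unfolding h_def using prim_moeb_derivative[OF hol a dA that] prim_has_derivative[OF hol a that]
      by (intro DERIV_diff)
    then show ?thesis using S2_D(3)[OF f A] by (simp add: has_field_derivative_at_within)
  qed
  then have "h z = h \<i>"
    using has_field_derivative_zero_constant[OF convex_uhp] z i_in_uhp by metis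
  also have "h \<i> = modsym A f"
  proof -
    obtain g where "\<And>a b. a \<in> uhp \<Longrightarrow> b \<in> uhp \<Longrightarrow> prim a f b = g b - g a"
      by (rule uhp_primitive[OF hol]) blast+
    then show ?thesis using a i_in_uhp moeb_uhp[OF dA i_in_uhp] by (simp add: h_def modsym_def)
  qed
  finally show ?thesis by (simp add: h_def algebra_simps)
qed

lemma modsym_mult:
  assumes f: "f \<in> S2 \<Gamma>" and A: "A \<in> \<Gamma>" and B: "B \<in> \<Gamma>"
  shows "modsym (A ** B) f = modsym A f + modsym B f"
proof -
  have "prim \<i> f (moeb (A ** B) \<i>) = prim \<i> f (moeb A (moeb B \<i>))"
    using B by (simp add: moeb_mult i_in_uhp det_Gamma)
  then show ?thesis
    using prim_moeb[OF f mult_Gamma[OF A B] i_in_uhp i_in_uhp]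
      prim_moeb[OF f A i_in_uhp moeb_uhp[OF det_Gamma[OF B] i_in_uhp]]
      prim_moeb[OF f B i_in_uhp i_in_uhp] by simp
qed

text \<open>The period can be computed from any base point. In the coordinate of the cusp it is an
  integral over a horizontal segment of length \<open>|n|\<close> at height \<open>y\<close>, which
  is exponentially small in \<open>y\<close>.\<close>

lemma modsym_stab_cusp:
  assumes f: "f \<in> S2 \<Gamma>" and c: "cusp \<Gamma> \<aa>" "scaling_matrix \<Gamma> \<aa> S" and A: "A \<in> stab \<Gamma> \<aa>"
  shows "modsym A f = 0"
proof -
  have hol: "f holomorphic_on uhp" and dS: "det S = 1" and AG: "A \<in> \<Gamma>"
    using f c A by (auto simp: S2_D scaling_matrix_def stab_def)
  obtain n :: int where n: "matrix_inv S ** A ** S = transl (of_int n) \<or> matrix_inv S ** A ** S = - transl (of_int n)"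
    using stab_scaling_cases[OF c(2) A] .
  obtain b K Y where K: "b > 0" "K > 0" "Y > 0" "\<And>w. Im w > Y \<Longrightarrow> norm (slash 2 f S w) \<le> K * exp (- b * Im w)"
    by (rule cusp_local_decay[OF S2_D(4)[OF f] c]) blast
  define q where "q w = prim \<i> f (moeb S w)" for w
  have shift: "q (w + of_int n) = q w + modsym A f" if w: "w \<in> uhp" for w
  proof -
    have "moeb (matrix_inv S ** A ** S) w = w + of_int n" using n by auto
    then have "moeb S (moeb (matrix_inv S ** A ** S) w) = moeb S (w + of_int n)" by simp
    moreover have "moeb S (moeb (matrix_inv S ** A ** S) w) = moeb A (moeb S w)"
      using w dS AG by (simp add: moeb_mult moeb_uhp det_mult_sl2 det_matrix_inv_sl2 det_Gamma moeb_inv_cancel)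
    ultimately show ?thesis
      using prim_moeb[OF f AG i_in_uhp moeb_uhp[OF dS w]] by (simp add: q_def)
  qed
  have bound: "norm (modsym A f) \<le> K * exp (- b * y) * \<bar>of_int n\<bar>" if y: "y > Y" for y
  proof -
    let ?H = "{w. Im w \<ge> y}"
    have "norm (q (\<i> * of_real y + of_int n) - q (\<i> * of_real y)) \<le> (K * exp (- b * y)) * norm ((\<i> * of_real y + of_int n) - \<i> * of_real y)"
    proof (rule field_differentiable_bound[where S = ?H and f' = "slash 2 f S"])
      show "convex ?H" by (rule convex_halfspace_Im_ge)
      show "(q has_field_derivative slash 2 f S w) (at w within ?H)" if "w \<in> ?H" for w
        unfolding q_def using that y K prim_moeb_derivative[OF hol i_in_uhp dS, of w]
        by (auto intro: has_field_derivative_at_within simp: uhp_def)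
      show "norm (slash 2 f S w) \<le> K * exp (- b * y)" if "w \<in> ?H" for w
      proof -
        have "norm (slash 2 f S w) \<le> K * exp (- b * Im w)" using K(4) that y by auto
        also have "\<dots> \<le> K * exp (- b * y)" using K that by (intro mult_left_mono) auto
        finally show ?thesis .
      qed
    qed auto
    then show ?thesis using shift[of "\<i> * of_real y"] y K by (simp add: uhp_def)
  qed
  have "((\<lambda>y. K * exp (- b * y) * \<bar>of_int n\<bar>) \<longlongrightarrow> 0) at_top"
  proof -
    have "filterlim (\<lambda>y. - b * y) at_bot at_top"
      using K(1) by (intro filterlim_tendsto_neg_mult_at_bot[OF tendsto_const _ filterlim_ident]) auto
    then have "((\<lambda>y. exp (- b * y)) \<longlongrightarrow> 0) at_top" by (rule filterlim_compose[OF exp_at_bot])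
    from tendsto_mult_left_zero[OF tendsto_mult_right_zero[OF this, of K], of "\<bar>of_int n\<bar>"]
    show ?thesis .
  qed
  then have "norm (modsym A f) \<le> 0"
    by (rule tendsto_lowerbound) (use bound in \<open>auto intro: eventually_mono[OF eventually_gt_at_top[of Y]]\<close>)
  then show ?thesis by simp
qed

lemma parabolic_fixed_cusp:
  assumes "A \<in> \<Gamma>" "parabolic A" obtains \<aa> where "cusp \<Gamma> \<aa>" "A \<in> stab \<Gamma> \<aa>"
proof -
  have "\<exists>\<aa>\<in>boundary_points. act A \<aa> = \<aa>"
  proof (cases "A$2$1 = 0")
    case True then show ?thesis by (intro bexI[of _ None]) (auto simp: act_def boundary_points_def)
  next
    case False
    \<comment> \<open>\<open>x\<close> is the double root of the quadratic equation for fixed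
      points, whose discriminant is \<open>t * t - 4 = 0\<close>.\<close>
    define x where "x = (A$1$1 - A$2$2) / (2 * A$2$1)"
    define t where "t = A$1$1 + A$2$2"
    have "\<bar>t\<bar> = 2" using assms(2) by (simp add: parabolic_def trace_def sum_2 t_def)
    then have t: "t * t = 4" using abs_mult_self[of t] by simp
    have d: "A$1$1 * A$2$2 - A$1$2 * A$2$1 = 1" using assms by (simp add: parabolic_def sl2_det)
    have j: "A$2$1 * x + A$2$2 = t / 2" using False by (simp add: x_def t_def field_simps)
    have "(2 * A$2$1) * (A$1$1 * x + A$1$2) = A$1$1 * (A$1$1 - A$2$2) + 2 * (A$1$2 * A$2$1)"
      using False by (simp add: x_def field_simps)
    also have "\<dots> = A$1$1 * (A$1$1 - A$2$2) + 2 * (A$1$1 * A$2$2 - 1)" using d by simp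
    also have "\<dots> = (A$1$1 - A$2$2) * (t / 2) + (t * t / 2 - 2)" by (simp add: t_def field_simps)
    also have "\<dots> = (A$1$1 - A$2$2) * (t / 2)" using t by simp
    also have "\<dots> = (2 * A$2$1) * (x * (t / 2))" using False by (simp add: x_def)
    finally have n: "A$1$1 * x + A$1$2 = x * (t / 2)" using False by simp
    have t0: "t \<noteq> 0" using t by auto
    have jc: "jfac A (of_real x) = of_real (t / 2)" unfolding jfac_def by (simp only: flip: j of_real_mult of_real_add)
    have num: "of_real (A$1$1) * of_real x + of_real (A$1$2) = (of_real (x * (t / 2)) :: complex)"
      by (simp only: flip: n of_real_mult of_real_add)
    have "moeb A (of_real x) = of_real (x * (t / 2) / (t / 2))"
      unfolding moeb_def jc num by (simp only: of_real_divide)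
    then have "moeb A (of_real x) = of_real x" using t0 by simp
    then show ?thesis using jc t0 by (intro bexI[of _ "Some (of_real x)"]) (auto simp: act_def boundary_points_def)
  qed
  then show ?thesis using that assms by (auto simp: cusp_def stab_def)
qed

lemma modsym_parabolic:
  assumes sc: "\<And>\<aa>. cusp \<Gamma> \<aa> \<Longrightarrow> \<exists>S. scaling_matrix \<Gamma> \<aa> S"
    and "f \<in> S2 \<Gamma>" "A \<in> \<Gamma>" "parabolic A"
  shows "modsym A f = 0"
  using parabolic_fixed_cusp[OF assms(3,4)] sc modsym_stab_cusp[OF assms(2)] by metis

text \<open>By \<open>modsym_stab_cusp\<close> the primitive is periodic in the coordinate of the
  cusp, so a strip of width 1 is enough. Across the strip the derivative is bounded, and upwards it
  has an integrable exponential majorant.\<close>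

lemma prim_bounded_cusp:
  assumes f: "f \<in> S2 \<Gamma>" and c: "cusp \<Gamma> \<aa>" "scaling_matrix \<Gamma> \<aa> S" and a: "a \<in> uhp"
  shows "\<exists>B Y. \<forall>w. Im w > Y \<longrightarrow> norm (prim a f (moeb S w)) \<le> B"
proof -
  have hol: "f holomorphic_on uhp" and dS: "det S = 1"
    using f c by (auto simp: S2_D scaling_matrix_def)
  obtain b K Y where K: "b > 0" "K > 0" "Y > 0" "\<And>w. Im w > Y \<Longrightarrow> norm (slash 2 f S w) \<le> K * exp (- b * Im w)"
    by (rule cusp_local_decay[OF S2_D(4)[OF f] c]) blast
  define q where "q w = prim a f (moeb S w)" for w
  have dq: "(q has_field_derivative slash 2 f S w) (at w)" if "Im w > Y" for w
    unfolding q_def using that K by (intro prim_moeb_derivative hol a dS) (auto simp: uhp_def)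
  have shift: "q (w + of_int n) = q w" if w: "w \<in> uhp" for w n
  proof -
    define A where "A = S ** transl (of_int n) ** matrix_inv S"
    have A: "A \<in> stab \<Gamma> \<aa>" unfolding A_def by (rule scaling_transl_stab[OF c(2)])
    have "moeb A (moeb S w) = moeb S (w + of_int n)"
      using w dS by (simp add: A_def moeb_mult moeb_uhp det_mult_sl2 det_matrix_inv_sl2 moeb_inv_cancel)
    then show ?thesis
      using prim_moeb[OF f _ a moeb_uhp[OF dS w], of A] A modsym_stab_cusp[OF f c A] by (simp add: q_def stab_def)
  qed
  have K1: "norm (slash 2 f S w) \<le> K" if "Im w > Y" for w
  proof -
    have "K * exp (- b * Im w) \<le> K * 1" using K that by (intro mult_left_mono) auto
    then show ?thesis using K(4)[OF that] by simp
  qed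
  define w0 where "w0 = \<i> * of_real (Y + 1)"
  have vert: "norm (q (\<i> * of_real y) - q w0) \<le> K / b" if y: "y > Y + 1" for y
  proof -
    \<comment> \<open>A primitive of the majorant \<open>K * exp (- b * t)\<close>.\<close>
    define F where "F t = - (K / b) * exp (- b * t)" for t
    have "norm (q (\<i> * of_real y) - q (\<i> * of_real (Y + 1))) \<le> F y - F (Y + 1)"
    proof (rule differentiable_bound_general[where f' = "\<lambda>t. \<i> * slash 2 f S (\<i> * of_real t)" and
        \<phi>' = "\<lambda>t. K * exp (- b * t)", OF y, of "\<lambda>t. q (\<i> * of_real t)" F])
      have q1: "((\<lambda>t. q (\<i> * of_real t)) has_vector_derivative \<i> * slash 2 f S (\<i> * of_real t)) (at t)"
        if "t > Y" for t
      proof -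
        have "((\<lambda>t. \<i> * of_real t) has_vector_derivative \<i>) (at t)"
          unfolding has_vector_derivative_def
          by (auto intro!: derivative_eq_intros simp: scaleR_conv_of_real mult.commute)
        then show ?thesis
          using field_vector_diff_chain_at[of "\<lambda>t. \<i> * of_real t" \<i> t q "slash 2 f S (\<i> * of_real t)"]
            dq[of "\<i> * of_real t"] that by (simp add: o_def)
      qed
      show "continuous_on {Y + 1..y} (\<lambda>t. q (\<i> * of_real t))"
        by (intro continuous_at_imp_continuous_on ballI has_vector_derivative_continuous[OF q1]) auto
      show "((\<lambda>t. q (\<i> * of_real t)) has_vector_derivative \<i> * slash 2 f S (\<i> * of_real t)) (at t)"
        if "Y + 1 < t" "t < y" for t using q1 that by simp
      show "continuous_on {Y + 1..y} F" unfolding F_def by (intro continuous_intros)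
      show "(F has_vector_derivative K * exp (- b * t)) (at t)" for t
        unfolding F_def using K by (auto intro!: derivative_eq_intros simp: has_real_derivative_iff_has_vector_derivative[symmetric])
      show "norm (\<i> * slash 2 f S (\<i> * of_real t)) \<le> K * exp (- b * t)" if "Y + 1 < t" "t < y" for t
        using K(4)[of "\<i> * of_real t"] that by (simp add: norm_mult)
    qed
    also have "\<dots> \<le> K / b"
    proof -
      have "F y \<le> 0" using K by (simp add: F_def)
      moreover have "exp (- b * (Y + 1)) \<le> 1" using K by simp
      then have "K / b * exp (- b * (Y + 1)) \<le> K / b * 1" using K by (intro mult_left_mono) auto
      ultimately show ?thesis unfolding F_def by linarith
    qed
    finally show ?thesis by (simp add: w0_def)
  qed
  have "norm (q w) \<le> K + K / b + norm (q w0)" if w: "Im w > Y + 1" for w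
  proof -
    define x where "x = frac (Re w)"
    define y where "y = Im w"
    have xw: "w = Complex x y + of_int \<lfloor>Re w\<rfloor>" by (simp add: x_def y_def frac_def complex_eq_iff)
    have "q w = q (Complex x y)" using shift[of "Complex x y" "\<lfloor>Re w\<rfloor>"] w K xw by (simp add: uhp_def y_def)
    moreover have "norm (q (Complex x y) - q (\<i> * of_real y)) \<le> K * norm (Complex x y - \<i> * of_real y)"
      by (rule field_differentiable_bound[where S = "{w. Im w > Y}" and f' = "slash 2 f S"])
        (use dq K1 w in \<open>auto intro: has_field_derivative_at_within convex_halfspace_Im_gt simp: y_def\<close>)
    moreover have "norm (Complex x y - \<i> * of_real y) \<le> 1"
    proof -
      have "Complex x y - \<i> * of_real y = of_real x" by (simp add: complex_eq_iff)
      then show ?thesis using frac_ge_0[of "Re w"] frac_lt_1[of "Re w"] by (simp add: x_def)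
    qed
    then have "K * norm (Complex x y - \<i> * of_real y) \<le> K * 1" using K by (intro mult_left_mono) auto
    moreover have "norm (q (\<i> * of_real y) - q w0) \<le> K / b" using vert w by (simp add: y_def)
    ultimately show ?thesis
      using norm_triangle_sub[of "q (Complex x y)" "q (\<i> * of_real y)"] norm_triangle_sub[of "q (\<i> * of_real y)" "q w0"] by simp
  qed
  then show ?thesis unfolding q_def by blast
qed

text \<open>The factor \<open>f\<close> absorbs the automorphy factor, and the integral changes by
  the period of \<open>h\<close>, which vanishes for parabolic elements. Since the integral is
  bounded at the cusps, the decay of \<open>f\<close> persists.\<close>

lemma times_int_S22:
  assumes sc: "\<And>\<aa>. cusp \<Gamma> \<aa> \<Longrightarrow> \<exists>S. scaling_matrix \<Gamma> \<aa> S"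
    and f: "f \<in> S2 \<Gamma>" and h: "h \<in> S2 \<Gamma>" and z0: "z0 \<in> uhp"
  shows "times_int z0 f h \<in> S22 \<Gamma>"
    "A \<in> \<Gamma> \<Longrightarrow> slash 2 (times_int z0 f h) A - times_int z0 f h = cscale (modsym A h) f"
proof -
  show sl: "slash 2 (times_int z0 f h) A - times_int z0 f h = cscale (modsym A h) f" if A: "A \<in> \<Gamma>" for A
  proof
    fix z
    show "(slash 2 (times_int z0 f h) A - times_int z0 f h) z = cscale (modsym A h) f z"
    proof (cases "z \<in> uhp")
      case True
      then show ?thesis
        using prim_moeb[OF h A z0 True] S2_transform[OF f A True] jfac_nonzero[OF det_Gamma[OF A] True]
        by (simp add: slash2 times_int_def cscale_def divide_simps) (simp add: algebra_simps)
    next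
      case False
      then show ?thesis using A S2_D(2)[OF f] by (simp add: slash2 times_int_def cscale_def moeb_uhp_iff det_Gamma)
    qed
  qed
  have "times_int z0 f h holomorphic_on uhp"
    unfolding times_int_def using S2_D(1)[OF f] prim_holomorphic[OF S2_D(1)[OF h] z0]
    by (intro holomorphic_intros)
  moreover have "decays_at_cusps \<Gamma> (times_int z0 f h)"
    unfolding times_int_def using prim_bounded_cusp[OF h _ _ z0]
    by (intro decays_mult_bounded S2_D(4)[OF f])
  moreover have "cscale c f \<in> S2 \<Gamma>" for c using f funspace.subspace_scale[OF S2_subspace] by blast
  moreover have "slash 2 (times_int z0 f h) A - times_int z0 f h = 0" if "A \<in> \<Gamma>" "parabolic A" for A
    using sl[OF that(1)] modsym_parabolic[OF sc h that] by (simp add: cscale_def zero_fun_def)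
  moreover have "times_int z0 f h z = 0" if "z \<notin> uhp" for z
    using S2_D(2)[OF f that] by (simp add: times_int_def)
  ultimately show "times_int z0 f h \<in> S22 \<Gamma>"
    unfolding S22_def mem_Collect_eq using sl by metis
qed

lemma S2_subset_S22: "S2 \<Gamma> \<subseteq> S22 \<Gamma>"
  using funspace.subspace_0[OF S2_subspace] by (auto simp: S22_def S2_D)

end

text \<open>In the variable \<open>q = exp (2 pi i w)\<close> the function \<open>h\<close> becomes
  a function \<open>g\<close> on a punctured disc that tends to 0 at the centre. The singularity is
  removable, so \<open>g\<close> is bounded by a multiple of \<open>|q|\<close> near 0, and
  \<open>|q|\<close> is the exponential in the conclusion.\<close>

lemma periodic_exp_decay:
  assumes hol: "h holomorphic_on {w. Im w > Y}" and per: "\<And>w. Im w > Y \<Longrightarrow> h (w + 1) = h w"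
    and lim: "\<And>e. e > 0 \<Longrightarrow> \<exists>Y'. \<forall>w. Im w > Y' \<longrightarrow> norm (h w) < e"
  obtains K Y' where "\<And>w. Im w > Y' \<Longrightarrow> norm (h w) \<le> K * exp (- (2 * pi) * Im w)"
proof -
  have per_nat: "h (w + of_nat n) = h w" if "Im w > Y" for w n
  proof (induction n)
    case (Suc n) then show ?case using per[of "w + of_nat n"] that by (simp add: add.assoc add.commute[of 1])
  qed simp
  have per_int: "h (w + of_int n) = h w" if "Im w > Y" for w n
    using per_nat[OF that] per_nat[of "w + of_int n" "nat (- n)"] that by (cases n rule: int_cases2) auto
  define L where "L q = Ln q / (2 * of_real pi * \<i>)" for q
  define E where "E w = exp (2 * of_real pi * \<i> * w)" for w
  have EL: "E (L q) = q" if "q \<noteq> 0" for q using that by (simp add: E_def L_def)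
  have nE: "norm (E w) = exp (- (2 * pi) * Im w)" for w by (simp add: E_def)
  define r where "r = exp (- (2 * pi) * Y)"
  have ImE: "Im w > Y \<longleftrightarrow> norm (E w) < r" for w unfolding nE r_def by simp
  have Eeq: "h w = h w'" if e: "E w = E w'" and y: "Im w > Y" for w w'
  proof -
    obtain n :: int where "2 * of_real pi * \<i> * w = 2 * of_real pi * \<i> * w' + of_int (2 * n) * pi * \<i>"
      using e unfolding E_def exp_eq by blast
    then have "2 * of_real pi * \<i> * w = 2 * of_real pi * \<i> * (w' + of_int n)" by (simp add: algebra_simps)
    then have w: "w = w' + of_int n" by simp
    then show ?thesis using per_int[of w' n] y by simp
  qed
  define g where "g q = (if q = 0 then 0 else h (L q))" for q
  have gE: "g (E w) = h w" if "Im w > Y" for w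
    using Eeq[of w "L (E w)"] EL[of "E w"] that by (simp add: g_def E_def)
  have "g holomorphic_on ball 0 r - {0}"
  proof -
    have "g field_differentiable at q" if q: "q \<in> ball 0 r - {0}" for q
    proof -
      have *: "g field_differentiable at q"
        if K: "K field_differentiable at q" "open T" "q \<in> T" "\<And>p. p \<in> T \<Longrightarrow> E (K p) = p" for K T
      proof -
        have y: "Im (K q) > Y" using K(4)[OF K(3)] q ImE[of "K q"] by simp
        have "h field_differentiable at (K q)"
          using hol y by (simp add: holomorphic_on_open open_halfspace_Im_gt field_differentiable_def)
        then have "(h \<circ> K) field_differentiable at q" using K(1) by (rule field_differentiable_compose[rotated])
        moreover have "g p = (h \<circ> K) p" if "p \<in> T \<inter> (ball 0 r - {0})" for p
        proof -
          have "E (K p) = p" using K that by blast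
          then have "Im (K p) > Y" using ImE[of "K p"] that by simp
          then show ?thesis using gE[of "K p"] \<open>E (K p) = p\<close> by simp
        qed
        moreover have "open (T \<inter> (ball 0 r - {0}))" using K by (intro open_Int open_delete) auto
        ultimately show ?thesis
          unfolding field_differentiable_def using q K
          by (metis IntI has_field_derivative_transform_within_open)
      qed
      show ?thesis
      proof (cases "q \<in> \<real>\<^sub>\<le>\<^sub>0")
        case False
        have "L field_differentiable at q"
          unfolding L_def using False by (intro field_differentiable_divide field_differentiable_at_Ln) auto
        then show ?thesis by (rule *[where T = "- {0}"]) (use q EL in auto)
      next
        \<comment> \<open>On the negative real axis the logarithm of \<open>- p\<close> is taken
          instead; the summand \<open>1 / 2\<close> restores the sign.\<close>
        case True
        have mq: "- q \<notin> \<real>\<^sub>\<le>\<^sub>0" using True q by (auto simp: complex_nonpos_Reals_iff complex_eq_iff)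
        have "(\<lambda>p. Ln (- p)) field_differentiable at q"
          using field_differentiable_compose[of uminus q Ln] field_differentiable_at_Ln[OF mq]
          by (simp add: o_def field_differentiable_minus)
        then have "(\<lambda>p. L (- p) + 1 / 2) field_differentiable at q"
          unfolding L_def by (intro field_differentiable_add field_differentiable_divide) auto
        moreover have "E (L (- p) + 1 / 2) = p" if "p \<noteq> 0" for p
        proof -
          have "E (L (- p) + 1 / 2) = E (L (- p)) * exp (of_real pi * \<i>)"
            by (simp add: E_def distrib_left exp_add)
          then show ?thesis using EL[of "- p"] that by simp
        qed
        ultimately show ?thesis by (intro *[where K = "\<lambda>p. L (- p) + 1 / 2" and T = "- {0}"]) (use q in auto)
      qed
    qed
    then show ?thesis by (simp add: holomorphic_on_def field_differentiable_at_within)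
  qed
  moreover have "continuous_on (ball 0 r) g"
  proof -
    have "isCont g 0"
      unfolding continuous_at_eps_delta
    proof (intro allI impI)
      fix e :: real assume "e > 0"
      then obtain Y' where Y': "\<And>w. Im w > Y' \<Longrightarrow> norm (h w) < e" using lim by blast
      have "norm (g q) < e" if "norm q < exp (- (2 * pi) * Y')" for q
      proof (cases "q = 0")
        case False
        have "exp (- (2 * pi) * Im (L q)) < exp (- (2 * pi) * Y')" using nE[of "L q"] EL[OF False] that by simp
        then have "Im (L q) > Y'" by simp
        then show ?thesis using Y' False by (simp add: g_def)
      qed (use \<open>e > 0\<close> in \<open>simp add: g_def\<close>)
      then show "\<exists>d>0. \<forall>x'. dist x' 0 < d \<longrightarrow> dist (g x') (g 0) < e"
        by (intro exI[of _ "exp (- (2 * pi) * Y')"]) (auto simp: g_def)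
    qed
    moreover have "isCont g q" if "q \<in> ball 0 r - {0}" for q
      using \<open>g holomorphic_on ball 0 r - {0}\<close> that
      by (meson continuous_on_eq_continuous_at holomorphic_on_imp_continuous_on open_ball open_delete)
    ultimately show ?thesis by (intro continuous_at_imp_continuous_on) blast
  qed
  ultimately have gh: "g holomorphic_on ball 0 r"
    using no_isolated_singularity[of "ball 0 r" g "{0}"] by simp
  have r0: "r > 0" by (simp add: r_def)
  have "continuous_on (cball 0 (r / 2)) (deriv g)"
    using holomorphic_deriv[OF gh] r0 by (intro holomorphic_on_imp_continuous_on) (auto elim!: holomorphic_on_subset)
  then obtain K where K: "\<And>q. q \<in> cball 0 (r / 2) \<Longrightarrow> norm (deriv g q) \<le> K"
  proof -
    have "bounded (deriv g ` cball 0 (r / 2))"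
      using \<open>continuous_on (cball 0 (r / 2)) (deriv g)\<close>
      by (intro compact_imp_bounded compact_continuous_image compact_cball)
    then show ?thesis using that unfolding bounded_iff by blast
  qed
  have gK: "norm (g q) \<le> K * norm q" if q: "q \<in> cball 0 (r / 2)" for q
  proof -
    have "norm (g q - g 0) \<le> K * norm (q - 0)"
    proof (rule field_differentiable_bound[where S = "cball 0 (r / 2)" and f' = "deriv g"])
      show "(g has_field_derivative deriv g p) (at p within cball 0 (r / 2))" if "p \<in> cball 0 (r / 2)" for p
        using holomorphic_derivI[OF gh open_ball, of p] that r0 by (auto intro: has_field_derivative_at_within)
    qed (use K q r0 in auto)
    then show ?thesis by (simp add: g_def)
  qed
  show ?thesis
  proof (rule that[of "\<bar>Y\<bar> + 1" K])
    fix w assume w: "Im w > \<bar>Y\<bar> + 1"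
    \<comment> \<open>One unit above \<open>Y\<close> the norm of \<open>E w\<close> is at most
      \<open>r * exp (- 1)\<close>, hence at most half the radius.\<close>
    have "norm (E w) \<le> r / 2"
    proof -
      have "- (2 * pi) * Im w \<le> - (2 * pi) * Y + - 1"
      proof -
        have "Im w \<ge> Y + 1" using w by linarith
        then have "(2 * pi) * Im w \<ge> (2 * pi) * (Y + 1)" by (intro mult_left_mono) auto
        then show ?thesis using pi_gt3 by (simp add: algebra_simps)
      qed
      then have "norm (E w) \<le> exp (- (2 * pi) * Y + - 1)" unfolding nE by (simp only: exp_le_cancel_iff)
      also have "\<dots> = r * exp (- 1)" by (simp only: r_def exp_add)
      also have "\<dots> \<le> r * (1 / 2)"
        using exp_ge_add_one_self[of 1] r0 by (intro mult_left_mono) (auto simp: exp_minus field_simps)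
      finally show ?thesis by simp
    qed
    then show "norm (h w) \<le> K * exp (- (2 * pi) * Im w)"
      using gK[of "E w"] gE[of w] w nE[of w] by simp
  qed
qed

section \<open>Growth in a fundamental domain\<close>

locale cusped_domain = fuchsian_group +
  fixes F :: "complex set" and C :: "complex option set" and \<sigma> :: "complex option \<Rightarrow> real^2^2"
  assumes fundamental: "fundamental_domain \<Gamma> F"
    and cusp_reps: "cusp_representatives \<Gamma> F C"
    and scaling: "\<And>\<aa>. \<aa> \<in> C \<Longrightarrow> scaling_matrix \<Gamma> \<aa> (\<sigma> \<aa>)"
begin

lemma F_uhp: "F \<subseteq> uhp" and open_F: "open F"
  using fundamental by (auto simp: fundamental_domain_def)

lemma finite_C: "finite C" and C_cusp: "\<aa> \<in> C \<Longrightarrow> cusp \<Gamma> \<aa>"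
  using cusp_reps by (auto simp: cusp_representatives_def)

lemma cusp_equiv_C:
  assumes "cusp \<Gamma> \<bb>" shows "\<exists>\<aa>\<in>C. \<exists>A\<in>\<Gamma>. \<bb> = act A \<aa>"
proof -
  obtain \<aa> where a: "\<aa> \<in> C" "\<aa> \<in> orbit \<Gamma> \<bb>"
    using cusp_reps assms unfolding cusp_representatives_def by blast
  then obtain A where A: "A \<in> \<Gamma>" "\<aa> = act A \<bb>" by (auto simp: orbit_def)
  then have "\<bb> = act (matrix_inv A) \<aa>" by (simp add: act_inv_cancel det_Gamma)
  then show ?thesis using a A inv_Gamma by blast
qed

text \<open>Scaling matrices for all cusps, obtained by translating those of the representatives. A
  height measured with one of them is a height measured with some \<open>\<sigma> \<aa>\<close>
  after a motion by the group.\<close>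

definition cscal :: "complex option \<Rightarrow> real^2^2" where
  "cscal \<bb> = (SOME S. \<exists>\<aa>\<in>C. \<exists>A\<in>\<Gamma>. \<bb> = act A \<aa> \<and> S = A ** \<sigma> \<aa>)"

lemma cscal:
  assumes "cusp \<Gamma> \<bb>"
  obtains \<aa> A where "\<aa> \<in> C" "A \<in> \<Gamma>" "\<bb> = act A \<aa>" "cscal \<bb> = A ** \<sigma> \<aa>"
proof -
  have "\<exists>\<aa>\<in>C. \<exists>A\<in>\<Gamma>. \<bb> = act A \<aa> \<and> cscal \<bb> = A ** \<sigma> \<aa>"
    unfolding cscal_def by (rule someI_ex) (use cusp_equiv_C[OF assms] in blast)
  then show ?thesis using that by blast
qed

lemma scaling_cscal: assumes "cusp \<Gamma> \<bb>" shows "scaling_matrix \<Gamma> \<bb> (cscal \<bb>)"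
proof -
  obtain \<aa> A where "\<aa> \<in> C" "A \<in> \<Gamma>" "\<bb> = act A \<aa>" "cscal \<bb> = A ** \<sigma> \<aa>" by (rule cscal[OF assms])
  then show ?thesis using scaling_act[OF scaling] by simp
qed

lemma scaling_exists: "cusp \<Gamma> \<bb> \<Longrightarrow> \<exists>S. scaling_matrix \<Gamma> \<bb> S"
  using scaling_cscal by blast

lemma closure_F_ext:
  assumes "z \<in> closure F" "z \<in> uhp"
  shows "Some z \<in> ext_uhp \<Gamma> closure_of (Some ` F)"
  unfolding in_closure_of
proof (intro conjI allI impI)
  show "Some z \<in> topspace (ext_uhp \<Gamma>)" using assms by (simp add: topspace_ext)
  fix T assume T: "Some z \<in> T \<and> openin (ext_uhp \<Gamma>) T"
  then have "open {z \<in> uhp. Some z \<in> T}" by (simp add: openin_ext_uhp ext_open_def)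
  moreover have "z \<in> {z \<in> uhp. Some z \<in> T}" using T assms by simp
  ultimately have "{z \<in> uhp. Some z \<in> T} \<inter> F \<noteq> {}"
    using assms(1) open_Int_closure_eq_empty by blast
  then show "\<exists>y. y \<in> Some ` F \<and> y \<in> T" by blast
qed

text \<open>The closure of \<open>F\<close> in the extended half-plane is compact. Covered by balls
  whose closures lie in the half-plane and by horoballs, it has a finite subcover; the balls give
  \<open>M\<close> and the horoballs give \<open>Bs\<close>. The heights \<open>Y\<close> are
  prescribed before the cover is chosen, so they can be adapted to each application.\<close>

lemma closure_F_cover:
  assumes Y: "\<And>\<bb>. cusp \<Gamma> \<bb> \<Longrightarrow> Y \<bb> > 0"
  obtains M Bs where "compact M" "M \<subseteq> uhp" "finite Bs" "\<And>\<bb>. \<bb> \<in> Bs \<Longrightarrow> cusp \<Gamma> \<bb>"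
    "\<And>z. z \<in> closure F \<Longrightarrow> z \<in> uhp \<Longrightarrow> z \<in> M \<or> (\<exists>\<bb>\<in>Bs. Im (moeb (matrix_inv (cscal \<bb>)) z) > Y \<bb>)"
proof -
  let ?K = "ext_uhp \<Gamma> closure_of (Some ` F)"
  define I where "I = {(z, r). z \<in> uhp \<and> r > 0 \<and> cball z r \<subseteq> uhp} <+> {\<bb>. cusp \<Gamma> \<bb>}"
  define f where "f = case_sum (\<lambda>(z, r). Some ` ball z r) (\<lambda>\<bb>. horoball (cscal \<bb>) (Y \<bb>))"
  have comp: "compactin (ext_uhp \<Gamma>) ?K" using fundamental by (simp add: fundamental_domain_def)
  have op: "openin (ext_uhp \<Gamma>) U" if U: "U \<in> f ` I" for U
  proof -
    obtain i where i: "i \<in> I" "U = f i" using U by blast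
    show ?thesis
    proof (cases i)
      case (Inl p)
      obtain z r where p: "p = (z, r)" by (cases p)
      have "ball z r \<subseteq> uhp" using i Inl p ball_subset_cball by (fastforce simp: I_def)
      then show ?thesis using Inl i p by (auto simp: f_def openin_ext_uhp intro!: ext_open_Some)
    next
      case (Inr \<bb>)
      then have b: "cusp \<Gamma> \<bb>" using i by (auto simp: I_def)
      then have "det (cscal \<bb>) = 1" "act (cscal \<bb>) None = \<bb>" using scaling_cscal by (auto simp: scaling_matrix_def)
      then show ?thesis using Inr i b Y by (auto simp: f_def openin_ext_uhp intro!: ext_open_horoball)
    qed
  qed
  have cov: "?K \<subseteq> \<Union>(f ` I)"
  proof
    fix p assume "p \<in> ?K"
    then have "p \<in> topspace (ext_uhp \<Gamma>)" by (simp add: in_closure_of)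
    then consider z where "p = Some z" "z \<in> uhp" | "cusp \<Gamma> p" by (auto simp: topspace_ext)
    then show "p \<in> \<Union>(f ` I)"
    proof cases
      case 1
      obtain r where "r > 0" "cball z r \<subseteq> uhp" using open_uhp 1 open_contains_cball by blast
      then have "Inl (z, r) \<in> I" "p \<in> f (Inl (z, r))" using 1 by (auto simp: I_def f_def)
      then show ?thesis by blast
    next
      case 2
      have "act (cscal p) None = p" using scaling_cscal[OF 2] by (simp add: scaling_matrix_def)
      then have "Inr p \<in> I" "p \<in> f (Inr p)" using 2 by (auto simp: I_def f_def horoball_def)
      then show ?thesis by blast
    qed
  qed
  obtain \<F> where F: "finite \<F>" "\<F> \<subseteq> f ` I" "?K \<subseteq> \<Union>\<F>"
    using comp op cov unfolding compactin_def by meson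
  obtain J where J: "J \<subseteq> I" "finite J" "\<F> = f ` J" using finite_subset_image[OF F(1,2)] by blast
  define Bs where "Bs = Inr -` J"
  define M where "M = (\<Union>(z, r)\<in>Inl -` J. cball z r)"
  show ?thesis
  proof
    show "compact M" unfolding M_def using J(2) by (intro compact_UN finite_vimageI) (auto simp: inj_on_def)
    have "cball z r \<subseteq> uhp" if "Inl (z, r) \<in> J" for z r using J(1) that by (auto simp: I_def)
    then show "M \<subseteq> uhp" unfolding M_def by auto
    show "finite Bs" unfolding Bs_def using J(2) by (intro finite_vimageI) (auto simp: inj_on_def)
    show "cusp \<Gamma> \<bb>" if "\<bb> \<in> Bs" for \<bb> using that J(1) by (auto simp: Bs_def I_def)
    fix z assume z: "z \<in> closure F" "z \<in> uhp"
    obtain j where j: "j \<in> J" "Some z \<in> f j" using closure_F_ext[OF z] F(3) J(3) by blast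
    show "z \<in> M \<or> (\<exists>\<bb>\<in>Bs. Im (moeb (matrix_inv (cscal \<bb>)) z) > Y \<bb>)"
    proof (cases j)
      case (Inl p)
      obtain u r where p: "p = (u, r)" by (cases p)
      have "z \<in> ball u r" using j Inl p by (auto simp: f_def)
      then have "z \<in> cball u r" by simp
      then have "z \<in> M" using j Inl p unfolding M_def by (auto simp del: mem_cball intro!: bexI[of _ "(u, r)"])
      then show ?thesis by simp
    next
      case (Inr \<bb>)
      have b: "cusp \<Gamma> \<bb>" using j Inr J(1) by (auto simp: I_def)
      have "act (cscal \<bb>) None = \<bb>" using scaling_cscal[OF b] by (simp add: scaling_matrix_def)
      then have "Some z \<noteq> act (cscal \<bb>) None" using cusp_not_uhp[OF b] z by auto
      then have "Im (moeb (matrix_inv (cscal \<bb>)) z) > Y \<bb>" using j Inr by (auto simp: f_def horoball_def)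
      then show ?thesis using j Inr by (auto simp: Bs_def)
    qed
  qed
qed

lemma move_to_F:
  assumes "z \<in> uhp" obtains A where "A \<in> \<Gamma>" "moeb A z \<in> closure F" "moeb A z \<in> uhp"
proof -
  obtain A where "A \<in> \<Gamma>" "moeb A z \<in> closure F"
    using fundamental assms unfolding fundamental_domain_def by blast
  then show ?thesis using that[of A] assms by (simp add: moeb_uhp det_Gamma)
qed

end

context fuchsian_group
begin

text \<open>Either the height above the cusp is preserved, and continuity bounds it on
  \<open>Q\<close>, or the new height is at most \<open>R / e\<close>, where \<open>e\<close> is the
  least height on \<open>Q\<close>.\<close>

lemma compact_height_bound:
  assumes S: "scaling_matrix \<Gamma> \<aa> S" and Q: "compact Q" "Q \<subseteq> uhp"
  shows "\<exists>B. \<forall>A\<in>\<Gamma>. \<forall>z\<in>Q. Im (moeb (matrix_inv S) (moeb A z)) \<le> B"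
proof (cases "Q = {}")
  case False
  have dS: "det S = 1" "det (matrix_inv S) = 1" using S by (auto simp: scaling_matrix_def det_matrix_inv_sl2)
  obtain R where R: "R > 0" "\<And>A w. A \<in> \<Gamma> \<Longrightarrow> w \<in> uhp \<Longrightarrow> (matrix_inv S ** A ** S) $ 2 $ 1 \<noteq> 0 \<Longrightarrow>
      Im (moeb (matrix_inv S ** A ** S) w) \<le> R / Im w"
    by (rule scaling_pair_height[OF S S]) blast
  have "continuous_on Q (\<lambda>z. Im (moeb (matrix_inv S) z))"
    using continuous_on_subset[OF continuous_on_moeb[OF dS(2)] Q(2)] by (intro continuous_intros)
  then obtain z1 z2 where z: "z1 \<in> Q" "z2 \<in> Q"
    "\<And>z. z \<in> Q \<Longrightarrow> Im (moeb (matrix_inv S) z1) \<le> Im (moeb (matrix_inv S) z)"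
    "\<And>z. z \<in> Q \<Longrightarrow> Im (moeb (matrix_inv S) z) \<le> Im (moeb (matrix_inv S) z2)"
    using continuous_attains_inf[OF Q(1) False] continuous_attains_sup[OF Q(1) False] by metis
  define e where "e = Im (moeb (matrix_inv S) z1)"
  have e: "e > 0" using moeb_uhp[OF dS(2), of z1] z Q by (auto simp: e_def uhp_def)
  have "Im (moeb (matrix_inv S) (moeb A z)) \<le> max (Im (moeb (matrix_inv S) z2)) (R / e)"
    if A: "A \<in> \<Gamma>" and zQ: "z \<in> Q" for A z
  proof -
    define w where "w = moeb (matrix_inv S) z"
    have w: "w \<in> uhp" "z = moeb S w" using zQ Q dS by (auto simp: w_def moeb_uhp moeb_inv_cancel)
    have eq: "moeb (matrix_inv S) (moeb A z) = moeb (matrix_inv S ** A ** S) w"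
      using w dS A by (simp add: moeb_mult moeb_uhp det_mult_sl2 det_Gamma)
    have we: "Im w \<ge> e" using z(3)[OF zQ] by (simp add: w_def e_def)
    show ?thesis
    proof (cases "(matrix_inv S ** A ** S) $ 2 $ 1 = 0")
      case True
      then show ?thesis unfolding eq using scaling_pair_Im[OF S S A True] z(4)[OF zQ] by (simp add: w_def)
    next
      case False
      have "R / Im w \<le> R / e" using we e R by (intro divide_left_mono mult_pos_pos) auto
      then show ?thesis unfolding eq using R(2)[OF A w(1) False] by simp
    qed
  qed
  then show ?thesis by blast
qed auto

end

lemma decays_small:
  assumes "decays_at_cusps \<Gamma> f" "cusp \<Gamma> \<aa>" "scaling_matrix \<Gamma> \<aa> S" "e > 0"
  shows "eventually (\<lambda>y. \<forall>w. Im w = y \<longrightarrow> norm (slash 2 f S w) < e) at_top"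
proof -
  obtain c K Y where K: "c > 0" "K > 0" "Y > 0" "\<And>w. Im w > Y \<Longrightarrow> norm (slash 2 f S w) \<le> K * exp (- c * Im w)"
    by (rule cusp_local_decay[OF assms(1-3)]) blast
  have "filterlim (\<lambda>y. - c * y) at_bot at_top"
    using K(1) by (intro filterlim_tendsto_neg_mult_at_bot[OF tendsto_const _ filterlim_ident]) auto
  then have "((\<lambda>y. exp (- c * y)) \<longlongrightarrow> 0) at_top" by (rule filterlim_compose[OF exp_at_bot])
  from tendsto_mult_right_zero[OF this, of K] have "eventually (\<lambda>y. K * exp (- c * y) < e) at_top"
    using assms(4) by (intro order_tendstoD(2)) auto
  then show ?thesis using eventually_gt_at_top[of Y]
    by eventually_elim (use K(4) in force)
qed

context cusped_domain
begin

text \<open>The growth condition is given on the open set \<open>F\<close>, whereas points are moved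
  into its closure. The maximum in \<open>yF\<close> is replaced by the sum of the heights, which is
  visibly continuous, so that the bound passes to limits.\<close>

lemma growth_on_closure:
  assumes W: "continuous_on uhp W" and K: "\<forall>z\<in>F. Im z * norm (W z) \<le> K * yF C \<sigma> z powr (1 / 2)"
    and C: "C \<noteq> {}" and z: "z \<in> closure F" "z \<in> uhp"
  shows "Im z * norm (W z) \<le> \<bar>K\<bar> * sqrt (\<Sum>\<aa>\<in>C. Im (moeb (matrix_inv (\<sigma> \<aa>)) z))"
proof -
  let ?s = "\<lambda>z. \<Sum>\<aa>\<in>C. Im (moeb (matrix_inv (\<sigma> \<aa>)) z)"
  have d: "det (matrix_inv (\<sigma> \<aa>)) = 1" if "\<aa> \<in> C" for \<aa>
    using scaling[OF that] by (simp add: scaling_matrix_def det_matrix_inv_sl2)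
  have bF: "Im x * norm (W x) \<le> \<bar>K\<bar> * sqrt (?s x)" if x: "x \<in> F" for x
  proof -
    have pos: "Im (moeb (matrix_inv (\<sigma> \<aa>)) x) > 0" if "\<aa> \<in> C" for \<aa>
      using moeb_uhp[OF d[OF that], of x] x F_uhp by (auto simp: uhp_def)
    have "yF C \<sigma> x \<in> (\<lambda>\<aa>. Im (moeb (matrix_inv (\<sigma> \<aa>)) x)) ` C"
      unfolding yF_def using finite_C C by (intro Max_in) auto
    then obtain \<aa> where a: "\<aa> \<in> C" "yF C \<sigma> x = Im (moeb (matrix_inv (\<sigma> \<aa>)) x)" by blast
    have "yF C \<sigma> x \<le> ?s x" unfolding a(2)
      using member_le_sum[OF a(1), of "\<lambda>\<aa>. Im (moeb (matrix_inv (\<sigma> \<aa>)) x)"] pos finite_C by (auto simp: less_imp_le)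
    then have "yF C \<sigma> x powr (1 / 2) \<le> sqrt (?s x)"
      using pos[OF a(1)] a(2) by (simp add: powr_half_sqrt)
    moreover have "Im x * norm (W x) \<le> \<bar>K\<bar> * yF C \<sigma> x powr (1 / 2)"
      using K x by (meson abs_ge_self mult_right_mono order_trans powr_ge_zero)
    ultimately show ?thesis by (meson abs_ge_zero mult_left_mono order_trans)
  qed
  obtain x where x: "\<And>n. x n \<in> F" "x \<longlonglongrightarrow> z" using z(1) unfolding closure_sequential by blast
  have cW: "isCont W z" using W z open_uhp by (simp add: continuous_on_eq_continuous_at)
  have cs: "isCont ?s z"
  proof -
    have "continuous_on uhp ?s" by (intro continuous_intros continuous_on_moeb d)
    then show ?thesis using z continuous_on_eq_continuous_at[OF open_uhp] by blast
  qed
  have "(\<lambda>n. Im (x n) * norm (W (x n))) \<longlonglongrightarrow> Im z * norm (W z)"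
    by (intro tendsto_intros x isCont_tendsto_compose[OF cW])
  moreover have "(\<lambda>n. \<bar>K\<bar> * sqrt (?s (x n))) \<longlonglongrightarrow> \<bar>K\<bar> * sqrt (?s z)"
    by (intro tendsto_intros isCont_tendsto_compose[OF cs] x)
  ultimately show ?thesis using bF x by (intro LIMSEQ_le) auto
qed

text \<open>At a cusp \<open>W\<close> becomes a periodic function bounded by \<open>1 / sqrt y\<close> up to a constant, which excludes a
  constant term and negative terms in its Fourier expansion.\<close>

lemma growth_imp_decay:
  assumes hol: "W holomorphic_on uhp"
    and slW: "\<And>A. A \<in> \<Gamma> \<Longrightarrow> slash 2 W A - W \<in> S2 \<Gamma>"
    and par: "\<And>A. A \<in> \<Gamma> \<Longrightarrow> parabolic A \<Longrightarrow> slash 2 W A - W = 0"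
    and gr: "\<forall>z\<in>F. Im z * norm (W z) \<le> K * yF C \<sigma> z powr (1 / 2)"
  shows "decays_at_cusps \<Gamma> W"
  unfolding decays_at_cusps_def
proof (intro allI impI)
  fix \<aa> S assume "cusp \<Gamma> \<aa> \<and> scaling_matrix \<Gamma> \<aa> S"
  then have c: "cusp \<Gamma> \<aa>" and S: "scaling_matrix \<Gamma> \<aa> S" by auto
  have dS: "det S = 1" "act S None = \<aa>" using S by (auto simp: scaling_matrix_def)
  have C0: "C \<noteq> {}" using cusp_equiv_C[OF c] by blast
  have Wstab: "slash 2 W P z = W z" if P: "P \<in> stab \<Gamma> \<aa>" and z: "z \<in> uhp" for P z
    using stab_cusp_cases[OF S P]
  proof (elim disjE)
    assume "parabolic P"
    then have "slash 2 W P - W = 0" using par P by (simp add: stab_def)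
    then show ?thesis by (metis eq_iff_diff_eq_0)
  qed (simp_all add: slash2)
  define hb where "hb T R \<longleftrightarrow> R > 0 \<and> (\<forall>A\<in>\<Gamma>. \<forall>w\<in>uhp. (matrix_inv T ** A ** S) $ 2 $ 1 \<noteq> 0 \<longrightarrow>
      Im (moeb (matrix_inv T ** A ** S) w) \<le> R / Im w)" for T and R :: real
  have ex_hb: "\<exists>R. hb T R" if "scaling_matrix \<Gamma> \<bb> T" for \<bb> T
    by (rule scaling_pair_height[OF S that]) (auto simp: hb_def)
  define R where "R \<bb> = (SOME R. hb (cscal \<bb>) R)" for \<bb>
  define R' where "R' \<bb> = (SOME R. hb (\<sigma> \<bb>) R)" for \<bb>
  have hbR: "hb (cscal \<bb>) (R \<bb>)" if "cusp \<Gamma> \<bb>" for \<bb>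
    unfolding R_def by (rule someI_ex[OF ex_hb[OF scaling_cscal[OF that]]])
  have hbR': "hb (\<sigma> \<bb>) (R' \<bb>)" if "\<bb> \<in> C" for \<bb>
    unfolding R'_def by (rule someI_ex[OF ex_hb[OF scaling[OF that]]])
  have R: "\<And>\<bb>. cusp \<Gamma> \<bb> \<Longrightarrow> R \<bb> > 0"
    "\<And>\<bb> A w. cusp \<Gamma> \<bb> \<Longrightarrow> A \<in> \<Gamma> \<Longrightarrow> w \<in> uhp \<Longrightarrow> (matrix_inv (cscal \<bb>) ** A ** S) $ 2 $ 1 \<noteq> 0 \<Longrightarrow>
      Im (moeb (matrix_inv (cscal \<bb>) ** A ** S) w) \<le> R \<bb> / Im w"
    using hbR unfolding hb_def by simp_all
  have R': "\<And>\<bb>. \<bb> \<in> C \<Longrightarrow> R' \<bb> > 0"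
    "\<And>\<bb> A w. \<bb> \<in> C \<Longrightarrow> A \<in> \<Gamma> \<Longrightarrow> w \<in> uhp \<Longrightarrow> (matrix_inv (\<sigma> \<bb>) ** A ** S) $ 2 $ 1 \<noteq> 0 \<Longrightarrow>
      Im (moeb (matrix_inv (\<sigma> \<bb>) ** A ** S) w) \<le> R' \<bb> / Im w"
    using hbR' unfolding hb_def by simp_all
  obtain M Bs where M: "compact M" "M \<subseteq> uhp" "finite Bs" "\<And>\<bb>. \<bb> \<in> Bs \<Longrightarrow> cusp \<Gamma> \<bb>"
    "\<And>z. z \<in> closure F \<Longrightarrow> z \<in> uhp \<Longrightarrow> z \<in> M \<or> (\<exists>\<bb>\<in>Bs. Im (moeb (matrix_inv (cscal \<bb>)) z) > 1)"
    by (rule closure_F_cover[of "\<lambda>_. 1"]) auto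
  obtain YM where YM: "\<And>A z. A \<in> \<Gamma> \<Longrightarrow> z \<in> M \<Longrightarrow> Im (moeb (matrix_inv S) (moeb A z)) \<le> YM"
    using compact_height_bound[OF S M(1,2)] by blast
  \<comment> \<open>A point above height \<open>Y1\<close> at the cusp is not equivalent to a point
    of \<open>M\<close>, and its image under an element of the group has height less than 1 above
    any cusp occurring here unless that element identifies the two cusps.\<close>
  define Y1 where "Y1 = \<bar>YM\<bar> + sum R Bs + sum R' C + 1"
  have sums: "sum R Bs \<ge> 0" "sum R' C \<ge> 0"
    using R(1) R'(1) M(4) by (intro sum_nonneg; simp add: less_imp_le)+
  have Y1: "Y1 \<ge> 1" "Y1 > YM" "\<And>\<bb>. \<bb> \<in> Bs \<Longrightarrow> R \<bb> < Y1" "\<And>\<bb>. \<bb> \<in> C \<Longrightarrow> R' \<bb> < Y1"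
  proof -
    show "Y1 \<ge> 1" "Y1 > YM" using sums by (auto simp: Y1_def)
    show "R \<bb> < Y1" if "\<bb> \<in> Bs" for \<bb>
      using member_le_sum[OF that, of R] R(1) M(3,4) sums by (force simp: Y1_def less_imp_le)
    show "R' \<bb> < Y1" if "\<bb> \<in> C" for \<bb>
      using member_le_sum[OF that, of R'] R'(1) finite_C sums by (force simp: Y1_def less_imp_le)
  qed
  \<comment> \<open>Only finitely many cusps occur, so finitely many cusp forms \<open>G\<close>
    measure the failure of \<open>W\<close> to be invariant, however many group elements are
    involved.\<close>
  define Bs' where "Bs' = {\<bb> \<in> Bs. \<exists>A\<in>\<Gamma>. act A \<aa> = \<bb>}"
  have "\<forall>\<bb>\<in>Bs'. \<exists>A. A \<in> \<Gamma> \<and> act A \<aa> = \<bb>" by (auto simp: Bs'_def)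
  then obtain \<delta> where \<delta>: "\<And>\<bb>. \<bb> \<in> Bs' \<Longrightarrow> \<delta> \<bb> \<in> \<Gamma>" "\<And>\<bb>. \<bb> \<in> Bs' \<Longrightarrow> act (\<delta> \<bb>) \<aa> = \<bb>" by metis
  define G where "G \<bb> = slash 2 W (\<delta> \<bb>) - W" for \<bb>
  have G: "G \<bb> \<in> S2 \<Gamma>" if "\<bb> \<in> Bs'" for \<bb> using slW \<delta>(1)[OF that] by (simp add: G_def)
  define N where "N w = (\<Sum>\<bb>\<in>Bs'. norm (slash 2 (G \<bb>) S w))" for w
  define K' where "K' = \<bar>K\<bar> * sqrt (real (card C))"
  have main: "norm (slash 2 W S w) \<le> K' / sqrt (Im w) + N w" if w: "Im w > Y1" for w
  proof -
    have wu: "w \<in> uhp" and w1: "Im w > 1" using w Y1(1) by (auto simp: uhp_def)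
    define z where "z = moeb S w"
    have zu: "z \<in> uhp" using wu dS by (simp add: z_def moeb_uhp)
    obtain A where A: "A \<in> \<Gamma>" "moeb A z \<in> closure F" "moeb A z \<in> uhp" by (rule move_to_F[OF zu])
    have dA: "det A = 1" using A by (simp add: det_Gamma)
    have D: "moeb (matrix_inv T ** A ** S) w = moeb (matrix_inv T) (moeb A z)" if "det T = 1" for T
      using that dA dS wu by (simp add: moeb_mult moeb_uhp det_mult_sl2 det_matrix_inv_sl2 z_def)
    have "moeb A z \<notin> M"
    proof
      assume "moeb A z \<in> M"
      then have "Im (moeb (matrix_inv S) (moeb (matrix_inv A) (moeb A z))) \<le> YM"
        by (intro YM inv_Gamma A)
      then have "Im w \<le> YM" using zu wu dA dS by (simp add: moeb_inv_cancel z_def)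
      then show False using w Y1 by simp
    qed
    then obtain \<bb> where b: "\<bb> \<in> Bs" "Im (moeb (matrix_inv (cscal \<bb>)) (moeb A z)) > 1"
      using M(5)[OF A(2,3)] by blast
    have cb: "cusp \<Gamma> \<bb>" using M(4) b by blast
    have Sb: "scaling_matrix \<Gamma> \<bb> (cscal \<bb>)" "det (cscal \<bb>) = 1"
      using scaling_cscal[OF cb] by (auto simp: scaling_matrix_def)
    have "(matrix_inv (cscal \<bb>) ** A ** S) $ 2 $ 1 = 0"
    proof (rule ccontr)
      assume "(matrix_inv (cscal \<bb>) ** A ** S) $ 2 $ 1 \<noteq> 0"
      from R(2)[OF cb A(1) wu this] have "1 < R \<bb> / Im w" using b(2) D[OF Sb(2)] by simp
      then have "Im w < R \<bb>" using w1 by (simp add: field_simps)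
      then show False using w Y1(3)[OF b(1)] by simp
    qed
    then have Ab: "act A \<aa> = \<bb>" using scaling_pair_upper(1)[OF S Sb(1) A(1)] by simp
    then have b': "\<bb> \<in> Bs'" using b A by (auto simp: Bs'_def)
    \<comment> \<open>\<open>A\<close> differs from the chosen \<open>\<delta> \<bb>\<close> by an
      element of the stabilizer of \<open>\<aa>\<close>, under which \<open>W\<close> is
      invariant.\<close>
    define P where "P = matrix_inv (\<delta> \<bb>) ** A"
    have d\<delta>: "det (\<delta> \<bb>) = 1" using \<delta>(1)[OF b'] by (simp add: det_Gamma)
    have "act (matrix_inv (\<delta> \<bb>)) \<bb> = \<aa>" using \<delta>(2)[OF b'] act_inv_cancel(1)[OF d\<delta>, of \<aa>] by simp
    then have P: "P \<in> stab \<Gamma> \<aa>" "P \<in> \<Gamma>"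
      using Ab A \<delta>(1)[OF b'] d\<delta> dA
      by (auto simp: P_def stab_def mult_Gamma inv_Gamma act_mult det_matrix_inv_sl2)
    have AP: "A = \<delta> \<bb> ** P" using d\<delta> by (simp add: P_def matrix_inv_cancel)
    have dP: "det P = 1" using P by (simp add: det_Gamma)
    have "slash 2 W A z = slash 2 (slash 2 W (\<delta> \<bb>)) P z"
      unfolding AP using zu dP by (intro slash2_mult)
    also have "slash 2 W (\<delta> \<bb>) = W + G \<bb>" by (simp add: G_def)
    also have "slash 2 (W + G \<bb>) P z = W z + G \<bb> z"
      using Wstab[OF P(1) zu] S2_D(3)[OF G[OF b'] P(2)] by (simp add: slash2_add)
    finally have sl: "slash 2 W A z = W z + G \<bb> z" .
    \<comment> \<open>Each height in the sum equals \<open>Im w\<close> or is at most 1.\<close>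
    have hs: "(\<Sum>\<bb>\<in>C. Im (moeb (matrix_inv (\<sigma> \<bb>)) (moeb A z))) \<le> real (card C) * Im w"
    proof (rule sum_bounded_above)
      fix \<bb> assume bC: "\<bb> \<in> C"
      have d: "det (\<sigma> \<bb>) = 1" using scaling[OF bC] by (simp add: scaling_matrix_def)
      show "Im (moeb (matrix_inv (\<sigma> \<bb>)) (moeb A z)) \<le> Im w"
      proof (cases "(matrix_inv (\<sigma> \<bb>) ** A ** S) $ 2 $ 1 = 0")
        case True
        then show ?thesis using scaling_pair_Im[OF S scaling[OF bC] A(1) True, of w] D[OF d] by simp
      next
        case False
        have "Im (moeb (matrix_inv (\<sigma> \<bb>)) (moeb A z)) \<le> R' \<bb> / Im w"
          using R'(2)[OF bC A(1) wu False] D[OF d] by simp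
        also have "\<dots> \<le> 1" using Y1(4)[OF bC] w w1 by (simp add: field_simps)
        finally show ?thesis using w1 by simp
      qed
    qed
    have "Im (moeb A z) * norm (W (moeb A z)) \<le> \<bar>K\<bar> * sqrt (\<Sum>\<bb>\<in>C. Im (moeb (matrix_inv (\<sigma> \<bb>)) (moeb A z)))"
      using growth_on_closure[OF holomorphic_on_imp_continuous_on[OF hol] gr C0 A(2,3)] .
    also have "\<dots> \<le> \<bar>K\<bar> * sqrt (real (card C) * Im w)"
      using hs by (intro mult_left_mono) auto
    also have "\<dots> = K' * sqrt (Im w)" by (simp add: K'_def real_sqrt_mult)
    finally have 1: "Im z * norm (W z + G \<bb> z) \<le> K' * sqrt (Im w)"
      using Im_slash2[OF dA zu, of W] sl by simp
    have "Im z * norm (W z) \<le> Im z * norm (W z + G \<bb> z) + Im z * norm (G \<bb> z)"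
      using norm_triangle_ineq4[of "W z + G \<bb> z" "G \<bb> z"] zu
      by (simp add: uhp_def mult_left_mono flip: distrib_left)
    then have "Im w * norm (slash 2 W S w) \<le> K' * sqrt (Im w) + Im w * norm (slash 2 (G \<bb>) S w)"
      using 1 Im_slash2[OF dS(1) wu, of W] Im_slash2[OF dS(1) wu, of "G \<bb>"] by (simp add: z_def)
    also have "norm (slash 2 (G \<bb>) S w) \<le> N w"
      unfolding N_def using M(3) b' by (intro member_le_sum) (auto simp: Bs'_def)
    finally have "Im w * norm (slash 2 W S w) \<le> K' * sqrt (Im w) + Im w * N w"
      using w1 by (simp add: mult_left_mono)
    also have "\<dots> = Im w * (K' / sqrt (Im w) + N w)"
    proof -
      have "Im w / sqrt (Im w) = sqrt (Im w)" by (rule real_div_sqrt) (use w1 in simp)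
      then show ?thesis by (simp add: distrib_left) (metis times_divide_eq_right mult.commute)
    qed
    finally show ?thesis using w1 by simp
  qed
  have lim: "\<exists>Y'. \<forall>w. Im w > Y' \<longrightarrow> norm (slash 2 W S w) < e" if e: "e > 0" for e
  proof -
    \<comment> \<open>The summand 1 keeps the divisor positive.\<close>
    define n where "n = real (card Bs') + 1"
    have n: "n > 0" by (simp add: n_def)
    have fB: "finite Bs'" using M(3) by (simp add: Bs'_def)
    have "eventually (\<lambda>y. \<forall>\<bb>\<in>Bs'. \<forall>w. Im w = y \<longrightarrow> norm (slash 2 (G \<bb>) S w) < e / (2 * n)) at_top"
      using fB e n by (intro eventually_ball_finite ballI decays_small[OF S2_D(4)[OF G] c S]) auto
    moreover have "((\<lambda>y. K' / sqrt y) \<longlongrightarrow> 0) at_top"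
      by (intro tendsto_divide_0[OF tendsto_const] filterlim_at_top_imp_at_infinity sqrt_at_top)
    then have "eventually (\<lambda>y. K' / sqrt y < e / 2) at_top"
      using e by (intro order_tendstoD(2)) auto
    ultimately have "eventually (\<lambda>y. \<forall>w. Im w = y \<longrightarrow> norm (slash 2 W S w) < e) at_top"
      using eventually_gt_at_top[of Y1]
    proof eventually_elim
      case (elim y)
      show ?case
      proof (intro allI impI)
        fix w assume w: "Im w = y"
        have "N w \<le> real (card Bs') * (e / (2 * n))"
          unfolding N_def using elim w by (intro sum_bounded_above) (auto simp: less_imp_le)
        also have "\<dots> \<le> n * (e / (2 * n))" using e n by (intro mult_right_mono) (auto simp: n_def)
        also have "\<dots> = e / 2" using n by simp
        finally have "N w \<le> e / 2" .
        moreover have "norm (slash 2 W S w) \<le> K' / sqrt y + N w" using main[of w] elim(3) w by simp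
        ultimately show "norm (slash 2 W S w) < e" using elim(2) by linarith
      qed
    qed
    then obtain Y' where Y': "\<forall>y\<ge>Y'. \<forall>w. Im w = y \<longrightarrow> norm (slash 2 W S w) < e"
      unfolding eventually_at_top_linorder by blast
    have "norm (slash 2 W S w) < e" if "Im w > Y'" for w
      using Y'[rule_format, of "Im w" w] that by simp
    then show ?thesis by blast
  qed
  have per: "slash 2 W S (w + 1) = slash 2 W S w" if "Im w > 0" for w
  proof -
    have wu: "w \<in> uhp" using that by (simp add: uhp_def)
    define P where "P = S ** transl (of_int 1) ** matrix_inv S"
    have P: "P \<in> stab \<Gamma> \<aa>" unfolding P_def by (rule scaling_transl_stab[OF S])
    have "slash 2 W S (w + 1) = slash 2 W (S ** transl 1) w"
      using wu by (simp add: slash2_mult) (simp add: slash2)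
    also have "S ** transl 1 = P ** S" using dS by (simp add: P_def matrix_inv_cancel)
    also have "slash 2 W (P ** S) w = slash 2 (slash 2 W P) S w" using wu dS by (simp add: slash2_mult)
    also have "\<dots> = slash 2 W S w"
      using Wstab[OF P moeb_uhp[OF dS(1) wu]] by (simp add: slash2[of _ S])
    finally show ?thesis .
  qed
  have hS: "slash 2 W S holomorphic_on {w. Im w > 0}"
    using holomorphic_slash2[OF dS(1) hol] by (simp add: uhp_def)
  obtain K Y' where "\<And>w. Im w > Y' \<Longrightarrow> norm (slash 2 W S w) \<le> K * exp (- (2 * pi) * Im w)"
    by (rule periodic_exp_decay[OF hS per lim]) (simp, blast+)
  then show "\<exists>c>0. \<exists>K Y. \<forall>z. Im z > Y \<and> Im z > 0 \<longrightarrow> norm (slash 2 W S z) \<le> K * exp (- c * Im z)"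
    by (intro exI[of _ "2 * pi"] conjI exI[of _ K] exI[of _ Y']) auto
qed

end

section \<open>Wirtinger calculus\<close>

text \<open>\<open>p\<close> and \<open>q\<close> are the derivatives of \<open>f\<close> by
  \<open>z\<close> and by \<open>cnj z\<close>; their continuity amounts to continuous real
  differentiability of \<open>f\<close>.\<close>

definition wirt :: "(complex \<Rightarrow> complex) \<Rightarrow> (complex \<Rightarrow> complex) \<Rightarrow> (complex \<Rightarrow> complex) \<Rightarrow> complex set \<Rightarrow> bool" where
  "wirt f p q U \<longleftrightarrow> (\<forall>z\<in>U. (f has_derivative (\<lambda>v. p z * v + q z * cnj v)) (at z)) \<and>
     continuous_on U p \<and> continuous_on U q"

lemma wirt_continuous: "wirt f p q U \<Longrightarrow> continuous_on U f"
  unfolding wirt_def by (meson continuous_at_imp_continuous_on has_derivative_continuous)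

lemma wirt_unique:
  assumes "(f has_derivative (\<lambda>v. a * v + b * cnj v)) (at z)" "(f has_derivative (\<lambda>v. a' * v + b' * cnj v)) (at z)"
  shows "a = a'" "b = b'"
proof -
  have eq: "a * v + b * cnj v = a' * v + b' * cnj v" for v
    using has_derivative_unique[OF assms] by (rule fun_cong)
  have 1: "a + b = a' + b'" using eq[of 1] by simp
  have "\<i> * (a - b) = \<i> * (a' - b')" using eq[of \<i>] by (simp add: algebra_simps)
  then have 2: "a - b = a' - b'" by simp
  have "(a + b) + (a - b) = (a' + b') + (a' - b')" using 1 2 by simp
  then show a: "a = a'" by simp
  then show "b = b'" using 1 by simp
qed

lemma wirt_holomorphic:
  assumes "f holomorphic_on U" "open U" shows "wirt f (deriv f) (\<lambda>_. 0) U"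
  using assms holomorphic_derivI[OF assms] holomorphic_on_imp_continuous_on[OF holomorphic_deriv[OF assms]]
  by (auto simp: wirt_def has_field_derivative_def)

lemma wirt_cnj:
  assumes "wirt f p q U" shows "wirt (\<lambda>z. cnj (f z)) (\<lambda>z. cnj (q z)) (\<lambda>z. cnj (p z)) U"
  using assms unfolding wirt_def
  by (auto intro!: derivative_eq_intros continuous_intros simp: fun_eq_iff algebra_simps)

lemma wirt_add:
  assumes "wirt f p q U" "wirt f' p' q' U"
  shows "wirt (\<lambda>z. f z + f' z) (\<lambda>z. p z + p' z) (\<lambda>z. q z + q' z) U"
  using assms unfolding wirt_def
  by (auto intro!: derivative_eq_intros continuous_intros simp: fun_eq_iff algebra_simps)

lemma wirt_mult:
  assumes "wirt f p q U" "wirt f' p' q' U"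
  shows "wirt (\<lambda>z. f z * f' z) (\<lambda>z. f z * p' z + p z * f' z) (\<lambda>z. f z * q' z + q z * f' z) U"
  using assms wirt_continuous[OF assms(1)] wirt_continuous[OF assms(2)] unfolding wirt_def
  by (auto intro!: derivative_eq_intros continuous_intros simp: fun_eq_iff algebra_simps)

lemma wirt_const: "wirt (\<lambda>_. c) (\<lambda>_. 0) (\<lambda>_. 0) U"
  by (auto simp: wirt_def)

lemma wirt_sum:
  assumes "finite I" "\<And>i. i \<in> I \<Longrightarrow> wirt (f i) (p i) (q i) U"
  shows "wirt (\<lambda>z. \<Sum>i\<in>I. f i z) (\<lambda>z. \<Sum>i\<in>I. p i z) (\<lambda>z. \<Sum>i\<in>I. q i z) U"
  using assms
proof (induction I rule: finite_induct)
  case empty then show ?case using wirt_const[of 0] by simp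
next
  case (insert i I)
  then have "wirt (\<lambda>z. f i z + (\<Sum>i\<in>I. f i z)) (\<lambda>z. p i z + (\<Sum>i\<in>I. p i z)) (\<lambda>z. q i z + (\<Sum>i\<in>I. q i z)) U"
    by (intro wirt_add) auto
  then show ?case using insert by simp
qed

lemma wirt_real_compose:
  assumes w: "wirt (\<lambda>z. of_real (r z)) p q U"
    and k: "\<And>z. z \<in> U \<Longrightarrow> (k has_real_derivative k' (r z)) (at (r z))"
    and c: "continuous_on (r ` U) k'"
  shows "wirt (\<lambda>z. of_real (k (r z))) (\<lambda>z. of_real (k' (r z)) * p z) (\<lambda>z. of_real (k' (r z)) * q z) U"
proof -
  have rc: "continuous_on U r"
    using wirt_continuous[OF w] continuous_on_Re[of U "\<lambda>z. of_real (r z)"] by simp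
  have d: "((\<lambda>z. of_real (k (r z)) :: complex) has_derivative
      (\<lambda>v. of_real (k' (r z)) * p z * v + of_real (k' (r z)) * q z * cnj v)) (at z)" if z: "z \<in> U" for z
  proof -
    let ?D = "\<lambda>v. p z * v + q z * cnj v"
    have D: "((\<lambda>z. of_real (r z)) has_derivative ?D) (at z)" using w z by (simp add: wirt_def)
    have "((\<lambda>z. Im (of_real (r z))) has_derivative (\<lambda>v. Im (?D v))) (at z)" by (rule has_derivative_Im[OF D])
    then have "((\<lambda>z. 0::real) has_derivative (\<lambda>v. Im (?D v))) (at z)" by simp
    \<comment> \<open>The function is real valued, so its differential takes real values and can be
      multiplied by the real derivative of \<open>k\<close>.\<close>
    then have Im0: "Im (?D v) = 0" for v
      using has_derivative_unique[OF _ has_derivative_const] by metis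
    have "((\<lambda>z. Re (of_real (r z))) has_derivative (\<lambda>v. Re (?D v))) (at z)" by (rule has_derivative_Re[OF D])
    then have r: "(r has_derivative (\<lambda>v. Re (?D v))) (at z)" by simp
    have "((\<lambda>z. k (r z)) has_derivative (\<lambda>v. k' (r z) * Re (?D v))) (at z)"
      using has_derivative_compose[OF r k[OF z, unfolded has_field_derivative_def]] by simp
    then have "((\<lambda>z. of_real (k (r z)) :: complex) has_derivative (\<lambda>v. of_real (k' (r z) * Re (?D v)))) (at z)"
      by (rule has_derivative_of_real)
    moreover have "of_real (k' (r z) * Re (?D v)) = of_real (k' (r z)) * p z * v + of_real (k' (r z)) * q z * cnj v" for v
    proof -
      have "of_real (Re (?D v)) = ?D v" using Im0[of v] by (simp add: complex_eq_iff)
      then show ?thesis by (simp only: of_real_mult) (simp add: algebra_simps)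
    qed
    ultimately show ?thesis by simp
  qed
  have "continuous_on U (\<lambda>z. k' (r z))" using continuous_on_compose2[OF c rc] by blast
  then show ?thesis using d w unfolding wirt_def by (auto intro!: continuous_intros)
qed

text \<open>The inner function is holomorphic, so the derivative by \<open>cnj z\<close> picks up
  the conjugate of its derivative.\<close>

lemma wirt_moeb:
  assumes A: "det A = 1" and w: "wirt f p q uhp"
  shows "wirt (\<lambda>z. f (moeb A z)) (\<lambda>z. p (moeb A z) / (jfac A z)\<^sup>2) (\<lambda>z. q (moeb A z) / cnj ((jfac A z)\<^sup>2)) uhp"
  unfolding wirt_def
proof (intro conjI ballI)
  fix z assume z: "z \<in> uhp"
  have 1: "(moeb A has_derivative (\<lambda>v. (1 / (jfac A z)\<^sup>2) * v)) (at z)"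
    using moeb_has_derivative[OF A jfac_nonzero[OF A z]] unfolding has_field_derivative_def .
  have "(f has_derivative (\<lambda>v. p (moeb A z) * v + q (moeb A z) * cnj v)) (at (moeb A z))"
    using w moeb_uhp[OF A z] by (simp add: wirt_def)
  from has_derivative_compose[OF 1 this]
  show "((\<lambda>z. f (moeb A z)) has_derivative
      (\<lambda>v. p (moeb A z) / (jfac A z)\<^sup>2 * v + q (moeb A z) / cnj ((jfac A z)\<^sup>2) * cnj v)) (at z)" by simp
next
  have m: "continuous_on uhp (moeb A)" using holomorphic_moeb[OF A] by (rule holomorphic_on_imp_continuous_on)
  have j: "continuous_on uhp (jfac A)" using holomorphic_jfac by (rule holomorphic_on_imp_continuous_on)
  have im: "moeb A ` uhp \<subseteq> uhp" using moeb_uhp[OF A] by auto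
  have pq: "continuous_on uhp p" "continuous_on uhp q" using w by (auto simp: wirt_def)
  show "continuous_on uhp (\<lambda>z. p (moeb A z) / (jfac A z)\<^sup>2)"
    using jfac_nonzero[OF A] by (intro continuous_intros continuous_on_compose2[OF pq(1) m im] j) auto
  show "continuous_on uhp (\<lambda>z. q (moeb A z) / cnj ((jfac A z)\<^sup>2))"
    using jfac_nonzero[OF A] by (intro continuous_intros continuous_on_compose2[OF pq(2) m im] j) auto
qed

lemma wirt_Im: "wirt (\<lambda>z. of_real (Im z)) (\<lambda>_. - \<i> / 2) (\<lambda>_. \<i> / 2) U"
proof -
  have "((\<lambda>z. of_real (Im z) :: complex) has_derivative (\<lambda>v. - \<i> / 2 * v + \<i> / 2 * cnj v)) (at z)" for z
  proof -
    have "((\<lambda>z. of_real (Im z) :: complex) has_derivative (\<lambda>v. of_real (Im v))) (at z)"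
      by (intro derivative_intros)
    moreover have "of_real (Im v) = - \<i> / 2 * v + \<i> / 2 * cnj v" for v :: complex by (simp add: complex_eq_iff)
    ultimately show ?thesis by simp
  qed
  then show ?thesis by (simp add: wirt_def)
qed

lemma wirt_ident: "wirt (\<lambda>z. z) (\<lambda>_. 1) (\<lambda>_. 0) U"
  by (simp add: wirt_def)

lemma wirt_norm2: "wirt (\<lambda>z. of_real ((norm z)\<^sup>2)) (\<lambda>z. cnj z) (\<lambda>z. z) U"
proof -
  have "wirt (\<lambda>z. z * cnj z) (\<lambda>z. z * cnj 0 + 1 * cnj z) (\<lambda>z. z * cnj 1 + 0 * cnj z) U"
    by (intro wirt_mult wirt_cnj[OF wirt_ident] wirt_ident)
  then show ?thesis by (simp add: complex_norm_square[symmetric] del: of_real_power)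
qed

lemma wirt_cong_open:
  assumes "wirt f p q U" "open U" "\<And>z. z \<in> U \<Longrightarrow> g z = f z"
  shows "wirt g p q U"
  unfolding wirt_def
proof (intro conjI ballI)
  fix z assume z: "z \<in> U"
  have "(f has_derivative (\<lambda>v. p z * v + q z * cnj v)) (at z)" using assms(1) z by (simp add: wirt_def)
  then show "(g has_derivative (\<lambda>v. p z * v + q z * cnj v)) (at z)"
    by (rule has_derivative_transform_within_open[OF _ assms(2) z]) (simp add: assms(3))
qed (use assms(1) in \<open>auto simp: wirt_def\<close>)

lemma wirt_subset: "wirt f p q U \<Longrightarrow> V \<subseteq> U \<Longrightarrow> wirt f p q V"
  unfolding wirt_def by (meson continuous_on_subset subsetD)

section \<open>Integrals of derivatives with compact support\<close>

lemma continuous_compact_support_integrable: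
  fixes k :: "complex \<Rightarrow> complex"
  assumes "continuous_on UNIV k" "compact Q" "\<And>z. z \<notin> Q \<Longrightarrow> k z = 0"
  shows "integrable lborel k"
proof -
  have "integrable lborel (\<lambda>z. indicator Q z *\<^sub>R k z)"
    by (intro borel_integrable_compact assms continuous_on_subset[OF assms(1)]) auto
  moreover have "(\<lambda>z. indicator Q z *\<^sub>R k z) = k" using assms(3) by (auto simp: indicator_def fun_eq_iff)
  ultimately show ?thesis by simp
qed

text \<open>By translation invariance the difference quotients of \<open>f\<close> have integral 0.
  They are dominated by a constant on a compact set, so the directional derivatives have integral 0
  as well, and the directions 1 and \<open>\<i>\<close> separate \<open>p\<close> from
  \<open>q\<close>.\<close>

lemma integral_dbar_zero:
  assumes w: "wirt f p q UNIV" and Q: "compact Q" and 0: "\<And>z. z \<notin> Q \<Longrightarrow> f z = 0"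
  shows "(LINT z|lborel. q z) = 0"
proof -
  have pq0: "p z = 0 \<and> q z = 0" if z: "z \<notin> Q" for z
  proof -
    have "((\<lambda>_. 0) has_derivative (\<lambda>v. 0 * v + 0 * cnj v)) (at z)" by simp
    then have "(f has_derivative (\<lambda>v. 0 * v + 0 * cnj v)) (at z)"
      by (rule has_derivative_transform_within_open[of _ _ _ _ "- Q"])
        (use z 0 Q in \<open>auto simp: compact_imp_closed open_closed\<close>)
    moreover have "(f has_derivative (\<lambda>v. p z * v + q z * cnj v)) (at z)" using w by (simp add: wirt_def)
    ultimately show ?thesis using wirt_unique[of f "p z" "q z" z 0 0] by simp
  qed
  have cp: "continuous_on UNIV p" and cq: "continuous_on UNIV q" and cf: "continuous_on UNIV f"
    using w wirt_continuous[OF w] by (auto simp: wirt_def)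
  have ip: "integrable lborel p" and iq: "integrable lborel q" and iff: "integrable lborel f"
    using continuous_compact_support_integrable[OF _ Q] cp cq cf pq0 0 by blast+
  have bd: "\<exists>L\<ge>0. \<forall>z. norm (k z) \<le> L" if "continuous_on UNIV k" "\<And>z. z \<notin> Q \<Longrightarrow> k z = 0" for k :: "complex \<Rightarrow> complex"
  proof -
    have "bounded (k ` Q)" using that Q by (intro compact_imp_bounded compact_continuous_image) (auto elim: continuous_on_subset)
    then obtain L where "L > 0" "\<forall>z\<in>Q. norm (k z) \<le> L" unfolding bounded_pos by blast
    then show ?thesis using that(2) by (intro exI[of _ L]) (metis less_imp_le norm_zero)
  qed
  obtain L1 L2 where L: "L1 \<ge> 0" "L2 \<ge> 0" "\<And>z. norm (p z) \<le> L1" "\<And>z. norm (q z) \<le> L2"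
    using bd[OF cp] bd[OF cq] pq0 by metis
  have dir: "(LINT z|lborel. p z * v + q z * cnj v) = 0" if v: "norm v = 1" for v
  proof -
    define t where "t n = 1 / real (Suc n)" for n
    have t: "t n > 0" "t n \<le> 1" for n by (auto simp: t_def)
    have t0: "t \<longlonglongrightarrow> 0" unfolding t_def by (rule LIMSEQ_Suc[OF lim_1_over_n])
    define s where "s n z = (f (z + of_real (t n) * v) - f z) / of_real (t n)" for n z
    \<comment> \<open>All difference quotients with step at most 1 vanish outside
      \<open>Q'\<close>.\<close>
    define Q' where "Q' = (\<lambda>(x, y). x - y) ` (Q \<times> cball 0 1)"
    have Q': "compact Q'" unfolding Q'_def
      by (intro compact_continuous_image compact_Times Q compact_cball) (auto simp: case_prod_beta intro!: continuous_intros)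
    have lip: "norm (f x - f y) \<le> (L1 + L2) * norm (x - y)" for x y
    proof (rule differentiable_bound[of UNIV f "\<lambda>z v. p z * v + q z * cnj v"])
      show "(f has_derivative (\<lambda>v. p z * v + q z * cnj v)) (at z within UNIV)" for z using w by (simp add: wirt_def)
      show "onorm (\<lambda>v. p z * v + q z * cnj v) \<le> L1 + L2" for z
      proof (rule onorm_bound)
        show "norm (p z * v + q z * cnj v) \<le> (L1 + L2) * norm v" for v
        proof -
          have "norm (p z * v + q z * cnj v) \<le> norm (p z) * norm v + norm (q z) * norm v"
            using norm_triangle_ineq[of "p z * v" "q z * cnj v"] by (simp add: norm_mult)
          also have "\<dots> \<le> L1 * norm v + L2 * norm v" using L by (intro add_mono mult_right_mono) auto
          finally show ?thesis by (simp add: distrib_right)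
        qed
      qed (use L in auto)
    qed auto
    have int_s: "integrable lborel (s n)" "(LINT z|lborel. s n z) = 0" for n
    proof -
      have fm: "f \<in> borel_measurable borel" by (rule borel_measurable_continuous_onI[OF cf])
      have tr: "distr lborel borel ((+) (of_real (t n) * v)) = lborel" by (simp add: lborel_distr_plus)
      have i: "integrable lborel (\<lambda>z. f (of_real (t n) * v + z))"
        using iff integrable_distr_eq[of "(+) (of_real (t n) * v)" lborel borel f] fm by (simp add: tr)
      have "(LINT z|lborel. f (of_real (t n) * v + z)) = (LINT z|lborel. f z)"
        using integral_distr[of "(+) (of_real (t n) * v)" lborel borel f] fm by (simp add: tr)
      then show "integrable lborel (s n)" "(LINT z|lborel. s n z) = 0"
        unfolding s_def using i iff by (auto simp: add.commute)
    qed
    have "(\<lambda>n. LINT z|lborel. s n z) \<longlonglongrightarrow> (LINT z|lborel. p z * v + q z * cnj v)"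
    proof (rule integral_dominated_convergence[where w = "\<lambda>z. indicator Q' z *\<^sub>R (L1 + L2)"])
      show "(\<lambda>z. p z * v + q z * cnj v) \<in> borel_measurable lborel" using ip iq by (intro borel_measurable_integrable) auto
      show "s n \<in> borel_measurable lborel" for n using int_s by (intro borel_measurable_integrable)
      show "integrable lborel (\<lambda>z. indicator Q' z *\<^sub>R (L1 + L2))"
        by (rule borel_integrable_compact[OF Q']) simp
      show "AE z in lborel. (\<lambda>n. s n z) \<longlonglongrightarrow> p z * v + q z * cnj v"
      proof (rule AE_I2)
        fix z
        have "(f has_derivative (\<lambda>v. p z * v + q z * cnj v)) (at z)" using w by (simp add: wirt_def)
        moreover have "((\<lambda>x. z + of_real x * v) has_derivative (\<lambda>x. of_real x * v)) (at 0)"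
          by (auto intro!: derivative_eq_intros)
        ultimately have "((\<lambda>x. f (z + of_real x * v)) has_derivative (\<lambda>x. p z * (of_real x * v) + q z * cnj (of_real x * v))) (at 0)"
          using has_derivative_compose[of "\<lambda>x. z + of_real x * v" "\<lambda>x. of_real x * v" 0 UNIV f "\<lambda>v. p z * v + q z * cnj v"] by simp
        then have "((\<lambda>x. norm ((f (z + of_real x * v) - f z) - (p z * (of_real x * v) + q z * cnj (of_real x * v))) / norm x) \<longlongrightarrow> 0) (at (0::real))"
          unfolding has_derivative_iff_norm by simp
        moreover have "filterlim t (at 0) sequentially"
          using t0 t by (auto simp: filterlim_at intro!: always_eventually) (metis less_irrefl)
        ultimately have "(\<lambda>n. norm ((f (z + of_real (t n) * v) - f z) - (p z * (of_real (t n) * v) + q z * cnj (of_real (t n) * v))) / norm (t n)) \<longlonglongrightarrow> 0"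
          by (rule filterlim_compose)
        moreover have "norm ((f (z + of_real (t n) * v) - f z) - (p z * (of_real (t n) * v) + q z * cnj (of_real (t n) * v))) / norm (t n)
          = norm (s n z - (p z * v + q z * cnj v))" for n
        proof -
          have tn: "(of_real (t n) :: complex) \<noteq> 0" using t[of n] by simp
          have "(f (z + of_real (t n) * v) - f z) - (p z * (of_real (t n) * v) + q z * cnj (of_real (t n) * v))
            = of_real (t n) * (s n z - (p z * v + q z * cnj v))"
            unfolding s_def using tn by (simp add: field_simps)
          then show ?thesis using t[of n] by (simp add: norm_mult)
        qed
        ultimately have "(\<lambda>n. norm (s n z - (p z * v + q z * cnj v))) \<longlonglongrightarrow> 0" by simp
        then show "(\<lambda>n. s n z) \<longlonglongrightarrow> p z * v + q z * cnj v"
          by (simp add: tendsto_norm_zero_iff LIM_zero_iff)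
      qed
      show "AE z in lborel. norm (s n z) \<le> indicator Q' z *\<^sub>R (L1 + L2)" for n
      proof (rule AE_I2)
        fix z
        show "norm (s n z) \<le> indicator Q' z *\<^sub>R (L1 + L2)"
        proof (cases "z \<in> Q'")
          case True
          have "norm (s n z) = norm (f (z + of_real (t n) * v) - f z) / t n"
            using t[of n] by (simp add: s_def norm_divide)
          also have "\<dots> \<le> (L1 + L2) * norm (of_real (t n) * v) / t n"
            using lip[of "z + of_real (t n) * v" z] t[of n] by (intro divide_right_mono) auto
          also have "\<dots> = L1 + L2" using t[of n] v by (simp add: norm_mult)
          finally show ?thesis using True by simp
        next
          case False
          have a: "z + u \<notin> Q" if "norm u \<le> 1" for u
          proof
            assume "z + u \<in> Q"
            then have "(z + u, u) \<in> Q \<times> cball 0 1" using that by simp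
            then have "z \<in> Q'" unfolding Q'_def by force
            then show False using False by simp
          qed
          have "norm (of_real (t n) * v) \<le> 1" using t[of n] v by (simp add: norm_mult)
          then show ?thesis using a[of 0] a[of "of_real (t n) * v"] 0 False by (simp add: s_def)
        qed
      qed
    qed
    then show ?thesis using int_s(2) LIMSEQ_unique[OF _ tendsto_const] by (simp add: LIMSEQ_const_iff)
  qed
  have 1: "(LINT z|lborel. p z) + (LINT z|lborel. q z) = 0" using dir[of 1] ip iq by simp
  have 2: "(LINT z|lborel. p z) * \<i> - (LINT z|lborel. q z) * \<i> = 0" using dir[of \<i>] ip iq by simp
  have "(LINT z|lborel. p z) = (LINT z|lborel. q z)"
    using 2 by (metis eq_iff_diff_eq_0 i_squared mult_cancel_right mult_zero_left neg_equal_0_iff_equal zero_neq_one)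
  then show ?thesis using 1 by (simp flip: mult_2)
qed

section \<open>Change of variables and unfolding\<close>

text \<open>Plane measure is transported to \<open>real^2\<close>, where the Jacobian is a
  determinant of a matrix.\<close>

definition v2c :: "real^2 \<Rightarrow> complex" where "v2c x = Complex (x$1) (x$2)"
definition c2v :: "complex \<Rightarrow> real^2" where "c2v z = vector [Re z, Im z]"

lemma c2v_nth [simp]: "c2v z $ 1 = Re z" "c2v z $ 2 = Im z"
  by (simp_all add: c2v_def)

lemma v2c_c2v [simp]: "v2c (c2v z) = z" and c2v_v2c [simp]: "c2v (v2c x) = x"
  by (simp_all add: v2c_def vec_eq_iff forall_2)

lemma bounded_linear_v2c: "bounded_linear v2c"
  by (intro linear_conv_bounded_linear[THEN iffD1]) (auto intro!: linearI simp: v2c_def complex_eq_iff)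

lemma bounded_linear_c2v: "bounded_linear c2v"
  by (intro linear_conv_bounded_linear[THEN iffD1]) (auto intro!: linearI simp: vec_eq_iff forall_2)

lemma measurable_v2c [measurable]: "v2c \<in> borel_measurable borel"
  using bounded_linear_v2c by (intro borel_measurable_continuous_onI linear_continuous_on)

lemma lborel_complex_distr: "(lborel :: complex measure) = distr lborel borel v2c"
proof (rule lborel_eqI)
  fix l u :: complex assume le: "\<And>b. b \<in> Basis \<Longrightarrow> l \<bullet> b \<le> u \<bullet> b"
  have lu: "Re l \<le> Re u" "Im l \<le> Im u" using le[of 1] le[of \<i>] by (auto simp: Basis_complex_def)
  have "v2c -` box l u = box (c2v l) (c2v u)"
    by (auto simp: in_box_complex_iff mem_box_cart forall_2 v2c_def)
  then have "emeasure (distr lborel borel v2c) (box l u) = emeasure lborel (box (c2v l) (c2v u))"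
    by (simp add: emeasure_distr)
  also have "\<dots> = emeasure lborel (cbox (c2v l) (c2v u))"
    by (simp add: emeasure_lborel_box_eq emeasure_lborel_cbox_eq)
  also have "\<dots> = ennreal (measure lborel (cbox (c2v l) (c2v u)))"
    by (intro emeasure_eq_ennreal_measure) (simp add: emeasure_lborel_cbox_eq)
  also have "measure lborel (cbox (c2v l) (c2v u)) = (Re u - Re l) * (Im u - Im l)"
  proof -
    have "c2v l \<in> cbox (c2v l) (c2v u)" using lu by (auto simp: mem_box_cart forall_2)
    then have "cbox (c2v l) (c2v u) \<noteq> {}" by blast
    then show ?thesis by (subst content_cbox_cart) (auto simp: UNIV_2)
  qed
  finally show "emeasure (distr lborel borel v2c) (box l u) = (\<Prod>b\<in>Basis. (u - l) \<bullet> b)"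
    by (simp add: Basis_complex_def)
qed simp

lemma measurable_jfac [measurable]: "jfac A \<in> borel_measurable borel"
  unfolding jfac_def by measurable

lemma measurable_moeb [measurable]: "moeb A \<in> borel_measurable borel"
  unfolding moeb_def by measurable

lemma sets_uhp [measurable]: "uhp \<in> sets borel"
  using open_uhp by simp

lemma moeb_image_eq:
  assumes "det A = 1" "E \<subseteq> uhp"
  shows "moeb A ` E = {z \<in> uhp. moeb (matrix_inv A) z \<in> E}"
proof (intro equalityI subsetI)
  fix z assume "z \<in> moeb A ` E"
  then show "z \<in> {z \<in> uhp. moeb (matrix_inv A) z \<in> E}"
    using assms by (auto simp: moeb_uhp moeb_inv_cancel subset_eq)
next
  fix z assume z: "z \<in> {z \<in> uhp. moeb (matrix_inv A) z \<in> E}"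
  then have "moeb A (moeb (matrix_inv A) z) = z" using assms by (simp add: moeb_inv_cancel)
  then show "z \<in> moeb A ` E" using z by (metis (no_types, lifting) image_eqI mem_Collect_eq)
qed

lemma sets_moeb_image:
  assumes "det A = 1" "E \<subseteq> uhp" "E \<in> sets borel"
  shows "moeb A ` E \<in> sets borel"
proof -
  have "{z \<in> uhp. moeb (matrix_inv A) z \<in> E} = uhp \<inter> (moeb (matrix_inv A) -` E \<inter> space borel)" by auto
  also have "\<dots> \<in> sets borel" using measurable_sets[OF measurable_moeb assms(3)] by (intro sets.Int) auto
  finally show ?thesis using moeb_image_eq[OF assms(1,2)] by simp
qed

lemma det_complex_mult: "det (matrix (\<lambda>h. c2v (m * v2c h))) = (norm m)\<^sup>2"
proof -
  have "v2c (axis 1 1) = 1" "v2c (axis 2 1) = \<i>"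
    by (simp_all add: v2c_def axis_def complex_eq_iff)
  then have "det (matrix (\<lambda>h. c2v (m * v2c h))) = Re m * Re m + Im m * Im m"
    by (simp add: det_2 matrix_def)
  then show ?thesis unfolding cmod_power2 by (simp add: power2_eq_square)
qed

text \<open>The Jacobian of \<open>moeb A\<close>: the complex derivative is
  \<open>1 / (jfac A z)^2\<close>, and the real determinant is the square of its norm.\<close>

definition moeb_dens :: "real^2^2 \<Rightarrow> complex \<Rightarrow> real" where
  "moeb_dens A z = 1 / norm (jfac A z) ^ 4"

lemma measurable_moeb_dens [measurable]: "moeb_dens A \<in> borel_measurable borel"
  unfolding moeb_dens_def by measurable

lemma moeb_dens_nonneg: "moeb_dens A z \<ge> 0" by (simp add: moeb_dens_def)

text \<open>On a compact set the Jacobian is bounded, hence integrable over \<open>E\<close>, as the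
  change of variables requires.\<close>

lemma emeasure_moeb_compact:
  assumes A: "det A = 1" and E: "E \<in> sets borel" "E \<subseteq> Q" and Q: "compact Q" "Q \<subseteq> uhp"
  shows "emeasure lborel (moeb A ` E) = (\<integral>\<^sup>+z. ennreal (moeb_dens A z) * indicator E z \<partial>lborel)"
proof -
  define S where "S = v2c -` E"
  define k where "k x = indicator S x * moeb_dens A (v2c x)" for x
  have Eu: "E \<subseteq> uhp" using E Q by blast
  have S: "S \<in> sets borel" using measurable_sets[OF measurable_v2c E(1)] by (simp add: S_def)
  have [measurable]: "k \<in> borel_measurable borel" unfolding k_def using S by measurable
  have k0: "k x \<ge> 0" for x by (simp add: k_def moeb_dens_nonneg)
  have nn: "(\<integral>\<^sup>+z. ennreal (moeb_dens A z) * indicator E z \<partial>lborel) = (\<integral>\<^sup>+x. ennreal (k x) \<partial>lborel)"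
    by (subst lborel_complex_distr, subst nn_integral_distr)
      (use E in \<open>auto intro!: nn_integral_cong simp: k_def S_def indicator_def\<close>)
  have "continuous_on Q (moeb_dens A)"
    unfolding moeb_dens_def using Q jfac_nonzero[OF A]
    by (intro continuous_intros holomorphic_on_imp_continuous_on[OF holomorphic_jfac]) auto
  then have "bounded (moeb_dens A ` Q)" using Q by (intro compact_imp_bounded compact_continuous_image)
  then obtain B where B: "\<And>z. z \<in> Q \<Longrightarrow> moeb_dens A z \<le> B" "B > 0"
    unfolding bounded_pos by (auto simp: moeb_dens_nonneg)
  have "(\<integral>\<^sup>+z. ennreal (moeb_dens A z) * indicator E z \<partial>lborel) \<le> (\<integral>\<^sup>+z. ennreal B * indicator Q z \<partial>lborel)"
    using B E by (intro nn_integral_mono) (auto simp: indicator_def intro!: ennreal_leI)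
  also have "\<dots> = ennreal B * emeasure lborel Q"
    using Q by (simp add: nn_integral_cmult_indicator compact_imp_closed)
  also have "\<dots> < \<infinity>" using emeasure_bounded_finite[OF compact_imp_bounded[OF Q(1)]] by (simp add: ennreal_mult_less_top)
  finally have fin: "(\<integral>\<^sup>+x. ennreal (k x) \<partial>lborel) < \<infinity>" using nn by simp
  have ik: "integrable lborel k"
    by (rule integrableI_nonneg) (use fin k0 in auto)
  have "(k has_integral integral\<^sup>L lborel k) UNIV" by (rule has_integral_integral_lborel[OF ik])
  moreover have "k = (\<lambda>x. if x \<in> S then moeb_dens A (v2c x) else 0)" by (auto simp: k_def)
  ultimately have hi: "((\<lambda>x. moeb_dens A (v2c x)) has_integral integral\<^sup>L lborel k) S"
    by (simp add: has_integral_restrict_UNIV)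
  define g where "g x = c2v (moeb A (v2c x))" for x
  define g' where "g' x = (\<lambda>h. c2v (1 / (jfac A (v2c x))\<^sup>2 * v2c h))" for x
  have der: "(g has_derivative g' x) (at x within S)" if "x \<in> S" for x
  proof -
    have z: "v2c x \<in> uhp" using that Eu by (auto simp: S_def)
    have "(moeb A has_derivative (\<lambda>v. 1 / (jfac A (v2c x))\<^sup>2 * v)) (at (v2c x))"
      using moeb_has_derivative[OF A jfac_nonzero[OF A z]] unfolding has_field_derivative_def .
    from has_derivative_compose[OF bounded_linear.has_derivative[OF bounded_linear_v2c has_derivative_ident] this]
    have "((\<lambda>x. moeb A (v2c x)) has_derivative (\<lambda>h. 1 / (jfac A (v2c x))\<^sup>2 * v2c h)) (at x within S)" .
    from bounded_linear.has_derivative[OF bounded_linear_c2v this] show ?thesis unfolding g_def g'_def .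
  qed
  have inj: "inj_on g S"
  proof (rule inj_onI)
    fix x y assume x: "x \<in> S" "y \<in> S" "g x = g y"
    then have "moeb A (v2c x) = moeb A (v2c y)" unfolding g_def by (metis v2c_c2v)
    moreover have "v2c x \<in> uhp" "v2c y \<in> uhp" using x Eu by (auto simp: S_def)
    ultimately have "v2c x = v2c y" using moeb_inv_cancel(1)[OF A] by metis
    then show "x = y" by (metis c2v_v2c)
  qed
  have dt: "\<bar>det (matrix (g' x))\<bar> = moeb_dens A (v2c x)" for x
    unfolding g'_def det_complex_mult moeb_dens_def
    by (simp add: norm_divide norm_power power_divide flip: power_mult)
  have "S \<in> sets lebesgue" using S by simp
  from has_measure_differentiable_image[OF this der inj, of "integral\<^sup>L lborel k"] hi
  have m: "g ` S \<in> lmeasurable" "measure lebesgue (g ` S) = integral\<^sup>L lborel k" by (simp_all add: dt)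
  have gS: "v2c -` (moeb A ` E) = g ` S"
  proof (intro equalityI subsetI)
    fix x assume "x \<in> v2c -` (moeb A ` E)"
    then obtain z where z: "z \<in> E" "v2c x = moeb A z" by auto
    then have "x = g (c2v z)" by (metis c2v_v2c g_def v2c_c2v)
    moreover have "c2v z \<in> S" using z by (simp add: S_def)
    ultimately show "x \<in> g ` S" by blast
  qed (auto simp: g_def S_def)
  have ms: "moeb A ` E \<in> sets borel" by (rule sets_moeb_image[OF A Eu E(1)])
  then have gb: "g ` S \<in> sets borel" using measurable_sets[OF measurable_v2c ms] gS by simp
  have "emeasure lborel (moeb A ` E) = emeasure lborel (g ` S)"
    by (subst lborel_complex_distr, subst emeasure_distr) (use ms gS in auto)
  also have "\<dots> = emeasure lebesgue (g ` S)" using gb by simp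
  also have "\<dots> = ennreal (measure lebesgue (g ` S))" using m(1) by (simp add: emeasure_eq_measure2)
  also have "\<dots> = (\<integral>\<^sup>+x. ennreal (k x) \<partial>lborel)"
    unfolding m(2) using ik k0 by (intro nn_integral_eq_integral[symmetric]) auto
  finally show ?thesis using nn by simp
qed

text \<open>The half-plane is exhausted by the compact sets \<open>Q n\<close>, and both sides are
  continuous along increasing unions.\<close>

lemma emeasure_moeb:
  assumes A: "det A = 1" and E: "E \<in> sets borel" "E \<subseteq> uhp"
  shows "emeasure lborel (moeb A ` E) = (\<integral>\<^sup>+z. ennreal (moeb_dens A z) * indicator E z \<partial>lborel)"
proof -
  define Q where "Q n = cball 0 (real n) \<inter> {z. Im z \<ge> 1 / real (Suc n)}" for n
  have Qc: "compact (Q n)" for n unfolding Q_def by (intro compact_Int_closed compact_cball closed_halfspace_Im_ge)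
  have Qu: "Q n \<subseteq> uhp" for n
  proof
    fix z assume "z \<in> Q n"
    then have "1 / real (Suc n) \<le> Im z" by (simp add: Q_def)
    moreover have "0 < 1 / real (Suc n)" by simp
    ultimately have "0 < Im z" by linarith
    then show "z \<in> uhp" by (simp add: uhp_def)
  qed
  have Qm: "Q m \<subseteq> Q n" if "m \<le> n" for m n
  proof
    fix z assume z: "z \<in> Q m"
    have "1 / real (Suc n) \<le> 1 / real (Suc m)" using that by (intro divide_left_mono) auto
    then show "z \<in> Q n" using z that by (auto simp: Q_def)
  qed
  have QU: "\<exists>n. z \<in> Q n" if "z \<in> uhp" for z
  proof -
    have p: "Im z > 0" using that by (simp add: uhp_def)
    obtain n where n: "norm z < real n" using reals_Archimedean2 by blast
    obtain m where m: "1 / real (Suc m) < Im z" using p nat_approx_posE by blast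
    have "1 / real (Suc (max m n)) \<le> 1 / real (Suc m)" by (intro divide_left_mono) auto
    then have "z \<in> Q (max m n)" using n m by (auto simp: Q_def)
    then show ?thesis by blast
  qed
  define E' where "E' n = E \<inter> Q n" for n
  have E'b: "E' n \<in> sets borel" for n
    unfolding E'_def using E(1) borel_closed[OF compact_imp_closed[OF Qc]] by (intro sets.Int)
  have E'U: "(\<Union>n. E' n) = E" using QU E by (auto simp: E'_def)
  have inc: "incseq E'" using Qm by (auto simp: incseq_def E'_def)
  have "emeasure lborel (moeb A ` E) = emeasure lborel (\<Union>n. moeb A ` E' n)" by (simp add: image_UN[symmetric] E'U)
  also have "\<dots> = (SUP n. emeasure lborel (moeb A ` E' n))"
  proof (rule SUP_emeasure_incseq[symmetric])
    show "range (\<lambda>n. moeb A ` E' n) \<subseteq> sets lborel"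
    proof -
      have "E' n \<subseteq> uhp" for n using E by (auto simp: E'_def)
      then have "moeb A ` E' n \<in> sets borel" for n using sets_moeb_image[OF A _ E'b] by blast
      then show ?thesis by auto
    qed
    show "incseq (\<lambda>n. moeb A ` E' n)" using inc by (auto simp: incseq_def intro!: image_mono)
  qed
  also have "\<dots> = (SUP n. emeasure (density lborel (moeb_dens A)) (E' n))"
  proof -
    have "E' n \<subseteq> Q n" for n by (auto simp: E'_def)
    then have "emeasure lborel (moeb A ` E' n) = emeasure (density lborel (moeb_dens A)) (E' n)" for n
      using emeasure_moeb_compact[OF A E'b[of n] _ Qc[of n] Qu[of n]] E'b[of n] by (simp add: emeasure_density)
    then show ?thesis by simp
  qed
  also have "\<dots> = emeasure (density lborel (moeb_dens A)) (\<Union>n. E' n)"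
    by (rule SUP_emeasure_incseq) (use E'b inc in auto)
  also have "\<dots> = (\<integral>\<^sup>+z. ennreal (moeb_dens A z) * indicator E z \<partial>lborel)"
    unfolding E'U using E by (simp add: emeasure_density)
  finally show ?thesis .
qed

text \<open>The formula for sets as an identity of measures, from which the substitution rules for
  integrals follow.\<close>

lemma distr_moeb:
  assumes A: "det A = 1"
  shows "distr (density lborel (\<lambda>z. indicator uhp z * moeb_dens A z)) borel (moeb A) = density lborel (\<lambda>z. indicator uhp z :: real)"
    (is "?L = ?R")
proof (rule measure_eqI)
  show "sets ?L = sets ?R" by simp
  fix E assume "E \<in> sets ?L"
  then have E: "E \<in> sets borel" by simp
  define E' where "E' = {z \<in> uhp. moeb A z \<in> E}"
  have "E' = uhp \<inter> (moeb A -` E \<inter> space borel)" by (auto simp: E'_def)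
  then have E'b: "E' \<in> sets borel" using measurable_sets[OF measurable_moeb E] by auto
  have "moeb A -` E \<in> sets borel" using measurable_sets[OF measurable_moeb E] by simp
  then have "emeasure ?L E = (\<integral>\<^sup>+z. ennreal (moeb_dens A z) * indicator E' z \<partial>lborel)"
    using E by (subst emeasure_distr) (auto simp: emeasure_density E'_def indicator_def intro!: nn_integral_cong)
  also have "\<dots> = emeasure lborel (moeb A ` E')"
    by (rule emeasure_moeb[OF A E'b, symmetric]) (auto simp: E'_def)
  also have "moeb A ` E' = uhp \<inter> E"
    using A by (subst moeb_image_eq) (auto simp: E'_def moeb_uhp det_matrix_inv_sl2 moeb_inv_cancel)
  also have "emeasure lborel (uhp \<inter> E) = (\<integral>\<^sup>+z. indicator (uhp \<inter> E) z \<partial>lborel)"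
    using E by (intro nn_integral_indicator[symmetric]) auto
  also have "\<dots> = (\<integral>\<^sup>+z. ennreal (indicator uhp z) * indicator E z \<partial>lborel)"
    by (rule nn_integral_cong) (auto simp: indicator_def)
  also have "\<dots> = emeasure ?R E"
    using E by (intro emeasure_density[symmetric]) auto
  finally show "emeasure ?L E = emeasure ?R E" .
qed

lemma nn_integral_moeb:
  assumes A: "det A = 1" and [measurable]: "h \<in> borel_measurable borel"
  shows "(\<integral>\<^sup>+z. h z * indicator uhp z \<partial>lborel) = (\<integral>\<^sup>+z. h (moeb A z) * ennreal (moeb_dens A z) * indicator uhp z \<partial>lborel)"
proof -
  have "(\<integral>\<^sup>+z. h z * indicator uhp z \<partial>lborel) = (\<integral>\<^sup>+z. h z \<partial>density lborel (\<lambda>z. indicator uhp z :: real))"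
    by (subst nn_integral_density) (auto intro!: nn_integral_cong simp: indicator_def)
  also have "\<dots> = (\<integral>\<^sup>+z. h (moeb A z) \<partial>density lborel (\<lambda>z. indicator uhp z * moeb_dens A z))"
    unfolding distr_moeb[OF A, symmetric] by (subst nn_integral_distr) auto
  also have "\<dots> = (\<integral>\<^sup>+z. h (moeb A z) * ennreal (moeb_dens A z) * indicator uhp z \<partial>lborel)"
    by (subst nn_integral_density) (auto intro!: nn_integral_cong simp: indicator_def mult.commute)
  finally show ?thesis .
qed

lemma integral_moeb:
  fixes k :: "complex \<Rightarrow> complex"
  assumes A: "det A = 1" and [measurable]: "k \<in> borel_measurable borel"
  shows "(LINT z|lborel. indicator uhp z *\<^sub>R k z) = (LINT z|lborel. (indicator uhp z * moeb_dens A z) *\<^sub>R k (moeb A z))"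
    "integrable lborel (\<lambda>z. indicator uhp z *\<^sub>R k z) \<longleftrightarrow> integrable lborel (\<lambda>z. (indicator uhp z * moeb_dens A z) *\<^sub>R k (moeb A z))"
proof -
  have nn: "AE x in lborel. 0 \<le> indicator uhp x * moeb_dens A x" "AE x in lborel. 0 \<le> (indicator uhp x :: real)"
    by (auto simp: moeb_dens_nonneg)
  have "(LINT z|lborel. indicator uhp z *\<^sub>R k z) = integral\<^sup>L (density lborel (\<lambda>z. indicator uhp z :: real)) k"
    by (subst integral_density) auto
  also have "\<dots> = (LINT z|density lborel (\<lambda>z. indicator uhp z * moeb_dens A z). k (moeb A z))"
    unfolding distr_moeb[OF A, symmetric] by (subst integral_distr) auto
  also have "\<dots> = (LINT z|lborel. (indicator uhp z * moeb_dens A z) *\<^sub>R k (moeb A z))"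
    using nn by (subst integral_density) auto
  finally show "(LINT z|lborel. indicator uhp z *\<^sub>R k z) = (LINT z|lborel. (indicator uhp z * moeb_dens A z) *\<^sub>R k (moeb A z))" .
  have "integrable lborel (\<lambda>z. indicator uhp z *\<^sub>R k z) \<longleftrightarrow> integrable (density lborel (\<lambda>z. indicator uhp z :: real)) k"
    by (subst integrable_density) auto
  also have "\<dots> \<longleftrightarrow> integrable (density lborel (\<lambda>z. indicator uhp z * moeb_dens A z)) (\<lambda>z. k (moeb A z))"
    unfolding distr_moeb[OF A, symmetric] by (subst integrable_distr_eq) auto
  also have "\<dots> \<longleftrightarrow> integrable lborel (\<lambda>z. (indicator uhp z * moeb_dens A z) *\<^sub>R k (moeb A z))"
    using nn by (subst integrable_density) auto
  finally show "integrable lborel (\<lambda>z. indicator uhp z *\<^sub>R k z) \<longleftrightarrow> integrable lborel (\<lambda>z. (indicator uhp z * moeb_dens A z) *\<^sub>R k (moeb A z))" .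
qed

lemma moeb_fix_open:
  assumes D: "det D = 1" and x: "x \<in> uhp" and e: "e > 0" and f: "\<And>y. y \<in> ball x e \<Longrightarrow> y \<in> uhp \<and> moeb D y = y"
  shows "D = mat 1 \<or> D = - mat 1"
proof -
  define a b c d where "a = D$1$1" and "b = D$1$2" and "c = D$2$1" and "d = D$2$2"
  have eq: "of_real a * y + of_real b = y * (of_real c * y + of_real d)" if "y \<in> ball x e" for y
  proof -
    have "jfac D y \<noteq> 0" "moeb D y = y" using f[OF that] jfac_nonzero[OF D] by auto
    then show ?thesis by (simp add: moeb_def jfac_def field_simps a_def b_def c_def d_def)
  qed
  define t where "t = e / 2"
  have t: "t > 0" "x + of_real t \<in> ball x e" using e by (auto simp: t_def dist_norm)
  have xb: "x \<in> ball x e" using e by simp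
  \<comment> \<open>Obtained by subtracting the fixed point equations at \<open>x\<close> and at
    \<open>x + t\<close>. The second factor must vanish, and its imaginary part is
    \<open>c * (2 * Im x)\<close>, which forces \<open>c = 0\<close>.\<close>
  have "of_real t * (of_real c * (2 * x + of_real t) + of_real d - of_real a) = (0::complex)"
  proof -
    define y where "y = x + of_real t"
    have "of_real t * (of_real c * (2 * x + of_real t) + of_real d - of_real a) =
        (y * (of_real c * y + of_real d) - (of_real a * y + of_real b)) -
        (x * (of_real c * x + of_real d) - (of_real a * x + of_real b))"
      by (simp add: y_def algebra_simps)
    then show ?thesis using eq[OF t(2)] eq[OF xb] by (simp add: y_def)
  qed
  then have z: "of_real c * (2 * x + of_real t) + of_real d - of_real a = 0" using t by simp
  have "c * (2 * Im x) = 0" using arg_cong[OF z, of Im] by simp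
  then have c0: "c = 0" using x by (simp add: uhp_def)
  then have da: "d = a" using z by simp
  then have b0: "b = 0" using eq[OF xb] c0 by simp
  have "a * a = 1" using D c0 da by (simp add: sl2_det a_def b_def c_def d_def)
  then have "a = 1 \<or> a = - 1" by (metis square_eq_1_iff)
  then show ?thesis
  proof
    assume "a = 1"
    then have "D = mat 1" using c0 b0 da by (intro mat2_eqI) (simp_all add: a_def b_def c_def d_def)
    then show ?thesis ..
  next
    assume "a = - 1"
    then have "D = - mat 1" using c0 b0 da by (intro mat2_eqI) (simp_all add: a_def b_def c_def d_def)
    then show ?thesis ..
  qed
qed

section \<open>Unfolding over the fundamental domain\<close>

context cusped_domain
begin

text \<open>The closure of \<open>F\<close> may reach the cusps, but a point of it that is
  equivalent to a point of \<open>Q\<close> has bounded height above each cusp. With the horoballs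
  of the cover placed above these bounds, the point lies in the compact part \<open>M\<close>, and
  proper discontinuity applies.\<close>

lemma finite_meeting:
  assumes Q: "compact Q" "Q \<subseteq> uhp"
  shows "finite {A \<in> \<Gamma>. \<exists>z. z \<in> closure F \<and> z \<in> uhp \<and> moeb A z \<in> Q}"
proof -
  define h where "h \<bb> B \<longleftrightarrow> (\<forall>A\<in>\<Gamma>. \<forall>z\<in>Q. Im (moeb (matrix_inv (cscal \<bb>)) (moeb A z)) \<le> B)" for \<bb> B
  define B where "B \<bb> = (SOME B. h \<bb> B)" for \<bb>
  have hB: "h \<bb> (B \<bb>)" if "cusp \<Gamma> \<bb>" for \<bb>
    unfolding B_def using compact_height_bound[OF scaling_cscal[OF that] Q] by (intro someI_ex[of "h \<bb>"]) (simp add: h_def)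
  obtain M Bs where M: "compact M" "M \<subseteq> uhp" "finite Bs" "\<And>\<bb>. \<bb> \<in> Bs \<Longrightarrow> cusp \<Gamma> \<bb>"
    "\<And>z. z \<in> closure F \<Longrightarrow> z \<in> uhp \<Longrightarrow> z \<in> M \<or> (\<exists>\<bb>\<in>Bs. Im (moeb (matrix_inv (cscal \<bb>)) z) > \<bar>B \<bb>\<bar> + 1)"
    by (rule closure_F_cover[of "\<lambda>\<bb>. \<bar>B \<bb>\<bar> + 1"]) auto
  have "z \<in> M" if A: "A \<in> \<Gamma>" and z: "z \<in> closure F" "z \<in> uhp" "moeb A z \<in> Q" for A z
  proof (rule ccontr)
    assume "z \<notin> M"
    then obtain \<bb> where b: "\<bb> \<in> Bs" "Im (moeb (matrix_inv (cscal \<bb>)) z) > \<bar>B \<bb>\<bar> + 1" using M(5) z by blast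
    have "Im (moeb (matrix_inv (cscal \<bb>)) (moeb (matrix_inv A) (moeb A z))) \<le> B \<bb>"
      using hB[OF M(4)[OF b(1)]] inv_Gamma[OF A] z(3) unfolding h_def by blast
    then show False using b z A by (simp add: moeb_inv_cancel det_Gamma)
  qed
  then have "{A \<in> \<Gamma>. \<exists>z. z \<in> closure F \<and> z \<in> uhp \<and> moeb A z \<in> Q} \<subseteq> {A \<in> \<Gamma>. \<exists>z\<in>M. moeb A z \<in> Q}"
    by blast
  then show ?thesis using proper_discontinuity[OF M(1,2) Q] finite_subset by blast
qed

text \<open>The definition of a fundamental domain only says that a point of \<open>F\<close> moved
  into \<open>F\<close> is fixed. As \<open>F\<close> is open, \<open>D\<close> fixes a whole disc
  pointwise, so it is plus or minus the identity.\<close>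

lemma F_unique:
  assumes A: "A \<in> \<Gamma>" and B: "B \<in> \<Gamma>" and z: "z \<in> uhp"
    and FA: "moeb (matrix_inv A) z \<in> F" and FB: "moeb (matrix_inv B) z \<in> F"
  shows "B = A \<or> B = - A"
proof -
  define D where "D = matrix_inv B ** A"
  define x where "x = moeb (matrix_inv A) z"
  have d: "det A = 1" "det B = 1" "det D = 1" "D \<in> \<Gamma>"
    using A B by (auto simp: D_def det_Gamma mult_Gamma inv_Gamma)
  have xu: "x \<in> uhp" using FA F_uhp by (auto simp: x_def)
  have Dx: "moeb D x = moeb (matrix_inv B) z"
    using d z xu by (simp add: D_def moeb_mult x_def moeb_inv_cancel)
  have "continuous_on F (moeb D)" using continuous_on_subset[OF continuous_on_moeb[OF d(3)] F_uhp] .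
  then have "open (moeb D -` F \<inter> F)" using continuous_on_open_vimage[OF open_F] open_F by blast
  moreover have "x \<in> moeb D -` F \<inter> F" using FA FB Dx by (simp add: x_def)
  ultimately obtain e where e: "e > 0" "ball x e \<subseteq> moeb D -` F \<inter> F" using open_contains_ball by blast
  have "y \<in> uhp \<and> moeb D y = y" if "y \<in> ball x e" for y
  proof -
    have y: "y \<in> F" "moeb D y \<in> F" using e that by auto
    then show ?thesis using fundamental d(4) F_uhp unfolding fundamental_domain_def by blast
  qed
  then have "D = mat 1 \<or> D = - mat 1" using moeb_fix_open[OF d(3) xu e(1)] by blast
  moreover have "B ** D = A" using d by (simp add: D_def matrix_inv_cancel)
  ultimately show ?thesis by (auto simp: minus_matrix_mult)
qed

text \<open>An exceptional point has a translate on the frontier of \<open>F\<close>, and such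
  points form a countable union of null sets.\<close>

lemma AE_in_translate: "AE z in lborel. z \<in> uhp \<longrightarrow> (\<exists>A\<in>\<Gamma>. moeb A z \<in> F)"
proof -
  define N where "N = (\<Union>A\<in>\<Gamma>. moeb A ` (frontier F \<inter> uhp))"
  have "negligible (moeb A ` (frontier F \<inter> uhp))" if A: "A \<in> \<Gamma>" for A
  proof (rule negligible_differentiable_image_negligible)
    show "negligible (frontier F \<inter> uhp)" using fundamental by (simp add: fundamental_domain_def)
    show "moeb A differentiable_on frontier F \<inter> uhp"
      unfolding differentiable_on_def
    proof
      fix z assume "z \<in> frontier F \<inter> uhp"
      then have "(moeb A has_field_derivative 1 / (jfac A z)\<^sup>2) (at z)"
        using A by (intro moeb_has_derivative jfac_nonzero det_Gamma) auto
      then show "moeb A differentiable at z within frontier F \<inter> uhp"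
        unfolding has_field_derivative_def differentiable_def using has_derivative_at_withinI by blast
    qed
  qed simp
  then have "negligible N" unfolding N_def using countable_Gamma
    by (intro negligible_countable_Union) auto
  then have "N \<in> null_sets lebesgue" by (simp add: negligible_iff_null_sets)
  then have "AE z in lebesgue. z \<notin> N" by (rule AE_not_in)
  then have "AE z in lborel. z \<notin> N" by (simp add: AE_completion_iff)
  then show ?thesis
  proof (rule AE_mp, intro AE_I2 impI)
    fix z assume zN: "z \<notin> N" and z: "z \<in> uhp"
    obtain A where A: "A \<in> \<Gamma>" "moeb A z \<in> closure F" "moeb A z \<in> uhp" by (rule move_to_F[OF z])
    have "moeb A z \<notin> frontier F"
    proof
      assume "moeb A z \<in> frontier F"
      then have "moeb (matrix_inv A) (moeb A z) \<in> N" unfolding N_def using A inv_Gamma by blast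
      then show False using zN z A by (simp add: moeb_inv_cancel det_Gamma)
    qed
    then have "moeb A z \<in> F" using A open_F by (simp add: frontier_def interior_open)
    then show "\<exists>A\<in>\<Gamma>. moeb A z \<in> F" using A by blast
  qed
qed

lemma sets_F [measurable]: "F \<in> sets borel" using open_F by simp

lemma card_translates:
  assumes N: "N \<subseteq> \<Gamma>" and z: "z \<in> uhp"
  shows "finite {A \<in> N. moeb (matrix_inv A) z \<in> F} \<and> card {A \<in> N. moeb (matrix_inv A) z \<in> F} \<le> 2"
proof (cases "{A \<in> N. moeb (matrix_inv A) z \<in> F} = {}")
  case False
  then obtain A where A: "A \<in> N" "moeb (matrix_inv A) z \<in> F" by blast
  then have sub: "{A \<in> N. moeb (matrix_inv A) z \<in> F} \<subseteq> {A, - A}"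
    using F_unique[of A _ z] z N by blast
  then have "card {A \<in> N. moeb (matrix_inv A) z \<in> F} \<le> card {A, - A}" by (intro card_mono) auto
  also have "\<dots> \<le> 2" by (simp add: card_insert_if)
  finally show ?thesis using finite_subset[OF sub] by simp
next
  case True then show ?thesis unfolding True by simp
qed

text \<open>Almost every point of \<open>Q\<close> is reached from \<open>F\<close> by exactly two
  matrices, \<open>A\<close> and \<open>- A\<close>, since the group consists of matrices and
  contains the negatives; this is the factor 2. All matrices that bring a point of \<open>F\<close>
  into the support lie in the finite set \<open>N\<close>.\<close>

lemma unfolding_integral:
  fixes k :: "complex \<Rightarrow> complex"
  assumes k: "continuous_on UNIV k" and Q: "compact Q" "Q \<subseteq> uhp" and k0: "\<And>z. z \<notin> Q \<Longrightarrow> k z = 0"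
    and N: "finite N" "N \<subseteq> \<Gamma>" "\<And>A z. A \<in> \<Gamma> \<Longrightarrow> z \<in> F \<Longrightarrow> moeb A z \<in> Q \<Longrightarrow> A \<in> N"
  shows "integrable lborel (\<lambda>z. indicator F z *\<^sub>R (\<Sum>A\<in>N. moeb_dens A z *\<^sub>R k (moeb A z)))"
    "(LINT z|lborel. indicator F z *\<^sub>R (\<Sum>A\<in>N. moeb_dens A z *\<^sub>R k (moeb A z))) = 2 * (LINT z|lborel. k z)"
proof -
  have km [measurable]: "k \<in> borel_measurable borel" using k by (rule borel_measurable_continuous_onI)
  have ik: "integrable lborel k" by (rule continuous_compact_support_integrable[OF k Q(1) k0])
  \<comment> \<open>The part of \<open>k\<close> on the translate of \<open>F\<close> by
    \<open>A\<close>.\<close>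
  define kA where "kA A z = indicator F (moeb (matrix_inv A) z) *\<^sub>R k z" for A z
  have kAm [measurable]: "kA A \<in> borel_measurable borel" for A unfolding kA_def by measurable
  have ikA: "integrable lborel (\<lambda>z. indicator uhp z *\<^sub>R kA A z)" for A
    by (rule Bochner_Integration.integrable_bound[OF ik]) (auto simp: kA_def indicator_def)
  have eqA: "(indicator uhp z * moeb_dens A z) *\<^sub>R kA A (moeb A z) = indicator F z *\<^sub>R (moeb_dens A z *\<^sub>R k (moeb A z))"
    if "A \<in> \<Gamma>" for A z
    using that F_uhp by (cases "z \<in> uhp") (auto simp: kA_def moeb_inv_cancel det_Gamma indicator_def)
  have iA: "integrable lborel (\<lambda>z. indicator F z *\<^sub>R (moeb_dens A z *\<^sub>R k (moeb A z)))"
    "(LINT z|lborel. indicator uhp z *\<^sub>R kA A z) = (LINT z|lborel. indicator F z *\<^sub>R (moeb_dens A z *\<^sub>R k (moeb A z)))"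
    if A: "A \<in> \<Gamma>" for A
  proof -
    have e: "(\<lambda>z. (indicator uhp z * moeb_dens A z) *\<^sub>R kA A (moeb A z)) =
        (\<lambda>z. indicator F z *\<^sub>R (moeb_dens A z *\<^sub>R k (moeb A z)))"
      by (rule ext) (rule eqA[OF A])
    show "integrable lborel (\<lambda>z. indicator F z *\<^sub>R (moeb_dens A z *\<^sub>R k (moeb A z)))"
      using integral_moeb(2)[OF det_Gamma[OF A] kAm[of A]] ikA[of A] unfolding e by blast
    show "(LINT z|lborel. indicator uhp z *\<^sub>R kA A z) = (LINT z|lborel. indicator F z *\<^sub>R (moeb_dens A z *\<^sub>R k (moeb A z)))"
      using integral_moeb(1)[OF det_Gamma[OF A] kAm[of A]] unfolding e .
  qed
  have sum: "indicator F z *\<^sub>R (\<Sum>A\<in>N. moeb_dens A z *\<^sub>R k (moeb A z)) =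
      (\<Sum>A\<in>N. indicator F z *\<^sub>R (moeb_dens A z *\<^sub>R k (moeb A z)))" for z
    by (simp add: scaleR_sum_right)
  show "integrable lborel (\<lambda>z. indicator F z *\<^sub>R (\<Sum>A\<in>N. moeb_dens A z *\<^sub>R k (moeb A z)))"
    unfolding sum using iA N by (intro Bochner_Integration.integrable_sum) auto
  have "(LINT z|lborel. indicator F z *\<^sub>R (\<Sum>A\<in>N. moeb_dens A z *\<^sub>R k (moeb A z))) =
      (\<Sum>A\<in>N. (LINT z|lborel. indicator F z *\<^sub>R (moeb_dens A z *\<^sub>R k (moeb A z))))"
    unfolding sum using iA N by (intro Bochner_Integration.integral_sum) auto
  also have "\<dots> = (\<Sum>A\<in>N. (LINT z|lborel. indicator uhp z *\<^sub>R kA A z))"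
    using iA(2) N by (intro sum.cong) auto
  also have "\<dots> = (LINT z|lborel. (\<Sum>A\<in>N. indicator uhp z *\<^sub>R kA A z))"
    using ikA by (intro Bochner_Integration.integral_sum[symmetric]) auto
  also have "\<dots> = (LINT z|lborel. 2 * k z)"
  proof (rule integral_cong_AE)
    show "AE z in lborel. (\<Sum>A\<in>N. indicator uhp z *\<^sub>R kA A z) = 2 * k z"
    proof (rule AE_mp[OF AE_in_translate], intro AE_I2 impI)
      fix z assume z: "z \<in> uhp \<longrightarrow> (\<exists>A\<in>\<Gamma>. moeb A z \<in> F)"
      show "(\<Sum>A\<in>N. indicator uhp z *\<^sub>R kA A z) = 2 * k z"
      proof (cases "z \<in> Q")
        case False
        then show ?thesis using k0 by (simp add: kA_def)
      next
        case True
        then have zu: "z \<in> uhp" using Q by blast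
        then obtain A0 where A0: "A0 \<in> \<Gamma>" "moeb A0 z \<in> F" using z by blast
        define A where "A = matrix_inv A0"
        have A: "A \<in> \<Gamma>" "matrix_inv A = A0" "det A = 1"
          using A0 by (auto simp: A_def inv_Gamma matrix_inv_inv_sl2 det_Gamma det_matrix_inv_sl2)
        have mA: "matrix_inv (- A) = - A0" using A
          by (intro mat2_eqI) (simp_all add: matrix_inv_entry det_uminus_sl2 flip: A(2))
        have AN: "A \<in> N" "- A \<in> N"
          using N(3)[of A "moeb A0 z"] N(3)[of "- A" "moeb A0 z"] A A0 True minus_Gamma[OF A(1)] zu
          by (auto simp: A_def moeb_inv_cancel det_Gamma)
        have "A \<noteq> - A"
        proof
          assume "A = - A"
          then have "A $ i $ j = - (A $ i $ j)" for i j by (metis vector_uminus_component)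
          then have "A $ i $ j = 0" for i j by (metis equation_minus_iff neg_equal_zero)
          then show False using A(3) by (simp add: sl2_det)
        qed
        moreover have "{B \<in> N. moeb (matrix_inv B) z \<in> F} = {A, - A}"
          using F_unique[of A _ z] A A0 AN N(2) zu mA by auto
        ultimately have c: "card {B \<in> N. moeb (matrix_inv B) z \<in> F} = 2" by simp
        have "(\<Sum>B\<in>N. indicator uhp z *\<^sub>R kA B z) = (\<Sum>B\<in>N. if moeb (matrix_inv B) z \<in> F then k z else 0)"
          using zu by (intro sum.cong) (auto simp: kA_def)
        also have "\<dots> = (\<Sum>B\<in>{B \<in> N. moeb (matrix_inv B) z \<in> F}. k z)"
          using N(1) by (simp add: sum.If_cases Int_def)
        also have "\<dots> = 2 * k z" using c by simp
        finally show ?thesis .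
      qed
    qed
  qed measurable
  also have "\<dots> = 2 * (LINT z|lborel. k z)" by simp
  finally show "(LINT z|lborel. indicator F z *\<^sub>R (\<Sum>A\<in>N. moeb_dens A z *\<^sub>R k (moeb A z))) = 2 * (LINT z|lborel. k z)" .
qed

end

section \<open>Hyperbolic area\<close>

definition harea :: "complex measure" where
  "harea = density lborel (\<lambda>z. ennreal (1 / (Im z)\<^sup>2) * indicator uhp z)"

lemma sets_harea [simp, measurable_cong]: "sets harea = sets borel"
  by (simp add: harea_def)

lemma emeasure_harea:
  "E \<in> sets borel \<Longrightarrow> emeasure harea E = (\<integral>\<^sup>+z. ennreal (1 / (Im z)\<^sup>2) * indicator uhp z * indicator E z \<partial>lborel)"
  unfolding harea_def by (subst emeasure_density) auto

lemma harea_moeb: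
  assumes A: "det A = 1" and E: "E \<in> sets borel" "E \<subseteq> uhp"
  shows "emeasure harea (moeb A ` E) = emeasure harea E"
proof -
  have ms [measurable]: "moeb A ` E \<in> sets borel" by (rule sets_moeb_image[OF A E(2,1)])
  have "emeasure harea (moeb A ` E) = (\<integral>\<^sup>+z. (ennreal (1 / (Im z)\<^sup>2) * indicator (moeb A ` E) z) * indicator uhp z \<partial>lborel)"
    unfolding emeasure_harea[OF ms] by (intro nn_integral_cong) (simp add: mult_ac)
  also have "\<dots> = (\<integral>\<^sup>+z. (ennreal (1 / (Im (moeb A z))\<^sup>2) * indicator (moeb A ` E) (moeb A z)) * ennreal (moeb_dens A z) * indicator uhp z \<partial>lborel)"
    by (intro nn_integral_moeb[OF A]) measurable
  also have "\<dots> = (\<integral>\<^sup>+z. ennreal (1 / (Im z)\<^sup>2) * indicator uhp z * indicator E z \<partial>lborel)"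
  proof (intro nn_integral_cong)
    fix z
    show "(ennreal (1 / (Im (moeb A z))\<^sup>2) * indicator (moeb A ` E) (moeb A z)) * ennreal (moeb_dens A z) * indicator uhp z =
        ennreal (1 / (Im z)\<^sup>2) * indicator uhp z * indicator E z"
    proof (cases "z \<in> uhp")
      case True
      have "moeb A z \<in> moeb A ` E \<longleftrightarrow> z \<in> E"
        using True A E(2) by (auto simp: moeb_image_eq moeb_uhp moeb_inv_cancel)
      moreover have "ennreal (1 / (Im (moeb A z))\<^sup>2) * ennreal (moeb_dens A z) = ennreal (1 / (Im z)\<^sup>2)"
      proof -
        have j: "norm (jfac A z) \<noteq> 0" using jfac_nonzero[OF A True] by simp
        have "1 / (Im (moeb A z))\<^sup>2 * moeb_dens A z = 1 / (Im z)\<^sup>2"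
          unfolding Im_moeb[OF A] moeb_dens_def using j by (simp add: power_divide flip: power_mult)
        then show ?thesis by (simp add: moeb_dens_nonneg flip: ennreal_mult)
      qed
      ultimately show ?thesis using True by (simp add: indicator_def)
    qed simp
  qed
  also have "\<dots> = emeasure harea E" by (simp add: emeasure_harea[OF E(1)])
  finally show ?thesis .
qed

lemma harea_compact:
  assumes "compact Q" "Q \<subseteq> uhp" shows "emeasure harea Q < \<infinity>"
proof -
  have Qb: "Q \<in> sets borel" using borel_closed[OF compact_imp_closed[OF assms(1)]] .
  have "continuous_on Q (\<lambda>z. 1 / (Im z)\<^sup>2)" using assms by (intro continuous_intros) (auto simp: uhp_def)
  then have "bounded ((\<lambda>z. 1 / (Im z)\<^sup>2) ` Q)" using assms by (intro compact_imp_bounded compact_continuous_image)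
  then obtain B where B: "\<And>z. z \<in> Q \<Longrightarrow> 1 / (Im z)\<^sup>2 \<le> B" unfolding bounded_pos by auto
  have "emeasure harea Q \<le> (\<integral>\<^sup>+z. ennreal B * indicator Q z \<partial>lborel)"
    unfolding emeasure_harea[OF Qb] using B
    by (intro nn_integral_mono) (auto simp: indicator_def intro!: ennreal_leI)
  also have "\<dots> = ennreal B * emeasure lborel Q" using Qb by (simp add: nn_integral_cmult_indicator)
  also have "\<dots> < \<infinity>"
    using emeasure_bounded_finite[OF compact_imp_bounded[OF assms(1)]] by (simp add: ennreal_mult_less_top)
  finally show ?thesis .
qed

definition cusp_strip :: "complex set" where
  "cusp_strip = {w. 0 \<le> Re w \<and> Re w \<le> 1 \<and> 1 \<le> Im w}"

lemma closed_cusp_strip: "closed cusp_strip"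
  unfolding cusp_strip_def by (intro closed_Collect_conj closed_Collect_le continuous_intros)

lemma cusp_strip_uhp: "cusp_strip \<subseteq> uhp"
  by (auto simp: cusp_strip_def uhp_def)

text \<open>The box between heights \<open>2 ^ n\<close> and \<open>2 ^ Suc n\<close> has Euclidean
  area \<open>2 ^ n\<close> and density at most the inverse square of \<open>2 ^ n\<close>, so the
  hyperbolic areas are dominated by a geometric series.\<close>

lemma harea_cusp_strip: "emeasure harea cusp_strip < \<infinity>"
proof -
  define R where "R n = cbox (Complex 0 (2 ^ n)) (Complex 1 (2 ^ Suc n))" for n :: nat
  have Rb: "R n \<in> sets borel" for n by (simp add: R_def)
  have "cusp_strip \<subseteq> (\<Union>n. R n)"
  proof
    fix w assume w: "w \<in> cusp_strip"
    define y where "y = Im w"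
    have y: "y \<ge> 1" using w by (simp add: y_def cusp_strip_def)
    obtain m where m: "y < 2 ^ m" using real_arch_pow[of 2 y] by auto
    define n where "n = (LEAST n. y < 2 ^ Suc n)"
    have ex: "y < 2 ^ Suc m" using m by (simp add: less_le_trans)
    have n1: "y < 2 ^ Suc n" unfolding n_def by (rule LeastI[of _ m]) (rule ex)
    have n2: "2 ^ n \<le> y"
    proof (cases n)
      case 0 then show ?thesis using y by simp
    next
      case (Suc k)
      then have "\<not> y < 2 ^ Suc k" using not_less_Least[of k "\<lambda>n. y < 2 ^ Suc n"] by (simp add: n_def)
      then show ?thesis using Suc by simp
    qed
    have "w \<in> R n" using w n1 n2 by (auto simp: R_def in_cbox_complex_iff cusp_strip_def y_def)
    then show "w \<in> (\<Union>n. R n)" by blast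
  qed
  then have "emeasure harea cusp_strip \<le> emeasure harea (\<Union>n. R n)"
    using Rb by (intro emeasure_mono) auto
  also have "\<dots> \<le> suminf (\<lambda>n. emeasure harea (R n))"
    using Rb by (intro emeasure_subadditive_countably) auto
  also have "\<dots> \<le> suminf (\<lambda>n. ennreal ((1 / 2) ^ n))"
  proof (intro suminf_le)
    fix n
    have "emeasure harea (R n) \<le> (\<integral>\<^sup>+z. ennreal (1 / (2 ^ n)\<^sup>2) * indicator (R n) z \<partial>lborel)"
      unfolding emeasure_harea[OF Rb]
      by (intro nn_integral_mono)
        (auto simp: indicator_def R_def in_cbox_complex_iff uhp_def intro!: ennreal_leI divide_left_mono power_mono)
    also have "\<dots> = ennreal (1 / (2 ^ n)\<^sup>2) * emeasure lborel (R n)"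
      using Rb by (simp add: nn_integral_cmult_indicator)
    also have "emeasure lborel (R n) = ennreal (2 ^ n)"
      by (simp add: R_def emeasure_lborel_cbox_eq Basis_complex_def)
    also have "ennreal (1 / (2 ^ n)\<^sup>2) * ennreal (2 ^ n) = ennreal ((1 / 2) ^ n)"
      by (simp add: power2_eq_square power_one_over flip: ennreal_mult)
    finally show "emeasure harea (R n) \<le> ennreal ((1 / 2) ^ n)" .
  qed auto
  also have "\<dots> = ennreal (suminf (\<lambda>n. (1 / 2) ^ n))" by (intro suminf_ennreal2) (auto intro: summable_geometric)
  also have "\<dots> < \<infinity>" by simp
  finally show ?thesis .
qed

context cusped_domain
begin

text \<open>Every point of \<open>F\<close> is equivalent to a point of \<open>Q\<close>, a compact
  set together with finitely many images of the cusp strip. A point of \<open>Q\<close> is reached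
  from \<open>F\<close> by at most two elements, so invariance of the area bounds the area of
  \<open>F\<close> by twice that of \<open>Q\<close>.\<close>

lemma harea_F: "emeasure harea F < \<infinity>"
proof -
  obtain M Bs where M: "compact M" "M \<subseteq> uhp" "finite Bs" "\<And>\<bb>. \<bb> \<in> Bs \<Longrightarrow> cusp \<Gamma> \<bb>"
    "\<And>z. z \<in> closure F \<Longrightarrow> z \<in> uhp \<Longrightarrow> z \<in> M \<or> (\<exists>\<bb>\<in>Bs. Im (moeb (matrix_inv (cscal \<bb>)) z) > 1)"
    by (rule closure_F_cover[of "\<lambda>_. 1"]) auto
  have dS: "det (cscal \<bb>) = 1" if "\<bb> \<in> Bs" for \<bb>
    using scaling_cscal[OF M(4)[OF that]] by (simp add: scaling_matrix_def)
  define Q where "Q = M \<union> (\<Union>\<bb>\<in>Bs. moeb (cscal \<bb>) ` cusp_strip)"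
  have sb: "moeb (cscal \<bb>) ` cusp_strip \<in> sets borel" if "\<bb> \<in> Bs" for \<bb>
    using sets_moeb_image[OF dS[OF that] cusp_strip_uhp] closed_cusp_strip by simp
  have Mb: "M \<in> sets borel" using borel_closed[OF compact_imp_closed[OF M(1)]] .
  have Qb: "Q \<in> sets borel" unfolding Q_def using Mb sb M(3) by (intro sets.Un sets.finite_UN) auto
  have Qu: "Q \<subseteq> uhp" unfolding Q_def using M(2) dS cusp_strip_uhp by (auto simp: moeb_uhp subset_eq)
  have "emeasure harea Q \<le> emeasure harea M + emeasure harea (\<Union>\<bb>\<in>Bs. moeb (cscal \<bb>) ` cusp_strip)"
    unfolding Q_def using Mb sb M(3) by (intro emeasure_subadditive) auto
  also have "\<dots> \<le> emeasure harea M + (\<Sum>\<bb>\<in>Bs. emeasure harea (moeb (cscal \<bb>) ` cusp_strip))"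
    using sb M(3) by (intro add_left_mono emeasure_subadditive_finite) auto
  also have "\<dots> = emeasure harea M + (\<Sum>\<bb>\<in>Bs. emeasure harea cusp_strip)"
    using harea_moeb[OF dS _ cusp_strip_uhp] closed_cusp_strip by simp
  also have "\<dots> < \<infinity>" using harea_compact[OF M(1,2)] harea_cusp_strip by (simp add: ennreal_mult_less_top of_nat_less_top)
  finally have Qfin: "emeasure harea Q < \<infinity>" .
  have hit: "\<exists>A\<in>\<Gamma>. moeb A z \<in> Q" if z: "z \<in> F" for z
  proof -
    have zu: "z \<in> uhp" "z \<in> closure F" using z F_uhp closure_subset by auto
    then consider "z \<in> M" | \<bb> where "\<bb> \<in> Bs" "Im (moeb (matrix_inv (cscal \<bb>)) z) > 1" using M(5) by blast
    then show ?thesis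
    proof cases
      case 1 then show ?thesis using one_Gamma by (intro bexI[of _ "mat 1"]) (auto simp: Q_def)
    next
      case 2
      define S where "S = cscal \<bb>"
      define w where "w = moeb (matrix_inv S) z"
      define n where "n = - \<lfloor>Re w\<rfloor>"
      have S: "scaling_matrix \<Gamma> \<bb> S" "det S = 1" using scaling_cscal[OF M(4)[OF 2(1)]] dS[OF 2(1)] by (auto simp: S_def)
      have wu: "w \<in> uhp" using zu S by (simp add: w_def moeb_uhp det_matrix_inv_sl2)
      have "w + of_int n \<in> cusp_strip"
        using 2(2) by (auto simp: cusp_strip_def n_def S_def w_def) linarith+
      moreover have "moeb (S ** transl (of_int n) ** matrix_inv S) z = moeb S (w + of_int n)"
        using zu S wu by (simp add: moeb_mult det_mult_sl2 det_matrix_inv_sl2 w_def)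
      ultimately show ?thesis
        using scaling_transl_stab[OF S(1), of n] 2(1) unfolding stab_def Q_def S_def by blast
    qed
  qed
  define G where "G A = {z \<in> F. moeb A z \<in> Q}" for A
  have "G A = F \<inter> (moeb A -` Q \<inter> space borel)" for A by (auto simp: G_def)
  then have Gb: "G A \<in> sets borel" for A using measurable_sets[OF measurable_moeb Qb] sets_F by auto
  have bound: "(\<Sum>A\<in>N. emeasure harea (G A)) \<le> 2 * emeasure harea Q" if N: "finite N" "N \<subseteq> \<Gamma>" for N
  proof -
    have img: "moeb A ` G A \<in> sets borel" "emeasure harea (moeb A ` G A) = emeasure harea (G A)" if "A \<in> N" for A
    proof -
      have "G A \<subseteq> uhp" using F_uhp by (auto simp: G_def)
      moreover have "det A = 1" using that N det_Gamma by blast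
      ultimately show "moeb A ` G A \<in> sets borel" "emeasure harea (moeb A ` G A) = emeasure harea (G A)"
        using sets_moeb_image harea_moeb Gb by blast+
    qed
    have "(\<Sum>A\<in>N. emeasure harea (G A)) = (\<Sum>A\<in>N. \<integral>\<^sup>+z. indicator (moeb A ` G A) z \<partial>harea)"
      using img by (intro sum.cong) (auto simp: nn_integral_indicator)
    also have "\<dots> = (\<integral>\<^sup>+z. (\<Sum>A\<in>N. indicator (moeb A ` G A) z) \<partial>harea)"
      using img by (intro nn_integral_sum[symmetric]) auto
    also have "\<dots> \<le> (\<integral>\<^sup>+z. 2 * indicator Q z \<partial>harea)"
    proof (intro nn_integral_mono)
      fix z
      show "(\<Sum>A\<in>N. indicator (moeb A ` G A) z) \<le> (2 * indicator Q z :: ennreal)"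
      proof (cases "z \<in> Q")
        case False
        then have "z \<notin> moeb A ` G A" for A by (auto simp: G_def)
        then show ?thesis by simp
      next
        case True
        then have zu: "z \<in> uhp" using Qu by blast
        have sub: "moeb (matrix_inv A) z \<in> F" if "A \<in> N" "z \<in> moeb A ` G A" for A
          using that N F_uhp by (auto simp: G_def moeb_inv_cancel det_Gamma subset_eq)
        have "(\<Sum>A\<in>N. indicator (moeb A ` G A) z) = (\<Sum>A\<in>{A \<in> N. z \<in> moeb A ` G A}. (1::ennreal))"
          using N(1) by (intro sum.mono_neutral_cong_right) auto
        also have "\<dots> = of_nat (card {A \<in> N. z \<in> moeb A ` G A})" by simp
        also have "card {A \<in> N. z \<in> moeb A ` G A} \<le> card {A \<in> N. moeb (matrix_inv A) z \<in> F}"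
          using sub card_translates[OF N(2) zu] by (intro card_mono) auto
        then have "(of_nat (card {A \<in> N. z \<in> moeb A ` G A}) :: ennreal) \<le> of_nat 2"
          using card_translates[OF N(2) zu] by (intro of_nat_mono) linarith
        finally show ?thesis using True by simp
      qed
    qed
    also have "\<dots> = 2 * emeasure harea Q" using Qb by (simp add: nn_integral_cmult_indicator)
    finally show ?thesis .
  qed
  \<comment> \<open>The overlap estimate is for finite sets of elements; an increasing sequence of
    them exhausts the countable group.\<close>
  define \<Gamma>n where "\<Gamma>n m = from_nat_into \<Gamma> ` {..<m}" for m :: nat
  have ne: "\<Gamma> \<noteq> {}" using one_Gamma by blast
  have G1: "finite (\<Gamma>n m)" "\<Gamma>n m \<subseteq> \<Gamma>" for m unfolding \<Gamma>n_def using from_nat_into[OF ne] by auto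
  have "F = (\<Union>m. \<Union>A\<in>\<Gamma>n m. G A)"
  proof (intro equalityI subsetI)
    fix z assume z: "z \<in> F"
    obtain A where A: "A \<in> \<Gamma>" "moeb A z \<in> Q" using hit[OF z] by blast
    obtain n where "from_nat_into \<Gamma> n = A" using from_nat_into_surj[OF countable_Gamma A(1)] by blast
    then have "A \<in> \<Gamma>n (Suc n)" by (auto simp: \<Gamma>n_def)
    then show "z \<in> (\<Union>m. \<Union>A\<in>\<Gamma>n m. G A)" using z A by (auto simp: G_def)
  qed (auto simp: G_def)
  moreover have "emeasure harea (\<Union>m. \<Union>A\<in>\<Gamma>n m. G A) = (SUP m. emeasure harea (\<Union>A\<in>\<Gamma>n m. G A))"
  proof (rule SUP_emeasure_incseq[symmetric])
    show "range (\<lambda>m. \<Union>A\<in>\<Gamma>n m. G A) \<subseteq> sets harea" using Gb G1 by (auto intro!: sets.finite_UN)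
    have "\<Gamma>n m \<subseteq> \<Gamma>n n" if "m \<le> n" for m n using that by (auto simp: \<Gamma>n_def)
    then show "incseq (\<lambda>m. \<Union>A\<in>\<Gamma>n m. G A)" unfolding incseq_def by blast
  qed
  moreover have "emeasure harea (\<Union>A\<in>\<Gamma>n m. G A) \<le> 2 * emeasure harea Q" for m
    by (rule order_trans[OF emeasure_subadditive_finite bound[OF G1]]) (use Gb G1 in auto)
  ultimately have "emeasure harea F \<le> 2 * emeasure harea Q" by (metis SUP_least)
  also have "\<dots> < \<infinity>" using Qfin by (simp add: ennreal_mult_less_top)
  finally show ?thesis .
qed

lemma integrable_inverse_Im2: "integrable lborel (\<lambda>z. indicator F z * (1 / (Im z)\<^sup>2))"
proof (rule integrableI_nonneg)
  have "(\<integral>\<^sup>+z. ennreal (indicator F z * (1 / (Im z)\<^sup>2)) \<partial>lborel) = emeasure harea F"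
    unfolding emeasure_harea[OF sets_F] using F_uhp
    by (intro nn_integral_cong) (auto simp: indicator_def)
  then show "(\<integral>\<^sup>+z. ennreal (indicator F z * (1 / (Im z)\<^sup>2)) \<partial>lborel) < \<infinity>" using harea_F by simp
qed auto

end

section \<open>Stokes' theorem on the quotient\<close>

text \<open>The square of the positive part is continuously differentiable, which is the regularity
  that \<open>wirt\<close> asks of a cutoff.\<close>

definition msq :: "real \<Rightarrow> real" where "msq x = (max 0 x)\<^sup>2"

lemma msq_has_derivative: "(msq has_real_derivative 2 * max 0 x) (at x)"
proof -
  consider "x < 0" | "x > 0" | "x = 0" by linarith
  then show ?thesis
  proof cases
    case 1
    have "((\<lambda>_. 0) has_real_derivative 0) (at x)" by simp
    then have "(msq has_real_derivative 0) (at x)"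
      by (rule has_field_derivative_transform_within_open[of _ _ _ "{..<0}"]) (use 1 in \<open>auto simp: msq_def\<close>)
    then show ?thesis using 1 by simp
  next
    case 2
    have "((\<lambda>x. x\<^sup>2) has_real_derivative 2 * x) (at x)" by (auto intro!: derivative_eq_intros)
    then have "(msq has_real_derivative 2 * x) (at x)"
      by (rule has_field_derivative_transform_within_open[of _ _ _ "{0<..}"]) (use 2 in \<open>auto simp: msq_def\<close>)
    then show ?thesis using 2 by simp
  next
    case 3
    have "((\<lambda>h. (msq h - msq 0) / h) \<longlongrightarrow> 0) (at 0)"
    proof (rule Lim_null_comparison)
      show "eventually (\<lambda>h. norm ((msq h - msq 0) / h) \<le> \<bar>h\<bar>) (at 0)"
        by (rule always_eventually) (auto simp: msq_def max_def power2_eq_square abs_mult)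
      show "((\<lambda>h::real. \<bar>h\<bar>) \<longlongrightarrow> 0) (at 0)" by (intro tendsto_rabs_zero tendsto_ident_at)
    qed
    then show ?thesis using 3 by (simp add: has_field_derivative_iff)
  qed
qed

lemma msq_nonneg: "msq x \<ge> 0" and msq_eq_0_iff: "msq x = 0 \<longleftrightarrow> x \<le> 0" and msq_ge_1: "x \<ge> 1 \<Longrightarrow> msq x \<ge> 1"
  by (auto simp: msq_def max_def)

text \<open>Wirtinger derivatives are unique, so the local ones agree on overlaps.\<close>

lemma wirt_local:
  assumes "\<And>z. z \<in> U \<Longrightarrow> \<exists>V p q. open V \<and> z \<in> V \<and> V \<subseteq> U \<and> wirt f p q V"
  shows "\<exists>p q. wirt f p q U"
proof -
  obtain V p q where V: "\<And>z. z \<in> U \<Longrightarrow> open (V z)" "\<And>z. z \<in> U \<Longrightarrow> z \<in> V z" "\<And>z. z \<in> U \<Longrightarrow> V z \<subseteq> U"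
    "\<And>z. z \<in> U \<Longrightarrow> wirt f (p z) (q z) (V z)"
    using assms by metis
  define P where "P z = p z z" for z
  define R where "R z = q z z" for z
  have eq: "P w = p z w" "R w = q z w" if "z \<in> U" "w \<in> V z" for z w
  proof -
    have wU: "w \<in> U" using V that by blast
    have "(f has_derivative (\<lambda>v. p w w * v + q w w * cnj v)) (at w)" "(f has_derivative (\<lambda>v. p z w * v + q z w * cnj v)) (at w)"
      using V(4)[OF wU] V(4)[OF that(1)] V(2)[OF wU] that(2) by (auto simp: wirt_def)
    from wirt_unique[OF this] show "P w = p z w" "R w = q z w" by (auto simp: P_def R_def)
  qed
  have cont: "continuous_on U h" if h: "\<And>z w. z \<in> U \<Longrightarrow> w \<in> V z \<Longrightarrow> h w = g z w" "\<And>z. z \<in> U \<Longrightarrow> continuous_on (V z) (g z)"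
    for h :: "complex \<Rightarrow> complex" and g
  proof (rule continuous_at_imp_continuous_on, rule ballI)
    fix z assume z: "z \<in> U"
    have "continuous_on (V z) h" using h(2)[OF z] h(1)[OF z] by (simp cong: continuous_on_cong)
    then show "isCont h z" using V(1,2)[OF z] continuous_on_eq_continuous_at by blast
  qed
  have "(f has_derivative (\<lambda>v. P z * v + R z * cnj v)) (at z)" if "z \<in> U" for z
    using V(4)[OF that] V(2)[OF that] by (auto simp: wirt_def P_def R_def)
  moreover have "continuous_on U P" "continuous_on U R"
    using cont[of P p] cont[of R q] eq V(4) by (auto simp: wirt_def)
  ultimately show ?thesis unfolding wirt_def by blast
qed

lemma wirt_cong_dbar:
  assumes "wirt f p q U" "\<And>z. z \<in> U \<Longrightarrow> q' z = q z" shows "wirt f p q' U"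
proof -
  have "continuous_on U q' \<longleftrightarrow> continuous_on U q" by (rule continuous_on_cong[OF refl]) (rule assms(2))
  then show ?thesis using assms unfolding wirt_def by auto
qed

text \<open>\<open>U\<close> and the complement of \<open>Q\<close> form an open cover of the plane,
  and the extension by zero is differentiable on each of them.\<close>

lemma wirt_extend:
  assumes w: "wirt f p q U" and U: "open U" and Q: "compact Q" "Q \<subseteq> U" and 0: "\<And>z. z \<in> U \<Longrightarrow> z \<notin> Q \<Longrightarrow> f z = 0"
  obtains p' q' where "wirt (\<lambda>z. if z \<in> U then f z else 0) p' q' UNIV"
    "\<And>z. z \<notin> Q \<Longrightarrow> q' z = 0"
proof -
  let ?f = "\<lambda>z. if z \<in> U then f z else 0"
  have oQ: "open (- Q)" using Q by (simp add: compact_imp_closed open_Compl)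
  have fQ: "?f z = 0" if "z \<in> - Q" for z using that 0 by auto
  have 1: "wirt ?f p q U" by (rule wirt_cong_open[OF w U]) simp
  have 2: "wirt ?f (\<lambda>_. 0) (\<lambda>_. 0) (- Q)" by (rule wirt_cong_open[OF wirt_const[of 0] oQ]) (rule fQ)
  have "\<exists>p q. wirt ?f p q UNIV"
  proof (rule wirt_local)
    fix z :: complex
    show "\<exists>V p q. open V \<and> z \<in> V \<and> V \<subseteq> UNIV \<and> wirt ?f p q V"
    proof (cases "z \<in> U")
      case True then show ?thesis using 1 U by blast
    next
      case False
      then have "z \<in> - Q" using Q by blast
      then show ?thesis using 2 oQ by blast
    qed
  qed
  then obtain p' q' where w': "wirt ?f p' q' UNIV" by blast
  have "q' z = 0" if "z \<notin> Q" for z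
    using wirt_unique(2)[of ?f "p' z" "q' z" z 0 0] w' 2 that by (auto simp: wirt_def)
  then show ?thesis using that w' by blast
qed

section \<open>Invariant functions with compact support modulo the group\<close>

context cusped_domain
begin

lemma orbit_finite:
  assumes "compact Q" "Q \<subseteq> uhp" "z \<in> uhp" shows "finite {A \<in> \<Gamma>. moeb A z \<in> Q}"
  using proper_discontinuity[of "{z}" Q] assms by simp

text \<open>The index set of the sum depends on \<open>z\<close>. Near a given point it is replaced
  by the fixed finite set \<open>N\<close>, the additional terms being zero; uniqueness of the
  derivative then yields one formula on the whole half-plane.\<close>

lemma wirt_orbit_sum:
  assumes w: "wirt \<psi> p q UNIV" and Q: "compact Q" "Q \<subseteq> uhp" and 0: "\<And>z. z \<notin> Q \<Longrightarrow> \<psi> z = 0" "\<And>z. z \<notin> Q \<Longrightarrow> q z = 0"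
    and c: "\<And>A. A \<in> \<Gamma> \<Longrightarrow> c A holomorphic_on uhp"
  shows "\<exists>P. wirt (\<lambda>z. \<Sum>A\<in>{A \<in> \<Gamma>. moeb A z \<in> Q}. \<psi> (moeb A z) * c A z) P
    (\<lambda>z. \<Sum>A\<in>{A \<in> \<Gamma>. moeb A z \<in> Q}. q (moeb A z) / cnj ((jfac A z)\<^sup>2) * c A z) uhp"
proof -
  let ?f = "\<lambda>z. \<Sum>A\<in>{A \<in> \<Gamma>. moeb A z \<in> Q}. \<psi> (moeb A z) * c A z"
  let ?q = "\<lambda>z. \<Sum>A\<in>{A \<in> \<Gamma>. moeb A z \<in> Q}. q (moeb A z) / cnj ((jfac A z)\<^sup>2) * c A z"
  have loc: "\<exists>V P. open V \<and> z \<in> V \<and> V \<subseteq> uhp \<and> wirt ?f P ?q V" if z: "z \<in> uhp" for z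
  proof -
    obtain r where r: "r > 0" "cball z r \<subseteq> uhp" using open_uhp z open_contains_cball by blast
    define N where "N = {A \<in> \<Gamma>. \<exists>w\<in>cball z r. moeb A w \<in> Q}"
    have N: "finite N" "N \<subseteq> \<Gamma>" unfolding N_def using r Q proper_discontinuity by auto
    have V: "ball z r \<subseteq> uhp" using r(2) ball_subset_cball by blast
    have sum_eq: "(\<Sum>A\<in>{A \<in> \<Gamma>. moeb A w \<in> Q}. h A w) = (\<Sum>A\<in>N. h A w)"
      if "w \<in> ball z r" "\<And>A. moeb A w \<notin> Q \<Longrightarrow> h A w = 0" for w and h :: "real^2^2 \<Rightarrow> complex \<Rightarrow> complex"
    proof (rule sum.mono_neutral_left)
      show "{A \<in> \<Gamma>. moeb A w \<in> Q} \<subseteq> N" using that(1) by (auto simp: N_def intro!: bexI[of _ w])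
      show "\<forall>A\<in>N - {A \<in> \<Gamma>. moeb A w \<in> Q}. h A w = 0" using that(2) N(2) by blast
    qed (rule N)
    have "wirt (\<lambda>w. \<psi> (moeb A w) * c A w)
        (\<lambda>w. \<psi> (moeb A w) * deriv (c A) w + p (moeb A w) / (jfac A w)\<^sup>2 * c A w)
        (\<lambda>w. \<psi> (moeb A w) * 0 + q (moeb A w) / cnj ((jfac A w)\<^sup>2) * c A w) uhp" if A: "A \<in> N" for A
    proof -
      have AG: "A \<in> \<Gamma>" using A N by blast
      show ?thesis
        by (intro wirt_mult wirt_moeb[OF det_Gamma[OF AG]] wirt_holomorphic[OF c[OF AG] open_uhp] wirt_subset[OF w]) auto
    qed
    then have "wirt (\<lambda>w. \<Sum>A\<in>N. \<psi> (moeb A w) * c A w)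
        (\<lambda>w. \<Sum>A\<in>N. \<psi> (moeb A w) * deriv (c A) w + p (moeb A w) / (jfac A w)\<^sup>2 * c A w)
        (\<lambda>w. \<Sum>A\<in>N. \<psi> (moeb A w) * 0 + q (moeb A w) / cnj ((jfac A w)\<^sup>2) * c A w) uhp"
      by (intro wirt_sum N)
    from wirt_subset[OF this V]
    have W: "wirt (\<lambda>w. \<Sum>A\<in>N. \<psi> (moeb A w) * c A w)
        (\<lambda>w. \<Sum>A\<in>N. \<psi> (moeb A w) * deriv (c A) w + p (moeb A w) / (jfac A w)\<^sup>2 * c A w)
        (\<lambda>w. \<Sum>A\<in>N. q (moeb A w) / cnj ((jfac A w)\<^sup>2) * c A w) (ball z r)" by simp
    have f_eq: "?f w = (\<Sum>A\<in>N. \<psi> (moeb A w) * c A w)" if "w \<in> ball z r" for w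
      by (rule sum_eq[OF that, of "\<lambda>A w. \<psi> (moeb A w) * c A w"]) (simp add: 0)
    have q_eq: "?q w = (\<Sum>A\<in>N. q (moeb A w) / cnj ((jfac A w)\<^sup>2) * c A w)" if "w \<in> ball z r" for w
      by (rule sum_eq[OF that, of "\<lambda>A w. q (moeb A w) / cnj ((jfac A w)\<^sup>2) * c A w"]) (simp add: 0)
    from wirt_cong_open[OF W open_ball f_eq]
    have "wirt ?f (\<lambda>w. \<Sum>A\<in>N. \<psi> (moeb A w) * deriv (c A) w + p (moeb A w) / (jfac A w)\<^sup>2 * c A w)
        (\<lambda>w. \<Sum>A\<in>N. q (moeb A w) / cnj ((jfac A w)\<^sup>2) * c A w) (ball z r)" .
    then have "wirt ?f (\<lambda>w. \<Sum>A\<in>N. \<psi> (moeb A w) * deriv (c A) w + p (moeb A w) / (jfac A w)\<^sup>2 * c A w) ?q (ball z r)"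
      by (rule wirt_cong_dbar) (rule q_eq)
    then show ?thesis using V r(1) by (intro exI[of _ "ball z r"]) auto
  qed
  then have "\<exists>P R. wirt ?f P R uhp" by (intro wirt_local) blast
  then obtain P R where PR: "wirt ?f P R uhp" by blast
  have "R z = ?q z" if z: "z \<in> uhp" for z
  proof -
    obtain V P' where "z \<in> V" "wirt ?f P' ?q V" using loc[OF z] by blast
    then have "(?f has_derivative (\<lambda>v. P' z * v + ?q z * cnj v)) (at z)" by (simp add: wirt_def)
    moreover have "(?f has_derivative (\<lambda>v. P z * v + R z * cnj v)) (at z)" using PR z by (simp add: wirt_def)
    ultimately show ?thesis using wirt_unique(2) by blast
  qed
  then have "wirt ?f P ?q uhp" by (intro wirt_cong_dbar[OF PR]) simp
  then show ?thesis by blast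
qed

lemma bump_exists:
  assumes Q': "compact Q'" "Q' \<subseteq> uhp"
  obtains \<phi> :: "complex \<Rightarrow> real" and p q Q where "wirt (\<lambda>z. of_real (\<phi> z)) p q UNIV" "\<And>z. \<phi> z \<ge> 0"
    "\<And>z. z \<in> Q' \<Longrightarrow> \<phi> z \<ge> 1" "compact Q" "Q \<subseteq> uhp" "\<And>z. z \<notin> Q \<Longrightarrow> \<phi> z = 0" "\<And>z. z \<notin> Q \<Longrightarrow> q z = 0"
proof -
  obtain \<epsilon> R where eR: "\<epsilon> > 0" "R > 0" "\<And>z. z \<in> Q' \<Longrightarrow> Im z \<ge> \<epsilon> \<and> norm z \<le> R"
  proof (cases "Q' = {}")
    case True then show ?thesis using that[of 1 1] by simp
  next
    case False
    obtain z where z: "z \<in> Q'" "\<And>w. w \<in> Q' \<Longrightarrow> Im z \<le> Im w"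
    proof -
      have "continuous_on Q' Im" by (intro continuous_intros)
      then show ?thesis using continuous_attains_inf[OF Q'(1) False] that by blast
    qed
    obtain R where "R > 0" "\<forall>z\<in>Q'. norm z \<le> R"
      using compact_imp_bounded[OF Q'(1)] unfolding bounded_pos by blast
    then show ?thesis using that[of "Im z" R] z Q' by (auto simp: uhp_def)
  qed
  \<comment> \<open>Both arguments of \<open>msq\<close> are at least 1 on \<open>Q'\<close>, and
    one of them is nonpositive unless \<open>Im z > \<epsilon> / 2\<close> and
    \<open>|z|^2 < 2 R^2\<close>.\<close>
  define \<phi> where "\<phi> z = msq (2 * Im z / \<epsilon> - 1) * msq (2 - (norm z)\<^sup>2 / R\<^sup>2)" for z :: complex
  define Q where "Q = cball 0 (2 * R) \<inter> {z. Im z \<ge> \<epsilon> / 2}"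
  have Qc: "compact Q" unfolding Q_def by (intro compact_Int_closed compact_cball closed_halfspace_Im_ge)
  have Qu: "Q \<subseteq> uhp" using eR by (auto simp: Q_def uhp_def)
  have d1: "((\<lambda>y. msq (2 * y / \<epsilon> - 1)) has_real_derivative 2 * max 0 (2 * y / \<epsilon> - 1) * (2 / \<epsilon>)) (at y)" for y
    by (rule DERIV_chain2[OF msq_has_derivative]) (use eR in \<open>auto intro!: derivative_eq_intros\<close>)
  have w1: "wirt (\<lambda>z. of_real (msq (2 * Im z / \<epsilon> - 1))) (\<lambda>z. of_real ((\<lambda>y. 2 * max 0 (2 * y / \<epsilon> - 1) * (2 / \<epsilon>)) (Im z)) * (- \<i> / 2))
      (\<lambda>z. of_real ((\<lambda>y. 2 * max 0 (2 * y / \<epsilon> - 1) * (2 / \<epsilon>)) (Im z)) * (\<i> / 2)) UNIV"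
    by (rule wirt_real_compose[OF wirt_Im, where k = "\<lambda>y. msq (2 * y / \<epsilon> - 1)"
          and k' = "\<lambda>y. 2 * max 0 (2 * y / \<epsilon> - 1) * (2 / \<epsilon>)", OF d1])
      (use eR in \<open>auto intro!: continuous_intros\<close>)
  have d2: "((\<lambda>s. msq (2 - s / R\<^sup>2)) has_real_derivative 2 * max 0 (2 - s / R\<^sup>2) * (- 1 / R\<^sup>2)) (at s)" for s
  proof -
    have "((\<lambda>s. 2 - s / R\<^sup>2) has_real_derivative 0 - 1 / R\<^sup>2) (at s)"
      by (intro DERIV_diff DERIV_const DERIV_cdivide DERIV_ident)
    from DERIV_chain2[OF msq_has_derivative this] show ?thesis by simp
  qed
  have w2: "wirt (\<lambda>z. of_real (msq (2 - (norm z)\<^sup>2 / R\<^sup>2))) (\<lambda>z. of_real ((\<lambda>s. 2 * max 0 (2 - s / R\<^sup>2) * (- 1 / R\<^sup>2)) ((norm z)\<^sup>2)) * cnj z)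
      (\<lambda>z. of_real ((\<lambda>s. 2 * max 0 (2 - s / R\<^sup>2) * (- 1 / R\<^sup>2)) ((norm z)\<^sup>2)) * z) UNIV"
    by (rule wirt_real_compose[OF wirt_norm2, where k = "\<lambda>s. msq (2 - s / R\<^sup>2)"
          and k' = "\<lambda>s. 2 * max 0 (2 - s / R\<^sup>2) * (- 1 / R\<^sup>2)", OF d2])
      (use eR in \<open>auto intro!: continuous_intros\<close>)
  obtain p q where w: "wirt (\<lambda>z. of_real (\<phi> z)) p q UNIV"
    using wirt_mult[OF w1 w2] unfolding \<phi>_def of_real_mult by blast
  have \<phi>0: "\<phi> z = 0" if "z \<notin> Q" for z
  proof (cases "Im z \<ge> \<epsilon> / 2")
    case True
    then have "norm z > 2 * R" using that by (auto simp: Q_def)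
    then have "(2 * R)\<^sup>2 \<le> (norm z)\<^sup>2" using eR by (intro power_mono) auto
    moreover have "(2 * R)\<^sup>2 = 4 * R\<^sup>2" "0 < R\<^sup>2" using eR by (auto simp: power_mult_distrib)
    ultimately have "2 * R\<^sup>2 \<le> (norm z)\<^sup>2" by linarith
    then have "2 - (norm z)\<^sup>2 / R\<^sup>2 \<le> 0" using \<open>0 < R\<^sup>2\<close> by (simp add: pos_le_divide_eq)
    then show ?thesis by (simp add: \<phi>_def msq_eq_0_iff[THEN iffD2])
  next
    case False
    then have "2 * Im z / \<epsilon> - 1 \<le> 0" using eR by (simp add: field_simps)
    then show ?thesis by (simp add: \<phi>_def msq_eq_0_iff[THEN iffD2])
  qed
  have oQ: "open (- Q)" using Qc by (simp add: compact_imp_closed open_Compl)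
  have "wirt (\<lambda>z. of_real (\<phi> z)) (\<lambda>_. 0) (\<lambda>_. 0) (- Q)"
    by (rule wirt_cong_open[OF wirt_const[of 0] oQ]) (simp add: \<phi>0)
  then have q0: "q z = 0" if "z \<notin> Q" for z
    using wirt_unique(2)[of "\<lambda>z. of_real (\<phi> z)" "p z" "q z" z 0 0] w that by (auto simp: wirt_def)
  have \<phi>1: "\<phi> z \<ge> 1" if z: "z \<in> Q'" for z
  proof -
    have "2 * Im z / \<epsilon> - 1 \<ge> 1" using eR(3)[OF z] eR(1) by (simp add: field_simps)
    moreover have "(norm z)\<^sup>2 \<le> R\<^sup>2" using eR(3)[OF z] by (intro power_mono) auto
    then have "2 - (norm z)\<^sup>2 / R\<^sup>2 \<ge> 1" using eR by (simp add: field_simps)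
    ultimately have "1 * 1 \<le> \<phi> z" unfolding \<phi>_def by (intro mult_mono msq_ge_1) (auto simp: msq_nonneg)
    then show ?thesis by simp
  qed
  show ?thesis
    by (rule that[OF w _ \<phi>1 Qc Qu \<phi>0 q0]) (auto simp: \<phi>_def msq_nonneg)
qed

text \<open>It equals \<open>1 / t\<close> for \<open>t >= 1\<close> and is continuously
  differentiable down to \<open>t = 0\<close>; in this way an orbit sum of bumps can serve as a
  divisor even where it vanishes.\<close>

definition recip_cut :: "real \<Rightarrow> real" where "recip_cut t = 1 / (t + msq (1 - t))"

text \<open>A partition of unity makes \<open>W\<close> the sum of the weight 2 translates of the
  compactly supported \<open>\<psi>\<close>, which is \<open>\<phi> * W / \<Phi>\<close> where
  \<open>W\<close> does not vanish. Hence \<open>q\<close> is the sum of the translates of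
  \<open>\<psi>q\<close> weighted by the Jacobian. The integral over \<open>F\<close> unfolds to
  twice the integral of \<open>\<psi>q\<close> over the plane, which is 0 by
  \<open>integral_dbar_zero\<close>.\<close>

lemma stokes_compact_support:
  assumes W: "wirt W p q uhp" and inv: "\<And>A z. A \<in> \<Gamma> \<Longrightarrow> z \<in> uhp \<Longrightarrow> slash 2 W A z = W z"
    and Q': "compact Q'" "Q' \<subseteq> uhp" and supp: "\<And>z. z \<in> uhp \<Longrightarrow> W z \<noteq> 0 \<Longrightarrow> \<exists>A\<in>\<Gamma>. moeb A z \<in> Q'"
  shows "integrable lborel (\<lambda>z. indicator F z *\<^sub>R q z)" "(LINT z|lborel. indicator F z *\<^sub>R q z) = 0"
proof -
  obtain \<phi> :: "complex \<Rightarrow> real" and \<phi>p \<phi>q Q where \<phi>: "wirt (\<lambda>z. of_real (\<phi> z)) \<phi>p \<phi>q UNIV" "\<And>z. \<phi> z \<ge> 0"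
    "\<And>z. z \<in> Q' \<Longrightarrow> \<phi> z \<ge> 1" and Q: "compact Q" "Q \<subseteq> uhp" and \<phi>0: "\<And>z. z \<notin> Q \<Longrightarrow> \<phi> z = 0" "\<And>z. z \<notin> Q \<Longrightarrow> \<phi>q z = 0"
    by (rule bump_exists[OF Q']) blast
  define N where "N z = {A \<in> \<Gamma>. moeb A z \<in> Q}" for z
  have fN: "finite (N z)" if "z \<in> uhp" for z unfolding N_def by (rule orbit_finite[OF Q that])
  \<comment> \<open>Summing the bump over the orbit makes it invariant.\<close>
  define \<Phi> where "\<Phi> z = (\<Sum>A\<in>N z. \<phi> (moeb A z))" for z
  have \<Phi>nn: "\<Phi> z \<ge> 0" for z unfolding \<Phi>_def by (intro sum_nonneg \<phi>)
  obtain P1 R1 where w\<Phi>: "wirt (\<lambda>z. of_real (\<Phi> z)) P1 R1 uhp"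
    using wirt_orbit_sum[OF \<phi>(1) Q _ \<phi>0(2), of "\<lambda>_ _. 1"] \<phi>0(1) unfolding \<Phi>_def N_def by auto
  have \<Phi>inv: "\<Phi> (moeb B z) = \<Phi> z" if B: "B \<in> \<Gamma>" and z: "z \<in> uhp" for B z
  proof -
    have "bij_betw (\<lambda>A. A ** matrix_inv B) (N z) (N (moeb B z))"
    proof (rule bij_betwI[where g = "\<lambda>A. A ** B"])
      show "(\<lambda>A. A ** matrix_inv B) \<in> N z \<rightarrow> N (moeb B z)"
        using B z by (auto simp: N_def mult_Gamma inv_Gamma moeb_mult det_Gamma det_matrix_inv_sl2 moeb_uhp moeb_inv_cancel)
      show "(\<lambda>A. A ** B) \<in> N (moeb B z) \<rightarrow> N z"
        using B z by (auto simp: N_def mult_Gamma moeb_mult det_Gamma)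
    qed (use B in \<open>auto simp: matrix_inv_cancel det_Gamma\<close>)
    from sum.reindex_bij_betw[OF this, of "\<lambda>A. \<phi> (moeb A (moeb B z))"]
    have "\<Phi> (moeb B z) = (\<Sum>A\<in>N z. \<phi> (moeb (A ** matrix_inv B) (moeb B z)))" by (simp add: \<Phi>_def)
    also have "\<dots> = (\<Sum>A\<in>N z. \<phi> (moeb A z))"
      using B z by (intro sum.cong) (auto simp: moeb_mult det_Gamma det_matrix_inv_sl2 moeb_uhp moeb_inv_cancel)
    finally show ?thesis by (simp add: \<Phi>_def)
  qed
  have den: "t + msq (1 - t) > 0" if "t \<ge> 0" for t
    using that msq_nonneg[of "1 - t"] msq_ge_1[of "1 - t"] by (cases "t = 0") auto
  define rc' where "rc' t = - (1 - 2 * max 0 (1 - t)) / (t + msq (1 - t))\<^sup>2" for t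
  have drc: "(recip_cut has_real_derivative rc' t) (at t)" if "t \<ge> 0" for t
  proof -
    have "((\<lambda>t. msq (1 - t)) has_real_derivative 2 * max 0 (1 - t) * (- 1)) (at t)"
      by (rule DERIV_chain2[OF msq_has_derivative]) (auto intro!: derivative_eq_intros)
    then have d: "((\<lambda>t. t + msq (1 - t)) has_real_derivative 1 - 2 * max 0 (1 - t)) (at t)"
      by (auto intro!: derivative_eq_intros)
    have "((\<lambda>t. inverse (t + msq (1 - t))) has_real_derivative - (1 - 2 * max 0 (1 - t)) / (t + msq (1 - t))\<^sup>2) (at t)"
      using den[OF that] by (intro DERIV_cong[OF DERIV_inverse_fun[OF d]]) (simp_all add: power2_eq_square divide_inverse algebra_simps)
    then show ?thesis by (simp add: recip_cut_def[abs_def] rc'_def inverse_eq_divide)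
  qed
  have crc: "continuous_on {0..} rc'"
  proof -
    have "continuous_on {0..} (\<lambda>t. msq (1 - t))" unfolding msq_def by (intro continuous_intros)
    then show ?thesis unfolding rc'_def using den by (intro continuous_intros) (force simp: less_imp_neq)+
  qed
  obtain P2 R2 where w\<omega>: "wirt (\<lambda>z. of_real (recip_cut (\<Phi> z))) P2 R2 uhp"
    using wirt_real_compose[OF w\<Phi>, of recip_cut rc'] drc \<Phi>nn continuous_on_subset[OF crc, of "\<Phi> ` uhp"] by force
  define \<psi>0 where "\<psi>0 z = of_real (\<phi> z) * (of_real (recip_cut (\<Phi> z)) * W z)" for z
  obtain P3 R3 where w3: "wirt \<psi>0 P3 R3 uhp"
    using wirt_mult[OF wirt_subset[OF \<phi>(1)] wirt_mult[OF w\<omega> W]] unfolding \<psi>0_def by blast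
  define \<psi> where "\<psi> z = (if z \<in> uhp then \<psi>0 z else 0)" for z
  obtain \<psi>p \<psi>q where \<psi>: "wirt \<psi> \<psi>p \<psi>q UNIV" "\<And>z. z \<notin> Q \<Longrightarrow> \<psi>q z = 0"
    unfolding \<psi>_def by (rule wirt_extend[OF w3 open_uhp Q]) (auto simp: \<psi>0_def \<phi>0)
  have \<psi>Q: "\<psi> z = 0" if "z \<notin> Q" for z using that by (auto simp: \<psi>_def \<psi>0_def \<phi>0)
  have hj: "(\<lambda>z. 1 / (jfac A z)\<^sup>2) holomorphic_on uhp" if "A \<in> \<Gamma>" for A
    using that jfac_nonzero[OF det_Gamma] by (intro holomorphic_intros holomorphic_jfac) auto
  obtain P4 where w4: "wirt (\<lambda>z. \<Sum>A\<in>N z. \<psi> (moeb A z) * (1 / (jfac A z)\<^sup>2)) P4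
    (\<lambda>z. \<Sum>A\<in>N z. \<psi>q (moeb A z) / cnj ((jfac A z)\<^sup>2) * (1 / (jfac A z)\<^sup>2)) uhp"
    using wirt_orbit_sum[OF \<psi>(1) Q \<psi>Q \<psi>(2), of "\<lambda>A z. 1 / (jfac A z)\<^sup>2"] hj unfolding N_def by blast
  have WS: "W z = (\<Sum>A\<in>N z. \<psi> (moeb A z) * (1 / (jfac A z)\<^sup>2))" if z: "z \<in> uhp" for z
  proof -
    have "(\<Sum>A\<in>N z. \<psi> (moeb A z) * (1 / (jfac A z)\<^sup>2)) = (\<Sum>A\<in>N z. of_real (\<phi> (moeb A z)) * (of_real (recip_cut (\<Phi> z)) * W z))"
    proof (intro sum.cong refl)
      fix A assume "A \<in> N z"
      then have A: "A \<in> \<Gamma>" by (simp add: N_def)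
      have "W (moeb A z) / (jfac A z)\<^sup>2 = W z" using inv[OF A z] by (simp add: slash2)
      then show "\<psi> (moeb A z) * (1 / (jfac A z)\<^sup>2) = of_real (\<phi> (moeb A z)) * (of_real (recip_cut (\<Phi> z)) * W z)"
        using \<Phi>inv[OF A z] moeb_uhp[OF det_Gamma[OF A] z] by (simp add: \<psi>_def \<psi>0_def flip: \<open>W (moeb A z) / (jfac A z)\<^sup>2 = W z\<close>)
    qed
    also have "\<dots> = of_real (\<Phi> z * recip_cut (\<Phi> z)) * W z"
      by (simp add: \<Phi>_def sum_distrib_right mult.assoc)
    also have "\<dots> = W z"
    proof (cases "W z = 0")
      \<comment> \<open>Where \<open>W\<close> does not vanish, some translate of \<open>z\<close>
        lies in \<open>Q'\<close>; so \<open>\<Phi> z >= 1\<close>, and the cut reciprocal is the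
        true one.\<close>
      case False
      then obtain A where A: "A \<in> \<Gamma>" "moeb A z \<in> Q'" using supp[OF z] by blast
      have "\<phi> (moeb A z) \<ge> 1" using \<phi>(3) A by blast
      then have "A \<in> N z" using \<phi>0(1)[of "moeb A z"] A by (auto simp: N_def)
      then have "\<phi> (moeb A z) \<le> \<Phi> z" unfolding \<Phi>_def using fN[OF z] \<phi>(2) by (intro member_le_sum) auto
      then have g1: "\<Phi> z \<ge> 1" using \<open>\<phi> (moeb A z) \<ge> 1\<close> by simp
      then have "msq (1 - \<Phi> z) = 0" by (simp add: msq_eq_0_iff)
      then show ?thesis using g1 by (simp add: recip_cut_def)
    qed simp
    finally show ?thesis by simp
  qed
  have qS: "q z = (\<Sum>A\<in>N z. moeb_dens A z *\<^sub>R \<psi>q (moeb A z))" if z: "z \<in> uhp" for z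
  proof -
    have "wirt W P4 (\<lambda>z. \<Sum>A\<in>N z. \<psi>q (moeb A z) / cnj ((jfac A z)\<^sup>2) * (1 / (jfac A z)\<^sup>2)) uhp"
      by (rule wirt_cong_open[OF w4 open_uhp WS])
    then have "q z = (\<Sum>A\<in>N z. \<psi>q (moeb A z) / cnj ((jfac A z)\<^sup>2) * (1 / (jfac A z)\<^sup>2))"
      using W z unfolding wirt_def by (intro wirt_unique(2)[of W "p z" "q z" z "P4 z"]) auto
    also have "\<dots> = (\<Sum>A\<in>N z. moeb_dens A z *\<^sub>R \<psi>q (moeb A z))"
    proof (intro sum.cong refl)
      fix A
      \<comment> \<open>The weight and the conjugate factor from the chain rule together are the
        Jacobian of \<open>moeb A\<close>.\<close>
      have "cnj ((jfac A z)\<^sup>2) * (jfac A z)\<^sup>2 = of_real ((norm ((jfac A z)\<^sup>2))\<^sup>2)"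
        using complex_norm_square[of "(jfac A z)\<^sup>2"] by (simp only: mult.commute)
      also have "(norm ((jfac A z)\<^sup>2))\<^sup>2 = norm (jfac A z) ^ 4" by (simp add: norm_power flip: power_mult)
      finally have "cnj ((jfac A z)\<^sup>2) * (jfac A z)\<^sup>2 = of_real (norm (jfac A z) ^ 4)" .
      then show "\<psi>q (moeb A z) / cnj ((jfac A z)\<^sup>2) * (1 / (jfac A z)\<^sup>2) = moeb_dens A z *\<^sub>R \<psi>q (moeb A z)"
        by (simp add: moeb_dens_def scaleR_conv_of_real)
    qed
    finally show ?thesis .
  qed
  \<comment> \<open>By \<open>finite_meeting\<close> one finite set of matrices serves for all
    points of \<open>F\<close> at once.\<close>
  define NF where "NF = {A \<in> \<Gamma>. \<exists>z. z \<in> closure F \<and> z \<in> uhp \<and> moeb A z \<in> Q}"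
  have NF: "finite NF" "NF \<subseteq> \<Gamma>" "\<And>A z. A \<in> \<Gamma> \<Longrightarrow> z \<in> F \<Longrightarrow> moeb A z \<in> Q \<Longrightarrow> A \<in> NF"
    using finite_meeting[OF Q] F_uhp closure_subset unfolding NF_def by (simp, blast, blast)
  have eq: "indicator F z *\<^sub>R q z = indicator F z *\<^sub>R (\<Sum>A\<in>NF. moeb_dens A z *\<^sub>R \<psi>q (moeb A z))" for z
  proof (cases "z \<in> F")
    case True
    have "(\<Sum>A\<in>N z. moeb_dens A z *\<^sub>R \<psi>q (moeb A z)) = (\<Sum>A\<in>NF. moeb_dens A z *\<^sub>R \<psi>q (moeb A z))"
    proof (rule sum.mono_neutral_left[OF NF(1)])
      show "N z \<subseteq> NF" using NF(3)[OF _ True] by (auto simp: N_def)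
      show "\<forall>A\<in>NF - N z. moeb_dens A z *\<^sub>R \<psi>q (moeb A z) = 0" using NF(2) \<psi>(2) by (auto simp: N_def)
    qed
    then show ?thesis using qS[of z] True F_uhp by auto
  qed simp
  have cq: "continuous_on UNIV \<psi>q" using \<psi>(1) by (simp add: wirt_def)
  show "integrable lborel (\<lambda>z. indicator F z *\<^sub>R q z)"
    unfolding eq by (rule unfolding_integral(1)[OF cq Q \<psi>(2) NF])
  have "(LINT z|lborel. indicator F z *\<^sub>R q z) = 2 * (LINT z|lborel. \<psi>q z)"
    unfolding eq by (rule unfolding_integral(2)[OF cq Q \<psi>(2) NF])
  also have "(LINT z|lborel. \<psi>q z) = 0" by (rule integral_dbar_zero[OF \<psi>(1) Q(1) \<psi>Q])
  finally show "(LINT z|lborel. indicator F z *\<^sub>R q z) = 0" by simp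
qed

end

text \<open>\<open>n\<close> and \<open>m\<close> vanish on disjoint half-lines, so their sum is
  positive everywhere and the quotient is continuously differentiable.\<close>

lemma cutoff_exists:
  obtains e e' :: "real \<Rightarrow> real" and Ce where "\<And>t. (e has_real_derivative e' t) (at t)" "continuous_on UNIV e'"
    "\<And>t. 0 \<le> e t \<and> e t \<le> 1" "\<And>t. t \<le> 1 \<Longrightarrow> e t = 1" "\<And>t. t \<ge> 2 \<Longrightarrow> e t = 0"
    "\<And>t. t \<le> 1 \<or> t \<ge> 2 \<Longrightarrow> e' t = 0" "\<And>t. \<bar>e' t\<bar> \<le> Ce" "Ce \<ge> 0"
proof -
  define n m where "n t = msq (2 - t)" and "m t = msq (t - 1)" for t
  define n' m' where "n' t = 2 * max 0 (2 - t) * (- 1)" and "m' t = 2 * max 0 (t - 1) * 1" for t :: real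
  define e where "e t = n t / (n t + m t)" for t
  define e' where "e' t = (n' t * (n t + m t) - n t * (n' t + m' t)) / ((n t + m t) * (n t + m t))" for t
  have dn: "(n has_real_derivative n' t) (at t)" for t
    unfolding n_def n'_def by (rule DERIV_chain2[OF msq_has_derivative]) (auto intro!: derivative_eq_intros)
  have dm: "(m has_real_derivative m' t) (at t)" for t
    unfolding m_def m'_def by (rule DERIV_chain2[OF msq_has_derivative]) (auto intro!: derivative_eq_intros)
  have nn: "n t \<ge> 0" "m t \<ge> 0" for t by (auto simp: n_def m_def msq_nonneg)
  have pos: "n t + m t > 0" for t
  proof -
    have "n t \<noteq> 0 \<or> m t \<noteq> 0" using msq_eq_0_iff[of "2 - t"] msq_eq_0_iff[of "t - 1"] by (auto simp: n_def m_def)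
    then show ?thesis using nn[of t] by linarith
  qed
  have de: "(e has_real_derivative e' t) (at t)" for t
    unfolding e_def e'_def using pos[of t] by (intro DERIV_divide DERIV_add dn dm) auto
  have cn: "continuous_on UNIV n" "continuous_on UNIV m"
    using dn dm by (auto intro!: continuous_at_imp_continuous_on DERIV_isCont)
  have ce: "continuous_on UNIV e'"
    unfolding e'_def n'_def m'_def using pos by (intro continuous_intros cn) (metis less_irrefl mult_eq_0_iff)
  have lo: "m t = 0 \<and> m' t = 0" if "t \<le> 1" for t using that by (simp add: m_def m'_def msq_def)
  have hi: "n t = 0 \<and> n' t = 0" if "t \<ge> 2" for t using that by (simp add: n_def n'_def msq_def)
  have e'0: "e' t = 0" if "t \<le> 1 \<or> t \<ge> 2" for t
    using that lo[of t] hi[of t] by (auto simp: e'_def)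
  have "bounded (e' ` {1..2})"
    using continuous_on_subset[OF ce] by (intro compact_imp_bounded compact_continuous_image) auto
  then obtain Ce where Ce: "Ce > 0" "\<forall>t\<in>{1..2}. norm (e' t) \<le> Ce" unfolding bounded_pos by auto
  have "\<bar>e' t\<bar> \<le> Ce" for t using Ce e'0[of t] by (cases "t \<in> {1..2}") auto
  moreover have "0 \<le> e t \<and> e t \<le> 1" for t using nn[of t] pos[of t] by (simp add: e_def)
  moreover have "e t = 1" if "t \<le> 1" for t using lo[OF that] pos[of t] by (simp add: e_def)
  moreover have "e t = 0" if "t \<ge> 2" for t using hi[OF that] by (simp add: e_def)
  ultimately show ?thesis using that[of e e' Ce] de ce e'0 Ce(1) by auto
qed

text \<open>A comparison in the style of Harnack: on the disc of radius \<open>Im z0 / 4\<close> the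
  automorphy factor is at least 3/4, and the imaginary part at most 5/4, of the value at the centre;
  and \<open>(5/4) / (9/16) < 3\<close>. The constant does not depend on \<open>B\<close>.\<close>

lemma moeb_height_ratio:
  assumes B: "det B = 1" and z0: "z0 \<in> uhp" and z: "z \<in> uhp" "norm (z - z0) \<le> Im z0 / 4"
  shows "Im (moeb B z) \<le> 3 * Im (moeb B z0)"
proof -
  have y0: "Im z0 > 0" using z0 by (simp add: uhp_def)
  define j where "j = norm (jfac B z)"
  define j0 where "j0 = norm (jfac B z0)"
  have jp: "j > 0" "j0 > 0" using jfac_nonzero[OF B] z0 z by (auto simp: j_def j0_def)
  have "\<bar>B$2$1\<bar> * Im z0 = \<bar>Im (jfac B z0)\<bar>" using y0 by (simp add: jfac_def abs_mult)
  also have "\<dots> \<le> j0" unfolding j0_def by (rule abs_Im_le_cmod)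
  finally have c: "\<bar>B$2$1\<bar> * Im z0 \<le> j0" .
  have "jfac B z0 = jfac B z - of_real (B$2$1) * (z - z0)" by (simp add: jfac_def algebra_simps)
  then have "j0 \<le> j + \<bar>B$2$1\<bar> * norm (z - z0)"
    unfolding j_def j0_def using norm_triangle_ineq4[of "jfac B z" "of_real (B$2$1) * (z - z0)"] by (simp add: norm_mult)
  also have "\<bar>B$2$1\<bar> * norm (z - z0) \<le> \<bar>B$2$1\<bar> * (Im z0 / 4)" using z by (intro mult_left_mono) auto
  finally have jj: "3 / 4 * j0 \<le> j" using c by simp
  have "\<bar>Im (z - z0)\<bar> \<le> Im z0 / 4" using abs_Im_le_cmod[of "z - z0"] z by linarith
  then have yz: "Im z \<le> 5 / 4 * Im z0" using abs_ge_self[of "Im (z - z0)"] by simp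
  have "(3 / 4 * j0)\<^sup>2 \<le> j\<^sup>2" using jj jp by (intro power_mono) auto
  then have j2: "9 / 16 * j0\<^sup>2 \<le> j\<^sup>2" by (simp add: power_mult_distrib power2_eq_square)
  have j0p: "j0\<^sup>2 > 0" using jp by simp
  have "Im z / j\<^sup>2 \<le> (5 / 4 * Im z0) / (9 / 16 * j0\<^sup>2)"
    using yz j2 y0 j0p z by (intro frac_le) (auto simp: uhp_def)
  also have "\<dots> \<le> 3 * (Im z0 / j0\<^sup>2)" using y0 j0p by (simp add: field_simps)
  finally show ?thesis by (simp add: Im_moeb[OF B] j_def j0_def)
qed

section \<open>Cutoffs in the height above the cusps\<close>

context cusped_domain
begin

text \<open>\<open>Im (moeb B z)\<close> for \<open>B \<in> hmats\<close> are the heights of \<open>z\<close> above the cusps. All of them that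
  exceed \<open>Y0\<close> agree; \<open>Ht\<close> is the \<open>\<Gamma>\<close>-invariant function with this value, and constant elsewhere.
  It jumps where it equals \<open>Y0\<close>, so it is only used through cutoffs that are constant there.\<close>

definition hmats :: "(real^2^2) set" where
  "hmats = {B. \<exists>\<aa>\<in>C. \<exists>A\<in>\<Gamma>. B = matrix_inv (\<sigma> \<aa>) ** A}"

lemma hmats_det: "B \<in> hmats \<Longrightarrow> det B = 1"
  using scaling by (auto simp: hmats_def scaling_matrix_def det_mult_sl2 det_matrix_inv_sl2 det_Gamma)

lemma hmats_mult: "B \<in> hmats \<Longrightarrow> A \<in> \<Gamma> \<Longrightarrow> B ** A \<in> hmats"
  unfolding hmats_def using mult_Gamma by (force simp flip: matrix_mul_assoc)

text \<open>\<open>Y\<close> is at least 1 and exceeds all constants \<open>R\<close> from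
  \<open>scaling_pair_height\<close>. Two heights above \<open>Y\<close> can therefore only be
  related by an upper triangular matrix, and such a matrix preserves heights.\<close>

lemma height_threshold:
  "\<exists>Y\<ge>1. \<forall>B\<in>hmats. \<forall>B'\<in>hmats. \<forall>z\<in>uhp. Im (moeb B z) > Y \<longrightarrow> Im (moeb B' z) > Y \<longrightarrow> Im (moeb B' z) = Im (moeb B z)"
proof -
  define hb where "hb S T R \<longleftrightarrow> R > 0 \<and> (\<forall>A\<in>\<Gamma>. \<forall>w\<in>uhp. (matrix_inv T ** A ** S) $ 2 $ 1 \<noteq> 0 \<longrightarrow>
      Im (moeb (matrix_inv T ** A ** S) w) \<le> R / Im w)" for S T and R :: real
  define R where "R p = (SOME R. hb (\<sigma> (fst p)) (\<sigma> (snd p)) R)" for p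
  have hbR: "hb (\<sigma> \<aa>) (\<sigma> \<bb>) (R (\<aa>, \<bb>))" if "\<aa> \<in> C" "\<bb> \<in> C" for \<aa> \<bb>
  proof -
    have "\<exists>R. hb (\<sigma> \<aa>) (\<sigma> \<bb>) R"
      by (rule scaling_pair_height[OF scaling[OF that(1)] scaling[OF that(2)]]) (auto simp: hb_def)
    then show ?thesis unfolding R_def by (simp add: someI_ex)
  qed
  define Y where "Y = 1 + sum R (C \<times> C)"
  have Rp: "R p > 0" if "p \<in> C \<times> C" for p using hbR that by (cases p) (auto simp: hb_def)
  have RY: "R p < Y" if "p \<in> C \<times> C" for p
    using member_le_sum[OF that, of R] Rp finite_C by (force simp: Y_def less_imp_le)
  have Y1: "Y \<ge> 1" unfolding Y_def using Rp by (simp add: sum_nonneg less_imp_le)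
  have "Im (moeb B' z) = Im (moeb B z)"
    if B: "B \<in> hmats" and B': "B' \<in> hmats" and z: "z \<in> uhp" and h: "Im (moeb B z) > Y" "Im (moeb B' z) > Y" for B B' z
  proof -
    obtain \<aa> A where a: "\<aa> \<in> C" "A \<in> \<Gamma>" "B = matrix_inv (\<sigma> \<aa>) ** A" using B by (auto simp: hmats_def)
    obtain \<bb> A' where b: "\<bb> \<in> C" "A' \<in> \<Gamma>" "B' = matrix_inv (\<sigma> \<bb>) ** A'" using B' by (auto simp: hmats_def)
    have d: "det (\<sigma> \<aa>) = 1" "det (\<sigma> \<bb>) = 1" "det A = 1" "det A' = 1"
      using scaling a b by (auto simp: scaling_matrix_def det_Gamma)
    define w where "w = moeb B z"
    have wu: "w \<in> uhp" using hmats_det[OF B] z by (simp add: w_def moeb_uhp)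
    define X where "X = A' ** matrix_inv A"
    have X: "X \<in> \<Gamma>" using a b by (simp add: X_def mult_Gamma inv_Gamma)
    have "(matrix_inv (\<sigma> \<bb>) ** X ** \<sigma> \<aa>) ** B = B'"
      unfolding X_def a(3) b(3) using d by (simp add: matrix_inv_cancel matrix_mul_assoc)
    then have eq: "moeb (matrix_inv (\<sigma> \<bb>) ** X ** \<sigma> \<aa>) w = moeb B' z"
      using moeb_mult[OF hmats_det[OF B] z, of "matrix_inv (\<sigma> \<bb>) ** X ** \<sigma> \<aa>"] by (simp add: w_def)
    show ?thesis
    proof (cases "(matrix_inv (\<sigma> \<bb>) ** X ** \<sigma> \<aa>) $ 2 $ 1 = 0")
      case True
      then show ?thesis using scaling_pair_Im[OF scaling[OF a(1)] scaling[OF b(1)] X True, of w] eq by (simp add: w_def)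
    next
      case False
      have "Im (moeb B' z) \<le> R (\<aa>, \<bb>) / Im w"
        using hbR[OF a(1) b(1)] X wu False eq unfolding hb_def by metis
      also have "\<dots> \<le> 1" using RY[of "(\<aa>, \<bb>)"] a b h(1) Y1 by (simp add: w_def field_simps)
      finally show ?thesis using h Y1 by simp
    qed
  qed
  then show ?thesis using Y1 by blast
qed

definition Y0 :: real where
  "Y0 = (SOME Y. Y \<ge> 1 \<and> (\<forall>B\<in>hmats. \<forall>B'\<in>hmats. \<forall>z\<in>uhp. Im (moeb B z) > Y \<longrightarrow> Im (moeb B' z) > Y \<longrightarrow> Im (moeb B' z) = Im (moeb B z)))"

lemma Y0: "Y0 \<ge> 1" "B \<in> hmats \<Longrightarrow> B' \<in> hmats \<Longrightarrow> z \<in> uhp \<Longrightarrow> Im (moeb B z) > Y0 \<Longrightarrow> Im (moeb B' z) > Y0 \<Longrightarrow>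
    Im (moeb B' z) = Im (moeb B z)"
proof -
  have "Y0 \<ge> 1 \<and> (\<forall>B\<in>hmats. \<forall>B'\<in>hmats. \<forall>z\<in>uhp. Im (moeb B z) > Y0 \<longrightarrow> Im (moeb B' z) > Y0 \<longrightarrow> Im (moeb B' z) = Im (moeb B z))"
    unfolding Y0_def by (rule someI_ex) (use height_threshold in blast)
  then show "Y0 \<ge> 1" "B \<in> hmats \<Longrightarrow> B' \<in> hmats \<Longrightarrow> z \<in> uhp \<Longrightarrow> Im (moeb B z) > Y0 \<Longrightarrow> Im (moeb B' z) > Y0 \<Longrightarrow>
    Im (moeb B' z) = Im (moeb B z)" by blast+
qed

definition Ht :: "complex \<Rightarrow> real" where
  "Ht z = (if \<exists>B\<in>hmats. Im (moeb B z) > Y0 then Im (moeb (SOME B. B \<in> hmats \<and> Im (moeb B z) > Y0) z) else Y0)"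

lemma Ht_eq: assumes "B \<in> hmats" "z \<in> uhp" "Im (moeb B z) > Y0" shows "Ht z = Im (moeb B z)"
proof -
  define B' where "B' = (SOME B. B \<in> hmats \<and> Im (moeb B z) > Y0)"
  have "B' \<in> hmats \<and> Im (moeb B' z) > Y0" unfolding B'_def by (rule someI[of _ B]) (use assms in auto)
  then have "Im (moeb B' z) = Im (moeb B z)" using Y0(2)[OF assms(1) _ assms(2,3)] by blast
  then show ?thesis using assms by (auto simp: Ht_def B'_def)
qed

lemma Ht_low: "\<not> (\<exists>B\<in>hmats. Im (moeb B z) > Y0) \<Longrightarrow> Ht z = Y0"
  by (simp add: Ht_def)

lemma Ht_moeb: assumes A: "A \<in> \<Gamma>" and z: "z \<in> uhp" shows "Ht (moeb A z) = Ht z"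
proof (cases "\<exists>B\<in>hmats. Im (moeb B z) > Y0")
  case True
  then obtain B where B: "B \<in> hmats" "Im (moeb B z) > Y0" by blast
  have Az: "moeb A z \<in> uhp" using A z by (simp add: moeb_uhp det_Gamma)
  have eq: "moeb (B ** matrix_inv A) (moeb A z) = moeb B z"
    using A z Az by (simp add: moeb_mult det_Gamma det_matrix_inv_sl2 moeb_inv_cancel)
  have "Ht (moeb A z) = Im (moeb (B ** matrix_inv A) (moeb A z))"
    using hmats_mult[OF B(1) inv_Gamma[OF A]] Az eq B(2) by (intro Ht_eq) auto
  then show ?thesis using Ht_eq[OF B(1) z B(2)] eq by simp
next
  case False
  have "\<not> (\<exists>B\<in>hmats. Im (moeb B (moeb A z)) > Y0)"
  proof
    assume "\<exists>B\<in>hmats. Im (moeb B (moeb A z)) > Y0"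
    then obtain B where B: "B \<in> hmats" "Im (moeb B (moeb A z)) > Y0" by blast
    then have "B ** A \<in> hmats" "Im (moeb (B ** A) z) > Y0"
      using hmats_mult A z by (auto simp: moeb_mult det_Gamma)
    then show False using False by blast
  qed
  then show ?thesis using False by (simp add: Ht_low)
qed

text \<open>Where some height exceeds \<open>Y0\<close>, the function \<open>Ht\<close> is locally
  \<open>Im (moeb B z)\<close>. Elsewhere it may jump, but by \<open>moeb_height_ratio\<close> all
  heights nearby are at most \<open>3 * Y0 < T\<close>, where the cutoff is constantly 1.\<close>

lemma wirt_height_cutoff:
  assumes e: "\<And>t. (e has_real_derivative e' t) (at t)" "continuous_on UNIV e'" "\<And>t. t \<le> 1 \<Longrightarrow> e t = 1"
      "\<And>t. t \<le> 1 \<or> t \<ge> 2 \<Longrightarrow> e' t = 0" "\<And>t. \<bar>e' t\<bar> \<le> Ce"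
    and T: "T > 3 * Y0"
  obtains p q where "wirt (\<lambda>z. of_real (e (Ht z / T))) p q uhp" "\<And>z. z \<in> uhp \<Longrightarrow> Ht z < T \<Longrightarrow> q z = 0"
    "\<And>z. z \<in> uhp \<Longrightarrow> Ht z > 2 * T \<Longrightarrow> q z = 0"
    "\<And>z B. z \<in> uhp \<Longrightarrow> B \<in> hmats \<Longrightarrow> Im (moeb B z) > Y0 \<Longrightarrow> norm (q z) \<le> Ce / T / (norm (jfac B z))\<^sup>2"
proof -
  let ?f = "\<lambda>z. of_real (e (Ht z / T)) :: complex"
  have T0: "T > 0" using T Y0(1) by simp
  have loc1: "open {z \<in> uhp. Im (moeb B z) > Y0}" "\<exists>p. wirt ?f p (\<lambda>z. of_real (e' (Im (moeb B z) / T) * (1 / T)) * (\<i> / 2 / cnj ((jfac B z)\<^sup>2)))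
      {z \<in> uhp. Im (moeb B z) > Y0}" if B: "B \<in> hmats" for B
  proof -
    let ?V = "{z \<in> uhp. Im (moeb B z) > Y0}"
    have "continuous_on uhp (\<lambda>z. Im (moeb B z))" by (intro continuous_intros continuous_on_moeb hmats_det B)
    then have "open ((\<lambda>z. Im (moeb B z)) -` {Y0<..} \<inter> uhp)"
      using continuous_on_open_vimage[OF open_uhp] open_greaterThan by blast
    moreover have "?V = (\<lambda>z. Im (moeb B z)) -` {Y0<..} \<inter> uhp" by auto
    ultimately show oV: "open ?V" by simp
    have de: "((\<lambda>y. e (y / T)) has_real_derivative e' (y / T) * (1 / T)) (at y)" for y
      by (rule DERIV_chain2[OF e(1)]) (intro DERIV_cdivide DERIV_ident)
    have ce: "continuous_on U (\<lambda>y. e' (y / T) * (1 / T))" for U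
      using T0 by (intro continuous_intros continuous_on_compose2[OF e(2)]) auto
    have "wirt (\<lambda>z. of_real (e (Im (moeb B z) / T)))
        (\<lambda>z. of_real (e' (Im (moeb B z) / T) * (1 / T)) * (- \<i> / 2 / (jfac B z)\<^sup>2))
        (\<lambda>z. of_real (e' (Im (moeb B z) / T) * (1 / T)) * (\<i> / 2 / cnj ((jfac B z)\<^sup>2))) uhp"
      by (rule wirt_real_compose[OF wirt_moeb[OF hmats_det[OF B] wirt_Im], where k = "\<lambda>y. e (y / T)"
            and k' = "\<lambda>y. e' (y / T) * (1 / T)", OF de ce])
    then have "wirt (\<lambda>z. of_real (e (Im (moeb B z) / T)))
        (\<lambda>z. of_real (e' (Im (moeb B z) / T) * (1 / T)) * (- \<i> / 2 / (jfac B z)\<^sup>2))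
        (\<lambda>z. of_real (e' (Im (moeb B z) / T) * (1 / T)) * (\<i> / 2 / cnj ((jfac B z)\<^sup>2))) ?V"
      by (rule wirt_subset) auto
    then have "wirt ?f (\<lambda>z. of_real (e' (Im (moeb B z) / T) * (1 / T)) * (- \<i> / 2 / (jfac B z)\<^sup>2))
        (\<lambda>z. of_real (e' (Im (moeb B z) / T) * (1 / T)) * (\<i> / 2 / cnj ((jfac B z)\<^sup>2))) ?V"
      by (rule wirt_cong_open[OF _ oV]) (use Ht_eq[OF B] in simp)
    then show "\<exists>p. wirt ?f p (\<lambda>z. of_real (e' (Im (moeb B z) / T) * (1 / T)) * (\<i> / 2 / cnj ((jfac B z)\<^sup>2))) ?V" by blast
  qed
  have loc2: "\<exists>V. open V \<and> z0 \<in> V \<and> V \<subseteq> uhp \<and> wirt ?f (\<lambda>_. 0) (\<lambda>_. 0) V"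
    if z0: "z0 \<in> uhp" and no: "\<not> (\<exists>B\<in>hmats. Im (moeb B z0) > Y0)" for z0
  proof -
    define V where "V = ball z0 (Im z0 / 4) \<inter> uhp"
    have oV: "open V" unfolding V_def by (intro open_Int open_ball open_uhp)
    have zV: "z0 \<in> V" using z0 by (simp add: V_def uhp_def)
    have "?f z = 1" if z: "z \<in> V" for z
    proof -
      have zu: "z \<in> uhp" "norm (z - z0) \<le> Im z0 / 4" using z by (auto simp: V_def dist_norm norm_minus_commute)
      have "Ht z \<le> T"
      proof (cases "\<exists>B\<in>hmats. Im (moeb B z) > Y0")
        case True
        then obtain B where B: "B \<in> hmats" "Im (moeb B z) > Y0" by blast
        have "Im (moeb B z) \<le> 3 * Im (moeb B z0)" by (rule moeb_height_ratio[OF hmats_det[OF B(1)] z0 zu])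
        also have "\<dots> \<le> 3 * Y0" using no B by force
        finally show ?thesis using Ht_eq[OF B(1) zu(1) B(2)] T by simp
      next
        case False then show ?thesis using Ht_low T Y0(1) by simp
      qed
      then show ?thesis using e(3) T0 by simp
    qed
    then have "wirt ?f (\<lambda>_. 0) (\<lambda>_. 0) V" by (intro wirt_cong_open[OF wirt_const[of 1] oV])
    then show ?thesis using oV zV by (intro exI[of _ V]) (auto simp: V_def)
  qed
  have "\<exists>p q. wirt ?f p q uhp"
  proof (rule wirt_local)
    fix z assume z: "z \<in> uhp"
    show "\<exists>V p q. open V \<and> z \<in> V \<and> V \<subseteq> uhp \<and> wirt ?f p q V"
    proof (cases "\<exists>B\<in>hmats. Im (moeb B z) > Y0")
      case True
      then obtain B where B: "B \<in> hmats" "Im (moeb B z) > Y0" by blast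
      then show ?thesis using loc1[OF B(1)] z by (intro exI[of _ "{z \<in> uhp. Im (moeb B z) > Y0}"]) auto
    next
      case False
      then show ?thesis using loc2[OF z False] by blast
    qed
  qed
  then obtain p q where pq: "wirt ?f p q uhp" by blast
  have qB: "q z = of_real (e' (Im (moeb B z) / T) * (1 / T)) * (\<i> / 2 / cnj ((jfac B z)\<^sup>2))"
    if z: "z \<in> uhp" and B: "B \<in> hmats" "Im (moeb B z) > Y0" for z B
  proof -
    obtain p' where "wirt ?f p' (\<lambda>z. of_real (e' (Im (moeb B z) / T) * (1 / T)) * (\<i> / 2 / cnj ((jfac B z)\<^sup>2))) {z \<in> uhp. Im (moeb B z) > Y0}"
      using loc1(2)[OF B(1)] by blast
    then have "(?f has_derivative (\<lambda>v. p' z * v + of_real (e' (Im (moeb B z) / T) * (1 / T)) * (\<i> / 2 / cnj ((jfac B z)\<^sup>2)) * cnj v)) (at z)"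
      unfolding wirt_def using z B by blast
    moreover have "(?f has_derivative (\<lambda>v. p z * v + q z * cnj v)) (at z)" using pq z unfolding wirt_def by blast
    ultimately show ?thesis by (intro wirt_unique(2))
  qed
  have qno: "q z = 0" if z: "z \<in> uhp" and no: "\<not> (\<exists>B\<in>hmats. Im (moeb B z) > Y0)" for z
  proof -
    obtain V where "z \<in> V" "wirt ?f (\<lambda>_. 0) (\<lambda>_. 0) V" using loc2[OF z no] by blast
    then have "(?f has_derivative (\<lambda>v. 0 * v + 0 * cnj v)) (at z)" unfolding wirt_def by blast
    moreover have "(?f has_derivative (\<lambda>v. p z * v + q z * cnj v)) (at z)" using pq z unfolding wirt_def by blast
    ultimately show ?thesis by (intro wirt_unique(2))
  qed
  have q0: "q z = 0" if z: "z \<in> uhp" and h: "Ht z < T \<or> Ht z > 2 * T" for z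
  proof (cases "\<exists>B\<in>hmats. Im (moeb B z) > Y0")
    case True
    then obtain B where B: "B \<in> hmats" "Im (moeb B z) > Y0" by blast
    have "Im (moeb B z) / T \<le> 1 \<or> Im (moeb B z) / T \<ge> 2"
      using h Ht_eq[OF B(1) z B(2)] T0 by (auto simp: field_simps)
    then show ?thesis using qB[OF z B] e(4) by simp
  next
    case False then show ?thesis using qno[OF z] by blast
  qed
  have nq: "norm (q z) \<le> Ce / T / (norm (jfac B z))\<^sup>2"
    if z: "z \<in> uhp" and B: "B \<in> hmats" "Im (moeb B z) > Y0" for z B
  proof -
    have "norm (q z) = \<bar>e' (Im (moeb B z) / T)\<bar> / T * (1 / 2 / (norm (jfac B z))\<^sup>2)"
      unfolding qB[OF z B] using T0 by (simp add: norm_mult norm_divide norm_power)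
    also have "\<dots> \<le> Ce / T * (1 / (norm (jfac B z))\<^sup>2)"
    proof (rule mult_mono)
      show "\<bar>e' (Im (moeb B z) / T)\<bar> / T \<le> Ce / T" using e(5) T0 by (intro divide_right_mono) auto
      show "1 / 2 / (norm (jfac B z))\<^sup>2 \<le> 1 / (norm (jfac B z))\<^sup>2" by (intro divide_right_mono) auto
      show "0 \<le> Ce / T" using order_trans[OF abs_ge_zero e(5)] T0 by simp
    qed (use e(5) T0 in auto)
    finally show ?thesis by simp
  qed
  show ?thesis by (rule that[OF pq q0 q0 nq]) auto
qed

text \<open>By \<open>Im_moeb\<close> the bounded quantity is \<open>Im z * norm (W z)\<close>; it
  is written in terms of \<open>B\<close> to match the estimate for the derivative of the cutoff.
  The exponential decay enters through \<open>c * y * exp (- c * y) <= 1\<close>.\<close>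

lemma decay_height_bound:
  assumes dec: "decays_at_cusps \<Gamma> W" and inv: "\<And>A z. A \<in> \<Gamma> \<Longrightarrow> z \<in> uhp \<Longrightarrow> slash 2 W A z = W z"
  obtains K Y where "K \<ge> 0" "Y \<ge> 0" "\<And>B z. B \<in> hmats \<Longrightarrow> z \<in> uhp \<Longrightarrow> Im (moeb B z) > Y \<Longrightarrow>
    norm (W z) * (Im (moeb B z) * (norm (jfac B z))\<^sup>2) \<le> K"
proof -
  have "\<forall>\<aa>\<in>C. \<exists>p. fst p \<ge> 0 \<and> snd p \<ge> 0 \<and> (\<forall>w. Im w > snd p \<longrightarrow> Im w * norm (slash 2 W (\<sigma> \<aa>) w) \<le> fst p)"
  proof
    fix \<aa> assume a: "\<aa> \<in> C"
    obtain c K Y where K: "c > 0" "K > 0" "Y > 0" "\<And>w. Im w > Y \<Longrightarrow> norm (slash 2 W (\<sigma> \<aa>) w) \<le> K * exp (- c * Im w)"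
      by (rule cusp_local_decay[OF dec C_cusp[OF a] scaling[OF a]]) blast
    have "Im w * norm (slash 2 W (\<sigma> \<aa>) w) \<le> K / c" if w: "Im w > Y" for w
    proof -
      have yp: "Im w > 0" using w K by simp
      have "c * Im w \<le> exp (c * Im w)" using exp_ge_add_one_self[of "c * Im w"] by linarith
      then have "c * Im w * exp (- (c * Im w)) \<le> 1" by (simp add: exp_minus field_simps)
      then have t: "Im w * exp (- c * Im w) \<le> 1 / c" using K by (simp add: field_simps)
      have "Im w * norm (slash 2 W (\<sigma> \<aa>) w) \<le> Im w * (K * exp (- c * Im w))"
        using K(4)[OF w] yp by (intro mult_left_mono) auto
      also have "\<dots> = K * (Im w * exp (- c * Im w))" by simp
      also have "\<dots> \<le> K * (1 / c)" using t K by (intro mult_left_mono) auto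
      finally show ?thesis by simp
    qed
    then show "\<exists>p. fst p \<ge> 0 \<and> snd p \<ge> 0 \<and> (\<forall>w. Im w > snd p \<longrightarrow> Im w * norm (slash 2 W (\<sigma> \<aa>) w) \<le> fst p)"
      using K by (intro exI[of _ "(K / c, Y)"]) auto
  qed
  from bchoice[OF this] obtain P where P: "\<And>\<aa>. \<aa> \<in> C \<Longrightarrow> fst (P \<aa>) \<ge> 0" "\<And>\<aa>. \<aa> \<in> C \<Longrightarrow> snd (P \<aa>) \<ge> 0"
    "\<And>\<aa> w. \<aa> \<in> C \<Longrightarrow> Im w > snd (P \<aa>) \<Longrightarrow> Im w * norm (slash 2 W (\<sigma> \<aa>) w) \<le> fst (P \<aa>)"
    by auto
  show ?thesis
  proof (rule that[of "\<Sum>\<aa>\<in>C. fst (P \<aa>)" "\<Sum>\<aa>\<in>C. snd (P \<aa>)"])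
    show "(\<Sum>\<aa>\<in>C. fst (P \<aa>)) \<ge> 0" "(\<Sum>\<aa>\<in>C. snd (P \<aa>)) \<ge> 0" by (intro sum_nonneg P; assumption)+
    fix B z assume B: "B \<in> hmats" and z: "z \<in> uhp" and h: "Im (moeb B z) > (\<Sum>\<aa>\<in>C. snd (P \<aa>))"
    obtain \<aa> A where a: "\<aa> \<in> C" "A \<in> \<Gamma>" "B = matrix_inv (\<sigma> \<aa>) ** A" using B by (auto simp: hmats_def)
    have d: "det (\<sigma> \<aa>) = 1" "det A = 1" using scaling a by (auto simp: scaling_matrix_def det_Gamma)
    define w where "w = moeb B z"
    have AB: "A = \<sigma> \<aa> ** B" unfolding a(3) using d by (simp add: matrix_inv_cancel)
    have jB: "jfac B z \<noteq> 0" using jfac_nonzero[OF hmats_det[OF B] z] .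
    have "W z = slash 2 (slash 2 W (\<sigma> \<aa>)) B z"
      using inv[OF a(2) z] slash2_mult[OF hmats_det[OF B] z, of W "\<sigma> \<aa>"] AB by simp
    then have Wz: "norm (W z) * (norm (jfac B z))\<^sup>2 = norm (slash 2 W (\<sigma> \<aa>) w)"
      using jB by (simp add: slash2[of _ B] w_def norm_divide norm_power)
    have "snd (P \<aa>) \<le> (\<Sum>\<aa>\<in>C. snd (P \<aa>))" using a P finite_C by (intro member_le_sum) auto
    then have "Im w * norm (slash 2 W (\<sigma> \<aa>) w) \<le> fst (P \<aa>)" using P(3)[OF a(1), of w] h by (simp add: w_def)
    also have "\<dots> \<le> (\<Sum>\<aa>\<in>C. fst (P \<aa>))" using a P finite_C by (intro member_le_sum) auto
    finally have "Im w * (norm (W z) * (norm (jfac B z))\<^sup>2) \<le> (\<Sum>\<aa>\<in>C. fst (P \<aa>))"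
      unfolding Wz .
    then show "norm (W z) * (Im (moeb B z) * (norm (jfac B z))\<^sup>2) \<le> (\<Sum>\<aa>\<in>C. fst (P \<aa>))"
      unfolding w_def by (simp only: mult.left_commute)
  qed
qed

text \<open>Modulo the group a point lies in \<open>M\<close> or in the image of a cusp strip, and
  the bound on \<open>Ht\<close> cuts the strip off at height \<open>L\<close>. Heights up to
  \<open>Y0\<close> are invisible to \<open>Ht\<close>, hence the maximum in
  \<open>L\<close>.\<close>

lemma bounded_height_compact:
  obtains Q where "compact Q" "Q \<subseteq> uhp" "\<And>z. z \<in> uhp \<Longrightarrow> Ht z \<le> T \<Longrightarrow> \<exists>A\<in>\<Gamma>. moeb A z \<in> Q"
proof -
  obtain M Bs where M: "compact M" "M \<subseteq> uhp" "finite Bs" "\<And>\<bb>. \<bb> \<in> Bs \<Longrightarrow> cusp \<Gamma> \<bb>"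
    "\<And>z. z \<in> closure F \<Longrightarrow> z \<in> uhp \<Longrightarrow> z \<in> M \<or> (\<exists>\<bb>\<in>Bs. Im (moeb (matrix_inv (cscal \<bb>)) z) > 1)"
    by (rule closure_F_cover[of "\<lambda>_. 1"]) auto
  define L where "L = max T Y0"
  define R where "R = cbox (Complex 0 1) (Complex 1 L)"
  have Ru: "R \<subseteq> uhp" by (auto simp: R_def in_cbox_complex_iff uhp_def)
  define Q where "Q = M \<union> (\<Union>\<bb>\<in>Bs. moeb (cscal \<bb>) ` R)"
  have dS: "det (cscal \<bb>) = 1" if "\<bb> \<in> Bs" for \<bb>
    using scaling_cscal[OF M(4)[OF that]] by (simp add: scaling_matrix_def)
  show ?thesis
  proof (rule that[of Q])
    show "compact Q" unfolding Q_def using M(1,3) continuous_on_subset[OF continuous_on_moeb[OF dS] Ru]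
      by (intro compact_Un compact_UN compact_continuous_image) (auto simp: R_def)
    show "Q \<subseteq> uhp" unfolding Q_def using M(2) dS Ru by (auto simp: moeb_uhp subset_eq)
    fix z assume z: "z \<in> uhp" and h: "Ht z \<le> T"
    obtain A where A: "A \<in> \<Gamma>" "moeb A z \<in> closure F" "moeb A z \<in> uhp" by (rule move_to_F[OF z])
    consider "moeb A z \<in> M" | \<bb> where "\<bb> \<in> Bs" "Im (moeb (matrix_inv (cscal \<bb>)) (moeb A z)) > 1"
      using M(5)[OF A(2,3)] by blast
    then show "\<exists>A\<in>\<Gamma>. moeb A z \<in> Q"
    proof cases
      case 1 then show ?thesis using A by (auto simp: Q_def)
    next
      case 2
      define S where "S = cscal \<bb>"
      define w where "w = moeb (matrix_inv S) (moeb A z)"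
      define n where "n = - \<lfloor>Re w\<rfloor>"
      have S: "scaling_matrix \<Gamma> \<bb> S" "det S = 1" using scaling_cscal[OF M(4)[OF 2(1)]] dS[OF 2(1)] by (auto simp: S_def)
      obtain \<aa> X where X: "\<aa> \<in> C" "X \<in> \<Gamma>" "\<bb> = act X \<aa>" "cscal \<bb> = X ** \<sigma> \<aa>" by (rule cscal[OF M(4)[OF 2(1)]])
      have d: "det (\<sigma> \<aa>) = 1" "det X = 1" using X scaling by (auto simp: scaling_matrix_def det_Gamma)
      have "matrix_inv S ** A = matrix_inv (\<sigma> \<aa>) ** (matrix_inv X ** A)"
        using d by (simp add: S_def X(4) matrix_inv_mult_sl2 matrix_mul_assoc)
      then have hm: "matrix_inv S ** A \<in> hmats" using X(1) mult_Gamma[OF inv_Gamma[OF X(2)] A(1)] unfolding hmats_def by blast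
      have we: "w = moeb (matrix_inv S ** A) z" using A z by (simp add: w_def moeb_mult det_Gamma)
      have wL: "Im w \<le> L"
      proof (cases "Im w > Y0")
        case True
        then have "Ht z = Im w" using Ht_eq[OF hm z] we by simp
        then show ?thesis using h by (simp add: L_def)
      qed (simp add: L_def)
      have wu: "w \<in> uhp" using A(3) S by (simp add: w_def moeb_uhp det_matrix_inv_sl2)
      have "w + of_int n \<in> R"
        using 2(2) wL unfolding R_def in_cbox_complex_iff by (auto simp: n_def S_def w_def) linarith+
      moreover have "moeb (S ** transl (of_int n) ** matrix_inv S ** A) z = moeb S (w + of_int n)"
        using z A S wu by (simp add: moeb_mult det_mult_sl2 det_matrix_inv_sl2 w_def det_Gamma)
      moreover have "S ** transl (of_int n) ** matrix_inv S ** A \<in> \<Gamma>"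
        using scaling_transl_stab[OF S(1), of n] A by (simp add: stab_def mult_Gamma)
      ultimately show ?thesis using 2(1) unfolding Q_def S_def by blast
    qed
  qed
qed

text \<open>Cutting \<open>W\<close> off at height \<open>T n\<close> gives the case of compact
  support. The derivative of the cutoff lives on heights from \<open>T n\<close> to
  \<open>2 * T n\<close>, and its product with \<open>W\<close> is at most a multiple of
  \<open>1 / (Im z)^2\<close>. This is integrable since \<open>F\<close> has finite area, so
  dominated convergence removes the error.\<close>

theorem stokes:
  assumes W: "wirt W p q uhp" and inv: "\<And>A z. A \<in> \<Gamma> \<Longrightarrow> z \<in> uhp \<Longrightarrow> slash 2 W A z = W z"
    and dec: "decays_at_cusps \<Gamma> W" and iq: "integrable lborel (\<lambda>z. indicator F z *\<^sub>R q z)"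
  shows "(LINT z|lborel. indicator F z *\<^sub>R q z) = 0"
proof -
  obtain e e' :: "real \<Rightarrow> real" and Ce where e: "\<And>t. (e has_real_derivative e' t) (at t)" "continuous_on UNIV e'"
    "\<And>t. 0 \<le> e t \<and> e t \<le> 1" "\<And>t. t \<le> 1 \<Longrightarrow> e t = 1" "\<And>t. t \<ge> 2 \<Longrightarrow> e t = 0"
    "\<And>t. t \<le> 1 \<or> t \<ge> 2 \<Longrightarrow> e' t = 0" "\<And>t. \<bar>e' t\<bar> \<le> Ce" "Ce \<ge> 0"
    by (rule cutoff_exists) blast
  obtain K Y where K: "K \<ge> 0" "Y \<ge> 0" "\<And>B z. B \<in> hmats \<Longrightarrow> z \<in> uhp \<Longrightarrow> Im (moeb B z) > Y \<Longrightarrow>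
    norm (W z) * (Im (moeb B z) * (norm (jfac B z))\<^sup>2) \<le> K"
    by (rule decay_height_bound[OF dec inv]) blast+
  \<comment> \<open>Above \<open>3 * Y0\<close> for the cutoff to be differentiable, above
    \<open>Y\<close> for the bound on \<open>W\<close>, and tending to infinity.\<close>
  define T where "T n = 3 * Y0 + Y + 1 + real n" for n
  have T: "T n > 3 * Y0" "T n > Y" "T n > 0" "T n > Y0" for n using K(2) Y0(1) by (auto simp: T_def)
  have "\<forall>n. \<exists>pq. wirt (\<lambda>z. of_real (e (Ht z / T n))) (fst pq) (snd pq) uhp \<and> (\<forall>z\<in>uhp. Ht z < T n \<longrightarrow> snd pq z = 0) \<and>
    (\<forall>z\<in>uhp. Ht z > 2 * T n \<longrightarrow> snd pq z = 0) \<and>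
    (\<forall>z\<in>uhp. \<forall>B\<in>hmats. Im (moeb B z) > Y0 \<longrightarrow> norm (snd pq z) \<le> Ce / T n / (norm (jfac B z))\<^sup>2)"
  proof
    fix n
    obtain p q where "wirt (\<lambda>z. of_real (e (Ht z / T n))) p q uhp" "\<And>z. z \<in> uhp \<Longrightarrow> Ht z < T n \<Longrightarrow> q z = 0"
      "\<And>z. z \<in> uhp \<Longrightarrow> Ht z > 2 * T n \<Longrightarrow> q z = 0"
      "\<And>z B. z \<in> uhp \<Longrightarrow> B \<in> hmats \<Longrightarrow> Im (moeb B z) > Y0 \<Longrightarrow> norm (q z) \<le> Ce / T n / (norm (jfac B z))\<^sup>2"
      by (rule wirt_height_cutoff[OF e(1,2,4,6,7) T(1)]) blast+
    then show "\<exists>pq. wirt (\<lambda>z. of_real (e (Ht z / T n))) (fst pq) (snd pq) uhp \<and> (\<forall>z\<in>uhp. Ht z < T n \<longrightarrow> snd pq z = 0) \<and>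
      (\<forall>z\<in>uhp. Ht z > 2 * T n \<longrightarrow> snd pq z = 0) \<and>
      (\<forall>z\<in>uhp. \<forall>B\<in>hmats. Im (moeb B z) > Y0 \<longrightarrow> norm (snd pq z) \<le> Ce / T n / (norm (jfac B z))\<^sup>2)"
      by (intro exI[of _ "(p, q)"]) auto
  qed
  from choice[OF this] obtain pq where pq: "\<And>n. wirt (\<lambda>z. of_real (e (Ht z / T n))) (fst (pq n)) (snd (pq n)) uhp"
    "\<And>n z. z \<in> uhp \<Longrightarrow> Ht z < T n \<Longrightarrow> snd (pq n) z = 0" "\<And>n z. z \<in> uhp \<Longrightarrow> Ht z > 2 * T n \<Longrightarrow> snd (pq n) z = 0"
    "\<And>n z B. z \<in> uhp \<Longrightarrow> B \<in> hmats \<Longrightarrow> Im (moeb B z) > Y0 \<Longrightarrow> norm (snd (pq n) z) \<le> Ce / T n / (norm (jfac B z))\<^sup>2"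
    by blast
  define r where "r n z = of_real (e (Ht z / T n)) * q z + snd (pq n) z * W z" for n z
  have zero: "integrable lborel (\<lambda>z. indicator F z *\<^sub>R r n z)" "(LINT z|lborel. indicator F z *\<^sub>R r n z) = 0" for n
  proof -
    define Wn where "Wn z = of_real (e (Ht z / T n)) * W z" for z
    have "wirt Wn (\<lambda>z. of_real (e (Ht z / T n)) * p z + fst (pq n) z * W z) (r n) uhp"
      unfolding Wn_def r_def by (rule wirt_mult[OF pq(1) W])
    moreover have "slash 2 Wn A z = Wn z" if "A \<in> \<Gamma>" "z \<in> uhp" for A z
      using inv[OF that] Ht_moeb[OF that] by (simp add: slash2 Wn_def flip: times_divide_eq_right)
    moreover obtain Q where "compact Q" "Q \<subseteq> uhp" and Q: "\<And>z. z \<in> uhp \<Longrightarrow> Ht z \<le> 2 * T n \<Longrightarrow> \<exists>A\<in>\<Gamma>. moeb A z \<in> Q"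
      by (rule bounded_height_compact[of "2 * T n"]) blast
    moreover have "\<exists>A\<in>\<Gamma>. moeb A z \<in> Q" if "z \<in> uhp" "Wn z \<noteq> 0" for z
    proof (rule Q[OF that(1)])
      have "\<not> Ht z / T n \<ge> 2" using that(2) e(5) by (auto simp: Wn_def)
      then show "Ht z \<le> 2 * T n" using T(3)[of n] by (simp add: field_simps)
    qed
    ultimately show "integrable lborel (\<lambda>z. indicator F z *\<^sub>R r n z)" "(LINT z|lborel. indicator F z *\<^sub>R r n z) = 0"
      using stokes_compact_support by blast+
  qed
  have bd: "norm (snd (pq n) z * W z) \<le> 2 * Ce * K * (1 / (Im z)\<^sup>2)" if z: "z \<in> uhp" for n z
  proof (cases "Ht z < T n \<or> Ht z > 2 * T n")
    case True
    then have "snd (pq n) z = 0" using pq(2,3)[OF z] by blast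
    then show ?thesis using e(8) K(1) by simp
  next
    case False
    then have h: "T n \<le> Ht z" "Ht z \<le> 2 * T n" by auto
    then have "\<exists>B\<in>hmats. Im (moeb B z) > Y0" using Ht_low[of z] T(4)[of n] by force
    then obtain B where B: "B \<in> hmats" "Im (moeb B z) > Y0" by blast
    define y where "y = Im (moeb B z)"
    define j where "j = (norm (jfac B z))\<^sup>2"
    have yH: "y = Ht z" using Ht_eq[OF B(1) z B(2)] by (simp add: y_def)
    have jp: "j > 0" using jfac_nonzero[OF hmats_det[OF B(1)] z] by (simp add: j_def)
    have yp: "y > 0" "y > Y" using h yH T[of n] by auto
    have Imz: "Im z = y * j" using Im_moeb[OF hmats_det[OF B(1)], of z] jp by (simp add: y_def j_def)
    have 1: "norm (snd (pq n) z) \<le> Ce / T n / j" using pq(4)[OF z B] by (simp add: j_def)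
    have "norm (W z) * (y * j) \<le> K" using K(3)[OF B(1) z] yp by (simp add: y_def j_def)
    then have 2: "norm (W z) \<le> K / (y * j)" using yp jp by (simp add: pos_le_divide_eq)
    have "norm (snd (pq n) z * W z) \<le> (Ce / T n / j) * (K / (y * j))"
      unfolding norm_mult using 1 2 e(8) T(3)[of n] jp by (intro mult_mono) auto
    \<comment> \<open>The height equation \<open>Im z = y * j\<close> collects the factors, and
      \<open>y / T n\<close> is at most 2 on the support of the derivative.\<close>
    also have "\<dots> = (Ce * K * (1 / (Im z)\<^sup>2)) * (y / T n)"
      unfolding Imz using yp jp by (simp add: power2_eq_square)
    also have "\<dots> \<le> (Ce * K * (1 / (Im z)\<^sup>2)) * 2"
      using h yH T(3)[of n] e(8) K(1) by (intro mult_left_mono) (auto simp: field_simps)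
    finally show ?thesis by (simp add: mult_ac)
  qed
  have "(\<lambda>n. LINT z|lborel. indicator F z *\<^sub>R r n z) \<longlonglongrightarrow> (LINT z|lborel. indicator F z *\<^sub>R q z)"
  proof (rule integral_dominated_convergence[where w = "\<lambda>z. norm (indicator F z *\<^sub>R q z) + 2 * Ce * K * (indicator F z * (1 / (Im z)\<^sup>2))"])
    show "(\<lambda>z. indicator F z *\<^sub>R q z) \<in> borel_measurable lborel" using iq by (rule borel_measurable_integrable)
    show "(\<lambda>z. indicator F z *\<^sub>R r n z) \<in> borel_measurable lborel" for n using zero by (intro borel_measurable_integrable)
    show "integrable lborel (\<lambda>z. norm (indicator F z *\<^sub>R q z) + 2 * Ce * K * (indicator F z * (1 / (Im z)\<^sup>2)))"
      by (intro Bochner_Integration.integrable_add integrable_norm iq integrable_mult_right integrable_inverse_Im2)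
    show "AE z in lborel. (\<lambda>n. indicator F z *\<^sub>R r n z) \<longlonglongrightarrow> indicator F z *\<^sub>R q z"
    proof (rule AE_I2)
      fix z
      show "(\<lambda>n. indicator F z *\<^sub>R r n z) \<longlonglongrightarrow> indicator F z *\<^sub>R q z"
      proof (cases "z \<in> F")
        case True
        then have zu: "z \<in> uhp" using F_uhp by blast
        \<comment> \<open>Once \<open>n\<close> is large the point lies below the cutoff, so the
          sequence is eventually constant.\<close>
        obtain m where m: "Ht z < real m" using reals_Archimedean2 by blast
        have "indicator F z *\<^sub>R r n z = indicator F z *\<^sub>R q z" if "n \<ge> m" for n
        proof -
          have "Ht z < T n" using m that K(2) Y0(1) by (simp add: T_def)
          moreover from this have "e (Ht z / T n) = 1" using e(4) T(3)[of n] by simp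
          ultimately show ?thesis using pq(2)[OF zu] by (simp add: r_def)
        qed
        then show ?thesis by (intro tendsto_eventually) (auto simp: eventually_sequentially)
      qed simp
    qed
    show "AE z in lborel. norm (indicator F z *\<^sub>R r n z) \<le> norm (indicator F z *\<^sub>R q z) + 2 * Ce * K * (indicator F z * (1 / (Im z)\<^sup>2))" for n
    proof (rule AE_I2)
      fix z
      show "norm (indicator F z *\<^sub>R r n z) \<le> norm (indicator F z *\<^sub>R q z) + 2 * Ce * K * (indicator F z * (1 / (Im z)\<^sup>2))"
      proof (cases "z \<in> F")
        case True
        then have zu: "z \<in> uhp" using F_uhp by blast
        have "norm (of_real (e (Ht z / T n)) * q z) \<le> 1 * norm (q z)"
          unfolding norm_mult using e(3)[of "Ht z / T n"] by (intro mult_right_mono) auto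
        then have "norm (r n z) \<le> norm (q z) + 2 * Ce * K * (1 / (Im z)\<^sup>2)"
          unfolding r_def using norm_triangle_ineq[of "of_real (e (Ht z / T n)) * q z" "snd (pq n) z * W z"] bd[OF zu, of n] by linarith
        then show ?thesis using True by simp
      qed simp
    qed
  qed
  then show ?thesis using zero(2) by (simp add: LIMSEQ_const_iff)
qed

end

section \<open>The basis\<close>

text \<open>A basis is claimed for an indexed family, so its members must also be distinct. A
  coincidence of two members is itself a relation, with coefficients 1 and -1.\<close>

lemma (in vector_space) independent_family:
  fixes h :: "'i \<Rightarrow> 'b"
  assumes "finite I" "\<forall>c. (\<Sum>i\<in>I. scale (c i) (h i)) = 0 \<longrightarrow> (\<forall>i\<in>I. c i = 0)"
  shows "inj_on h I" "independent (h ` I)"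
proof -
  show inj: "inj_on h I"
  proof (rule inj_onI, rule ccontr)
    fix i j assume ij: "i \<in> I" "j \<in> I" "h i = h j" "i \<noteq> j"
    define c :: "'i \<Rightarrow> 'a" where "c k = (if k = i then 1 else if k = j then - 1 else 0)" for k
    have "(\<Sum>k\<in>I. scale (c k) (h k)) = (\<Sum>k\<in>{i, j}. scale (c k) (h k))"
      using assms(1) ij by (intro sum.mono_neutral_right) (auto simp: c_def)
    also have "\<dots> = 0" using ij by (simp add: c_def)
    finally have "c i = 0" using assms(2) ij(1) by blast
    then show False by (simp add: c_def)
  qed
  show "independent (h ` I)"
  proof
    assume "dependent (h ` I)"
    then obtain u v where u: "v \<in> h ` I" "u v \<noteq> 0" "(\<Sum>v\<in>h ` I. scale (u v) v) = 0"
      using dependent_finite[of "h ` I"] assms(1) by auto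
    have "(\<Sum>i\<in>I. scale (u (h i)) (h i)) = 0" using u(3) by (simp add: sum.reindex[OF inj])
    then show False using spec[OF assms(2), of "\<lambda>i. u (h i)"] u by blast
  qed
qed

lemma (in vector_space) span_family:
  assumes "finite I" "inj_on h I" "v \<in> span (h ` I)"
  obtains c where "v = (\<Sum>i\<in>I. scale (c i) (h i))"
proof -
  obtain u where "v = (\<Sum>x\<in>h ` I. scale (u x) x)" using assms span_finite[of "h ` I"] by auto
  then show ?thesis using that[of "\<lambda>i. u (h i)"] by (simp add: sum.reindex[OF assms(2)])
qed

text \<open>A count of dimensions: a vector outside the span of \<open>h\<close> would extend it to
  an independent set with more elements than the spanning family \<open>b\<close>.\<close>

lemma (in vector_space) independent_family_spans:
  assumes "finite I" "\<forall>c. (\<Sum>i\<in>I. scale (c i) (h i)) = 0 \<longrightarrow> (\<forall>i\<in>I. c i = 0)"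
    and K: "finite K" "card K \<le> card I" "h ` I \<subseteq> span (b ` K)" "v \<in> span (b ` K)"
  obtains c where "v = (\<Sum>i\<in>I. scale (c i) (h i))"
proof -
  note ind = independent_family[OF assms(1,2)]
  have "v \<in> span (h ` I)"
  proof (rule ccontr)
    assume v: "v \<notin> span (h ` I)"
    then have "independent (insert v (h ` I))" using ind(2) independent_insertI by blast
    moreover have "insert v (h ` I) \<subseteq> span (b ` K)" using K by auto
    ultimately have "card (insert v (h ` I)) \<le> card (b ` K)"
      using independent_span_bound[of "b ` K" "insert v (h ` I)"] K(1) by simp
    moreover have "v \<notin> h ` I" using v span_base by blast
    moreover have "card (b ` K) \<le> card K" using K(1) by (rule card_image_le)
    ultimately show False using K(2) card_image[OF ind(1)] assms(1) by simp
  qed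
  then show ?thesis by (rule span_family[OF assms(1) ind(1)]) (rule that)
qed

lemma basis_familyI:
  assumes "finite I" "\<forall>c. (\<Sum>i\<in>I. cscale (c i) (b i)) = 0 \<longrightarrow> (\<forall>i\<in>I. c i = 0)"
    and "\<And>c. (\<Sum>i\<in>I. cscale (c i) (b i)) \<in> V" "\<And>v. v \<in> V \<Longrightarrow> \<exists>c. v = (\<Sum>i\<in>I. cscale (c i) (b i))"
  shows "basis_family I b V"
proof -
  note ind = funspace.independent_family[OF assms(1,2)]
  have "funspace.span (b ` I) = V"
  proof
    show "V \<subseteq> funspace.span (b ` I)"
    proof
      fix v assume "v \<in> V"
      then obtain c where "v = (\<Sum>i\<in>I. cscale (c i) (b i))" using assms(4) by blast
      then show "v \<in> funspace.span (b ` I)"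
        by (simp only:) (intro funspace.span_sum funspace.span_scale funspace.span_base imageI)
    qed
    show "funspace.span (b ` I) \<subseteq> V"
    proof
      fix v assume "v \<in> funspace.span (b ` I)"
      then obtain c where "v = (\<Sum>i\<in>I. cscale (c i) (b i))" by (rule funspace.span_family[OF assms(1) ind(1)])
      then show "v \<in> V" using assms(3) by simp
    qed
  qed
  then show ?thesis using ind by (simp add: basis_family_def)
qed

lemma basis_family_coeff_zero:
  assumes "basis_family I b V" "finite I" "(\<Sum>i\<in>I. cscale (c i) (b i)) = 0" "i \<in> I"
  shows "c i = 0"
proof -
  have inj: "inj_on b I" using assms by (simp add: basis_family_def)
  define u where "u v = c (the_inv_into I b v)" for v
  have "(\<Sum>v\<in>b ` I. cscale (u v) v) = (\<Sum>i\<in>I. cscale (c i) (b i))"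
    using inj by (simp add: sum.reindex u_def the_inv_into_f_f)
  also have "\<dots> = 0" by (rule assms(3))
  finally have "\<not> (\<exists>v\<in>b ` I. u v \<noteq> 0)"
    using assms(1) funspace.dependent_finite[OF finite_imageI[OF assms(2)], of b] unfolding basis_family_def by metis
  then show ?thesis using assms(4) inj by (simp add: u_def the_inv_into_f_f)
qed

lemma sum_cscale_apply: "(\<Sum>i\<in>I. cscale (c i) (b i)) z = (\<Sum>i\<in>I. c i * b i z)"
  by (induction I rule: infinite_finite_induct) (auto simp: cscale_def)

lemma sum_fun_apply: "(\<Sum>i\<in>I. b i) z = (\<Sum>i\<in>I. b i z :: complex)"
  by (induction I rule: infinite_finite_induct) auto

lemma slash2_sum: "slash 2 (\<Sum>i\<in>I. b i) A = (\<Sum>i\<in>I. slash 2 (b i) A)"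
  by (auto simp: fun_eq_iff slash2 sum_fun_apply sum_divide_distrib)

lemma slash2_sum_diff:
  assumes "\<And>p. p \<in> S \<Longrightarrow> slash 2 (h p) A - h p = k p"
  shows "(slash 2 (\<Sum>p\<in>S. cscale (c p) (h p)) A - (\<Sum>p\<in>S. cscale (c p) (h p))) z = (\<Sum>p\<in>S. c p * k p z)"
proof -
  have "slash 2 (h p) A z = h p z + k p z" if "p \<in> S" for p
    using fun_cong[OF assms[OF that], of z] by (simp add: algebra_simps)
  then have "(\<Sum>p\<in>S. c p * slash 2 (h p) A z) = (\<Sum>p\<in>S. c p * h p z + c p * k p z)"
    by (intro sum.cong) (auto simp: distrib_left)
  then show ?thesis by (simp add: slash2_sum slash2_cscale sum_cscale_apply sum.distrib)
qed

lemma decays_sum: "(\<And>i. i \<in> I \<Longrightarrow> decays_at_cusps \<Gamma> (h i)) \<Longrightarrow> decays_at_cusps \<Gamma> (\<Sum>i\<in>I. h i)"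
  by (induction I rule: infinite_finite_induct) (auto intro: decays_add decays_0)

text \<open>The vanishing of \<open>D 1 + \<i> * D \<i>\<close> is the Cauchy-Riemann equation,
  which makes the real differential complex linear.\<close>

lemma has_dbar_zero_holomorphic:
  assumes "open U" "\<And>z. z \<in> U \<Longrightarrow> has_dbar W 0 z"
  shows "W holomorphic_on U"
  unfolding holomorphic_on_open[OF assms(1)]
proof
  fix z assume "z \<in> U"
  then obtain D where D: "(W has_derivative D) (at z)" "0 = (D 1 + \<i> * D \<i>) / 2"
    using assms(2) unfolding has_dbar_def by blast
  have "bounded_linear D" using D(1) by (rule has_derivative_bounded_linear)
  then interpret linear D by (rule bounded_linear.linear)
  have "D 1 + \<i> * D \<i> = 0" using D(2) by simp
  then have "\<i> * (D 1 + \<i> * D \<i>) = 0" by simp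
  then have Di: "D \<i> = \<i> * D 1" by (simp add: algebra_simps)
  have "D v = D 1 * v" for v
  proof -
    have "D v = D (Re v *\<^sub>R 1 + Im v *\<^sub>R \<i>)" by (rule arg_cong[of _ _ D]) (simp add: complex_eq_iff)
    also have "\<dots> = Re v *\<^sub>R D 1 + Im v *\<^sub>R D \<i>" by (simp only: add scale)
    also have "\<dots> = D 1 * v" unfolding Di by (simp add: complex_eq_iff algebra_simps)
    finally show ?thesis .
  qed
  then have "(W has_field_derivative D 1) (at z)"
    unfolding has_field_derivative_def by (intro has_derivative_eq_rhs[OF D(1)]) (rule ext)
  then show "\<exists>f'. (W has_field_derivative f') (at z)" ..
qed

lemma has_dbar_sum:
  assumes "\<And>i. i \<in> I \<Longrightarrow> has_dbar (h i) (d i) z"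
  shows "has_dbar (\<Sum>i\<in>I. cscale (c i) (h i)) (\<Sum>i\<in>I. c i * d i) z"
proof -
  have "\<forall>i\<in>I. \<exists>D. (h i has_derivative D) (at z) \<and> d i = (D 1 + \<i> * D \<i>) / 2"
    using assms by (simp add: has_dbar_def)
  then obtain D where D: "\<And>i. i \<in> I \<Longrightarrow> (h i has_derivative D i) (at z)" "\<And>i. i \<in> I \<Longrightarrow> d i = (D i 1 + \<i> * D i \<i>) / 2"
    by metis
  have "((\<lambda>z. \<Sum>i\<in>I. c i * h i z) has_derivative (\<lambda>v. \<Sum>i\<in>I. c i * D i v)) (at z)"
    by (intro has_derivative_sum has_derivative_mult_right D(1))
  moreover have "(\<Sum>i\<in>I. cscale (c i) (h i)) = (\<lambda>z. \<Sum>i\<in>I. c i * h i z)" by (auto simp: sum_cscale_apply)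
  moreover have "(\<Sum>i\<in>I. c i * d i) = ((\<Sum>i\<in>I. c i * D i 1) + \<i> * (\<Sum>i\<in>I. c i * D i \<i>)) / 2"
    by (simp add: D(2) sum_distrib_left sum_divide_distrib flip: sum.distrib) (simp add: algebra_simps)
  ultimately show ?thesis unfolding has_dbar_def by (intro exI[of _ "\<lambda>v. \<Sum>i\<in>I. c i * D i v"]) auto
qed

section \<open>Cocycles and periods\<close>

locale orthonormal_cusp_forms = cusped_domain +
  fixes g :: nat and f :: "nat \<Rightarrow> complex \<Rightarrow> complex" and z0 :: complex
  assumes genus: "has_genus \<Gamma> g" and onb: "orthonormal_basis \<Gamma> F g f" and z0: "z0 \<in> uhp"
begin

lemma basis_f: "basis_family {1..g} f (S2 \<Gamma>)"
  using onb by (simp add: orthonormal_basis_def)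

lemma f_S2: "i \<in> {1..g} \<Longrightarrow> f i \<in> S2 \<Gamma>"
  using basis_f funspace.span_base[of "f i" "f ` {1..g}"] by (auto simp: basis_family_def)

lemma f_coeff_zero:
  assumes "\<And>z. (\<Sum>j=1..g. c j * f j z) = 0" "j \<in> {1..g}" shows "c j = 0"
  using assms basis_family_coeff_zero[OF basis_f, of c j] by (auto simp: fun_eq_iff sum_cscale_apply)

lemma S2_expansion:
  assumes "h \<in> S2 \<Gamma>" obtains c where "h = (\<lambda>z. \<Sum>j=1..g. c j * f j z)"
proof -
  have f: "inj_on f {1..g}" "h \<in> funspace.span (f ` {1..g})" using basis_f assms by (auto simp: basis_family_def)
  obtain c where "h = (\<Sum>j=1..g. cscale (c j) (f j))" by (rule funspace.span_family[OF _ f]) auto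
  then have "h = (\<lambda>z. \<Sum>j=1..g. c j * f j z)" by (auto simp: sum_cscale_apply)
  then show ?thesis by (rule that)
qed

lemma petersson_eq: "petersson F h k = (LINT z|lborel. indicator F z *\<^sub>R (h z * cnj (k z)))"
  unfolding petersson_def set_lebesgue_integral_def
  using F_uhp by (intro Bochner_Integration.integral_cong) (auto simp: indicator_def uhp_def)

text \<open>A function that is not integrable has integral 0, so the normalization to 1 already
  contains the integrability of the squares. Mixed products are dominated by sums of
  squares.\<close>

lemma integrable_product:
  assumes i: "i \<in> {1..g}" and j: "j \<in> {1..g}"
  shows "integrable lborel (\<lambda>z. indicator F z *\<^sub>R (f j z * cnj (f i z)))"
proof -
  have sq: "integrable lborel (\<lambda>z. indicator F z *\<^sub>R (f i z * cnj (f i z)))" if "i \<in> {1..g}" for i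
  proof -
    have "(LINT z|lborel. indicator F z *\<^sub>R (f i z * cnj (f i z))) = 1"
      using onb that unfolding orthonormal_basis_def petersson_eq by auto
    then show ?thesis using not_integrable_integral_eq by fastforce
  qed
  have c: "continuous_on F (f i)" if "i \<in> {1..g}" for i
    using holomorphic_on_imp_continuous_on[OF S2_D(1)[OF f_S2[OF that]]] F_uhp by (rule continuous_on_subset)
  show ?thesis
  proof (rule Bochner_Integration.integrable_bound)
    show "integrable lborel (\<lambda>z. norm (indicator F z *\<^sub>R (f i z * cnj (f i z))) + norm (indicator F z *\<^sub>R (f j z * cnj (f j z))))"
      using sq i j by (intro Bochner_Integration.integrable_add integrable_norm) auto
    have "(\<lambda>z. indicator F z *\<^sub>R (f j z * cnj (f i z))) \<in> borel_measurable borel"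
      using c i j open_F by (intro borel_measurable_continuous_on_indicator continuous_intros) auto
    then show "(\<lambda>z. indicator F z *\<^sub>R (f j z * cnj (f i z))) \<in> borel_measurable lborel" by simp
    show "AE z in lborel. norm (indicator F z *\<^sub>R (f j z * cnj (f i z)))
      \<le> norm (norm (indicator F z *\<^sub>R (f i z * cnj (f i z))) + norm (indicator F z *\<^sub>R (f j z * cnj (f j z))))"
    proof (rule AE_I2)
      fix z
      have "2 * (norm (f j z) * norm (f i z)) \<le> norm (f i z) * norm (f i z) + norm (f j z) * norm (f j z)"
        using sum_squares_bound[of "norm (f j z)" "norm (f i z)"] by (simp add: power2_eq_square)
      then have "norm (f j z) * norm (f i z) \<le> norm (f i z) * norm (f i z) + norm (f j z) * norm (f j z)"
        using mult_nonneg_nonneg[OF norm_ge_zero norm_ge_zero, of "f j z" "f i z"] by linarith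
      then show "norm (indicator F z *\<^sub>R (f j z * cnj (f i z)))
        \<le> norm (norm (indicator F z *\<^sub>R (f i z * cnj (f i z))) + norm (indicator F z *\<^sub>R (f j z * cnj (f j z))))"
        by (simp add: norm_mult indicator_def)
    qed
  qed
qed

lemma trace_integral:
  shows "integrable lborel (\<lambda>z. indicator F z *\<^sub>R (\<Sum>i=1..g. \<Sum>j=1..g. a i j * (f j z * cnj (f i z))))"
    and "(LINT z|lborel. indicator F z *\<^sub>R (\<Sum>i=1..g. \<Sum>j=1..g. a i j * (f j z * cnj (f i z)))) = (\<Sum>i=1..g. a i i)"
proof -
  have eq: "indicator F z *\<^sub>R (\<Sum>i=1..g. \<Sum>j=1..g. a i j * (f j z * cnj (f i z)))
      = (\<Sum>i=1..g. \<Sum>j=1..g. a i j * (indicator F z *\<^sub>R (f j z * cnj (f i z))))" for z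
    by (simp add: scaleR_sum_right)
  show "integrable lborel (\<lambda>z. indicator F z *\<^sub>R (\<Sum>i=1..g. \<Sum>j=1..g. a i j * (f j z * cnj (f i z))))"
    unfolding eq using integrable_product by (intro Bochner_Integration.integrable_sum integrable_mult_right) auto
  have int: "integrable lborel (\<lambda>z. a i j * (indicator F z *\<^sub>R (f j z * cnj (f i z))))"
    if "i \<in> {1..g}" "j \<in> {1..g}" for i j
    using integrable_product[OF that] by (rule integrable_mult_right)
  have "(LINT z|lborel. (\<Sum>j=1..g. a i j * (indicator F z *\<^sub>R (f j z * cnj (f i z)))))
      = (\<Sum>j=1..g. a i j * petersson F (f j) (f i))" if "i \<in> {1..g}" for i
    using Bochner_Integration.integral_sum[OF int[OF that]] unfolding petersson_eq integral_mult_right_zero .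
  then have "(\<Sum>i=1..g. LINT z|lborel. (\<Sum>j=1..g. a i j * (indicator F z *\<^sub>R (f j z * cnj (f i z)))))
      = (\<Sum>i=1..g. \<Sum>j=1..g. a i j * petersson F (f j) (f i))"
    by (intro sum.cong) auto
  moreover have "(LINT z|lborel. (\<Sum>i=1..g. \<Sum>j=1..g. a i j * (indicator F z *\<^sub>R (f j z * cnj (f i z)))))
      = (\<Sum>i=1..g. LINT z|lborel. (\<Sum>j=1..g. a i j * (indicator F z *\<^sub>R (f j z * cnj (f i z)))))"
    by (rule Bochner_Integration.integral_sum[OF Bochner_Integration.integrable_sum[OF int]])
  ultimately have "(LINT z|lborel. (\<Sum>i=1..g. \<Sum>j=1..g. a i j * (indicator F z *\<^sub>R (f j z * cnj (f i z)))))
      = (\<Sum>i=1..g. \<Sum>j=1..g. a i j * petersson F (f j) (f i))" by simp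
  also have "\<dots> = (\<Sum>i=1..g. \<Sum>j=1..g. if j = i then a i j else 0)"
    using onb unfolding orthonormal_basis_def by (intro sum.cong) auto
  also have "\<dots> = (\<Sum>i=1..g. a i i)" by (intro sum.cong refl) (simp add: sum.delta)
  finally show "(LINT z|lborel. indicator F z *\<^sub>R (\<Sum>i=1..g. \<Sum>j=1..g. a i j * (f j z * cnj (f i z)))) = (\<Sum>i=1..g. a i i)"
    unfolding eq .
qed

text \<open>Subtracting primitives and conjugate primitives makes \<open>h\<close> invariant; the integral of its
  Wirtinger derivative is then the trace, by orthonormality, and vanishes by Stokes' theorem.\<close>

lemma cocycle_trace_zero:
  assumes h: "h \<in> S22 \<Gamma>" and sl: "\<And>A z. A \<in> \<Gamma> \<Longrightarrow> (slash 2 h A - h) z =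
    (\<Sum>j=1..g. (\<Sum>i=1..g. b i j * modsym A (f i) + a i j * cnj (modsym A (f i))) * f j z)"
  shows "(\<Sum>i=1..g. a i i) = 0"
proof -
  define T where "T i j z = f j z * (b i j * prim z0 (f i) z + a i j * cnj (prim z0 (f i) z))" for i j z
  define W where "W = h - (\<Sum>i=1..g. \<Sum>j=1..g. T i j)"
  have W: "W z = h z + (- 1) * (\<Sum>i=1..g. \<Sum>j=1..g. T i j z)" for z by (simp add: W_def sum_fun_apply)
  have hol: "f i holomorphic_on uhp" if "i \<in> {1..g}" for i using S2_D(1)[OF f_S2[OF that]] .
  have wP: "wirt (prim z0 (f i)) (f i) (\<lambda>_. 0) uhp" if "i \<in> {1..g}" for i
    using prim_has_derivative[OF hol[OF that] z0] holomorphic_on_imp_continuous_on[OF hol[OF that]]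
    by (auto simp: wirt_def has_field_derivative_def)
  have wT: "wirt (T i j) (\<lambda>z. f j z * (b i j * f i z) + deriv (f j) z * (b i j * prim z0 (f i) z + a i j * cnj (prim z0 (f i) z)))
      (\<lambda>z. f j z * (a i j * cnj (f i z))) uhp" if "i \<in> {1..g}" "j \<in> {1..g}" for i j
    using wirt_mult[OF wirt_holomorphic[OF hol[OF that(2)] open_uhp]
        wirt_add[OF wirt_mult[OF wirt_const[of "b i j"] wP[OF that(1)]] wirt_mult[OF wirt_const[of "a i j"] wirt_cnj[OF wP[OF that(1)]]]]]
    unfolding T_def by simp
  have hh: "h holomorphic_on uhp" "decays_at_cusps \<Gamma> h" using h by (auto simp: S22_def)
  \<comment> \<open>Only the conjugate primitives contribute to the derivative by
    \<open>cnj z\<close>; \<open>h\<close>, \<open>f j\<close> and the primitives themselves are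
    holomorphic.\<close>
  have "\<exists>p. wirt W p (\<lambda>z. 0 + ((- 1) * (\<Sum>i=1..g. \<Sum>j=1..g. f j z * (a i j * cnj (f i z))) + 0 * (\<Sum>i=1..g. \<Sum>j=1..g. T i j z))) uhp"
    unfolding W[abs_def]
    by (rule exI, rule wirt_add[OF wirt_holomorphic[OF hh(1) open_uhp] wirt_mult[OF wirt_const wirt_sum[OF _ wirt_sum[OF _ wT]]]]) auto
  moreover have "(\<lambda>z. 0 + ((- 1) * (\<Sum>i=1..g. \<Sum>j=1..g. f j z * (a i j * cnj (f i z))) + 0 * (\<Sum>i=1..g. \<Sum>j=1..g. T i j z)))
      = (\<lambda>z. \<Sum>i=1..g. \<Sum>j=1..g. - a i j * (f j z * cnj (f i z)))"
    by (simp add: fun_eq_iff sum_negf mult.left_commute)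
  ultimately obtain p where wW: "wirt W p (\<lambda>z. \<Sum>i=1..g. \<Sum>j=1..g. - a i j * (f j z * cnj (f i z))) uhp" by auto
  have inv: "slash 2 W A z = W z" if A: "A \<in> \<Gamma>" and z: "z \<in> uhp" for A z
  proof -
    define J where "J = (jfac A z)\<^sup>2"
    define s where "s = (\<Sum>j=1..g. (\<Sum>i=1..g. b i j * modsym A (f i) + a i j * cnj (modsym A (f i))) * f j z)"
    have J: "J \<noteq> 0" using jfac_nonzero[OF det_Gamma[OF A] z] by (simp add: J_def)
    have "h (moeb A z) / J - h z = s" using sl[OF A, of z] by (simp add: s_def slash2 J_def)
    then have 1: "h (moeb A z) = J * (h z + s)" using J by (simp add: field_simps)
    have "T i j (moeb A z) = J * (T i j z + (b i j * modsym A (f i) + a i j * cnj (modsym A (f i))) * f j z)"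
      if "i \<in> {1..g}" "j \<in> {1..g}" for i j
      using prim_moeb[OF f_S2[OF that(1)] A z0 z] S2_transform[OF f_S2[OF that(2)] A z]
      by (simp add: T_def J_def algebra_simps)
    then have "(\<Sum>i=1..g. \<Sum>j=1..g. T i j (moeb A z))
        = (\<Sum>i=1..g. \<Sum>j=1..g. J * (T i j z + (b i j * modsym A (f i) + a i j * cnj (modsym A (f i))) * f j z))"
      by (intro sum.cong) auto
    also have "\<dots> = J * ((\<Sum>i=1..g. \<Sum>j=1..g. T i j z) + (\<Sum>i=1..g. \<Sum>j=1..g. (b i j * modsym A (f i) + a i j * cnj (modsym A (f i))) * f j z))"
      by (simp only: sum.distrib sum_distrib_left distrib_left)
    also have "(\<Sum>i=1..g. \<Sum>j=1..g. (b i j * modsym A (f i) + a i j * cnj (modsym A (f i))) * f j z) = s"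
      unfolding s_def sum_distrib_right by (rule sum.swap)
    finally have 2: "(\<Sum>i=1..g. \<Sum>j=1..g. T i j (moeb A z)) = J * ((\<Sum>i=1..g. \<Sum>j=1..g. T i j z) + s)" .
    have "W (moeb A z) = J * W z" unfolding W 1 2 by (simp add: algebra_simps)
    then show ?thesis using J by (simp add: slash2 J_def)
  qed
  \<comment> \<open>Primitives and their conjugates are bounded near the cusps, so the decay of
    \<open>f j\<close> carries over.\<close>
  have dT: "decays_at_cusps \<Gamma> (T i j)" if i: "i \<in> {1..g}" and j: "j \<in> {1..g}" for i j
    unfolding T_def
  proof (rule decays_mult_bounded[OF S2_D(4)[OF f_S2[OF j]]])
    fix \<aa> S assume c: "cusp \<Gamma> \<aa>" "scaling_matrix \<Gamma> \<aa> S"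
    obtain B Y where B: "\<And>w. Im w > Y \<Longrightarrow> norm (prim z0 (f i) (moeb S w)) \<le> B"
      using prim_bounded_cusp[OF f_S2[OF i] c z0] by blast
    have "norm (b i j * prim z0 (f i) (moeb S w) + a i j * cnj (prim z0 (f i) (moeb S w))) \<le> norm (b i j) * B + norm (a i j) * B"
      if "Im w > Y" for w
    proof (rule order_trans[OF norm_triangle_ineq add_mono])
      show "norm (b i j * prim z0 (f i) (moeb S w)) \<le> norm (b i j) * B"
        unfolding norm_mult using B[OF that] by (intro mult_left_mono) auto
      show "norm (a i j * cnj (prim z0 (f i) (moeb S w))) \<le> norm (a i j) * B"
        unfolding norm_mult complex_mod_cnj using B[OF that] by (intro mult_left_mono) auto
    qed
    then show "\<exists>B Y. \<forall>w. Im w > Y \<longrightarrow> norm (b i j * prim z0 (f i) (moeb S w) + a i j * cnj (prim z0 (f i) (moeb S w))) \<le> B"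
      by blast
  qed
  have dW: "decays_at_cusps \<Gamma> W" unfolding W_def using dT by (intro decays_diff hh(2) decays_sum) auto
  have "(\<Sum>i=1..g. - a i i) = 0"
    using stokes[OF wW inv dW] trace_integral[of "\<lambda>i j. - a i j"] by simp
  then show ?thesis by (simp add: sum_negf)
qed

text \<open>A relation between the periods makes the zero function a solution of the cocycle equation
  whose matrix has trace \<open>\<Sum>\<bar>b i\<bar>\<^sup>2\<close>.\<close>

lemma modsym_independent:
  assumes rel: "\<And>A. A \<in> \<Gamma> \<Longrightarrow> (\<Sum>i=1..g. b i * modsym A (f i) + a i * cnj (modsym A (f i))) = 0" and i: "i \<in> {1..g}"
  shows "b i = 0" "a i = 0"
proof -
  have key: "b i = 0" if rel: "\<And>A. A \<in> \<Gamma> \<Longrightarrow> (\<Sum>i=1..g. b i * modsym A (f i) + a i * cnj (modsym A (f i))) = 0" for a b :: "nat \<Rightarrow> complex"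
  proof -
    have "(\<Sum>i=1..g. cnj (a i) * modsym A (f i) + cnj (b i) * cnj (modsym A (f i))) = 0" if "A \<in> \<Gamma>" for A
      using arg_cong[OF rel[OF that], of cnj] by (simp add: cnj_sum add.commute)
    \<comment> \<open>The conjugate relation, multiplied by \<open>b j\<close>, is a family of
      relations whose conjugate periods have the matrix \<open>b j * cnj (b i)\<close>; its diagonal
      consists of the squared norms.\<close>
    then have "(\<Sum>i=1..g. (b j * cnj (a i)) * modsym A (f i) + (b j * cnj (b i)) * cnj (modsym A (f i))) = 0" if "A \<in> \<Gamma>" for A j
      using that by (simp add: mult.assoc flip: sum_distrib_left distrib_left)
    then have "(\<Sum>i=1..g. b i * cnj (b i)) = 0"
      using funspace.subspace_0[OF S22_subspace[of \<Gamma>]]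
      by (intro cocycle_trace_zero[of 0 "\<lambda>i j. b j * cnj (a i)" "\<lambda>i j. b j * cnj (b i)"]) (simp_all add: slash2)
    then have "of_real (\<Sum>i=1..g. (norm (b i))\<^sup>2) = (0 :: complex)" unfolding of_real_sum complex_norm_square .
    then have "(\<Sum>i=1..g. (norm (b i))\<^sup>2) = 0" unfolding of_real_eq_0_iff .
    then show ?thesis using i by (simp add: sum_nonneg_eq_0_iff)
  qed
  show "b i = 0" by (rule key[OF rel])
  \<comment> \<open>Conjugation exchanges the roles of \<open>a\<close> and
    \<open>b\<close>.\<close>
  have "(\<Sum>i=1..g. cnj (a i) * modsym A (f i) + cnj (b i) * cnj (modsym A (f i))) = 0" if "A \<in> \<Gamma>" for A
    using arg_cong[OF rel[OF that], of cnj] by (simp add: cnj_sum add.commute)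
  then have "cnj (a i) = 0" by (rule key)
  then show "a i = 0" by simp
qed

text \<open>Both counts are \<open>2 * g\<close>: the homology coordinates span the parabolic
  homomorphisms, and the periods together with their conjugates are independent among them.\<close>

lemma parabolic_hom_expansion:
  assumes hom: "\<And>A B. A \<in> \<Gamma> \<Longrightarrow> B \<in> \<Gamma> \<Longrightarrow> \<phi> (A ** B) = \<phi> A + \<phi> B"
    and par: "\<And>A. A \<in> \<Gamma> \<Longrightarrow> parabolic A \<Longrightarrow> \<phi> A = 0"
  shows "\<exists>b a. \<forall>A\<in>\<Gamma>. \<phi> A = (\<Sum>i=1..g. b i * modsym A (f i) + a i * cnj (modsym A (f i)))"
proof -
  obtain m :: "nat \<Rightarrow> real^2^2 \<Rightarrow> int" where m: "\<And>\<phi> :: real^2^2 \<Rightarrow> complex. (\<And>A B. A \<in> \<Gamma> \<Longrightarrow> B \<in> \<Gamma> \<Longrightarrow> \<phi> (A ** B) = \<phi> A + \<phi> B) \<Longrightarrow>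
       (\<And>A. A \<in> \<Gamma> \<Longrightarrow> parabolic A \<Longrightarrow> \<phi> A = 0) \<Longrightarrow>
       \<exists>v. \<forall>A\<in>\<Gamma>. \<phi> A = (\<Sum>k<2 * g. v k * of_int (m k A))"
    by (rule parabolic_hom_finite_dim[OF scaling_exists genus]) blast+
  define sc where "sc c \<psi> A = c * \<psi> A" for c :: complex and \<psi> :: "real^2^2 \<Rightarrow> complex" and A
  interpret V: vector_space sc
    by unfold_locales (auto simp: sc_def fun_eq_iff algebra_simps)
  have app': "(\<Sum>i\<in>I. sc (c i) (h i)) A = (\<Sum>i\<in>I. c i * h i A)" for I :: "(nat + nat) set" and c h A
    by (induction I rule: infinite_finite_induct) (auto simp: sc_def)
  have app'': "(\<Sum>i\<in>I. sc (c i) (h i)) A = (\<Sum>i\<in>I. c i * h i A)" for I :: "nat set" and c h A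
    by (induction I rule: infinite_finite_induct) (auto simp: sc_def)
  \<comment> \<open>Setting functions to 0 outside the group turns equality on the group into
    equality of vectors.\<close>
  define res where "res \<psi> A = (if A \<in> \<Gamma> then \<psi> A else 0)" for \<psi> :: "real^2^2 \<Rightarrow> complex" and A
  define bb where "bb k = res (\<lambda>A. of_int (m k A))" for k
  have spn: "res \<psi> \<in> V.span (bb ` {..<2 * g})"
    if hom': "\<And>A B. A \<in> \<Gamma> \<Longrightarrow> B \<in> \<Gamma> \<Longrightarrow> \<psi> (A ** B) = \<psi> A + \<psi> B" and par': "\<And>A. A \<in> \<Gamma> \<Longrightarrow> parabolic A \<Longrightarrow> \<psi> A = 0" for \<psi>
  proof -
    obtain v where v: "\<And>A. A \<in> \<Gamma> \<Longrightarrow> \<psi> A = (\<Sum>k<2 * g. v k * of_int (m k A))" using m[OF hom' par'] by blast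
    have "res \<psi> = (\<Sum>k<2 * g. sc (v k) (bb k))"
      by (rule ext) (simp add: app'' res_def bb_def v)
    then show ?thesis by (simp only:) (intro V.span_sum V.span_scale V.span_base imageI)
  qed
  define h where "h = case_sum (\<lambda>i. res (\<lambda>A. modsym A (f i))) (\<lambda>i. res (\<lambda>A. cnj (modsym A (f i))))"
  have hsum: "(\<Sum>k\<in>{1..g} <+> {1..g}. sc (c k) (h k)) A
      = (\<Sum>i=1..g. c (Inl i) * modsym A (f i) + c (Inr i) * cnj (modsym A (f i)))" if "A \<in> \<Gamma>" for c A
    using that unfolding app' by (simp add: sum.Plus h_def res_def sum.distrib)
  have ind: "\<forall>c. (\<Sum>k\<in>{1..g} <+> {1..g}. sc (c k) (h k)) = 0 \<longrightarrow> (\<forall>k\<in>{1..g} <+> {1..g}. c k = 0)"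
  proof (intro allI impI)
    fix c assume 0: "(\<Sum>k\<in>{1..g} <+> {1..g}. sc (c k) (h k)) = 0"
    have "(\<Sum>i=1..g. c (Inl i) * modsym A (f i) + c (Inr i) * cnj (modsym A (f i))) = 0" if "A \<in> \<Gamma>" for A
      unfolding hsum[OF that, symmetric] using 0 by simp
    from modsym_independent[OF this] show "\<forall>k\<in>{1..g} <+> {1..g}. c k = 0" by auto
  qed
  have hs: "h ` ({1..g} <+> {1..g}) \<subseteq> V.span (bb ` {..<2 * g})"
    using modsym_mult f_S2 modsym_parabolic[OF scaling_exists] by (auto simp: h_def intro!: spn)
  obtain c where c: "res \<phi> = (\<Sum>k\<in>{1..g} <+> {1..g}. sc (c k) (h k))"
    by (rule V.independent_family_spans[OF _ ind _ _ hs spn[OF hom par]]) (auto simp: card_Plus)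
  have eq: "\<phi> A = (\<Sum>i=1..g. c (Inl i) * modsym A (f i) + c (Inr i) * cnj (modsym A (f i)))" if "A \<in> \<Gamma>" for A
    using hsum[OF that, of c] fun_cong[OF c, of A] that by (simp add: res_def)
  show ?thesis
  proof (intro exI ballI)
    fix A assume "A \<in> \<Gamma>"
    then show "\<phi> A = (\<Sum>i=1..g. c (Inl i) * modsym A (f i) + c (Inr i) * cnj (modsym A (f i)))" by (rule eq)
  qed
qed

text \<open>Slashing by \<open>B\<close> fixes the cusp form that belongs to \<open>A\<close>, so
  the cocycle relation becomes additive, and by independence of the \<open>f j\<close> each
  coefficient is a homomorphism. It vanishes on parabolic elements because \<open>h\<close> is
  invariant under them, and \<open>parabolic_hom_expansion\<close> applies.\<close>

lemma S22_cocycle: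
  assumes h: "h \<in> S22 \<Gamma>"
  obtains b a where "\<And>A z. A \<in> \<Gamma> \<Longrightarrow> (slash 2 h A - h) z =
    (\<Sum>j=1..g. (\<Sum>i=1..g. b i j * modsym A (f i) + a i j * cnj (modsym A (f i))) * f j z)"
proof -
  have "\<forall>A\<in>\<Gamma>. \<exists>c. slash 2 h A - h = (\<lambda>z. \<Sum>j=1..g. c j * f j z)"
  proof
    fix A assume "A \<in> \<Gamma>"
    then have "slash 2 h A - h \<in> S2 \<Gamma>" using h by (simp add: S22_def)
    then obtain c where "slash 2 h A - h = (\<lambda>z. \<Sum>j=1..g. c j * f j z)" by (rule S2_expansion)
    then show "\<exists>c. slash 2 h A - h = (\<lambda>z. \<Sum>j=1..g. c j * f j z)" by (intro exI[of _ c])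
  qed
  from bchoice[OF this] obtain \<phi> where \<phi>: "\<And>A. A \<in> \<Gamma> \<Longrightarrow> slash 2 h A - h = (\<lambda>z. \<Sum>j=1..g. \<phi> A j * f j z)" by blast
  have "\<exists>b a. \<forall>A\<in>\<Gamma>. \<phi> A j = (\<Sum>i=1..g. b i * modsym A (f i) + a i * cnj (modsym A (f i)))" if j: "j \<in> {1..g}" for j
  proof (rule parabolic_hom_expansion)
    show "\<phi> A j = 0" if "A \<in> \<Gamma>" "parabolic A" for A
    proof (rule f_coeff_zero[OF _ j])
      fix z
      have "slash 2 h A - h = 0" using h that by (simp add: S22_def)
      then show "(\<Sum>j=1..g. \<phi> A j * f j z) = 0" using \<phi>[OF that(1)] by (simp add: fun_eq_iff)
    qed
    show "\<phi> (A ** B) j = \<phi> A j + \<phi> B j" if AB: "A \<in> \<Gamma>" "B \<in> \<Gamma>" for A B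
    proof -
      have "(\<Sum>j=1..g. (\<phi> (A ** B) j - (\<phi> A j + \<phi> B j)) * f j z) = 0" for z
      proof (cases "z \<in> uhp")
        case True
        define J where "J = (jfac B z)\<^sup>2"
        have J: "J \<noteq> 0" using jfac_nonzero[OF det_Gamma[OF AB(2)] True] by (simp add: J_def)
        have 1: "slash 2 h A w = h w + (\<Sum>j=1..g. \<phi> A j * f j w)" for w
          using fun_cong[OF \<phi>[OF AB(1)], of w] by (simp add: algebra_simps)
        have 2: "h (moeb B z) / J = h z + (\<Sum>j=1..g. \<phi> B j * f j z)"
          using fun_cong[OF \<phi>[OF AB(2)], of z] by (simp add: algebra_simps slash2 J_def)
        have 3: "slash 2 h (A ** B) z = h z + (\<Sum>j=1..g. \<phi> (A ** B) j * f j z)"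
          using fun_cong[OF \<phi>[OF mult_Gamma[OF AB]], of z] by (simp add: algebra_simps)
        have 4: "(\<Sum>j=1..g. \<phi> A j * f j (moeb B z)) = J * (\<Sum>j=1..g. \<phi> A j * f j z)"
          unfolding sum_distrib_left using S2_transform[OF f_S2 AB(2) True] by (intro sum.cong refl) (simp add: J_def)
        have "slash 2 h (A ** B) z = slash 2 h A (moeb B z) / J"
          using slash2_mult[OF det_Gamma[OF AB(2)] True, of h A] by (simp add: slash2[of _ B] J_def)
        also have "\<dots> = h (moeb B z) / J + (\<Sum>j=1..g. \<phi> A j * f j z)"
          unfolding 1 4 using J by (simp add: add_divide_distrib)
        finally show ?thesis unfolding 2 3
          by (simp add: left_diff_distrib distrib_right sum_subtractf sum.distrib)
      next
        case False
        then show ?thesis using S2_D(2)[OF f_S2] by (intro sum.neutral) auto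
      qed
      from f_coeff_zero[OF this j] show ?thesis by simp
    qed
  qed
  then obtain b a where ba: "\<And>j A. j \<in> {1..g} \<Longrightarrow> A \<in> \<Gamma> \<Longrightarrow>
      \<phi> A j = (\<Sum>i=1..g. b j i * modsym A (f i) + a j i * cnj (modsym A (f i)))" by metis
  show ?thesis
  proof (rule that[of "\<lambda>i j. b j i" "\<lambda>i j. a j i"])
    fix A z assume A: "A \<in> \<Gamma>"
    show "(slash 2 h A - h) z = (\<Sum>j=1..g. (\<Sum>i=1..g. b j i * modsym A (f i) + a j i * cnj (modsym A (f i))) * f j z)"
      unfolding \<phi>[OF A] using ba A by (intro sum.cong) auto
  qed
qed

end

section \<open>Combinations of the \<open>Z\<close>-functions and of the products with
  integrals\<close>

locale zfun_system = orthonormal_cusp_forms +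
  fixes \<kappa> :: complex and Z :: "(complex \<Rightarrow> complex) \<Rightarrow> (complex \<Rightarrow> complex) \<Rightarrow> complex \<Rightarrow> complex"
  assumes Zfun: "\<And>lam mu. lam \<in> S2 \<Gamma> \<Longrightarrow> mu \<in> S2 \<Gamma> \<Longrightarrow> is_Zfun \<Gamma> F C \<sigma> \<kappa> lam mu (Z lam mu)"
begin

lemma Z_slash:
  "i \<in> {1..g} \<Longrightarrow> j \<in> {1..g} \<Longrightarrow> A \<in> \<Gamma> \<Longrightarrow>
    slash 2 (Z (f i) (f j)) A - Z (f i) (f j) = cscale (cnj (modsym A (f i))) (f j)"
  using Zfun[OF f_S2 f_S2, of i j] by (simp add: is_Zfun_def)

text \<open>Members of \<open>S22\<close> are functions on \<complex> that vanish off the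
  half-plane. \<open>Zzero\<close> is 0 there by its definition, and a span inherits this.\<close>

lemma Z_off_uhp:
  assumes "i \<in> {1..g}" "j \<in> {1..g}" "z \<notin> uhp" shows "Z (f i) (f j) z = 0"
proof -
  have "Z (f i) (f j) \<in> funspace.span {Zzero \<Gamma> \<aa> (\<sigma> \<aa>) (f i) m |\<aa> m. \<aa> \<in> C \<and> m > 0}"
    using Zfun[OF f_S2 f_S2, of i j] assms by (simp add: is_Zfun_def)
  moreover have "funspace.subspace {h. h z = 0}" by (auto simp: funspace.subspace_def cscale_def)
  moreover have "{Zzero \<Gamma> \<aa> (\<sigma> \<aa>) (f i) m |\<aa> m. \<aa> \<in> C \<and> m > 0} \<subseteq> {h. h z = 0}"
    using assms(3) by (auto simp: Zzero_def)
  ultimately show ?thesis using funspace.span_minimal by blast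
qed

definition zpart :: "(nat \<Rightarrow> nat \<Rightarrow> complex) \<Rightarrow> complex \<Rightarrow> complex" where
  "zpart a = (\<Sum>p\<in>{1..g} \<times> {1..g}. cscale (a (fst p) (snd p)) (Z (f (fst p)) (f (snd p))))"

text \<open>The coefficient \<open>b i j\<close> belongs to \<open>f j\<close> times the integral of
  \<open>f i\<close>. With this order of indices it multiplies the period of \<open>f i\<close> in
  the coefficient of \<open>f j\<close>, just as \<open>a i j\<close> multiplies the conjugate
  period in \<open>zpart\<close>.\<close>

definition ipart :: "(nat \<Rightarrow> nat \<Rightarrow> complex) \<Rightarrow> complex \<Rightarrow> complex" where
  "ipart b = (\<Sum>p\<in>{1..g} \<times> {1..g}. cscale (b (fst p) (snd p)) (times_int z0 (f (snd p)) (f (fst p))))"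

lemma zpart_slash:
  assumes "A \<in> \<Gamma>"
  shows "(slash 2 (zpart a) A - zpart a) z = (\<Sum>j=1..g. (\<Sum>i=1..g. a i j * cnj (modsym A (f i))) * f j z)"
proof -
  have "(slash 2 (zpart a) A - zpart a) z
      = (\<Sum>p\<in>{1..g} \<times> {1..g}. a (fst p) (snd p) * cscale (cnj (modsym A (f (fst p)))) (f (snd p)) z)"
    unfolding zpart_def using Z_slash assms by (intro slash2_sum_diff) auto
  also have "\<dots> = (\<Sum>i=1..g. \<Sum>j=1..g. a i j * cnj (modsym A (f i)) * f j z)"
    unfolding sum.cartesian_product by (intro sum.cong) (auto simp: cscale_def mult.assoc)
  also have "\<dots> = (\<Sum>j=1..g. (\<Sum>i=1..g. a i j * cnj (modsym A (f i))) * f j z)"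
    unfolding sum_distrib_right by (rule sum.swap)
  finally show ?thesis .
qed

lemma ipart_slash:
  assumes "A \<in> \<Gamma>"
  shows "(slash 2 (ipart b) A - ipart b) z = (\<Sum>j=1..g. (\<Sum>i=1..g. b i j * modsym A (f i)) * f j z)"
proof -
  have "(slash 2 (ipart b) A - ipart b) z
      = (\<Sum>p\<in>{1..g} \<times> {1..g}. b (fst p) (snd p) * cscale (modsym A (f (fst p))) (f (snd p)) z)"
    unfolding ipart_def using times_int_S22(2)[OF scaling_exists f_S2 f_S2 z0] assms by (intro slash2_sum_diff) auto
  also have "\<dots> = (\<Sum>i=1..g. \<Sum>j=1..g. b i j * modsym A (f i) * f j z)"
    unfolding sum.cartesian_product by (intro sum.cong) (auto simp: cscale_def mult.assoc)
  also have "\<dots> = (\<Sum>j=1..g. (\<Sum>i=1..g. b i j * modsym A (f i)) * f j z)"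
    unfolding sum_distrib_right by (rule sum.swap)
  finally show ?thesis .
qed

lemma f_combination_S2: "(\<Sum>j=1..g. cscale (c j) (f j)) \<in> S2 \<Gamma>"
  using f_S2 by (intro funspace.subspace_sum[OF S2_subspace] funspace.subspace_scale[OF S2_subspace])

lemma ipart_S22: "ipart b \<in> S22 \<Gamma>"
  unfolding ipart_def using times_int_S22(1)[OF scaling_exists f_S2 f_S2 z0]
  by (intro funspace.subspace_sum[OF S22_subspace] funspace.subspace_scale[OF S22_subspace]) auto

text \<open>By orthonormality the derivative of \<open>zpart a\<close> by \<open>cnj z\<close> is
  the trace of \<open>a\<close> times \<open>\<kappa> / y^2\<close>, hence zero, and the function is
  holomorphic. The growth bounds of the \<open>Z\<close>-functions add up, so
  \<open>growth_imp_decay\<close> gives the decay at the cusps.\<close>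

lemma zpart_S22:
  assumes tr: "(\<Sum>i=1..g. a i i) = 0" shows "zpart a \<in> S22 \<Gamma>"
proof -
  have off: "zpart a z = 0" if "z \<notin> uhp" for z
    unfolding zpart_def sum_cscale_apply using Z_off_uhp that by (intro sum.neutral) auto
  have hol: "zpart a holomorphic_on uhp"
  proof (rule has_dbar_zero_holomorphic[OF open_uhp])
    fix z assume z: "z \<in> uhp"
    define y where "y = complex_of_real ((Im z)\<^sup>2)"
    have y: "y \<noteq> 0" using z by (auto simp: y_def uhp_def)
    have "has_dbar (Z (f (fst p)) (f (snd p))) (if fst p = snd p then \<kappa> / y else 0) z" if p: "p \<in> {1..g} \<times> {1..g}" for p
    proof -
      obtain d where d: "has_dbar (Z (f (fst p)) (f (snd p))) d z" "y * d = \<kappa> * cnj (petersson F (f (fst p)) (f (snd p)))"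
      proof -
        have "is_Zfun \<Gamma> F C \<sigma> \<kappa> (f (fst p)) (f (snd p)) (Z (f (fst p)) (f (snd p)))"
          using p by (intro Zfun f_S2) auto
        then show ?thesis using that z unfolding is_Zfun_def y_def by blast
      qed
      have "petersson F (f (fst p)) (f (snd p)) = (if fst p = snd p then 1 else 0)"
        using onb p unfolding orthonormal_basis_def by auto
      then have "d = (if fst p = snd p then \<kappa> / y else 0)" using d(2) y by (auto simp: field_simps split: if_splits)
      then show ?thesis using d(1) by simp
    qed
    then have "has_dbar (zpart a) (\<Sum>p\<in>{1..g} \<times> {1..g}. a (fst p) (snd p) * (if fst p = snd p then \<kappa> / y else 0)) z"
      unfolding zpart_def by (rule has_dbar_sum)
    also have "(\<Sum>p\<in>{1..g} \<times> {1..g}. a (fst p) (snd p) * (if fst p = snd p then \<kappa> / y else 0))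
        = (\<Sum>i=1..g. \<Sum>j=1..g. if i = j then a i j * (\<kappa> / y) else 0)"
      unfolding sum.cartesian_product by (intro sum.cong) auto
    also have "\<dots> = (\<Sum>i=1..g. a i i * (\<kappa> / y))" by (intro sum.cong refl) (simp add: sum.delta')
    also have "\<dots> = 0" by (simp only: tr mult_zero_left flip: sum_distrib_right)
    finally show "has_dbar (zpart a) 0 z" .
  qed
  have slE: "slash 2 (zpart a) A - zpart a = (\<Sum>j=1..g. cscale (\<Sum>i=1..g. a i j * cnj (modsym A (f i))) (f j))" if "A \<in> \<Gamma>" for A
    by (rule ext) (simp only: zpart_slash[OF that] sum_cscale_apply)
  have sl: "slash 2 (zpart a) A - zpart a \<in> S2 \<Gamma>" if "A \<in> \<Gamma>" for A
    unfolding slE[OF that] by (rule f_combination_S2)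
  have par: "slash 2 (zpart a) A - zpart a = 0" if "A \<in> \<Gamma>" "parabolic A" for A
    unfolding slE[OF that(1)] using modsym_parabolic[OF scaling_exists f_S2 that]
    by (simp add: fun_eq_iff sum_cscale_apply)
  have "\<forall>p\<in>{1..g} \<times> {1..g}. \<exists>K. \<forall>z\<in>F. Im z * norm (Z (f (fst p)) (f (snd p)) z) \<le> K * yF C \<sigma> z powr (1 / 2)"
    using Zfun[OF f_S2 f_S2] unfolding is_Zfun_def by auto
  then obtain K where K: "\<And>p z. p \<in> {1..g} \<times> {1..g} \<Longrightarrow> z \<in> F \<Longrightarrow>
      Im z * norm (Z (f (fst p)) (f (snd p)) z) \<le> K p * yF C \<sigma> z powr (1 / 2)" by metis
  have "Im z * norm (zpart a z) \<le> (\<Sum>p\<in>{1..g} \<times> {1..g}. norm (a (fst p) (snd p)) * K p) * yF C \<sigma> z powr (1 / 2)" if z: "z \<in> F" for z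
  proof -
    have y: "Im z > 0" using z F_uhp by (auto simp: uhp_def)
    have "Im z * norm (zpart a z) \<le> Im z * (\<Sum>p\<in>{1..g} \<times> {1..g}. norm (a (fst p) (snd p)) * norm (Z (f (fst p)) (f (snd p)) z))"
      unfolding zpart_def sum_cscale_apply norm_mult[symmetric] using y by (intro mult_left_mono norm_sum) auto
    also have "\<dots> = (\<Sum>p\<in>{1..g} \<times> {1..g}. norm (a (fst p) (snd p)) * (Im z * norm (Z (f (fst p)) (f (snd p)) z)))"
      unfolding sum_distrib_left by (intro sum.cong refl mult.left_commute)
    also have "\<dots> \<le> (\<Sum>p\<in>{1..g} \<times> {1..g}. norm (a (fst p) (snd p)) * (K p * yF C \<sigma> z powr (1 / 2)))"
      using K z by (intro sum_mono mult_left_mono) auto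
    finally show ?thesis by (simp only: sum_distrib_right mult.assoc)
  qed
  then have "decays_at_cusps \<Gamma> (zpart a)" by (intro growth_imp_decay[OF hol sl par]) auto
  then show ?thesis unfolding S22_def using off hol sl par by blast
qed

text \<open>The cocycle of the combination is zero, which for each \<open>f j\<close> is a relation
  between periods and conjugate periods; \<open>modsym_independent\<close> makes it trivial. What
  remains is a relation between the \<open>f j\<close> themselves.\<close>

lemma combination_zero:
  assumes "zpart a + ipart b + (\<Sum>j=1..g. cscale (c j) (f j)) = 0" "i \<in> {1..g}" "j \<in> {1..g}"
  shows "a i j = 0" "b i j = 0" "c i = 0"
proof -
  let ?s = "\<Sum>j=1..g. cscale (c j) (f j)"
  have "(\<Sum>i=1..g. b i j * modsym A (f i) + a i j * cnj (modsym A (f i))) = 0" if A: "A \<in> \<Gamma>" and j: "j \<in> {1..g}" for A j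
  proof (rule f_coeff_zero[OF _ j])
    fix z
    have "slash 2 (zpart a + ipart b + ?s) A - (zpart a + ipart b + ?s) = 0"
      unfolding assms(1) by (simp add: slash2 fun_eq_iff)
    then have "(slash 2 (zpart a) A - zpart a) z + (slash 2 (ipart b) A - ipart b) z + (slash 2 ?s A - ?s) z = 0"
      by (simp add: slash2_add fun_eq_iff algebra_simps)
    then show "(\<Sum>j=1..g. (\<Sum>i=1..g. b i j * modsym A (f i) + a i j * cnj (modsym A (f i))) * f j z) = 0"
      unfolding zpart_slash[OF A] ipart_slash[OF A] using S2_D(3)[OF f_combination_S2 A, of c]
      by (simp add: sum.distrib distrib_right add.commute)
  qed
  then have ba: "b i j = 0" "a i j = 0" if "i \<in> {1..g}" "j \<in> {1..g}" for i j
    using modsym_independent[of "\<lambda>i. b i j" "\<lambda>i. a i j" i] that by blast+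
  show "a i j = 0" "b i j = 0" using ba assms(2,3) by auto
  have "zpart a = 0" "ipart b = 0"
    unfolding zpart_def ipart_def using ba by (auto intro!: sum.neutral)
  then have "?s = 0" using assms(1) by simp
  then show "c i = 0" using f_coeff_zero[of c i] assms(2) by (auto simp: fun_eq_iff sum_cscale_apply)
qed

lemma S22_combination:
  assumes h: "h \<in> S22 \<Gamma>"
  obtains a b c where "(\<Sum>i=1..g. a i i) = 0" "h = zpart a + ipart b + (\<Sum>j=1..g. cscale (c j) (f j))"
proof -
  obtain b a where sl: "\<And>A z. A \<in> \<Gamma> \<Longrightarrow> (slash 2 h A - h) z =
      (\<Sum>j=1..g. (\<Sum>i=1..g. b i j * modsym A (f i) + a i j * cnj (modsym A (f i))) * f j z)"
    by (rule S22_cocycle[OF h]) blast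
  have tr: "(\<Sum>i=1..g. a i i) = 0" by (rule cocycle_trace_zero[OF h sl])
  \<comment> \<open>The cocycles cancel, so \<open>R\<close> is invariant; holomorphy and decay come
    from its membership in \<open>S22\<close>, and it is a cusp form.\<close>
  define R where "R = h - (zpart a + ipart b)"
  have R: "R \<in> S22 \<Gamma>" unfolding R_def
    using h zpart_S22[of a, OF tr] ipart_S22 S22_subspace funspace.subspace_diff funspace.subspace_add by metis
  have "slash 2 R A = R" if A: "A \<in> \<Gamma>" for A
  proof
    fix z
    have "(slash 2 R A - R) z = (slash 2 h A - h) z - ((slash 2 (zpart a) A - zpart a) z + (slash 2 (ipart b) A - ipart b) z)"
      by (simp add: R_def slash2_diff slash2_add)
    also have "\<dots> = 0" unfolding zpart_slash[OF A] ipart_slash[OF A] sl[OF A]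
      by (simp add: sum.distrib distrib_right add.commute)
    finally show "slash 2 R A z = R z" by simp
  qed
  then have "R \<in> S2 \<Gamma>" using R by (simp add: S2_def S22_def)
  then obtain c where "R = (\<lambda>z. \<Sum>j=1..g. c j * f j z)" by (rule S2_expansion)
  then have "R = (\<Sum>j=1..g. cscale (c j) (f j))" by (simp add: fun_eq_iff sum_cscale_apply)
  then have "h = zpart a + ipart b + (\<Sum>j=1..g. cscale (c j) (f j))" unfolding R_def by (simp add: algebra_simps)
  with tr show ?thesis by (rule that)
qed

text \<open>Trace zero permits \<open>x 1 1\<close> to be subtracted from every diagonal entry of
  \<open>x\<close>, after which the term of index 1 drops out.\<close>

lemma sum_off_diagonal:
  fixes x :: "nat \<Rightarrow> nat \<Rightarrow> complex"
  assumes d: "\<And>i. i \<in> {2..g} \<Longrightarrow> a i i = d i" and tr: "(\<Sum>i=1..g. a i i) = 0"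
  shows "(\<Sum>(i, j)\<in>{(i, j). i \<in> {1..g} \<and> j \<in> {1..g} \<and> i \<noteq> j}. a i j * x i j) + (\<Sum>i=2..g. d i * (x i i - x 1 1))
    = (\<Sum>p\<in>{1..g} \<times> {1..g}. a (fst p) (snd p) * x (fst p) (snd p))"
proof -
  have "(\<Sum>p\<in>{1..g} \<times> {1..g}. a (fst p) (snd p) * x (fst p) (snd p)) = (\<Sum>i=1..g. \<Sum>j=1..g. a i j * x i j)"
    unfolding sum.cartesian_product by (intro sum.cong) auto
  also have "\<dots> = (\<Sum>i=1..g. a i i * x i i + (\<Sum>j\<in>{1..g} - {i}. a i j * x i j))"
    by (intro sum.cong refl sum.remove) auto
  also have "\<dots> = (\<Sum>i=1..g. a i i * x i i) + (\<Sum>i=1..g. \<Sum>j\<in>{1..g} - {i}. a i j * x i j)"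
    by (rule sum.distrib)
  also have "(\<Sum>i=1..g. \<Sum>j\<in>{1..g} - {i}. a i j * x i j)
      = (\<Sum>(i, j)\<in>{(i, j). i \<in> {1..g} \<and> j \<in> {1..g} \<and> i \<noteq> j}. a i j * x i j)"
    by (subst sum.Sigma) (auto intro!: sum.cong)
  also have "(\<Sum>i=1..g. a i i * x i i) = (\<Sum>i=1..g. a i i * x i i) - (\<Sum>i=1..g. a i i) * x 1 1" using tr by simp
  also have "\<dots> = (\<Sum>i=1..g. a i i * (x i i - x 1 1))"
    by (simp add: right_diff_distrib sum_subtractf sum_distrib_right)
  also have "\<dots> = (\<Sum>i=2..g. a i i * (x i i - x 1 1))"
    by (rule sum.mono_neutral_right) (auto simp: not_le less_Suc_eq numeral_2_eq_2 le_Suc_eq)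
  also have "\<dots> = (\<Sum>i=2..g. d i * (x i i - x 1 1))" using d by (intro sum.cong) auto
  finally show ?thesis by simp
qed

abbreviation bidx where
  "bidx \<equiv> {(i, j). i \<in> {1..g} \<and> j \<in> {1..g} \<and> i \<noteq> j} <+> {2..g} <+> ({1..g} \<times> {1..g}) <+> {1..g}"

abbreviation bfam where
  "bfam \<equiv> case_sum (\<lambda>(i, j). Z (f i) (f j)) (case_sum (\<lambda>i. Z (f i) (f i) - Z (f 1) (f 1))
     (case_sum (\<lambda>(i, j). times_int z0 (f i) (f j)) f))"

lemma finite_off_diagonal: "finite {(i, j). i \<in> {1..g} \<and> j \<in> {1..g} \<and> i \<noteq> j}"
  by (rule finite_subset[of _ "{1..g} \<times> {1..g}"]) auto

text \<open>The dictionary between coefficients on the sum type and the matrices \<open>a\<close>,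
  \<open>b\<close> with the vector \<open>c'\<close>. The entry \<open>a 1 1\<close> has no index of
  its own and is supplied by the trace condition. The pair is \<open>(j, i)\<close> for
  \<open>b i j\<close>, since \<open>times_int\<close> takes the factor \<open>f j\<close> first and
  the integrand \<open>f i\<close> second.\<close>

lemma bfam_sum:
  assumes off: "\<And>i j. i \<in> {1..g} \<Longrightarrow> j \<in> {1..g} \<Longrightarrow> i \<noteq> j \<Longrightarrow> c (Inl (i, j)) = a i j"
    and d: "\<And>i. i \<in> {2..g} \<Longrightarrow> c (Inr (Inl i)) = a i i" and tr: "(\<Sum>i=1..g. a i i) = 0"
    and b: "\<And>i j. i \<in> {1..g} \<Longrightarrow> j \<in> {1..g} \<Longrightarrow> c (Inr (Inr (Inl (j, i)))) = b i j"
    and c': "\<And>i. i \<in> {1..g} \<Longrightarrow> c (Inr (Inr (Inr i))) = c' i"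
  shows "(\<Sum>k\<in>bidx. cscale (c k) (bfam k)) = zpart a + ipart b + (\<Sum>j=1..g. cscale (c' j) (f j))"
proof
  fix z
  have "(\<Sum>k\<in>bidx. cscale (c k) (bfam k)) z
      = (\<Sum>p\<in>{(i, j). i \<in> {1..g} \<and> j \<in> {1..g} \<and> i \<noteq> j}. c (Inl p) * bfam (Inl p) z)
        + (\<Sum>i=2..g. c (Inr (Inl i)) * bfam (Inr (Inl i)) z)
        + (\<Sum>p\<in>{1..g} \<times> {1..g}. c (Inr (Inr (Inl p))) * bfam (Inr (Inr (Inl p))) z)
        + (\<Sum>i=1..g. c (Inr (Inr (Inr i))) * bfam (Inr (Inr (Inr i))) z)"
    unfolding sum_cscale_apply
    by (subst sum.Plus, rule finite_off_diagonal, simp, subst sum.Plus, simp, simp, subst sum.Plus) (auto simp: algebra_simps)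
  also have "(\<Sum>p\<in>{(i, j). i \<in> {1..g} \<and> j \<in> {1..g} \<and> i \<noteq> j}. c (Inl p) * bfam (Inl p) z)
      = (\<Sum>(i, j)\<in>{(i, j). i \<in> {1..g} \<and> j \<in> {1..g} \<and> i \<noteq> j}. a i j * Z (f i) (f j) z)"
    using off by (intro sum.cong) auto
  also have "(\<Sum>i=2..g. c (Inr (Inl i)) * bfam (Inr (Inl i)) z)
      = (\<Sum>i=2..g. c (Inr (Inl i)) * (Z (f i) (f i) z - Z (f 1) (f 1) z))"
    by (intro sum.cong) auto
  also have "(\<Sum>(i, j)\<in>{(i, j). i \<in> {1..g} \<and> j \<in> {1..g} \<and> i \<noteq> j}. a i j * Z (f i) (f j) z) + \<dots> = zpart a z"
    unfolding zpart_def sum_cscale_apply using d tr by (intro sum_off_diagonal) auto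
  also have "(\<Sum>p\<in>{1..g} \<times> {1..g}. c (Inr (Inr (Inl p))) * bfam (Inr (Inr (Inl p))) z) = ipart b z"
  proof -
    have "(\<Sum>p\<in>{1..g} \<times> {1..g}. c (Inr (Inr (Inl p))) * bfam (Inr (Inr (Inl p))) z)
        = (\<Sum>i=1..g. \<Sum>j=1..g. b j i * times_int z0 (f i) (f j) z)"
      unfolding sum.cartesian_product using b by (intro sum.cong) auto
    also have "\<dots> = (\<Sum>j=1..g. \<Sum>i=1..g. b j i * times_int z0 (f i) (f j) z)" by (rule sum.swap)
    also have "\<dots> = ipart b z"
      unfolding ipart_def sum_cscale_apply sum.cartesian_product by (intro sum.cong) auto
    finally show ?thesis .
  qed
  also have "(\<Sum>i=1..g. c (Inr (Inr (Inr i))) * bfam (Inr (Inr (Inr i))) z) = (\<Sum>j=1..g. cscale (c' j) (f j)) z"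
    unfolding sum_cscale_apply using c' by (intro sum.cong) auto
  finally show "(\<Sum>k\<in>bidx. cscale (c k) (bfam k)) z = (zpart a + ipart b + (\<Sum>j=1..g. cscale (c' j) (f j))) z" by simp
qed

lemma bfam_combination:
  obtains a b c' where "(\<Sum>i=1..g. a i i) = 0" "\<And>i j. i \<in> {1..g} \<Longrightarrow> j \<in> {1..g} \<Longrightarrow> i \<noteq> j \<Longrightarrow> c (Inl (i, j)) = a i j"
    "\<And>i. i \<in> {2..g} \<Longrightarrow> c (Inr (Inl i)) = a i i"
    "\<And>i j. i \<in> {1..g} \<Longrightarrow> j \<in> {1..g} \<Longrightarrow> c (Inr (Inr (Inl (j, i)))) = b i j"
    "\<And>i. i \<in> {1..g} \<Longrightarrow> c (Inr (Inr (Inr i))) = c' i"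
    "(\<Sum>k\<in>bidx. cscale (c k) (bfam k)) = zpart a + ipart b + (\<Sum>j=1..g. cscale (c' j) (f j))"
proof -
  \<comment> \<open>The value at \<open>(1, 1)\<close> is the one that makes the trace
    vanish.\<close>
  define a where "a i j = (if i \<noteq> j then c (Inl (i, j)) else if i = 1 then - (\<Sum>k=2..g. c (Inr (Inl k))) else c (Inr (Inl i)))" for i j
  have tr: "(\<Sum>i=1..g. a i i) = 0"
  \<comment> \<open>For \<open>g = 0\<close> there is no index 1 to split off; the trace is then an
    empty sum.\<close>
  proof (cases "g = 0")
    case False
    then have "(\<Sum>i=1..g. a i i) = a 1 1 + (\<Sum>i=2..g. a i i)"
      using sum.atLeast_Suc_atMost[of 1 g "\<lambda>i. a i i"] by (simp add: numeral_2_eq_2)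
    also have "(\<Sum>i=2..g. a i i) = (\<Sum>i=2..g. c (Inr (Inl i)))" by (intro sum.cong) (auto simp: a_def)
    finally show ?thesis by (simp add: a_def)
  qed simp
  have off: "c (Inl (i, j)) = a i j" if "i \<noteq> j" for i j using that by (simp add: a_def)
  have d: "c (Inr (Inl i)) = a i i" if "i \<in> {2..g}" for i using that by (simp add: a_def)
  show ?thesis
    by (rule that[OF tr off d refl refl bfam_sum[OF off d tr refl refl]])
qed

theorem basis_family_S22: "basis_family bidx bfam (S22 \<Gamma>)"
proof (rule basis_familyI)
  show "finite bidx" by (intro finite_Plus finite_off_diagonal) auto
  show "\<forall>c. (\<Sum>k\<in>bidx. cscale (c k) (bfam k)) = 0 \<longrightarrow> (\<forall>k\<in>bidx. c k = 0)"
  proof (intro allI impI)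
    fix c assume 0: "(\<Sum>k\<in>bidx. cscale (c k) (bfam k)) = 0"
    obtain a b c' where abc: "\<And>i j. i \<in> {1..g} \<Longrightarrow> j \<in> {1..g} \<Longrightarrow> i \<noteq> j \<Longrightarrow> c (Inl (i, j)) = a i j"
      "\<And>i. i \<in> {2..g} \<Longrightarrow> c (Inr (Inl i)) = a i i"
      "\<And>i j. i \<in> {1..g} \<Longrightarrow> j \<in> {1..g} \<Longrightarrow> c (Inr (Inr (Inl (j, i)))) = b i j"
      "\<And>i. i \<in> {1..g} \<Longrightarrow> c (Inr (Inr (Inr i))) = c' i"
      "(\<Sum>k\<in>bidx. cscale (c k) (bfam k)) = zpart a + ipart b + (\<Sum>j=1..g. cscale (c' j) (f j))"
      by (rule bfam_combination[of c]) blast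
    note z = combination_zero[OF abc(5)[symmetric, unfolded 0]]
    have "c (Inr (Inl i)) = 0" if "i \<in> {2..g}" for i using abc(2)[OF that] z(1)[of i i] that by auto
    then show "\<forall>k\<in>bidx. c k = 0" using abc(1,3,4) z by auto
  qed
  show "(\<Sum>k\<in>bidx. cscale (c k) (bfam k)) \<in> S22 \<Gamma>" for c
  proof -
    obtain a b c' where abc: "(\<Sum>i=1..g. a i i) = 0"
      "(\<Sum>k\<in>bidx. cscale (c k) (bfam k)) = zpart a + ipart b + (\<Sum>j=1..g. cscale (c' j) (f j))"
      by (rule bfam_combination[of c]) blast
    show ?thesis unfolding abc(2) using S2_subset_S22 f_combination_S2
      by (intro funspace.subspace_add[OF S22_subspace] zpart_S22[of a, OF abc(1)] ipart_S22) blast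
  qed
  fix h assume "h \<in> S22 \<Gamma>"
  then obtain a b c' where "(\<Sum>i=1..g. a i i) = 0" "h = zpart a + ipart b + (\<Sum>j=1..g. cscale (c' j) (f j))"
    by (rule S22_combination)
  then have "h = (\<Sum>k\<in>bidx. cscale (case_sum (\<lambda>(i, j). a i j) (case_sum (\<lambda>i. a i i) (case_sum (\<lambda>(i, j). b j i) c')) k) (bfam k))"
    by (subst bfam_sum[of _ a b c']) auto
  then show "\<exists>c. h = (\<Sum>k\<in>bidx. cscale (c k) (bfam k))" by (intro exI)
qed

end

theorem theorem5p3:
  fixes \<Gamma> :: "(real^2^2) set" and F :: "complex set" and C :: "complex option set"
    and \<sigma> :: "complex option \<Rightarrow> real^2^2" and g :: nat and f :: "nat \<Rightarrow> complex \<Rightarrow> complex"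
    and Z :: "(complex \<Rightarrow> complex) \<Rightarrow> (complex \<Rightarrow> complex) \<Rightarrow> (complex \<Rightarrow> complex)"
    and \<kappa> z0 :: complex
  assumes "fuchsian_first_kind \<Gamma>"
    and "noncompact_quotient \<Gamma>"
    and "has_genus \<Gamma> g"
    and "fundamental_domain \<Gamma> F"
    and "cusp_representatives \<Gamma> F C"
    and "\<And>\<aa>. \<aa> \<in> C \<Longrightarrow> scaling_matrix \<Gamma> \<aa> (\<sigma> \<aa>)"
    and "\<And>lam mu. lam \<in> S2 \<Gamma> \<Longrightarrow> mu \<in> S2 \<Gamma> \<Longrightarrow> is_Zfun \<Gamma> F C \<sigma> \<kappa> lam mu (Z lam mu)"
    and "orthonormal_basis \<Gamma> F g f"
    and "z0 \<in> uhp"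
  shows "basis_family
    ({(i, j). i \<in> {1..g} \<and> j \<in> {1..g} \<and> i \<noteq> j} <+> {2..g} <+> ({1..g} \<times> {1..g}) <+> {1..g})
    (case_sum (\<lambda>(i, j). Z (f i) (f j))
      (case_sum (\<lambda>i. Z (f i) (f i) - Z (f 1) (f 1))
        (case_sum (\<lambda>(i, j). times_int z0 (f i) (f j))
          f)))
    (S22 \<Gamma>)"
proof -
  interpret zfun_system \<Gamma> F C \<sigma> g f z0 \<kappa> Z
    using assms by unfold_locales (auto simp: fuchsian_first_kind_def)
  show ?thesis by (rule basis_family_S22)
qed

end
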